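(* There exist absolute constants $C>0$ and $c>0$ such that the following holds. Let $f\colon\mathbb R\to\mathbb R$ be twice differentiable with $f''\geq\alpha>0$. Let $T>0$ and let $u\colon[0,T]\times\mathbb R\to\mathbb R$ be a bounded finite-entropy solution of $\partial_t u+\partial_x f(u)=0$ with $u(0,x)=u_0(x)$, and assume that $u$ satisfies the very strong trace property. Let $u_\ell>u_r$ be real numbers, $u_0^{shock}(x)=u_\ell\mathbf 1_{x<0}+u_r\mathbf 1_{x>0}$, $\sigma=\frac{f(u_r)-f(u_\ell)}{u_r-u_\ell}$, and $u^{shock}(t,x)=u_0^{shock}(x-\sigma t)$. Set $I=[\min(u_r,\inf u),\max(u_\ell,\sup u)]$, $M=\sup_I f''$ and $S=\sup_I|f'|$ (with $M<\infty$). Then there exists a Lipschitz path $h\colon[0,T]\to\mathbb R$ with $h(0)=0$ such that for all $t\in[0,T]$ and all $R>0$, $$\int_{-R}^{R}|u(t,x)-u^{shock}(t,x-h(t))|^2\,dx\leq\int_{-R-tS}^{R+tS}|u_0-u_0^{shock}|^2\,dx+C\frac{M^3}{\alpha^3}\,\mu_+([0,t]\times[-R-tS,R+tS]),$$ and in addition, for all $t\in[0,T]$, $$c\,\frac{\alpha}{M^2}(u_\ell-u_r)\int_0^t h'(\tau)^2\,d\tau\leq\int_{-2St}^{2St}(u_0-u_0^{shock})^2\,dx+\frac{M^3}{\alpha^3}\,\mu_+([0,t]\times[-2St,2St]).$$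
   Context: For a convex function $\eta$ ($\eta''\ge 0$) and $q$ with $q'=\eta'f'$, the entropy production of a bounded weak (distributional) solution $u$ of $\partial_t u+\partial_x f(u)=0$ on $[0,T]\times\mathbb R$ is the distribution $\mu_\eta=\partial_t\eta(u)+\partial_x q(u)$. A bounded weak solution $u$ is a finite-entropy solution if $\mu_\eta$ is a (signed) Radon measure on $[0,T]\times\mathbb R$ for every convex $\eta$ (as a distribution it lives on $(0,T)\times\mathbb R$; the lines $t=0$ and $t=T$ are not charged). $\mu$ denotes the entropy production for $\eta(v)=v^2/2$: $\mu=\partial_t\frac{u^2}{2}+\partial_x q(u)$, $q(v)=\int_0^v s f'(s)\,ds$; $\mu_+$ is its positive part. Finite-entropy solutions have an a.e. representative, always used here, for which $[0,T]\ni t\mapsto u(t,\cdot)\in L^1_{loc}(\mathbb R)$ is continuous; this gives meaning to $u(t,\cdot)$ and to the initial condition. Very strong trace property: for any Lipschitz path $x\colon[0,T]\to\mathbb R$ there exist traces $t\mapsto u(t,x(t)\pm)$ such that (for an a.e. representative of $u$) $\operatorname{ess\,lim}_{y\to0^+}u(t,x(t)\pm y)=u(t,x(t)\pm)$ for a.e. $t\in[0,T]$. *)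

theory Defs
  imports "HOL-Analysis.Analysis" "HOL-Probability.Essential_Supremum"
begin

section \<open>Distributions on the open strip\<close>

fun C_k :: "nat \<Rightarrow> (real \<times> real \<Rightarrow> real) \<Rightarrow> bool" where
  "C_k 0 \<phi> \<longleftrightarrow> continuous_on UNIV \<phi>"
| "C_k (Suc k) \<phi> \<longleftrightarrow>
     (\<exists>\<phi>t \<phi>x. (\<forall>z. (\<phi> has_derivative (\<lambda>w. fst w * \<phi>t z + snd w * \<phi>x z)) (at z))
            \<and> C_k k \<phi>t \<and> C_k k \<phi>x)"

definition test_function :: "real \<Rightarrow> (real \<times> real \<Rightarrow> real) \<Rightarrow> bool" where
  "test_function T \<phi> \<longleftrightarrow>
     (\<forall>k. C_k k \<phi>) \<and> compact (closure {z. \<phi> z \<noteq> 0}) \<and>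
     closure {z. \<phi> z \<noteq> 0} \<subseteq> {0<..<T} \<times> UNIV"

text \<open>The distribution \<open>\<partial>\<^sub>t a(u) + \<partial>\<^sub>x b(u)\<close> on \<open>(0,T) \<times> \<real>\<close>, evaluated at \<open>\<phi>\<close>.\<close>

definition divergence ::
  "real \<Rightarrow> (real \<Rightarrow> real \<Rightarrow> real) \<Rightarrow> (real \<Rightarrow> real) \<Rightarrow> (real \<Rightarrow> real) \<Rightarrow> (real \<times> real \<Rightarrow> real) \<Rightarrow> real" where
  "divergence T u a b \<phi> =
     - (LINT (t, x):{0<..<T} \<times> UNIV|lebesgue.
          a (u t x) * deriv (\<lambda>s. \<phi> (s, x)) t + b (u t x) * deriv (\<lambda>y. \<phi> (t, y)) x)"

section \<open>Finite-entropy solutions\<close>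

abbreviation strip :: "real \<Rightarrow> (real \<times> real) measure" where
  "strip T \<equiv> lebesgue_on ({0..T} \<times> UNIV)"

definition ess_bounded :: "real \<Rightarrow> (real \<Rightarrow> real \<Rightarrow> real) \<Rightarrow> bool" where
  "ess_bounded T u \<longleftrightarrow>
     (\<lambda>(t, x). u t x) \<in> borel_measurable (strip T) \<and>
     (\<exists>B. AE (t, x) in strip T. \<bar>u t x\<bar> \<le> B)"

definition weak_solution :: "real \<Rightarrow> (real \<Rightarrow> real) \<Rightarrow> (real \<Rightarrow> real \<Rightarrow> real) \<Rightarrow> bool" where
  "weak_solution T f u \<longleftrightarrow>
     (\<forall>\<phi>. test_function T \<phi> \<longrightarrow> divergence T u (\<lambda>v. v) f \<phi> = 0)"

definition twice_differentiable :: "(real \<Rightarrow> real) \<Rightarrow> bool" where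
  "twice_differentiable g \<longleftrightarrow>
     (\<forall>v. g field_differentiable at v) \<and> (\<forall>v. deriv g field_differentiable at v)"

text \<open>A signed Radon measure on \<open>[0,T] \<times> \<real>\<close> not charging the lines \<open>t = 0\<close> and \<open>t = T\<close>, given
  by its Jordan decomposition: the positive part \<open>P\<close> and the negative part \<open>N\<close> are mutually
  singular locally finite Borel measures, extended by zero to the whole plane. Finiteness on
  compact subsets of the plane includes finiteness up to the boundary of the strip.\<close>

definition radon_on_strip :: "real \<Rightarrow> (real \<times> real) measure \<Rightarrow> bool" where
  "radon_on_strip T P \<longleftrightarrow>
     sets P = sets borel \<and>
     (\<forall>K. compact K \<longrightarrow> emeasure P K < \<infinity>) \<and>
     emeasure P (- ({0<..<T} \<times> UNIV)) = 0"

definition signed_radon_on_strip ::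
  "real \<Rightarrow> (real \<times> real) measure \<Rightarrow> (real \<times> real) measure \<Rightarrow> bool" where
  "signed_radon_on_strip T P N \<longleftrightarrow>
     radon_on_strip T P \<and> radon_on_strip T N \<and>
     (\<exists>A\<in>sets borel. emeasure P (- A) = 0 \<and> emeasure N A = 0)"

text \<open>The distribution \<open>\<partial>\<^sub>t \<eta>(u) + \<partial>\<^sub>x q(u)\<close> is the signed Radon measure \<open>P - N\<close>.\<close>

definition entropy_production ::
  "real \<Rightarrow> (real \<Rightarrow> real \<Rightarrow> real) \<Rightarrow> (real \<Rightarrow> real) \<Rightarrow> (real \<Rightarrow> real)
    \<Rightarrow> (real \<times> real) measure \<Rightarrow> (real \<times> real) measure \<Rightarrow> bool" where
  "entropy_production T u \<eta> q P N \<longleftrightarrow>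
     signed_radon_on_strip T P N \<and>
     (\<forall>\<phi>. test_function T \<phi> \<longrightarrow> divergence T u \<eta> q \<phi> = (LINT z|P. \<phi> z) - (LINT z|N. \<phi> z))"

definition finite_entropy_solution ::
  "real \<Rightarrow> (real \<Rightarrow> real) \<Rightarrow> (real \<Rightarrow> real \<Rightarrow> real) \<Rightarrow> bool" where
  "finite_entropy_solution T f u \<longleftrightarrow>
     ess_bounded T u \<and> weak_solution T f u \<and>
     (\<forall>\<eta> q. twice_differentiable \<eta> \<and> (\<forall>v. deriv (deriv \<eta>) v \<ge> 0) \<and>
            (\<forall>v. (q has_real_derivative deriv \<eta> v * deriv f v) (at v))
        \<longrightarrow> (\<exists>P N. entropy_production T u \<eta> q P N))"

definition square_flux :: "(real \<Rightarrow> real) \<Rightarrow> real \<Rightarrow> real" where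
  "square_flux f v = (LBINT s=0..v. s * deriv f s)"

text \<open>\<open>u\<close> is the representative for which \<open>t \<mapsto> u(t,\<cdot>) \<in> L\<^sup>1\<^sub>l\<^sub>o\<^sub>c(\<real>)\<close> is continuous.\<close>

definition L1loc_continuous :: "real \<Rightarrow> (real \<Rightarrow> real \<Rightarrow> real) \<Rightarrow> bool" where
  "L1loc_continuous T u \<longleftrightarrow>
     (\<forall>t\<in>{0..T}. \<forall>R. set_integrable lebesgue {-R..R} (u t)) \<and>
     (\<forall>t\<in>{0..T}. \<forall>R. ((\<lambda>s. LINT x:{-R..R}|lebesgue. \<bar>u s x - u t x\<bar>) \<longlongrightarrow> 0) (at t within {0..T}))"

section \<open>Traces along Lipschitz paths\<close>

text \<open>Limits along this filter are essential limits as \<open>y \<rightarrow> 0+\<close>: a property holds eventually iff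
  it holds for almost every \<open>y\<close> in some interval \<open>(0,\<delta>)\<close>.\<close>

definition ess_at_right_0 :: "real filter" where
  "ess_at_right_0 = inf (at_right 0) (ae_filter lebesgue)"

definition lipschitz_path :: "real \<Rightarrow> (real \<Rightarrow> real) \<Rightarrow> bool" where
  "lipschitz_path T \<gamma> \<longleftrightarrow> (\<exists>L. L-lipschitz_on {0..T} \<gamma>)"

definition very_strong_traces :: "real \<Rightarrow> (real \<Rightarrow> real \<Rightarrow> real) \<Rightarrow> bool" where
  "very_strong_traces T u \<longleftrightarrow>
     (\<forall>\<gamma>. lipschitz_path T \<gamma> \<longrightarrow>
       (\<exists>up um v. (AE (t, x) in strip T. v t x = u t x) \<and>
         (AE t in lebesgue_on {0..T}.
            ((\<lambda>y. v t (\<gamma> t + y)) \<longlongrightarrow> up t) ess_at_right_0 \<and>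
            ((\<lambda>y. v t (\<gamma> t - y)) \<longlongrightarrow> um t) ess_at_right_0)))"

section \<open>Shocks and the constants\<close>

definition shock_data :: "real \<Rightarrow> real \<Rightarrow> real \<Rightarrow> real" where
  "shock_data ul ur x = ul * indicator {..<0} x + ur * indicator {0<..} x"

definition shock_speed :: "(real \<Rightarrow> real) \<Rightarrow> real \<Rightarrow> real \<Rightarrow> real" where
  "shock_speed f ul ur = (f ur - f ul) / (ur - ul)"

definition shock :: "(real \<Rightarrow> real) \<Rightarrow> real \<Rightarrow> real \<Rightarrow> real \<Rightarrow> real \<Rightarrow> real" where
  "shock f ul ur t x = shock_data ul ur (x - shock_speed f ul ur * t)"

text \<open>Since \<open>u\<close> is an \<open>L\<^sup>\<infinity>\<close> function, its supremum and infimum are the essential ones.\<close>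

definition sup_u :: "real \<Rightarrow> (real \<Rightarrow> real \<Rightarrow> real) \<Rightarrow> real" where
  "sup_u T u = real_of_ereal (esssup (strip T) (\<lambda>(t, x). ereal (u t x)))"

definition inf_u :: "real \<Rightarrow> (real \<Rightarrow> real \<Rightarrow> real) \<Rightarrow> real" where
  "inf_u T u = - sup_u T (\<lambda>t x. - u t x)"

definition state_interval :: "real \<Rightarrow> (real \<Rightarrow> real \<Rightarrow> real) \<Rightarrow> real \<Rightarrow> real \<Rightarrow> real set" where
  "state_interval T u ul ur = {min ur (inf_u T u)..max ul (sup_u T u)}"

end

(*
The shift makes h(t) + sigma t a generalized (Filippov) characteristic x of u issued from the origin:
at almost every time its speed lies between the characteristic speeds f' of the two traces of u along
the path. Left of x the distance of u to u_l, right of x that to u_r, is measured by the relative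
entropy (u - c)^2 / 2, whose production is the same measure mu for every constant c. Testing both
balance laws with a cutoff supported in a cone of slope S, on which the lateral flux has the right
sign, leaves on the path the difference of the two relative entropy fluxes seen by x. If the traces
agree, x moves with the characteristic speed f'; otherwise the Rankine-Hugoniot condition (the balance
law of u itself on the path) makes x a shock of u, possibly with a positive production m. In both
cases a cubic convexity estimate bounds the difference by 2 max(0,m) - kappa (x' - sigma)^2, where
kappa is a multiple of alpha (u_l - u_r) / M^2, and the positive part of m is controlled by mu_+ of
the path.
*)
theory Submission
  imports Defs "HOL-Complex_Analysis.Great_Picard"
begin

section \<open>Convexity estimate for the relative entropy balance across one jump\<close>

section \<open>Entropy dissipation of a shock\<close>

text \<open>Gain: let \<open>G'\<close> be the line through the two trace points minus
  \<open>f\<close>. The flux difference on the path is an increment of \<open>G\<close> between the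
  traces plus its increment from \<open>ur\<close> to \<open>ul\<close>. Comparing \<open>G\<close>
  with the cubic whose derivative has the same zeros turns \<open>f'' \<ge> \<alpha>\<close> into a
  squared distance between the state pairs, and \<open>f'' \<le> M\<close> turns that distance into
  one of speeds; hence \<open>\<alpha> / M\<^sup>2\<close>. Cost: production counts once off the
  path and twice on it, and undoing the half in the relative entropy gives the factor 4. The
  obstacles are of regularity. The path is only Lipschitz, so cutoffs adapted to it have derivatives
  almost everywhere, while distributions are tested with smooth functions: the balance laws are
  therefore extended to Lipschitz test functions by mollification. Traces belong to a path that is
  already given, so the path is built without them, as a limit of Euler polygons with spatially
  averaged speeds. The solution is controlled at almost every time, the claim is for every time and
  starts from \<open>u0\<close>; continuity of the slices in \<open>L^1\<close> on bounded sets
  bridges both ends.\<close>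

lemma deriv_sign_imp_mono:
  fixes k k' :: "real \<Rightarrow> real"
  assumes "\<And>v. lo \<le> v \<Longrightarrow> v \<le> hi \<Longrightarrow> (k has_real_derivative k' v) (at v)"
    and "\<And>v. lo \<le> v \<Longrightarrow> v \<le> hi \<Longrightarrow> 0 \<le> k' v"
    and "lo \<le> x" "x \<le> y" "y \<le> hi"
  shows "k x \<le> k y"
proof (rule DERIV_nonneg_imp_nondecreasing[OF \<open>x \<le> y\<close>])
  fix z assume "x \<le> z" "z \<le> y"
  then have "lo \<le> z" "z \<le> hi" using assms by simp_all
  then show "\<exists>d. (k has_real_derivative d) (at z) \<and> 0 \<le> d"
    using assms(1,2)[of z] by blast
qed

lemma deriv_sign_imp_antimono:
  fixes k k' :: "real \<Rightarrow> real"
  assumes "\<And>v. lo \<le> v \<Longrightarrow> v \<le> hi \<Longrightarrow> (k has_real_derivative k' v) (at v)"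
    and "\<And>v. lo \<le> v \<Longrightarrow> v \<le> hi \<Longrightarrow> k' v \<le> 0"
    and "lo \<le> x" "x \<le> y" "y \<le> hi"
  shows "k y \<le> k x"
proof (rule DERIV_nonpos_imp_nonincreasing[OF \<open>x \<le> y\<close>])
  fix z assume "x \<le> z" "z \<le> y"
  then have "lo \<le> z" "z \<le> hi" using assms by simp_all
  then show "\<exists>d. (k has_real_derivative d) (at z) \<and> d \<le> 0"
    using assms(1,2)[of z] by blast
qed

text \<open>A concave \<open>k\<close> with zeros \<open>a \<le> b\<close> is nonnegative between
  them and nonpositive elsewhere on \<open>[lo, hi]\<close>, so \<open>K\<close> falls, rises from
  \<open>a\<close> to \<open>b\<close> and falls again: no increment over a subinterval exceeds the
  one from \<open>a\<close> to \<open>b\<close>. The condition for \<open>a = b\<close> makes the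
  zero a double one, so that in this case \<open>k \<le> 0\<close> throughout.\<close>

lemma concave_increment_le:
  fixes K k k' k'' :: "real \<Rightarrow> real"
  assumes K: "\<And>v. (K has_real_derivative k v) (at v)"
    and k: "\<And>v. (k has_real_derivative k' v) (at v)"
    and k': "\<And>v. (k' has_real_derivative k'' v) (at v)"
    and conc: "\<And>v. v \<in> {lo..hi} \<Longrightarrow> k'' v \<le> 0"
    and ab: "a \<le> b" "k a = 0" "k b = 0" "a = b \<Longrightarrow> k' a = 0"
    and lh: "lo \<le> a" "b \<le> hi" "lo \<le> x" "x \<le> y" "y \<le> hi"
  shows "K y - K x \<le> K b - K a"
proof -
  \<comment> \<open>Rolle's theorem if \<open>a < b\<close>; \<open>k\<close> increases up to
    \<open>\<xi>\<close> and decreases after it.\<close>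
  obtain \<xi> where \<xi>: "a \<le> \<xi>" "\<xi> \<le> b" "k' \<xi> = 0"
  proof (cases "a = b")
    case False
    then have "a < b" using ab by simp
    then obtain z where "a < z" "z < b" "k b - k a = (b - a) * k' z"
      using MVT2[of a b k k'] k by blast
    then show thesis using that[of z] ab \<open>a < b\<close> by simp
  qed (use that ab in auto)
  have anti: "k' w \<le> k' v" if "lo \<le> v" "v \<le> w" "w \<le> hi" for v w
    by (rule deriv_sign_imp_antimono[where lo=lo and hi=hi, OF k' _ that]) (use conc in auto)
  have up: "k v \<le> k w" if "lo \<le> v" "v \<le> w" "w \<le> \<xi>" for v w
    by (rule deriv_sign_imp_mono[where lo=lo and hi=\<xi>, OF k _ that])
       (use anti[of _ \<xi>] \<xi> lh in auto)
  have dn: "k w \<le> k v" if "\<xi> \<le> v" "v \<le> w" "w \<le> hi" for v w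
    by (rule deriv_sign_imp_antimono[where lo=\<xi> and hi=hi, OF k _ that])
       (use anti[of \<xi>] \<xi> lh in auto)
  have in1: "K v \<le> K w" if "a \<le> v" "v \<le> w" "w \<le> b" for v w
  proof (rule deriv_sign_imp_mono[where lo=a and hi=b, OF K _ that])
    fix z assume "a \<le> z" "z \<le> b" then show "0 \<le> k z"
      using up[of a z] dn[of z b] ab lh by (cases "z \<le> \<xi>") auto
  qed
  have out1: "K w \<le> K v" if "lo \<le> v" "v \<le> w" "w \<le> a" for v w
  proof (rule deriv_sign_imp_antimono[where lo=lo and hi=a, OF K _ that])
    fix z assume "lo \<le> z" "z \<le> a" then show "k z \<le> 0" using up[of z a] ab \<xi> by auto
  qed
  have out2: "K w \<le> K v" if "b \<le> v" "v \<le> w" "w \<le> hi" for v w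
  proof (rule deriv_sign_imp_antimono[where lo=b and hi=hi, OF K _ that])
    fix z assume "b \<le> z" "z \<le> hi" then show "k z \<le> 0" using dn[of b z] ab \<xi> by auto
  qed
  consider "y \<le> a" | "b \<le> x" | "a \<le> y" "x \<le> b" by linarith
  then show ?thesis
  proof cases
    case 1 then show ?thesis using out1[of x y] in1[of a b] ab lh by auto
  next
    case 2 then show ?thesis using out2[of x y] in1[of a b] ab lh by auto
  next
    case 3
    have "K y \<le> K b" using in1[of y b] out2[of b y] 3 lh ab by (cases "y \<le> b") auto
    moreover have "K a \<le> K x" using in1[of a x] out1[of x a] 3 lh ab by (cases "a \<le> x") auto
    ultimately show ?thesis by simp
  qed
qed

text \<open>\<open>P\<close> is an antiderivative of \<open>(v - a) * (b - v)\<close>, the model of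
  a concave derivative with zeros \<open>a\<close> and \<open>b\<close>. In this model the loss of
  increment on an interval \<open>[x, y]\<close> other than \<open>[a, b]\<close> can be computed
  exactly; it is cubic, a length times a squared distance of endpoints.\<close>

lemma cubic_gap:
  fixes a b x y :: real
  assumes "a \<le> b" "x \<le> y"
  defines "P \<equiv> \<lambda>v::real. (a + b) * v^2 / 2 - v^3 / 3 - a * b * v"
  shows "(P b - P a) - (P y - P x) \<ge> (y - x) * (max \<bar>a - x\<bar> \<bar>b - y\<bar>)\<^sup>2 / 6"
proof -
  define c r z d where "c = (a + b) / 2" "r = (b - a) / 2" "z = (x + y) / 2 - c" "d = (y - x) / 2"
  have eqs: "a = c - r" "b = c + r" "x = c + z - d" "y = c + z + d"
    by (auto simp: c_r_z_d_def field_simps)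
  have rd: "r \<ge> 0" "d \<ge> 0" using assms by (auto simp: c_r_z_d_def)
  \<comment> \<open>With midpoints differing by \<open>z\<close> and half-lengths \<open>r\<close>
    and \<open>d\<close> the gap splits into a term for the lengths and one for the positions, both
    nonnegative.\<close>
  have Q: "(P b - P a) - (P y - P x) = 2/3 * (r - d)^2 * (2 * r + d) + 2 * d * z^2"
    unfolding P_def eqs by (simp add: field_simps power2_eq_square power3_eq_cube)
  have "(max \<bar>a - x\<bar> \<bar>b - y\<bar>)\<^sup>2 \<le> 2 * (z^2 + (r - d)^2)"
  proof -
    have "(max \<bar>a - x\<bar> \<bar>b - y\<bar>) \<le> \<bar>z\<bar> + \<bar>r - d\<bar>"
    proof (rule max.boundedI)
      show "\<bar>a - x\<bar> \<le> \<bar>z\<bar> + \<bar>r - d\<bar>" "\<bar>b - y\<bar> \<le> \<bar>z\<bar> + \<bar>r - d\<bar>"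
        using eqs by linarith+
    qed
    then have "(max \<bar>a - x\<bar> \<bar>b - y\<bar>)\<^sup>2 \<le> (\<bar>z\<bar> + \<bar>r - d\<bar>)^2"
      by (rule power_mono) (simp add: le_max_iff_disj)
    also have "\<dots> \<le> 2 * (\<bar>z\<bar>^2 + \<bar>r - d\<bar>^2)"
      using sum_squares_bound[of "\<bar>z\<bar>" "\<bar>r-d\<bar>"] by (simp add: power2_sum)
    finally show ?thesis by simp
  qed
  then have "(y - x) * (max \<bar>a - x\<bar> \<bar>b - y\<bar>)\<^sup>2 \<le> (2 * d) * (2 * (z^2 + (r - d)^2))"
    using rd eqs by (intro mult_mono) simp_all
  then have "(y - x) * (max \<bar>a - x\<bar> \<bar>b - y\<bar>)\<^sup>2 / 6 \<le> (2 * d) * (2 * (z^2 + (r - d)^2)) / 6"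
    by (rule divide_right_mono) simp
  also have "\<dots> = 2/3 * (r - d)^2 * d + 2/3 * d * z^2" by (simp add: field_simps)
  also have "\<dots> \<le> 2/3 * (r - d)^2 * (2 * r + d) + 2 * d * z^2"
  proof -
    have "0 \<le> r * (r - d)\<^sup>2" "0 \<le> d * z\<^sup>2" using rd by simp_all
    moreover have "2/3 * (r - d)^2 * (2 * r + d) + 2 * d * z^2
        = 2/3 * (r - d)^2 * d + 2/3 * d * z^2 + (4/3 * (r * (r - d)\<^sup>2) + 4/3 * (d * z\<^sup>2))"
      by algebra
    ultimately show ?thesis by linarith
  qed
  finally show ?thesis using Q by simp
qed

text \<open>A chord slope is the mean of \<open>f'\<close> along the chord, parametrised over
  \<open>[0, 1]\<close>. Comparing the two chords at the same parameter leaves points that differ by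
  a convex combination of \<open>a - x\<close> and \<open>b - y\<close>, and the bound on
  \<open>f''\<close> makes \<open>f'\<close> Lipschitz. If \<open>a = b\<close> the slope
  \<open>s\<close> is that of the tangent.\<close>

lemma chord_slope_diff:
  fixes f f1 f2 :: "real \<Rightarrow> real"
  assumes f: "\<And>v. (f has_real_derivative f1 v) (at v)"
    and f1: "\<And>v. (f1 has_real_derivative f2 v) (at v)"
    and f2: "\<And>v. v \<in> {lo..hi} \<Longrightarrow> \<bar>f2 v\<bar> \<le> M"
    and s: "f b - f a = s * (b - a)" "a = b \<Longrightarrow> s = f1 a"
    and ab: "{a, b, x, y} \<subseteq> {lo..hi}" "x < y"
  shows "\<bar>s - (f y - f x) / (y - x)\<bar> \<le> M * max \<bar>a - x\<bar> \<bar>b - y\<bar>"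
proof -
  \<comment> \<open>A difference of antiderivatives in the chord parameter, so that the mean value
    theorem takes the place of the mean over \<open>t\<close>; the branch \<open>a = b\<close>
    covers the degenerate chord.\<close>
  define k where "k = (\<lambda>t. (if a = b then f1 a * t else f (a + t * (b - a)) / (b - a)) - f (x + t * (y - x)) / (y - x))"
  have dk: "(k has_real_derivative f1 (a + t * (b - a)) - f1 (x + t * (y - x))) (at t)" for t
  proof -
    have c: "((\<lambda>t. f (p + t * d)) has_real_derivative f1 (p + t * d) * d) (at t)" for p d
      by (rule DERIV_chain2[OF f]) (auto intro!: derivative_eq_intros)
    show ?thesis unfolding k_def using ab(2)
      by (cases "a = b") (auto intro!: derivative_eq_intros c)
  qed
  obtain t where t: "0 < t" "t < 1" "k 1 - k 0 = (1 - 0) * (f1 (a + t * (b - a)) - f1 (x + t * (y - x)))"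
    using MVT2[of 0 1 k, OF _ dk] by auto
  have k10: "k 1 - k 0 = s - (f y - f x) / (y - x)"
  proof (cases "a = b")
    case False
    then have "s = (f b - f a) / (b - a)" using s by simp
    then show ?thesis using False by (simp add: k_def diff_divide_distrib)
  next
    case True
    then have "k 1 - k 0 = f1 a - (f y - f x) / (y - x)" by (simp add: k_def diff_divide_distrib)
    then show ?thesis using s(2)[OF True] by simp
  qed
  have lip: "\<bar>f1 v - f1 w\<bar> \<le> M * \<bar>v - w\<bar>" if "v \<in> {lo..hi}" "w \<in> {lo..hi}" for v w
  proof -
    have "norm (f1 v - f1 w) \<le> M * norm (v - w)"
      by (rule field_differentiable_bound[of "{lo..hi}" f1 f2])
         (use that f2 has_field_derivative_at_within[OF f1] in auto)
    then show ?thesis by simp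
  qed
  have cv: "v + t * (w - v) \<in> {lo..hi}" if "v \<in> {lo..hi}" "w \<in> {lo..hi}" for v w
  proof -
    have "v + t * (w - v) = (1 - t) * v + t * w" by (simp add: algebra_simps)
    then show ?thesis using convexD[of "{lo..hi}" v w "1 - t" t] that t by auto
  qed
  have "\<bar>s - (f y - f x) / (y - x)\<bar> = \<bar>f1 (a + t * (b - a)) - f1 (x + t * (y - x))\<bar>"
    using k10 t(3) by simp
  also have "\<dots> \<le> M * \<bar>(a + t * (b - a)) - (x + t * (y - x))\<bar>"
    by (rule lip; rule cv) (use ab in auto)
  also have "(a + t * (b - a)) - (x + t * (y - x)) = (1 - t) * (a - x) + t * (b - y)"
    by (simp add: algebra_simps)
  also have "M * \<bar>(1 - t) * (a - x) + t * (b - y)\<bar> \<le> M * max \<bar>a - x\<bar> \<bar>b - y\<bar>"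
  proof (rule mult_left_mono)
    have "\<bar>(1 - t) * (a - x) + t * (b - y)\<bar> \<le> (1 - t) * \<bar>a - x\<bar> + t * \<bar>b - y\<bar>"
      using t abs_triangle_ineq[of "(1 - t) * (a - x)" "t * (b - y)"] by (simp add: abs_mult)
    also have "\<dots> \<le> (1 - t) * max \<bar>a - x\<bar> \<bar>b - y\<bar> + t * max \<bar>a - x\<bar> \<bar>b - y\<bar>"
      using t by (intro add_mono mult_left_mono) auto
    finally show "\<bar>(1 - t) * (a - x) + t * (b - y)\<bar> \<le> max \<bar>a - x\<bar> \<bar>b - y\<bar>" by (simp add: algebra_simps)
    show "0 \<le> M" using f2[of a] ab by force
  qed
  finally show ?thesis .
qed

definition rel_entropy :: "real \<Rightarrow> real \<Rightarrow> real" where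
  "rel_entropy c v = (v - c)\<^sup>2 / 2"

text \<open>Normalised to vanish at \<open>v = c\<close>. When \<open>q' v = v * f' v\<close>, its
  derivative is \<open>(v - c) * f' v\<close>, the characteristic speed times the derivative of
  \<open>rel_entropy c\<close>.\<close>

definition rel_flux :: "(real \<Rightarrow> real) \<Rightarrow> (real \<Rightarrow> real) \<Rightarrow> real \<Rightarrow> real \<Rightarrow> real" where
  "rel_flux f q c v = q v - q c - c * (f v - f c)"

text \<open>With \<open>G'\<close> the line through the trace points minus \<open>f\<close>, the
  left side is \<open>(G up - G um) + (G ul - G ur)\<close> and the production of the jump is
  \<open>G up - G um\<close>. The second increment is at most the one over the sorted trace interval
  \<open>[a, b]\<close>, less a defect from strict convexity. If \<open>up < um\<close> the two
  trace increments cancel; if \<open>um < up\<close> they add to twice the production.\<close>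

lemma shock_dissipation:
  fixes f f1 f2 q :: "real \<Rightarrow> real"
  assumes f: "\<And>v. (f has_real_derivative f1 v) (at v)"
    and f1: "\<And>v. (f1 has_real_derivative f2 v) (at v)"
    and f2: "\<And>v. v \<in> {lo..hi} \<Longrightarrow> \<alpha> \<le> f2 v \<and> f2 v \<le> M"
    and q: "\<And>v. (q has_real_derivative v * f1 v) (at v)"
    and \<alpha>: "\<alpha> > 0"
    and s: "f up - f um = s * (up - um)" "um = up \<Longrightarrow> s = f1 um"
    and mem: "{um, up, ul, ur} \<subseteq> {lo..hi}" "ur < ul"
  shows "s * rel_entropy ul um - rel_flux f q ul um - (s * rel_entropy ur up - rel_flux f q ur up)
    \<le> 2 * max 0 (q up - q um - s * (up\<^sup>2 - um\<^sup>2) / 2)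
      - \<alpha> / (12 * M\<^sup>2) * (ul - ur) * (s - (f ur - f ul) / (ur - ul))\<^sup>2"
proof -
  \<comment> \<open>An antiderivative of \<open>f\<close> expressed through \<open>q\<close>,
    because \<open>q' v = v * f1 v\<close>.\<close>
  define F where "F v = v * f v - q v" for v
  have F: "(F has_real_derivative f v) (at v)" for v
    unfolding F_def by (auto intro!: derivative_eq_intros f q simp: algebra_simps)
  have M: "M > 0" using f2[of um] mem \<alpha> by auto
  define a b where "a = min um up" "b = max um up"
  have ab: "a \<le> b" "lo \<le> a" "b \<le> hi" "{a, b, ur, ul} \<subseteq> {lo..hi}" using mem by (auto simp: a_b_def)
  have sab: "f b - f a = s * (b - a)"
    using s(1) by (cases "um \<le> up") (simp_all add: a_b_def algebra_simps)
  have sab': "s = f1 a" if "a = b"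
    using s(2) that by (cases "um \<le> up") (simp_all add: a_b_def)
  define G where "G v = f a * v + s * (v\<^sup>2 / 2 - a * v) - F v" for v
  define P where "P v = (a + b) * v^2 / 2 - v^3 / 3 - a * b * v" for v
  \<comment> \<open>Subtracting \<open>\<alpha> / 2\<close> times the model cubic uses up the
    uniform convexity: the derivative of \<open>K\<close> still vanishes at \<open>a\<close> and
    \<open>b\<close>, and its own second derivative \<open>\<alpha> - f2\<close> is still
    nonpositive, so the increment comparison applies to \<open>K\<close> and the cubic contributes
    the defect.\<close>
  define K where "K v = G v - \<alpha> / 2 * P v" for v
  have K: "K ul - K ur \<le> K b - K a"
  proof (rule concave_increment_le[where K=K and k="\<lambda>v. f a + s * (v - a) - f v - \<alpha> / 2 * ((v - a) * (b - v))"
        and k'="\<lambda>v. s - f1 v - \<alpha> / 2 * (a + b - 2 * v)" and k''="\<lambda>v. \<alpha> - f2 v" and lo=lo and hi=hi])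
    show "(K has_real_derivative f a + s * (v - a) - f v - \<alpha> / 2 * ((v - a) * (b - v))) (at v)" for v
      unfolding K_def G_def P_def
      by (auto intro!: derivative_eq_intros F simp: algebra_simps power2_eq_square)
    show "((\<lambda>v. f a + s * (v - a) - f v - \<alpha> / 2 * ((v - a) * (b - v))) has_real_derivative
        s - f1 v - \<alpha> / 2 * (a + b - 2 * v)) (at v)" for v
      by (auto intro!: derivative_eq_intros f simp: algebra_simps)
    show "((\<lambda>v. s - f1 v - \<alpha> / 2 * (a + b - 2 * v)) has_real_derivative \<alpha> - f2 v) (at v)" for v
      by (auto intro!: derivative_eq_intros f1 simp: algebra_simps)
    show "\<alpha> - f2 v \<le> 0" if "v \<in> {lo..hi}" for v using f2[OF that] by simp
    show "f a + s * (b - a) - f b - \<alpha> / 2 * ((b - a) * (b - b)) = 0" using sab by simp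
    show "s - f1 a - \<alpha> / 2 * (a + b - 2 * a) = 0" if "a = b" using sab' that by simp
    show "a \<le> b" "lo \<le> a" "b \<le> hi" "lo \<le> ur" "ur \<le> ul" "ul \<le> hi" using ab mem by simp_all
    show "f a + s * (a - a) - f a - \<alpha> / 2 * ((a - a) * (b - a)) = 0" by simp
  qed
  let ?mx = "max \<bar>a - ur\<bar> \<bar>b - ul\<bar>" and ?\<sigma> = "(f ur - f ul) / (ur - ul)"
  have \<sigma>: "?\<sigma> = (f ul - f ur) / (ul - ur)"
    by (metis minus_diff_eq minus_divide_divide)
  have f2': "\<bar>f2 v\<bar> \<le> M" if "v \<in> {lo..hi}" for v using f2[OF that] \<alpha> by linarith
  have "\<bar>s - (f ul - f ur) / (ul - ur)\<bar> \<le> M * ?mx"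
    by (rule chord_slope_diff[OF f f1 f2' sab sab' ab(4) mem(2)])
  then have "\<bar>s - ?\<sigma>\<bar>\<^sup>2 \<le> (M * ?mx)\<^sup>2" unfolding \<sigma> by (rule power_mono) simp
  then have "(s - ?\<sigma>)\<^sup>2 / M\<^sup>2 \<le> ?mx\<^sup>2"
    using M by (simp add: field_simps power_mult_distrib)
  \<comment> \<open>The \<open>1 / 12\<close> is the \<open>1 / 2\<close> in \<open>K\<close> times
    the \<open>1 / 6\<close> of \<open>cubic_gap\<close>.\<close>
  then have "\<alpha> / 12 * (ul - ur) * ((s - ?\<sigma>)\<^sup>2 / M\<^sup>2) \<le> \<alpha> / 12 * (ul - ur) * ?mx\<^sup>2"
    using \<alpha> mem(2) by (intro mult_left_mono) simp_all
  also have "\<dots> = \<alpha> / 2 * ((ul - ur) * ?mx\<^sup>2 / 6)" by simp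
  also have "\<dots> \<le> \<alpha> / 2 * ((P b - P a) - (P ul - P ur))"
  proof (rule mult_left_mono)
    show "(ul - ur) * ?mx\<^sup>2 / 6 \<le> P b - P a - (P ul - P ur)"
      unfolding P_def by (rule cubic_gap) (use ab(1) mem(2) in simp_all)
  qed (use \<alpha> in simp)
  finally have "\<alpha> / 12 * (ul - ur) * ((s - ?\<sigma>)\<^sup>2 / M\<^sup>2) \<le> \<alpha> / 2 * (P b - P a - (P ul - P ur))" .
  then have gap: "G ul - G ur \<le> G b - G a - \<alpha> / (12 * M\<^sup>2) * (ul - ur) * (s - ?\<sigma>)\<^sup>2"
  proof -
    have e: "\<alpha> / 12 * (ul - ur) * ((s - ?\<sigma>)\<^sup>2 / M\<^sup>2) = \<alpha> / (12 * M\<^sup>2) * (ul - ur) * (s - ?\<sigma>)\<^sup>2"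
      by simp
    assume "\<alpha> / 12 * (ul - ur) * ((s - ?\<sigma>)\<^sup>2 / M\<^sup>2) \<le> \<alpha> / 2 * (P b - P a - (P ul - P ur))"
    moreover have "\<alpha> / 2 * (P b - P a - (P ul - P ur)) = \<alpha> / 2 * P b - \<alpha> / 2 * P a - \<alpha> / 2 * P ul + \<alpha> / 2 * P ur"
      by algebra
    ultimately show ?thesis using K unfolding e K_def by linarith
  qed
  have line: "f um + s * (v - um) = f a + s * (v - a)" for v
    using s(1) by (cases "um \<le> up") (simp_all add: a_b_def algebra_simps)
  have lin: "f um = f a + s * (um - a)" "f up = f a + s * (up - a)"
    using line[of um] line[of up] s(1) by simp_all
  have m: "q up - q um - s * (up\<^sup>2 - um\<^sup>2) / 2 = G up - G um"
    by (simp add: G_def F_def lin field_simps power2_eq_square)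
  have D: "s * rel_entropy ul um - rel_flux f q ul um - (s * rel_entropy ur up - rel_flux f q ur up)
      = (G up - G um) + (G ul - G ur)"
    by (simp add: G_def F_def rel_entropy_def rel_flux_def lin field_simps power2_eq_square)
  have "G b - G a + (G up - G um) \<le> 2 * max 0 (G up - G um)"
    by (cases "um \<le> up") (auto simp: a_b_def min_def max_def)
  then show ?thesis unfolding D m using gap by linarith
qed

section \<open>Vitali coverings, differentiation of integrals, Rademacher's theorem on the
  line\<close>

section \<open>Lebesgue differentiation and Lipschitz functions\<close>

lemma set_integrable_bounded_Icc:
  fixes g :: "real \<Rightarrow> real"
  assumes [measurable]: "g \<in> borel_measurable borel" and "\<And>t. \<bar>g t\<bar> \<le> B"
  shows "set_integrable lborel {a..b} g"
  unfolding set_integrable_def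
  by (rule integrableI_bounded_set_indicator[where B=B]) (use assms(2) in \<open>auto simp: emeasure_lborel_Icc_eq\<close>)

text \<open>Vitali covering argument: up to a null set the exceptional points are covered by
  disjoint short intervals on which the mean of \<open>g\<close> exceeds \<open>q\<close>, all
  inside an open \<open>U\<close> that is barely larger than the set \<open>A\<close> where
  \<open>g < p\<close>. Their union \<open>J\<close> has integral at least \<open>q |J|\<close> but
  at most \<open>p |J| + B |U - A|\<close>, so \<open>|J|\<close> is small.\<close>

lemma negligible_upper_derivate_gt:
  fixes g :: "real \<Rightarrow> real"
  assumes gm[measurable]: "g \<in> borel_measurable borel" and g: "\<And>t. 0 \<le> g t" "\<And>t. g t \<le> B"
    and pq: "p < q"
  shows "negligible {t. g t < p \<and> (\<forall>d>0. \<exists>a b. a \<le> t \<and> t \<le> b \<and> a < b \<and> b - a < d \<and>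
           q * (b - a) < (LINT s:{a..b}|lborel. g s))}" (is "negligible ?E")
proof -
  let ?\<nu> = "density lborel (\<lambda>x. ennreal (g x))"
  have B: "0 \<le> B" using g[of 0] by linarith
  have \<nu>: "emeasure ?\<nu> {a..b} = ennreal (LINT s:{a..b}|lborel. g s)" for a b
  proof -
    have "emeasure ?\<nu> {a..b} = (\<integral>\<^sup>+x. ennreal (indicator {a..b} x * g x) \<partial>lborel)"
      by (subst emeasure_density) (auto intro!: nn_integral_cong simp: indicator_def)
    also have "\<dots> = ennreal (LINT s:{a..b}|lborel. g s)"
      unfolding set_lebesgue_integral_def
      using set_integrable_bounded_Icc[OF gm, of B a b] g
      by (subst nn_integral_eq_integral) (auto simp: set_integrable_def)
    finally show ?thesis .
  qed
  \<comment> \<open>Restriction to a bounded interval keeps \<open>J\<close> of finite measure,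
    which is needed to subtract \<open>p |J|\<close>.\<close>
  have "negligible (?E \<inter> {-real k<..<real k})" for k
    unfolding negligible_outer_le
  proof (intro allI impI)
    fix e :: real assume e: "e > 0"
    show "\<exists>T. ?E \<inter> {-real k<..<real k} \<subseteq> T \<and> T \<in> lmeasurable \<and> measure lebesgue T \<le> e"
    proof (cases "p > 0")
      case False
      then have "\<not> g t < p" for t using g(1)[of t] by linarith
      then have "?E = {}" by blast
      then have "?E \<inter> {-real k<..<real k} \<subseteq> {}" by (simp only: Int_empty_left subset_refl)
      then show ?thesis using e by (intro exI[of _ "{}"] conjI) simp_all
    next
      case True
      define A where "A = {t. g t < p} \<inter> {-real k<..<real k}"
      have A[measurable]: "A \<in> sets borel" unfolding A_def by measurable
      \<comment> \<open>Chosen so that \<open>B * \<delta> \<le> (q - p) * e\<close>; the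
        \<open>+ 1\<close> avoids a division by \<open>B = 0\<close>.\<close>
      define \<delta> where "\<delta> = e * (q - p) / (B + 1)"
      have \<delta>: "\<delta> > 0" using e pq B by (auto simp: \<delta>_def)
      obtain U where U: "open U" "A \<subseteq> U" "emeasure lebesgue (U - A) < ennreal \<delta>"
      proof -
        have "A \<in> sets lebesgue" using A by simp
        then show thesis
        proof (rule sets_lebesgue_outer_open[OF _ \<delta>])
          fix U assume "open U" "A \<subseteq> U" "emeasure lebesgue (U - A) < ennreal \<delta>"
          then show thesis by (rule that)
        qed
      qed
      have [measurable]: "U \<in> sets borel" using U by auto
      define K where "K = {(a, b). a < b \<and> {a..b} \<subseteq> U \<and> q * (b - a) < (LINT s:{a..b}|lborel. g s)}"
      define ce re where "ce i = (fst i + snd i) / 2" and "re i = (snd i - fst i) / 2" for i :: "real \<times> real"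
      have cb: "cball (ce i) (re i) = {fst i..snd i}" for i
        unfolding ce_def re_def cball_eq_atLeastAtMost by (simp add: field_simps)
      have ex: "\<exists>i. i \<in> K \<and> t \<in> cball (ce i) (re i) \<and> re i < d"
        if t: "t \<in> ?E \<inter> {-real k<..<real k}" and d: "0 < d" for t d
      proof -
        have "t \<in> U" using t U(2) by (auto simp: A_def)
        then obtain r where r: "r > 0" "ball t r \<subseteq> U" using U(1) open_contains_ball by blast
        obtain a b where ab: "a \<le> t" "t \<le> b" "a < b" "b - a < min d r"
          "q * (b - a) < (LINT s:{a..b}|lborel. g s)"
        proof -
          have "\<forall>d>0. \<exists>a b. a \<le> t \<and> t \<le> b \<and> a < b \<and> b - a < d \<and> q * (b - a) < (LINT s:{a..b}|lborel. g s)"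
            using t by blast
          then have "\<exists>a b. a \<le> t \<and> t \<le> b \<and> a < b \<and> b - a < min d r \<and> q * (b - a) < (LINT s:{a..b}|lborel. g s)"
            by (rule allE[where x="min d r"]) (use d r(1) in simp)
          then show thesis using that by blast
        qed
        have "{a..b} \<subseteq> ball t r" using ab by (auto simp: dist_real_def)
        then have "(a, b) \<in> K" using ab r by (auto simp: K_def)
        moreover have "t \<in> cball (ce (a, b)) (re (a, b))" unfolding cb using ab by simp
        moreover have "re (a, b) < d" using ab by (simp add: re_def)
        ultimately show ?thesis by blast
      qed
      have "\<And>i. i \<in> K \<Longrightarrow> 0 < re i" by (auto simp: K_def re_def)
      from Vitali_covering_theorem_cballs[of K re "?E \<inter> {-real k<..<real k}" ce, OF this ex]
      obtain C where C: "countable C" "C \<subseteq> K"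
        "pairwise (\<lambda>i j. disjnt (cball (ce i) (re i)) (cball (ce j) (re j))) C"
        "negligible (?E \<inter> {-real k<..<real k} - (\<Union>i\<in>C. cball (ce i) (re i)))"
        by blast
      define J where "J = (\<Union>i\<in>C. {fst i..snd i})"
      have Jm[measurable]: "J \<in> sets borel" unfolding J_def using C(1) by auto
      have disj: "disjoint_family_on (\<lambda>i. {fst i..snd i}) C"
        using C(3) unfolding pairwise_def disjnt_def disjoint_family_on_def cb by blast
      have "{fst i..snd i} \<subseteq> U" if "i \<in> C" for i
      proof -
        have "i \<in> K" using that C(2) by blast
        then show ?thesis unfolding K_def by (simp add: case_prod_beta)
      qed
      then have JU: "J \<subseteq> U" unfolding J_def by blast
      have "ennreal q * emeasure lborel J = (\<integral>\<^sup>+i. ennreal q * emeasure lborel {fst i..snd i} \<partial>count_space C)"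
        unfolding J_def using C(1) disj
        by (subst emeasure_UN_countable) (auto simp: nn_integral_cmult)
      also have "\<dots> \<le> (\<integral>\<^sup>+i. emeasure ?\<nu> {fst i..snd i} \<partial>count_space C)"
      proof (rule nn_integral_mono)
        fix i assume "i \<in> space (count_space C)"
        then have "i \<in> K" using C(2) by auto
        then have i: "fst i < snd i" "q * (snd i - fst i) < (LINT s:{fst i..snd i}|lborel. g s)"
          by (auto simp: K_def)
        have "ennreal q * emeasure lborel {fst i..snd i} = ennreal (q * (snd i - fst i))"
          using i True pq by (simp add: ennreal_mult)
        also have "\<dots> \<le> emeasure ?\<nu> {fst i..snd i}" unfolding \<nu> using i by (intro ennreal_leI) simp
        finally show "ennreal q * emeasure lborel {fst i..snd i} \<le> emeasure ?\<nu> {fst i..snd i}" .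
      qed
      also have "\<dots> = emeasure ?\<nu> J"
        unfolding J_def using C(1) disj by (subst emeasure_UN_countable) auto
      also have "\<dots> = (\<integral>\<^sup>+x. ennreal (g x) * indicator J x \<partial>lborel)"
        by (subst emeasure_density) auto
      also have "\<dots> \<le> (\<integral>\<^sup>+x. ennreal p * indicator J x + ennreal B * indicator (U - A) x \<partial>lborel)"
      proof (rule nn_integral_mono)
        fix x
        show "ennreal (g x) * indicator J x \<le> ennreal p * indicator J x + ennreal B * indicator (U - A) x"
        proof (cases "x \<in> J \<and> x \<notin> A")
          case True
          then show ?thesis using JU g(2)[of x] by (auto simp: ennreal_leI intro!: add_increasing)
        next
          case False
          then show ?thesis by (auto simp: indicator_def A_def ennreal_leI intro!: add_increasing2)
        qed
      qed
      also have "\<dots> = ennreal p * emeasure lborel J + ennreal B * emeasure lborel (U - A)"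
        by (subst nn_integral_add) (auto simp: nn_integral_cmult)
      also have "\<dots> \<le> ennreal p * emeasure lborel J + ennreal B * ennreal \<delta>"
        using U(3) by (intro add_left_mono mult_left_mono) (auto simp: less_imp_le)
      finally have main: "ennreal q * emeasure lborel J \<le> ennreal p * emeasure lborel J + ennreal B * ennreal \<delta>" .
      have "emeasure lborel J \<le> emeasure lborel (A \<union> (U - A))" using JU by (intro emeasure_mono) auto
      also have "\<dots> \<le> emeasure lborel A + emeasure lborel (U - A)" by (rule emeasure_subadditive) auto
      also have "\<dots> \<le> emeasure lborel {-real k..real k} + ennreal \<delta>"
        using U(3) by (intro add_mono emeasure_mono) (auto simp: A_def less_imp_le)
      also have "\<dots> < \<infinity>" by (simp add: emeasure_lborel_Icc_eq)
      finally have Jfin: "emeasure lborel J < \<infinity>" .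
      have eJ: "emeasure lborel J = ennreal (measure lborel J)"
        using Jfin by (intro emeasure_eq_ennreal_measure) auto
      have "ennreal (q * measure lborel J) \<le> ennreal (p * measure lborel J + B * \<delta>)"
        using main True pq B \<delta> unfolding eJ by (simp add: ennreal_mult ennreal_plus)
      then have "q * measure lborel J \<le> p * measure lborel J + B * \<delta>"
        using True B \<delta> by (subst (asm) ennreal_le_iff) (auto intro!: add_nonneg_nonneg)
      then have "(q - p) * measure lborel J \<le> B * \<delta>" by (simp add: algebra_simps)
      also have "\<dots> \<le> (B + 1) * \<delta>" using \<delta> by (simp add: algebra_simps)
      also have "\<dots> = (q - p) * e" using B by (simp add: \<delta>_def)
      finally have mJ: "measure lborel J \<le> e" using pq by simp
      define N where "N = ?E \<inter> {-real k<..<real k} - J"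
      have N: "N \<in> null_sets lebesgue" using C(4) unfolding N_def J_def cb negligible_iff_null_sets by simp
      have Jl: "J \<in> lmeasurable" using Jfin by (auto simp: fmeasurable_def)
      have "measure lebesgue (J \<union> N) = measure lebesgue J"
        using N Jl by (intro measure_Un_null_set) auto
      then have "measure lebesgue (J \<union> N) \<le> e" using mJ by simp
      moreover have "J \<union> N \<in> lmeasurable"
      proof (rule fmeasurable.Un[OF Jl])
        show "N \<in> lmeasurable" using N by (simp add: negligible_imp_measurable negligible_iff_null_sets)
      qed
      ultimately show ?thesis by (intro exI[of _ "J \<union> N"]) (auto simp: N_def)
    qed
  qed
  then have "negligible (\<Union>k::nat. ?E \<inter> {-real k<..<real k})"
    unfolding negligible_iff_null_sets by (rule null_sets_UN)
  moreover have "?E \<subseteq> (\<Union>k::nat. ?E \<inter> {-real k<..<real k})"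
  proof
    fix t assume "t \<in> ?E"
    moreover obtain k :: nat where "\<bar>t\<bar> < real k" using reals_Archimedean2 by blast
    then have "t \<in> {-real k<..<real k}" by simp linarith
    ultimately show "t \<in> (\<Union>k::nat. ?E \<inter> {-real k<..<real k})" by blast
  qed
  ultimately show ?thesis using negligible_subset by blast
qed


lemma has_real_derivative_of_interval_bounds:
  fixes F :: "real \<Rightarrow> real"
  assumes "\<And>e. e > 0 \<Longrightarrow> \<exists>d>0. \<forall>a b. a \<le> t \<longrightarrow> t \<le> b \<longrightarrow> a < b \<longrightarrow> b - a < d \<longrightarrow>
    \<bar>F b - F a - D * (b - a)\<bar> \<le> e * (b - a)"
  shows "(F has_real_derivative D) (at t)"
  unfolding DERIV_def LIM_def
proof (intro allI impI)
  fix e :: real assume "e > 0"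
  then obtain d where d: "d > 0" "\<And>a b. a \<le> t \<Longrightarrow> t \<le> b \<Longrightarrow> a < b \<Longrightarrow> b - a < d \<Longrightarrow>
      \<bar>F b - F a - D * (b - a)\<bar> \<le> e / 2 * (b - a)"
    using assms[of "e / 2"] by (meson half_gt_zero)
  have "dist ((F (t + h) - F t) / h) D < e" if h: "h \<noteq> 0" "\<bar>h\<bar> < d" for h
  proof -
    have "\<bar>F (t + h) - F t - D * h\<bar> \<le> e / 2 * \<bar>h\<bar>"
    proof (cases "h > 0")
      case True then show ?thesis using d(2)[of t "t + h"] h by simp
    next
      case False
      then have "\<bar>F t - F (t + h) - D * (t - (t + h))\<bar> \<le> e / 2 * (t - (t + h))"
        using h by (intro d(2)) auto
      moreover have "F t - F (t + h) - D * (t - (t + h)) = - (F (t + h) - F t - D * h)" by simp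
      ultimately show ?thesis using False by (simp only: abs_minus_cancel) simp
    qed
    moreover have "(F (t + h) - F t) / h - D = (F (t + h) - F t - D * h) / h" using h by (simp add: field_simps)
    ultimately have "\<bar>(F (t + h) - F t) / h - D\<bar> \<le> e / 2"
      using h by (simp add: abs_divide divide_le_eq)
    then show ?thesis using \<open>e > 0\<close> by (simp add: dist_real_def)
  qed
  then show "\<exists>s>0. \<forall>x. x \<noteq> 0 \<and> dist x 0 < s \<longrightarrow> dist ((F (t + x) - F t) / x) D < e"
    using d(1) by (intro exI[of _ d]) simp
qed

text \<open>If no rational pair \<open>p < q\<close> separates \<open>k t\<close> from the interval
  means of \<open>k\<close> near \<open>t\<close>, these means are asymptotically at most
  \<open>k t\<close>. Applied to \<open>k = g + B\<close> this bounds the means of \<open>g\<close>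
  from above, applied to \<open>k = B - g\<close> from below; the shifts by \<open>B\<close> make
  both functions nonnegative, as the covering lemma demands.\<close>

theorem lebesgue_differentiation:
  fixes g F :: "real \<Rightarrow> real"
  assumes gm[measurable]: "g \<in> borel_measurable borel" and g: "\<And>t. \<bar>g t\<bar> \<le> B"
    and F: "\<And>a b. a \<le> b \<Longrightarrow> F b - F a = (LINT s:{a..b}|lborel. g s)"
  shows "AE t in lborel. (F has_real_derivative g t) (at t)"
proof -
  define bad where "bad k p q = {t. k t < p \<and> (\<forall>d>0. \<exists>a b. a \<le> t \<and> t \<le> b \<and> a < b \<and> b - a < d \<and>
           q * (b - a) < (LINT s:{a..b}|lborel. k s))}" for k :: "real \<Rightarrow> real" and p q :: real
  have good: "\<exists>d>0. \<forall>a b. a \<le> t \<longrightarrow> t \<le> b \<longrightarrow> a < b \<longrightarrow> b - a < d \<longrightarrow>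
      (LINT s:{a..b}|lborel. k s) \<le> (k t + e) * (b - a)"
    if t: "\<And>p q. p \<in> \<rat> \<Longrightarrow> q \<in> \<rat> \<Longrightarrow> p < q \<Longrightarrow> t \<notin> bad k p q" and e: "e > 0" for k t e
  proof -
    obtain p where p: "p \<in> \<rat>" "k t < p" "p < k t + e / 2"
      using Rats_dense_in_real[of "k t" "k t + e / 2"] e by auto
    obtain q where q: "q \<in> \<rat>" "k t + e / 2 < q" "q < k t + e"
      using Rats_dense_in_real[of "k t + e / 2" "k t + e"] e by auto
    have "t \<notin> bad k p q" using t p q by auto
    then obtain d where d: "d > 0" "\<And>a b. a \<le> t \<Longrightarrow> t \<le> b \<Longrightarrow> a < b \<Longrightarrow> b - a < d \<Longrightarrow>
        \<not> q * (b - a) < (LINT s:{a..b}|lborel. k s)"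
      using p by (auto simp: bad_def)
    show ?thesis
    proof (intro exI[of _ d] conjI allI impI)
      fix a b assume ab: "a \<le> t" "t \<le> b" "a < b" "b - a < d"
      have "(LINT s:{a..b}|lborel. k s) \<le> q * (b - a)" using d(2)[OF ab] by simp
      also have "\<dots> \<le> (k t + e) * (b - a)" using q ab by (intro mult_right_mono) auto
      finally show "(LINT s:{a..b}|lborel. k s) \<le> (k t + e) * (b - a)" .
    qed (rule d(1))
  qed
  define k1 k2 where "k1 s = g s + B" and "k2 s = B - g s" for s
  have [measurable]: "k1 \<in> borel_measurable borel" "k2 \<in> borel_measurable borel"
    unfolding k1_def k2_def by measurable
  define N where "N = (\<Union>p\<in>\<rat>. \<Union>q\<in>\<rat>. if p < q then bad k1 p q \<union> bad k2 p q else {})"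
  have k12: "0 \<le> k1 t" "k1 t \<le> 2 * B" "0 \<le> k2 t" "k2 t \<le> 2 * B" for t
    using g[of t] by (auto simp: k1_def k2_def abs_le_iff)
  have "bad k1 p q \<union> bad k2 p q \<in> null_sets lebesgue" if "p < q" for p q
    unfolding bad_def
    using negligible_upper_derivate_gt[of k1 "2 * B" p q] negligible_upper_derivate_gt[of k2 "2 * B" p q] k12 that
    by (intro null_sets.Un) (simp_all add: negligible_iff_null_sets)
  then have "N \<in> null_sets lebesgue"
    unfolding N_def by (intro null_sets_UN' countable_rat) auto
  then have "AE t in lebesgue. t \<notin> N" by (rule AE_not_in)
  then have "AE t in lborel. t \<notin> N" by (simp only: AE_completion_iff)
  then show ?thesis
  proof (rule AE_mp, intro AE_I2 impI)
    fix t assume tN: "t \<notin> N"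
    have t1: "t \<notin> bad k1 p q" and t2: "t \<notin> bad k2 p q" if "p \<in> \<rat>" "q \<in> \<rat>" "p < q" for p q
      using tN that unfolding N_def by auto
    show "(F has_real_derivative g t) (at t)"
    proof (rule has_real_derivative_of_interval_bounds)
      fix e :: real assume e: "e > 0"
      obtain d1 where d1: "d1 > 0" "\<And>a b. a \<le> t \<Longrightarrow> t \<le> b \<Longrightarrow> a < b \<Longrightarrow> b - a < d1 \<Longrightarrow>
          (LINT s:{a..b}|lborel. k1 s) \<le> (k1 t + e) * (b - a)" using good[OF t1 e] by blast
      obtain d2 where d2: "d2 > 0" "\<And>a b. a \<le> t \<Longrightarrow> t \<le> b \<Longrightarrow> a < b \<Longrightarrow> b - a < d2 \<Longrightarrow>
          (LINT s:{a..b}|lborel. k2 s) \<le> (k2 t + e) * (b - a)" using good[OF t2 e] by blast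
      show "\<exists>d>0. \<forall>a b. a \<le> t \<longrightarrow> t \<le> b \<longrightarrow> a < b \<longrightarrow> b - a < d \<longrightarrow>
          \<bar>F b - F a - g t * (b - a)\<bar> \<le> e * (b - a)"
      proof (intro exI[of _ "min d1 d2"] conjI allI impI)
        fix a b assume ab: "a \<le> t" "t \<le> b" "a < b" "b - a < min d1 d2"
        have gi: "set_integrable lborel {a..b} g" by (rule set_integrable_bounded_Icc[OF gm g])
        have ci: "set_integrable lborel {a..b} (\<lambda>_. B)" by (rule set_integrable_bounded_Icc[of _ "\<bar>B\<bar>"]) auto
        have cB: "(LINT s:{a..b}|lborel. B) = B * (b - a)"
          using ab by (simp add: set_lebesgue_integral_def)
        have "(LINT s:{a..b}|lborel. k1 s) = F b - F a + B * (b - a)"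
          unfolding k1_def using gi ci F[of a b] ab by (subst set_integral_add) (auto simp: cB)
        moreover have "(LINT s:{a..b}|lborel. k2 s) = B * (b - a) - (F b - F a)"
          unfolding k2_def using gi ci F[of a b] ab by (subst set_integral_diff) (auto simp: cB)
        ultimately have "F b - F a + B * (b - a) \<le> (g t + B + e) * (b - a)"
            "B * (b - a) - (F b - F a) \<le> (B - g t + e) * (b - a)"
          using d1(2)[of a b] d2(2)[of a b] ab unfolding k1_def k2_def by simp_all
        then show "\<bar>F b - F a - g t * (b - a)\<bar> \<le> e * (b - a)"
          by (simp add: algebra_simps abs_le_iff)
      qed (use d1 d2 in simp)
    qed
  qed
qed

text \<open>Pushing Lebesgue measure forward by the inverse of \<open>G\<close> gives each interval
  the length of its image under \<open>G\<close>. A Lipschitz map sends null sets to null sets, so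
  this measure is absolutely continuous, and its Radon-Nikodym density plays the role of
  \<open>G'\<close>. The lower slope bound makes \<open>G\<close> a bijection with monotone, hence
  measurable, inverse.\<close>

lemma increasing_bilipschitz_density:
  fixes G :: "real \<Rightarrow> real"
  assumes lo: "\<And>s t. s \<le> t \<Longrightarrow> t - s \<le> G t - G s"
    and hi: "\<And>s t. s \<le> t \<Longrightarrow> G t - G s \<le> L * (t - s)"
  obtains f where "f \<in> borel_measurable borel"
    "\<And>a b. a \<le> b \<Longrightarrow> (\<integral>\<^sup>+x\<in>{a<..<b}. f x \<partial>lborel) = ennreal (G b - G a)"
proof -
  have smono: "G s < G t \<longleftrightarrow> s < t" for s t
    using lo[of s t] lo[of t s] by (cases "s < t") auto
  have Gabs: "\<bar>G s - G t\<bar> \<le> L * \<bar>s - t\<bar>" for s t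
    using lo[of s t] hi[of s t] lo[of t s] hi[of t s] by (cases "s \<le> t") auto
  have L: "L \<ge> 0" using Gabs[of 1 0] by auto
  have "L-lipschitz_on UNIV G"
    by (rule lipschitz_onI) (use Gabs L in \<open>auto simp: dist_real_def\<close>)
  then have cont: "continuous_on UNIV G" by (rule lipschitz_on_continuous_on)
  have "\<exists>s. G s = y" for y
  proof -
    define k where "k = \<bar>y - G 0\<bar>"
    have "G (- k) \<le> y" "y \<le> G k" using lo[of "-k" 0] lo[of 0 k] by (auto simp: k_def)
    then show ?thesis
      using IVT'[of G "-k" y k] cont by (auto simp: k_def intro: continuous_on_subset)
  qed
  then have surj: "surj G" by (metis surjI)
  have "inj G"
  proof (rule injI)
    fix s t assume "G s = G t" then show "s = t" using smono[of s t] smono[of t s] by linarith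
  qed
  with surj have bij: "bij G" by (simp add: bij_def)
  define H where "H = inv G"
  have GH: "G (H y) = y" "H (G x) = x" for x y
    using surj \<open>inj G\<close> by (simp_all add: H_def surj_f_inv_f)
  have "mono H"
  proof (rule monoI)
    fix a b :: real assume "a \<le> b"
    then show "H a \<le> H b" using smono[of "H b" "H a"] GH(1) by (simp add: not_less[symmetric])
  qed
  then have Hm[measurable]: "H \<in> borel_measurable borel" by (rule borel_measurable_mono)
  let ?\<nu> = "distr lborel borel H"
  have vim: "H -` A = G ` A" for A
  proof (intro set_eqI iffI)
    fix y assume "y \<in> H -` A" then show "y \<in> G ` A" using GH(1)[of y] by (intro image_eqI[of _ _ "H y"]) auto
  qed (auto simp: GH)
  have "absolutely_continuous lborel ?\<nu>"
    unfolding absolutely_continuous_def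
  proof
    fix A :: "real set" assume A: "A \<in> null_sets lborel"
    have "negligible A" using A by (simp add: negligible_iff_null_sets null_sets_completionI)
    then have "negligible (G ` A)"
    proof (rule negligible_locally_Lipschitz_image[rotated])
      fix x
      show "\<exists>T B. open T \<and> x \<in> T \<and> (\<forall>y\<in>A \<inter> T. norm (G y - G x) \<le> B * norm (y - x))"
        using Gabs by (intro exI[of _ UNIV] exI[of _ L]) simp
    qed simp
    moreover have [measurable]: "A \<in> sets borel" using A by auto
    moreover have "G ` A \<in> sets lborel"
      using measurable_sets[OF Hm \<open>A \<in> sets borel\<close>] by (simp add: vim)
    ultimately have "G ` A \<in> null_sets lborel"
      by (simp add: negligible_iff_null_sets null_sets_completion_iff)
    then have "emeasure lborel (G ` A) = 0" by (rule null_setsD1)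
    then show "A \<in> null_sets ?\<nu>" by (auto simp: emeasure_distr vim)
  qed
  then obtain f where f: "f \<in> borel_measurable lborel" "density lborel f = ?\<nu>"
    using sigma_finite_measure.Radon_Nikodym[OF sigma_finite_lborel, of ?\<nu>] by auto
  show thesis
  proof
    show fm: "f \<in> borel_measurable borel" using f by simp
    fix a b :: real assume "a \<le> b"
    have "G ` {a<..<b} = {G a<..<G b}"
    proof (intro set_eqI iffI)
      fix y assume "y \<in> {G a<..<G b}"
      then have "H y \<in> {a<..<b}" using smono[of a "H y"] smono[of "H y" b] GH(1)[of y] by auto
      then show "y \<in> G ` {a<..<b}" by (intro image_eqI[of _ _ "H y"]) (simp add: GH)
    qed (auto simp: smono)
    have "(\<integral>\<^sup>+x\<in>{a<..<b}. f x \<partial>lborel) = emeasure (density lborel f) {a<..<b}"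
      using fm by (subst emeasure_density) auto
    also have "\<dots> = ennreal (G b - G a)"
      unfolding f using \<open>G ` {a<..<b} = {G a<..<G b}\<close> lo[OF \<open>a \<le> b\<close>] \<open>a \<le> b\<close>
      by (simp add: emeasure_distr vim)
    finally show "(\<integral>\<^sup>+x\<in>{a<..<b}. f x \<partial>lborel) = ennreal (G b - G a)" .
  qed
qed

text \<open>Adding a steep linear function to \<open>x\<close> and to \<open>- x\<close> makes both
  increasing with slopes at least 1, so both are integrals of densities; once the density is known
  to be bounded, differentiation of integrals applies.\<close>

theorem lipschitz_AE_differentiable:
  fixes x :: "real \<Rightarrow> real"
  assumes "S-lipschitz_on UNIV x"
  obtains v where "v \<in> borel_measurable borel" "\<And>t. \<bar>v t\<bar> \<le> S"
    "AE t in lborel. (x has_real_derivative v t) (at t)"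
proof -
  have S: "S \<ge> 0" and lip: "\<bar>x s - x t\<bar> \<le> S * \<bar>s - t\<bar>" for s t
    using assms lipschitz_on_nonneg lipschitz_onD[OF assms, of s t] by (auto simp: dist_real_def)
  define L where "L = 2 * S + 1"
  define G1 G2 where "G1 t = x t + (S + 1) * t" and "G2 t = (S + 1) * t - x t" for t
  have 1: "t - s \<le> G1 t - G1 s" "G1 t - G1 s \<le> L * (t - s)"
      "t - s \<le> G2 t - G2 s" "G2 t - G2 s \<le> L * (t - s)" if "s \<le> t" for s t
    using lip[of t s] that by (auto simp: G1_def G2_def L_def abs_le_iff algebra_simps)
  obtain f1 where f1[measurable]: "f1 \<in> borel_measurable borel"
    and f1i: "\<And>a b. a \<le> b \<Longrightarrow> (\<integral>\<^sup>+x\<in>{a<..<b}. f1 x \<partial>lborel) = ennreal (G1 b - G1 a)"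
    using increasing_bilipschitz_density[of G1 L] 1 by blast
  obtain f2 where f2[measurable]: "f2 \<in> borel_measurable borel"
    and f2i: "\<And>a b. a \<le> b \<Longrightarrow> (\<integral>\<^sup>+x\<in>{a<..<b}. f2 x \<partial>lborel) = ennreal (G2 b - G2 a)"
    using increasing_bilipschitz_density[of G2 L] 1 by blast
  define c where "c = 2 * (S + 1)"
  have c: "c > 0" using S by (simp add: c_def)
  \<comment> \<open>The two densities sum to the constant \<open>c\<close>, which bounds each of them.\<close>
  let ?D = "density lborel (\<lambda>t. ennreal (1 / c) * (f1 t + f2 t))"
  have "lborel = ?D"
  proof (rule lborel_eqI)
    fix l u :: real assume "\<And>b. b \<in> Basis \<Longrightarrow> l \<bullet> b \<le> u \<bullet> b"
    then have lu: "l \<le> u" by simp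
    have "emeasure ?D (box l u) = (\<integral>\<^sup>+t. ennreal (1 / c) * (f1 t * indicator {l<..<u} t + f2 t * indicator {l<..<u} t) \<partial>lborel)"
      by (subst emeasure_density) (auto intro!: nn_integral_cong simp: box_real indicator_def)
    also have "\<dots> = ennreal (1 / c) * (ennreal (G1 u - G1 l) + ennreal (G2 u - G2 l))"
      using f1i[OF lu] f2i[OF lu] by (simp add: nn_integral_cmult nn_integral_add)
    also have "\<dots> = ennreal (1 / c * (c * (u - l)))"
      using 1[OF lu] lu c
      by (subst ennreal_plus[symmetric]) (auto simp: ennreal_mult[symmetric] G1_def G2_def c_def algebra_simps)
    also have "\<dots> = ennreal (\<Prod>b\<in>Basis. (u - l) \<bullet> b)" using c by simp
    finally show "emeasure ?D (box l u) = ennreal (\<Prod>b\<in>Basis. (u - l) \<bullet> b)" .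
  qed simp
  then have "density lborel (\<lambda>t. ennreal (1 / c) * (f1 t + f2 t)) = density lborel (\<lambda>_. 1)"
    by (simp add: density_1)
  then have "AE t in lborel. ennreal (1 / c) * (f1 t + f2 t) = 1"
    by (intro sigma_finite_measure.density_unique[OF sigma_finite_lborel]) auto
  then have f1c: "AE t in lborel. f1 t \<le> ennreal c"
  proof eventually_elim
    case (elim t)
    have "ennreal c = ennreal c * (ennreal (1 / c) * (f1 t + f2 t))" using elim by simp
    also have "\<dots> = (ennreal c * ennreal (1 / c)) * (f1 t + f2 t)" by (simp add: mult.assoc)
    also have "ennreal c * ennreal (1 / c) = 1" using c by (subst ennreal_mult[symmetric]) auto
    finally have "ennreal c = f1 t + f2 t" by simp
    then show ?case by (simp add: add_increasing2)
  qed
  define g where "g t = min c (enn2real (f1 t))" for t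
  have [measurable]: "g \<in> borel_measurable borel" unfolding g_def by measurable
  have gb: "0 \<le> g t" "g t \<le> c" for t using c by (auto simp: g_def)
  have gf: "AE t in lborel. ennreal (g t) = f1 t"
    using f1c
  proof eventually_elim
    case (elim t)
    then have "f1 t < top" using le_less_trans ennreal_less_top by blast
    moreover from this elim have "enn2real (f1 t) \<le> c" using c by (simp add: enn2real_leI)
    ultimately show ?case by (simp add: g_def min_absorb2)
  qed
  have G1g: "G1 b - G1 a = (LINT s:{a..b}|lborel. g s)" if "a \<le> b" for a b
  proof -
    have "ennreal (LINT s:{a..b}|lborel. g s) = (\<integral>\<^sup>+t. ennreal (indicator {a..b} t * g t) \<partial>lborel)"
      unfolding set_lebesgue_integral_def
      using set_integrable_bounded_Icc[of g c a b] gb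
      by (subst nn_integral_eq_integral) (auto simp: set_integrable_def abs_of_nonneg)
    also have "\<dots> = (\<integral>\<^sup>+t\<in>{a<..<b}. f1 t \<partial>lborel)"
    proof (rule nn_integral_cong_AE)
      show "AE t in lborel. ennreal (indicator {a..b} t * g t) = f1 t * indicator {a<..<b} t"
        using gf AE_lborel_singleton[of a] AE_lborel_singleton[of b]
        by eventually_elim (auto simp: indicator_def)
    qed
    also have "\<dots> = ennreal (G1 b - G1 a)" by (rule f1i[OF that])
    finally have "ennreal (LINT s:{a..b}|lborel. g s) = ennreal (G1 b - G1 a)" .
    moreover have "0 \<le> (LINT s:{a..b}|lborel. g s)"
      unfolding set_lebesgue_integral_def using gb by (intro integral_nonneg_AE) auto
    ultimately show ?thesis using 1(1)[OF that] that by simp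
  qed
  have diff: "AE t in lborel. (G1 has_real_derivative g t) (at t)"
    by (rule lebesgue_differentiation[of g c]) (use gb G1g in \<open>auto simp: abs_of_nonneg\<close>)
  \<comment> \<open>Clipping makes the bound hold at every \<open>t\<close>; at a point where
    \<open>x\<close> has derivative \<open>g t - (S + 1)\<close> that number lies in
    \<open>[- S, S]\<close> already.\<close>
  define v where "v t = max (- S) (min S (g t - (S + 1)))" for t
  have "AE t in lborel. (x has_real_derivative v t) (at t)"
    using diff
  proof eventually_elim
    case (elim t)
    have "x = (\<lambda>t. G1 t - (S + 1) * t)" by (simp add: G1_def fun_eq_iff)
    then have dx: "(x has_real_derivative g t - (S + 1)) (at t)"
      using elim by (auto intro!: derivative_eq_intros)
    have "\<bar>g t - (S + 1)\<bar> \<le> S"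
    proof (rule tendsto_upperbound)
      show "((\<lambda>h. \<bar>(x (t + h) - x t) / h\<bar>) \<longlongrightarrow> \<bar>g t - (S + 1)\<bar>) (at 0)"
        using dx unfolding DERIV_def by (rule tendsto_rabs)
      show "\<forall>\<^sub>F h in at 0. \<bar>(x (t + h) - x t) / h\<bar> \<le> S"
        unfolding eventually_at_filter
      proof (intro always_eventually allI impI)
        fix h :: real assume "h \<noteq> 0"
        then show "\<bar>(x (t + h) - x t) / h\<bar> \<le> S" using lip[of "t + h" t] by (simp add: abs_divide divide_le_eq)
      qed
    qed simp
    then have "v t = g t - (S + 1)" unfolding v_def by linarith
    then show ?case using dx by simp
  qed
  moreover have "v \<in> borel_measurable borel" unfolding v_def by measurable
  moreover have "\<bar>v t\<bar> \<le> S" for t using S by (auto simp: v_def)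
  ultimately show thesis using that by blast
qed

section \<open>From smooth to Lipschitz test functions\<close>

section \<open>Mollification of test functions\<close>

lemma C_k_SucI:
  assumes "\<And>z. (\<phi> has_derivative (\<lambda>w. fst w * \<phi>t z + snd w * \<phi>x z)) (at z)" "C_k k \<phi>t" "C_k k \<phi>x"
  shows "C_k (Suc k) \<phi>"
  unfolding C_k.simps using assms by (intro exI[of _ \<phi>t] exI[of _ \<phi>x] conjI allI)

lemma C_k_SucD:
  assumes "C_k (Suc k) \<phi>"
  shows "\<exists>\<phi>t \<phi>x. (\<forall>z. (\<phi> has_derivative (\<lambda>w. fst w * \<phi>t z + snd w * \<phi>x z)) (at z)) \<and> C_k k \<phi>t \<and> C_k k \<phi>x"
  using assms unfolding C_k.simps .

lemma C_k_Suc_imp: "C_k (Suc k) \<phi> \<Longrightarrow> C_k k \<phi>"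
proof (induction k arbitrary: \<phi>)
  case 0
  from C_k_SucD[OF this] obtain \<phi>t \<phi>x where "\<forall>z. (\<phi> has_derivative (\<lambda>w. fst w * \<phi>t z + snd w * \<phi>x z)) (at z)"
    by blast
  then have "isCont \<phi> z" for z using has_derivative_continuous by blast
  then show ?case by (simp add: continuous_at_imp_continuous_on)
next
  case (Suc k)
  from C_k_SucD[OF Suc.prems] obtain \<phi>t \<phi>x where d: "\<forall>z. (\<phi> has_derivative (\<lambda>w. fst w * \<phi>t z + snd w * \<phi>x z)) (at z)"
      "C_k (Suc k) \<phi>t" "C_k (Suc k) \<phi>x"
    by blast
  show ?case by (rule C_k_SucI[OF d(1)[rule_format]]) (intro Suc.IH d)+
qed

lemma C_k_imp_continuous: "C_k k \<phi> \<Longrightarrow> continuous_on UNIV \<phi>"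
proof (induction k)
  case (Suc k) then show ?case using C_k_Suc_imp by blast
qed simp

lemma C_k_const: "C_k k (\<lambda>_. c)"
proof (induction k arbitrary: c)
  case (Suc k)
  show ?case by (rule C_k_SucI[of _ "\<lambda>_. 0" "\<lambda>_. 0"]) (simp, rule Suc, rule Suc)
qed simp

lemma C_k_fst: "C_k k fst"
proof (cases k)
  case (Suc k)
  show ?thesis unfolding Suc
  proof (rule C_k_SucI[OF _ C_k_const C_k_const])
    show "(fst has_derivative (\<lambda>w. fst w * 1 + snd w * 0)) (at z)" for z :: "real \<times> real"
      by (rule has_derivative_eq_rhs[OF has_derivative_fst[OF has_derivative_ident]]) (simp add: fun_eq_iff)
  qed
qed (simp add: continuous_on_fst)

lemma C_k_snd: "C_k k snd"
proof (cases k)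
  case (Suc k)
  show ?thesis unfolding Suc
  proof (rule C_k_SucI[OF _ C_k_const C_k_const])
    show "(snd has_derivative (\<lambda>w. fst w * 0 + snd w * 1)) (at z)" for z :: "real \<times> real"
      by (rule has_derivative_eq_rhs[OF has_derivative_snd[OF has_derivative_ident]]) (simp add: fun_eq_iff)
  qed
qed (simp add: continuous_on_snd)

lemma C_k_add: "C_k k \<phi> \<Longrightarrow> C_k k \<psi> \<Longrightarrow> C_k k (\<lambda>z. \<phi> z + \<psi> z)"
proof (induction k arbitrary: \<phi> \<psi>)
  case 0 then show ?case by (auto intro: continuous_on_add)
next
  case (Suc k)
  from C_k_SucD[OF Suc.prems(1)] obtain \<phi>t \<phi>x where 1: "\<forall>z. (\<phi> has_derivative (\<lambda>w. fst w * \<phi>t z + snd w * \<phi>x z)) (at z)"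
      "C_k k \<phi>t" "C_k k \<phi>x" by blast
  from C_k_SucD[OF Suc.prems(2)] obtain \<psi>t \<psi>x where 2: "\<forall>z. (\<psi> has_derivative (\<lambda>w. fst w * \<psi>t z + snd w * \<psi>x z)) (at z)"
      "C_k k \<psi>t" "C_k k \<psi>x" by blast
  have "((\<lambda>z. \<phi> z + \<psi> z) has_derivative (\<lambda>w. fst w * (\<phi>t z + \<psi>t z) + snd w * (\<phi>x z + \<psi>x z))) (at z)" for z
    by (rule has_derivative_eq_rhs[OF has_derivative_add[OF 1(1)[rule_format] 2(1)[rule_format]]]) (simp add: fun_eq_iff algebra_simps)
  moreover have "C_k k (\<lambda>z. \<phi>t z + \<psi>t z)" "C_k k (\<lambda>z. \<phi>x z + \<psi>x z)" by (intro Suc.IH 1 2)+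
  ultimately show ?case by (rule C_k_SucI)
qed

lemma C_k_mult: "C_k k \<phi> \<Longrightarrow> C_k k \<psi> \<Longrightarrow> C_k k (\<lambda>z. \<phi> z * \<psi> z)"
proof (induction k arbitrary: \<phi> \<psi>)
  case 0 then show ?case by (auto intro: continuous_on_mult)
next
  case (Suc k)
  from C_k_SucD[OF Suc.prems(1)] obtain \<phi>t \<phi>x where 1: "\<forall>z. (\<phi> has_derivative (\<lambda>w. fst w * \<phi>t z + snd w * \<phi>x z)) (at z)"
      "C_k k \<phi>t" "C_k k \<phi>x" by blast
  from C_k_SucD[OF Suc.prems(2)] obtain \<psi>t \<psi>x where 2: "\<forall>z. (\<psi> has_derivative (\<lambda>w. fst w * \<psi>t z + snd w * \<psi>x z)) (at z)"
      "C_k k \<psi>t" "C_k k \<psi>x" by blast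
  have "((\<lambda>z. \<phi> z * \<psi> z) has_derivative
      (\<lambda>w. fst w * (\<phi> z * \<psi>t z + \<phi>t z * \<psi> z) + snd w * (\<phi> z * \<psi>x z + \<phi>x z * \<psi> z))) (at z)" for z
    by (rule has_derivative_eq_rhs[OF has_derivative_mult[OF 1(1)[rule_format] 2(1)[rule_format]]]) (simp add: fun_eq_iff algebra_simps)
  moreover have "C_k k (\<lambda>z. \<phi> z * \<psi>t z + \<phi>t z * \<psi> z)" "C_k k (\<lambda>z. \<phi> z * \<psi>x z + \<phi>x z * \<psi> z)"
    by (intro C_k_add Suc.IH C_k_Suc_imp[OF Suc.prems(1)] C_k_Suc_imp[OF Suc.prems(2)] 1 2)+
  ultimately show ?case by (rule C_k_SucI)
qed

text \<open>The function \<open>exp (- 1 / s)\<close> that is flat at 0, divided by powers of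
  \<open>s\<close> so that the family is closed under differentiation up to linear
  combinations.\<close>

definition flat :: "nat \<Rightarrow> real \<Rightarrow> real" where
  "flat n s = (if s > 0 then exp (- 1 / s) / s ^ n else 0)"

lemma flat_has_derivative:
  "(flat n has_real_derivative flat (n + 2) s - real n * flat (n + 1) s) (at s)"
proof -
  consider "s > 0" | "s < 0" | "s = 0" by linarith
  then show ?thesis
  proof cases
    case 1
    have "((\<lambda>s. exp (- 1 / s)) has_real_derivative exp (- 1 / s) * (1 / s\<^sup>2)) (at s)"
    proof (rule DERIV_fun_exp)
      have "((\<lambda>s. - inverse s) has_real_derivative - (- (inverse s ^ Suc (Suc 0)))) (at s)"
        using 1 by (intro DERIV_minus DERIV_inverse) simp
      then show "((\<lambda>s. - 1 / s) has_real_derivative 1 / s\<^sup>2) (at s)"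
        by (simp add: power2_eq_square inverse_eq_divide)
    qed
    from DERIV_divide[OF this DERIV_pow[of n]] 1
    have d: "((\<lambda>s. exp (- 1 / s) / s ^ n) has_real_derivative
      (exp (- 1 / s) * (1 / s\<^sup>2) * s ^ n - exp (- 1 / s) * (real n * s ^ (n - Suc 0))) / (s ^ n * s ^ n)) (at s)"
      by simp
    have e: "(E * (1 / s\<^sup>2) * s ^ n - E * (real n * s ^ (n - Suc 0))) / (s ^ n * s ^ n)
        = E / s ^ (n + 2) - real n * (E / s ^ (n + 1))" for E :: real
    proof (cases n)
      case (Suc m)
      have "(E * (1 / s\<^sup>2) * s ^ n - E * (real n * s ^ m)) / (s ^ n * s ^ n)
        = E * s ^ n / (s ^ 2 * s ^ n * s ^ n) - real n * (E * s ^ m / (s ^ n * s ^ n))"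
        using 1 by (simp add: diff_divide_distrib)
      also have "E * s ^ n / (s ^ 2 * s ^ n * s ^ n) = E / s ^ (n + 2)"
        using 1 by (simp add: power_add power2_eq_square)
      also have "E * s ^ m / (s ^ n * s ^ n) = E / s ^ (n + 1)"
        using 1 unfolding Suc by (simp add: power_add)
      finally show ?thesis using Suc by simp
    qed (simp add: power2_eq_square)
    have "((\<lambda>s. exp (- 1 / s) / s ^ n) has_real_derivative flat (n + 2) s - real n * flat (n + 1) s) (at s)"
      using d 1 unfolding e by (simp add: flat_def)
    moreover have ev: "\<forall>\<^sub>F y in nhds s. exp (- 1 / y) / y ^ n = flat n y"
      using eventually_nhds_in_open[of "{0<..}" s] 1 by (auto simp: flat_def elim: eventually_mono)
    ultimately show ?thesis using DERIV_cong_ev[OF refl ev refl] by simp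
  next
    case 2
    have ev: "\<forall>\<^sub>F y in nhds s. 0 = flat n y"
      using eventually_nhds_in_open[of "{..<0}" s] 2 by (auto simp: flat_def elim: eventually_mono)
    moreover have "((\<lambda>s. 0) has_real_derivative flat (n + 2) s - real n * flat (n + 1) s) (at s)"
      using 2 by (auto simp: flat_def)
    ultimately show ?thesis using DERIV_cong_ev[OF refl ev refl] by simp
  next
    case 3
    \<comment> \<open>With \<open>y = 1 / h\<close> this is the decay of
      \<open>y ^ (n + 1) / exp y\<close>.\<close>
    have "((\<lambda>h. exp (- 1 / h) / h ^ (n + 1)) \<longlongrightarrow> (0::real)) (at_right 0)"
    proof (subst filterlim_at_right_to_top, rule Lim_transform_eventually)
      show "((\<lambda>y. y ^ (n + 1) / exp y) \<longlongrightarrow> (0::real)) at_top" by (rule tendsto_power_div_exp_0)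
      show "\<forall>\<^sub>F y::real in at_top. y ^ (n + 1) / exp y = exp (- 1 / inverse y) / inverse y ^ (n + 1)"
      proof (intro always_eventually allI)
        fix y :: real
        have "- 1 / inverse y = - y" by (cases "y = 0") (simp_all add: field_simps)
        then show "y ^ (n + 1) / exp y = exp (- 1 / inverse y) / inverse y ^ (n + 1)"
          by (simp add: exp_minus power_inverse divide_inverse mult.commute)
      qed
    qed
    moreover have "\<forall>\<^sub>F h in at_right 0. exp (- 1 / h) / h ^ (n + 1) = (flat n (0 + h) - flat n 0) / h"
      by (auto simp: flat_def eventually_at_filter)
    ultimately have "((\<lambda>h. (flat n (0 + h) - flat n 0) / h) \<longlongrightarrow> 0) (at_right 0)"
      by (rule Lim_transform_eventually)
    moreover have "((\<lambda>h. (flat n (0 + h) - flat n 0) / h) \<longlongrightarrow> 0) (at_left 0)"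
      by (rule tendsto_eventually) (auto simp: flat_def eventually_at_filter)
    ultimately have "((\<lambda>h. (flat n (0 + h) - flat n 0) / h) \<longlongrightarrow> 0) (at 0)"
      by (simp add: filterlim_split_at)
    then show ?thesis using 3 by (simp add: DERIV_def flat_def)
  qed
qed

text \<open>The partial derivatives are linear factors times combinations of
  \<open>flat (n + 1)\<close> and \<open>flat (n + 2)\<close> of the same quadratic, so the
  induction on \<open>k\<close> has to keep \<open>n\<close> arbitrary.\<close>

lemma C_k_flat: "C_k k (\<lambda>z. flat n (d - (fst z)\<^sup>2 - (snd z)\<^sup>2))"
proof (induction k arbitrary: n)
  case 0
  have "continuous_on UNIV (flat n)"
    by (intro continuous_at_imp_continuous_on ballI DERIV_isCont[OF flat_has_derivative])
  then show ?case unfolding C_k.simps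
    by (rule continuous_on_compose2) (intro continuous_intros, simp)
next
  case (Suc k)
  let ?r = "\<lambda>z::real\<times>real. d - (fst z)\<^sup>2 - (snd z)\<^sup>2"
  define D where "D z = flat (n + 2) (?r z) + - real n * flat (n + 1) (?r z)" for z
  have D: "C_k k D" unfolding D_def by (intro C_k_add C_k_mult C_k_const Suc.IH)
  have "((\<lambda>z. flat n (?r z)) has_derivative (\<lambda>w. fst w * (- 2 * fst z * D z) + snd w * (- 2 * snd z * D z))) (at z)" for z
  proof -
    have "(?r has_derivative (\<lambda>w. - 2 * fst z * fst w - 2 * snd z * snd w)) (at z)"
      by (auto intro!: derivative_eq_intros)
    moreover have "(flat n has_derivative (\<lambda>h. D z * h)) (at (?r z))"
      using flat_has_derivative[of n "?r z"] by (simp add: has_field_derivative_def D_def mult_commute_abs)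
    ultimately have "(flat n \<circ> ?r has_derivative (\<lambda>h. D z * h) \<circ> (\<lambda>w. - 2 * fst z * fst w - 2 * snd z * snd w)) (at z)"
      by (rule diff_chain_at)
    then show ?thesis by (simp add: o_def algebra_simps)
  qed
  moreover have "C_k k (\<lambda>z. - 2 * fst z * D z)" "C_k k (\<lambda>z. - 2 * snd z * D z)"
    by (intro C_k_mult C_k_const C_k_fst C_k_snd D)+
  ultimately show ?case by (rule C_k_SucI)
qed

lemma obtain_mollifier:
  fixes \<delta> :: real
  assumes "\<delta> > 0"
  obtains \<rho> :: "real \<times> real \<Rightarrow> real" where "\<And>k. C_k k \<rho>" "\<And>z. 0 \<le> \<rho> z" "\<And>z. \<delta> \<le> norm z \<Longrightarrow> \<rho> z = 0"
    "integrable lborel \<rho>" "(LINT z|lborel. \<rho> z) = 1"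
proof -
  define b where "b z = flat 0 (\<delta>\<^sup>2 - (fst z)\<^sup>2 - (snd z)\<^sup>2)" for z :: "real \<times> real"
  have bC: "C_k k b" for k using C_k_flat[of k 0 "\<delta>\<^sup>2"] unfolding b_def .
  have cont: "continuous_on UNIV b" using C_k_imp_continuous[OF bC] .
  have nrm: "(norm z)\<^sup>2 = (fst z)\<^sup>2 + (snd z)\<^sup>2" for z :: "real \<times> real"
    by (cases z) (simp add: norm_Pair)
  have b0: "0 \<le> b z" for z by (simp add: b_def flat_def)
  have bout: "b z = 0" if "\<delta> \<le> norm z" for z
  proof -
    have "\<delta>\<^sup>2 \<le> (norm z)\<^sup>2" using that assms by (intro power_mono) auto
    then show ?thesis unfolding nrm by (simp add: b_def flat_def)
  qed
  have bin: "b z > 0" if "norm z < \<delta>" for z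
  proof -
    have "(norm z)\<^sup>2 < \<delta>\<^sup>2" using that by (intro power_strict_mono) auto
    then show ?thesis unfolding nrm by (simp add: b_def flat_def)
  qed
  have "integrable lborel (\<lambda>z. indicator (cball 0 \<delta>) z *\<^sub>R b z)"
    by (rule borel_integrable_compact[OF compact_cball]) (rule continuous_on_subset[OF cont], simp)
  moreover have "(\<lambda>z. indicator (cball 0 \<delta>) z *\<^sub>R b z) = b"
    using bout by (auto simp: fun_eq_iff indicator_def)
  ultimately have int: "integrable lborel b" by simp
  define J where "J = (LINT z|lborel. b z)"
  have "J \<noteq> 0"
  proof
    assume "J = 0"
    then have "AE z in lborel. b z = 0"
      using integral_nonneg_eq_0_iff_AE[OF int] b0 by (simp add: J_def)
    then have "AE z in lborel. z \<notin> ball (0 :: real \<times> real) \<delta>"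
    proof eventually_elim
      case (elim z) then show ?case using bin[of z] by auto
    qed
    then have "ball (0::real\<times>real) \<delta> \<in> null_sets lborel" by (subst (asm) AE_iff_null_sets[symmetric]) auto
    then have "negligible (ball (0::real\<times>real) \<delta>)" by (simp add: negligible_iff_null_sets null_sets_completionI)
    then show False using assms open_not_negligible[of "ball (0::real\<times>real) \<delta>"] by auto
  qed
  moreover have "J \<ge> 0" unfolding J_def using b0 by (intro integral_nonneg_AE) auto
  ultimately have J: "J > 0" by simp
  show thesis
  proof
    show "C_k k (\<lambda>z. b z * (1 / J))" for k by (intro C_k_mult bC C_k_const)
    show "0 \<le> b z * (1 / J)" for z using b0 J by simp
    show "b z * (1 / J) = 0" if "\<delta> \<le> norm z" for z using bout[OF that] by simp
    show "integrable lborel (\<lambda>z. b z * (1 / J))" using int by simp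
    show "(LINT z|lborel. b z * (1 / J)) = 1" using J by (simp add: J_def[symmetric])
  qed
qed

text \<open>All differentiability comes from \<open>\<rho>\<close>, one order at a time by the
  Leibniz rule, while \<open>\<phi>\<close> is merely continuous. Integrating over a fixed box
  provides the compact domain on which that rule is applied.\<close>

lemma C_k_convolution:
  fixes \<phi> \<rho> :: "real \<times> real \<Rightarrow> real"
  assumes \<phi>: "continuous_on UNIV \<phi>" and "C_k k \<rho>"
  shows "C_k k (\<lambda>z. integral (cbox a b) (\<lambda>w. \<phi> w * \<rho> (z - w)))"
  using assms(2)
proof (induction k arbitrary: \<rho>)
  case 0
  then have \<rho>: "continuous_on UNIV \<rho>" by simp
  have "continuous_on (UNIV \<times> cbox a b) (\<lambda>(z, w). \<phi> w * \<rho> (z - w))"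
    unfolding case_prod_beta
    by (intro continuous_on_mult continuous_on_compose2[OF \<phi>] continuous_on_compose2[OF \<rho>] continuous_intros subset_UNIV)
  then show ?case unfolding C_k.simps by (rule integral_continuous_on_param)
next
  case (Suc k)
  from C_k_SucD[OF Suc.prems] obtain \<rho>t \<rho>x where d: "\<forall>z. (\<rho> has_derivative (\<lambda>w. fst w * \<rho>t z + snd w * \<rho>x z)) (at z)"
      and C: "C_k k \<rho>t" "C_k k \<rho>x" by blast
  define e1 e2 :: "(real \<times> real) \<Rightarrow>\<^sub>L real" where "e1 = Blinfun fst" and "e2 = Blinfun snd"
  have e: "blinfun_apply e1 = fst" "blinfun_apply e2 = snd"
    unfolding e1_def e2_def by (simp_all add: bounded_linear_Blinfun_apply bounded_linear_fst bounded_linear_snd)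
  \<comment> \<open>The total derivative of the integrand as a bounded linear map; \<open>e1\<close>
    and \<open>e2\<close> are the coordinate projections.\<close>
  define D where "D z w = (\<phi> w * \<rho>t (z - w)) *\<^sub>R e1 + (\<phi> w * \<rho>x (z - w)) *\<^sub>R e2" for z w
  have ct: "continuous_on UNIV \<rho>t" "continuous_on UNIV \<rho>x" "continuous_on UNIV \<rho>"
    using C_k_imp_continuous C Suc.prems by blast+
  have i: "(\<lambda>w. \<phi> w * \<rho>t (z - w)) integrable_on cbox a b" "(\<lambda>w. \<phi> w * \<rho>x (z - w)) integrable_on cbox a b"
     "(\<lambda>w. \<phi> w * \<rho> (z - w)) integrable_on cbox a b" for z
    by (intro integrable_continuous continuous_on_mult continuous_on_subset[OF \<phi>]
        continuous_on_compose2[OF ct(1)] continuous_on_compose2[OF ct(2)] continuous_on_compose2[OF ct(3)]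
        continuous_intros; simp)+
  have "((\<lambda>z. integral (cbox a b) (\<lambda>w. \<phi> w * \<rho> (z - w))) has_derivative
      blinfun_apply (integral (cbox a b) (D z))) (at z within UNIV)" for z
  proof (rule leibniz_rule[where fx=D])
    fix z w
    have "((\<lambda>z. \<rho> (z - w)) has_derivative (\<lambda>h. fst h * \<rho>t (z - w) + snd h * \<rho>x (z - w))) (at z)"
    proof -
      have "((\<lambda>z. z - w) has_derivative (\<lambda>h. h)) (at z)" by (auto intro!: derivative_eq_intros)
      from has_derivative_compose[OF this d[rule_format]] show ?thesis .
    qed
    then have "((\<lambda>z. \<phi> w * \<rho> (z - w)) has_derivative (\<lambda>h. \<phi> w * (fst h * \<rho>t (z - w) + snd h * \<rho>x (z - w)))) (at z)"
      by (rule has_derivative_mult_right)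
    moreover have "blinfun_apply (D z w) = (\<lambda>h. \<phi> w * (fst h * \<rho>t (z - w) + snd h * \<rho>x (z - w)))"
      by (simp add: D_def fun_eq_iff blinfun.bilinear_simps e algebra_simps)
    ultimately show "((\<lambda>z. \<phi> w * \<rho> (z - w)) has_derivative blinfun_apply (D z w)) (at z within UNIV)"
      by simp
  next
    show "continuous_on (UNIV \<times> cbox a b) (\<lambda>(z, w). D z w)"
      unfolding D_def case_prod_beta
      by (intro continuous_on_add continuous_on_scaleR continuous_on_mult continuous_on_compose2[OF \<phi>]
          continuous_on_compose2[OF ct(1)] continuous_on_compose2[OF ct(2)] continuous_intros subset_UNIV)
  qed (use i in auto)
  moreover have "blinfun_apply (integral (cbox a b) (D z)) =
     (\<lambda>h. fst h * integral (cbox a b) (\<lambda>w. \<phi> w * \<rho>t (z - w)) + snd h * integral (cbox a b) (\<lambda>w. \<phi> w * \<rho>x (z - w)))" for z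
  proof -
    have "(D z has_integral (integral (cbox a b) (\<lambda>w. \<phi> w * \<rho>t (z - w)) *\<^sub>R e1
        + integral (cbox a b) (\<lambda>w. \<phi> w * \<rho>x (z - w)) *\<^sub>R e2)) (cbox a b)"
      unfolding D_def using i
      by (intro has_integral_add has_integral_scaleR_left integrable_integral)
    then show ?thesis
      by (simp add: integral_unique fun_eq_iff blinfun.bilinear_simps e)
  qed
  ultimately have "((\<lambda>z. integral (cbox a b) (\<lambda>w. \<phi> w * \<rho> (z - w))) has_derivative
     (\<lambda>h. fst h * integral (cbox a b) (\<lambda>w. \<phi> w * \<rho>t (z - w)) + snd h * integral (cbox a b) (\<lambda>w. \<phi> w * \<rho>x (z - w)))) (at z)" for z
    by simp
  then show ?case using Suc.IH[OF C(1)] Suc.IH[OF C(2)] by (rule C_k_SucI)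
qed

section \<open>Bounded functions of bounded support, reflections, translations and
  correlations\<close>

lemma integrable_lborel_bounded_support:
  fixes f :: "'a::euclidean_space \<Rightarrow> real"
  assumes "f \<in> borel_measurable borel" "\<And>z. \<bar>f z\<bar> \<le> B" "\<And>z. f z \<noteq> 0 \<Longrightarrow> norm z \<le> R"
  shows "integrable lborel f"
proof (rule integrableI_bounded_set[where A="cball 0 R" and B=B])
  show "AE x in lborel. x \<notin> cball 0 R \<longrightarrow> f x = 0" using assms(3) by (intro AE_I2) (auto simp: dist_norm)
  show "emeasure lborel (cball (0::'a) R) < \<infinity>" by (rule emeasure_lborel_cball_finite)
qed (use assms in auto)

lemma integrable_radon_bounded_support:
  fixes f :: "real \<times> real \<Rightarrow> real"
  assumes P: "radon_on_strip T P"
    and "f \<in> borel_measurable borel" "\<And>z. \<bar>f z\<bar> \<le> B" "\<And>z. f z \<noteq> 0 \<Longrightarrow> norm z \<le> R"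
  shows "integrable P f"
proof (rule integrableI_bounded_set[where A="cball 0 R" and B=B])
  have sP: "sets P = sets borel" using P by (simp add: radon_on_strip_def)
  show "f \<in> borel_measurable P" using assms(2) measurable_cong_sets[OF sP refl] by blast
  show "emeasure P (cball 0 R) < \<infinity>" using P by (simp add: radon_on_strip_def)
  show "cball 0 R \<in> sets P" using sP by simp
  show "AE x in P. x \<notin> cball 0 R \<longrightarrow> f x = 0" using assms(4) by (intro AE_I2) (auto simp: dist_norm)
qed (use assms in auto)

lemma lborel_distr_reflect: "distr lborel borel (\<lambda>w. z - w) = (lborel :: 'a::euclidean_space measure)"
proof (rule lborel_eqI[symmetric])
  fix l u :: 'a assume lu: "\<And>b. b \<in> Basis \<Longrightarrow> l \<bullet> b \<le> u \<bullet> b"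
  have "(\<lambda>w. z - w) -` box l u = box (z - u) (z - l)"
    by (auto simp: box_def inner_diff_left)
  moreover have "(\<Prod>b\<in>Basis. (z - l - (z - u)) \<bullet> b) = (\<Prod>b\<in>Basis. (u - l) \<bullet> b)"
    by (rule prod.cong) (auto simp: inner_diff_left)
  moreover have "emeasure lborel (box (z - u) (z - l)) = (\<Prod>b\<in>Basis. (z - l - (z - u)) \<bullet> b)"
    by (rule emeasure_lborel_box) (use lu in \<open>simp add: inner_diff_left\<close>)
  ultimately show "emeasure (distr lborel borel (\<lambda>w. z - w)) (box l u) = (\<Prod>b\<in>Basis. (u - l) \<bullet> b)"
    by (subst emeasure_distr) (auto intro!: borel_measurable_continuous_onI continuous_intros)
qed simp

lemma lborel_integral_reflect:
  fixes f :: "'a::euclidean_space \<Rightarrow> real"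
  assumes "f \<in> borel_measurable borel"
  shows "(LINT w|lborel. f (z - w)) = (LINT w|lborel. f w)"
proof -
  have "(LINT w|distr lborel borel (\<lambda>w. z - w). f w) = (LINT w|lborel. f (z - w))"
    by (rule integral_distr) (use assms in \<open>auto intro!: borel_measurable_continuous_onI continuous_intros\<close>)
  then show ?thesis by (simp add: lborel_distr_reflect)
qed

lemma lborel_integral_shift:
  fixes f :: "'a::euclidean_space \<Rightarrow> real"
  assumes "f \<in> borel_measurable borel"
  shows "(LINT w|lborel. f (w + z)) = (LINT w|lborel. f w)"
proof -
  have "(LINT w|distr lborel borel ((+) z). f w) = (LINT w|lborel. f (z + w))"
    by (rule integral_distr) (use assms in auto)
  then show ?thesis by (simp add: lborel_distr_plus add.commute)
qed

lemma AE_lborel_reflect: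
  assumes "AE w in (lborel :: 'a::euclidean_space measure). Q w"
  shows "AE w in lborel. Q (z - w)"
proof -
  have "AE w in distr lborel borel (\<lambda>w. z - w). Q w"
    unfolding lborel_distr_reflect[of z] by (rule assms)
  moreover have "(\<lambda>w. z - w) \<in> lborel \<rightarrow>\<^sub>M borel"
    by (auto intro!: borel_measurable_continuous_onI continuous_intros)
  ultimately show ?thesis by (rule AE_distrD[rotated])
qed

text \<open>Continuity of translations in the mean, for two factors that are only bounded and
  measurable: \<open>k\<close> will be an almost everywhere derivative of a Lipschitz function. Once
  \<open>a\<close> is replaced by bounded continuous functions converging to it almost everywhere,
  the translation can be moved onto the continuous factor.\<close>

lemma continuous_correlation:
  fixes a k :: "'a::euclidean_space \<Rightarrow> real"
  assumes [measurable]: "a \<in> borel_measurable borel" "k \<in> borel_measurable borel"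
    and a: "\<And>z. \<bar>a z\<bar> \<le> A" and k: "\<And>z. \<bar>k z\<bar> \<le> K" "\<And>z. k z \<noteq> 0 \<Longrightarrow> norm z \<le> R"
  shows "isCont (\<lambda>y. LINT z|lborel. a z * k (z - y)) 0"
proof -
  have A: "A \<ge> 0" and K: "K \<ge> 0" using a[of 0] k(1)[of 0] by auto
  obtain N g where N: "negligible N" and g: "\<And>n. continuous_on UNIV (g n)"
    and ga: "\<And>z. z \<notin> N \<Longrightarrow> (\<lambda>n. g n z) \<longlonglongrightarrow> a z"
  proof -
    have "a measurable_on UNIV" by (intro lebesgue_measurable_imp_measurable_on_real measurable_completion) auto
    then show thesis using that unfolding measurable_on_def by auto
  qed
  define c where "c n z = max (- A) (min A (g n z))" for n :: nat and z
  have c: "continuous_on UNIV (c n)" for n unfolding c_def by (intro continuous_intros g)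
  have [measurable]: "c n \<in> borel_measurable borel" for n using c by (rule borel_measurable_continuous_onI)
  have cb: "\<bar>c n z\<bar> \<le> A" for n z using A by (auto simp: c_def)
  have ca: "AE z in lborel. (\<lambda>n. c n z) \<longlonglongrightarrow> a z"
  proof -
    have "AE z in lebesgue. z \<notin> N" using N by (simp add: AE_not_in negligible_iff_null_sets)
    then have "AE z in lborel. z \<notin> N" by (simp only: AE_completion_iff)
    then show ?thesis
    proof eventually_elim
      case (elim z)
      have "(\<lambda>n. max (- A) (min A (g n z))) \<longlonglongrightarrow> max (- A) (min A (a z))"
        by (intro tendsto_max tendsto_min tendsto_const ga elim)
      moreover have "max (- A) (min A (a z)) = a z" using a[of z] by (simp add: abs_le_iff)
      ultimately show ?case by (simp add: c_def)
    qed
  qed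
  \<comment> \<open>The ball of radius \<open>R + 1\<close> contains the support of
    \<open>k (z - y)\<close> for every \<open>norm y \<le> 1\<close>.\<close>
  let ?I = "\<lambda>z. indicator (cball 0 (R + 1)) z :: real"
  have Im[measurable]: "?I \<in> borel_measurable borel" by (intro borel_measurable_indicator) simp
  have am[measurable]: "(\<lambda>z. \<bar>a z - c n z\<bar> * ?I z) \<in> borel_measurable borel" for n by measurable
  have small: "(\<lambda>n. LINT z|lborel. \<bar>a z - c n z\<bar> * ?I z) \<longlonglongrightarrow> (LINT z|(lborel :: 'a measure). (0::real))"
  proof (rule integral_dominated_convergence[where w="\<lambda>z. 2 * A * ?I z"])
    show "integrable lborel (\<lambda>z. 2 * A * ?I z)"
      by (rule integrable_lborel_bounded_support[where B="2 * A" and R="R+1"])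
         (use A in \<open>auto simp: indicator_def split: if_splits\<close>)
    show "AE z in lborel. (\<lambda>n. \<bar>a z - c n z\<bar> * ?I z) \<longlonglongrightarrow> 0"
      using ca
    proof eventually_elim
      case (elim z)
      have "(\<lambda>n. \<bar>a z - c n z\<bar> * ?I z) \<longlonglongrightarrow> \<bar>a z - a z\<bar> * ?I z" by (intro tendsto_intros elim)
      then show ?case by simp
    qed
    show "AE z in lborel. norm (\<bar>a z - c n z\<bar> * ?I z) \<le> 2 * A * ?I z" for n
    proof (intro AE_I2)
      fix z show "norm (\<bar>a z - c n z\<bar> * ?I z) \<le> 2 * A * ?I z"
        using a[of z] cb[of n z] by (auto simp: indicator_def)
    qed
  qed (use am in simp_all)
  have int: "integrable lborel (\<lambda>z. p z * k (z - y))" if "p \<in> borel_measurable borel" "\<And>z. \<bar>p z\<bar> \<le> A" for p y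
  proof (rule integrable_lborel_bounded_support[where B="A * K" and R="R + norm y"])
    show "(\<lambda>z. p z * k (z - y)) \<in> borel_measurable borel" using that(1) by measurable
    show "\<bar>p z * k (z - y)\<bar> \<le> A * K" for z
      unfolding abs_mult by (intro mult_mono that k A abs_ge_zero)
    show "norm z \<le> R + norm y" if "p z * k (z - y) \<noteq> 0" for z
    proof -
      have "norm (z - y) \<le> R" using that by (intro k(2)) auto
      then show ?thesis using norm_triangle_sub[of z y] by linarith
    qed
  qed
  have approx: "\<bar>(LINT z|lborel. a z * k (z - y)) - (LINT z|lborel. c n z * k (z - y))\<bar>
      \<le> K * (LINT z|lborel. \<bar>a z - c n z\<bar> * ?I z)" if "norm y \<le> 1" for y n
  proof -
    have i: "integrable lborel (\<lambda>z. \<bar>a z - c n z\<bar> * ?I z)"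
    proof (rule integrable_lborel_bounded_support[where B="2 * A" and R="R+1"])
      fix z show "\<bar>\<bar>a z - c n z\<bar> * ?I z\<bar> \<le> 2 * A" using a[of z] cb[of n z] A by (auto simp: indicator_def)
    qed (use am in \<open>auto simp: indicator_def split: if_splits\<close>)
    have "(LINT z|lborel. a z * k (z - y)) - (LINT z|lborel. c n z * k (z - y))
        = (LINT z|lborel. a z * k (z - y) - c n z * k (z - y))"
      by (rule Bochner_Integration.integral_diff[symmetric]) (intro int; simp add: a cb)+
    also have "\<bar>\<dots>\<bar> \<le> (LINT z|lborel. K * (\<bar>a z - c n z\<bar> * ?I z))"
    proof (rule order_trans[OF integral_abs_bound integral_mono])
      show "integrable lborel (\<lambda>z. \<bar>a z * k (z - y) - c n z * k (z - y)\<bar>)"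
        by (intro integrable_abs Bochner_Integration.integrable_diff int) (simp_all add: a cb)
      show "integrable lborel (\<lambda>z. K * (\<bar>a z - c n z\<bar> * ?I z))" using i by simp
      fix z
      have "\<bar>a z * k (z - y) - c n z * k (z - y)\<bar> = \<bar>a z - c n z\<bar> * \<bar>k (z - y)\<bar>"
        by (simp add: abs_mult[symmetric] algebra_simps)
      also have "\<dots> \<le> \<bar>a z - c n z\<bar> * (K * ?I z)"
      proof (rule mult_left_mono)
        show "\<bar>k (z - y)\<bar> \<le> K * ?I z"
        proof (cases "k (z - y) = 0")
          case False
          then have "norm z \<le> R + 1" using k(2)[of "z - y"] norm_triangle_sub[of z y] that by linarith
          then show ?thesis using k(1)[of "z - y"] by (simp add: indicator_def)
        qed (use K in simp)
      qed simp
      finally show "\<bar>a z * k (z - y) - c n z * k (z - y)\<bar> \<le> K * (\<bar>a z - c n z\<bar> * ?I z)" by (simp add: mult_ac)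
    qed
    finally show ?thesis by simp
  qed
  have contc: "isCont (\<lambda>y. LINT z|lborel. c n z * k (z - y)) 0" for n
    unfolding continuous_at_sequentially
  proof (intro allI impI)
    fix y :: "nat \<Rightarrow> 'a" assume y: "y \<longlonglongrightarrow> 0"
    \<comment> \<open>The substitution transfers the shift from \<open>k\<close> to the continuous
      \<open>c n\<close>.\<close>
    have eq: "(LINT z|lborel. c n z * k (z - y)) = (LINT z|lborel. c n (z + y) * k z)" for y
      using lborel_integral_shift[of "\<lambda>z. c n z * k (z - y)" y] by simp
    have "(\<lambda>m. LINT z|lborel. c n (z + y m) * k z) \<longlonglongrightarrow> (LINT z|lborel. c n (z + 0) * k z)"
    proof (rule integral_dominated_convergence[where w="\<lambda>z. A * \<bar>k z\<bar>"])
      show "integrable lborel (\<lambda>z. A * \<bar>k z\<bar>)"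
        by (intro integrable_mult_right integrable_abs integrable_lborel_bounded_support[OF _ k]) auto
      show "AE z in lborel. (\<lambda>m. c n (z + y m) * k z) \<longlonglongrightarrow> c n (z + 0) * k z"
      proof (intro AE_I2 tendsto_intros)
        fix z
        have "isCont (c n) (z + 0)" using c by (simp add: continuous_on_eq_continuous_at)
        moreover have "(\<lambda>m. z + y m) \<longlonglongrightarrow> z + 0" by (intro tendsto_intros y)
        ultimately show "(\<lambda>m. c n (z + y m)) \<longlonglongrightarrow> c n (z + 0)" by (rule isCont_tendsto_compose)
      qed
      show "AE z in lborel. norm (c n (z + y m) * k z) \<le> A * \<bar>k z\<bar>" for m
        by (intro AE_I2) (simp add: abs_mult mult_right_mono cb)
    qed auto
    then show "((\<lambda>y. LINT z|lborel. c n z * k (z - y)) \<circ> y) \<longlonglongrightarrow> (LINT z|lborel. c n z * k (z - 0))"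
      unfolding o_def eq by simp
  qed
  show ?thesis
    unfolding continuous_at_eps_delta
  proof (intro allI impI)
    fix e :: real assume e: "e > 0"
    let ?f = "\<lambda>n. LINT z|lborel. \<bar>a z - c n z\<bar> * ?I z"
    have "(\<lambda>n. K * ?f n) \<longlonglongrightarrow> K * (LINT z|(lborel::'a measure). (0::real))" by (intro tendsto_intros small)
    then have "(\<lambda>n. K * ?f n) \<longlonglongrightarrow> 0" by simp
    then obtain n where n: "K * ?f n < e / 3"
      using order_tendstoD(2)[of _ 0 sequentially "e / 3"] e by (auto simp: eventually_sequentially)
    obtain d where d: "d > 0" "\<And>y. dist y 0 < d \<Longrightarrow>
        dist (LINT z|lborel. c n z * k (z - y)) (LINT z|lborel. c n z * k (z - 0)) < e / 3"
      using contc[of n, unfolded continuous_at_eps_delta, rule_format, of "e / 3"] e by auto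
    show "\<exists>d>0. \<forall>y. dist y 0 < d \<longrightarrow> dist (LINT z|lborel. a z * k (z - y)) (LINT z|lborel. a z * k (z - 0)) < e"
    proof (intro exI[of _ "min d 1"] conjI allI impI)
      fix y :: 'a assume y: "dist y 0 < min d 1"
      show "dist (LINT z|lborel. a z * k (z - y)) (LINT z|lborel. a z * k (z - 0)) < e"
      proof -
        have y1: "norm y \<le> 1" and yd: "dist y 0 < d" using y by simp_all
        have n0: "norm (0::'a) \<le> 1" by simp
        show ?thesis using approx[OF y1, of n] approx[OF n0, of n] d(2)[OF yd] n unfolding dist_real_def by linarith
      qed
    qed (use d in simp)
  qed
qed

text \<open>The partial derivatives are carried along as everywhere bounded Borel functions rather
  than through \<open>deriv\<close>, so that product and chain rules produce concrete
  representatives.\<close>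

definition lipD :: "(real \<times> real \<Rightarrow> real) \<Rightarrow> (real \<times> real \<Rightarrow> real) \<Rightarrow> (real \<times> real \<Rightarrow> real) \<Rightarrow> bool" where
  "lipD \<phi> \<phi>t \<phi>x \<longleftrightarrow>
     \<phi>t \<in> borel_measurable borel \<and> \<phi>x \<in> borel_measurable borel \<and>
     (\<exists>B. B-lipschitz_on UNIV \<phi> \<and> (\<forall>z. \<bar>\<phi> z\<bar> \<le> B \<and> \<bar>\<phi>t z\<bar> \<le> B \<and> \<bar>\<phi>x z\<bar> \<le> B)) \<and>
     (AE z in lborel. ((\<lambda>s. \<phi> (s, snd z)) has_real_derivative \<phi>t z) (at (fst z))) \<and>
     (AE z in lborel. ((\<lambda>y. \<phi> (fst z, y)) has_real_derivative \<phi>x z) (at (snd z)))"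

text \<open>The support condition includes the chosen derivative representatives, because
  \<open>\<phi>\<close> does not determine them on null sets.\<close>

definition lip_test :: "real \<Rightarrow> (real \<times> real \<Rightarrow> real) \<Rightarrow> (real \<times> real \<Rightarrow> real) \<Rightarrow> (real \<times> real \<Rightarrow> real) \<Rightarrow> bool" where
  "lip_test T \<phi> \<phi>t \<phi>x \<longleftrightarrow> lipD \<phi> \<phi>t \<phi>x \<and>
     (\<exists>\<delta>>0. \<exists>r. \<forall>z. \<phi> z \<noteq> 0 \<or> \<phi>t z \<noteq> 0 \<or> \<phi>x z \<noteq> 0 \<longrightarrow> \<delta> \<le> fst z \<and> fst z \<le> T - \<delta> \<and> \<bar>snd z\<bar> \<le> r)"

text \<open>The working notion of a balance law with production \<open>P - N\<close>. Lipschitz test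
  functions are the class that is closed under multiplication by cutoffs along Lipschitz
  curves.\<close>

definition balance :: "real \<Rightarrow> (real \<times> real \<Rightarrow> real) \<Rightarrow> (real \<times> real \<Rightarrow> real) \<Rightarrow>
    (real \<times> real) measure \<Rightarrow> (real \<times> real) measure \<Rightarrow> bool" where
  "balance T a b P N \<longleftrightarrow> (\<forall>\<phi> \<phi>t \<phi>x. lip_test T \<phi> \<phi>t \<phi>x \<longrightarrow>
     - (LINT z|lborel. a z * \<phi>t z + b z * \<phi>x z) = (LINT z|P. \<phi> z) - (LINT z|N. \<phi> z))"

text \<open>Difference quotients of \<open>\<phi>\<close> are bounded by \<open>L\<close>, so
  dominated convergence moves the derivative onto \<open>\<phi>\<close>, where it exists almost
  everywhere. The limit \<open>D\<close> is given, so one sequence of increments suffices to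
  identify it.\<close>

lemma mollified_partial:
  fixes \<phi> \<rho> \<phi>e :: "real \<times> real \<Rightarrow> real"
  assumes L: "L-lipschitz_on UNIV \<phi>" and e: "norm e = 1"
    and d: "AE z in lborel. ((\<lambda>h. (\<phi> (z + h *\<^sub>R e) - \<phi> z) / h) \<longlongrightarrow> \<phi>e z) (at 0)"
    and [measurable]: "\<phi>e \<in> borel_measurable borel" "\<rho> \<in> borel_measurable borel"
    and \<rho>: "integrable lborel \<rho>" "\<And>z. 0 \<le> \<rho> z"
    and i: "\<And>z. integrable lborel (\<lambda>y. \<phi> (z - y) * \<rho> y)"
    and D: "((\<lambda>h. ((LINT y|lborel. \<phi> (z + h *\<^sub>R e - y) * \<rho> y) - (LINT y|lborel. \<phi> (z - y) * \<rho> y)) / h) \<longlongrightarrow> D) (at 0)"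
  shows "D = (LINT y|lborel. \<phi>e (z - y) * \<rho> y)"
proof -
  have [measurable]: "\<phi> \<in> borel_measurable borel"
    using lipschitz_on_continuous_on[OF L] by (rule borel_measurable_continuous_onI)
  define h where "h n = inverse (real (Suc n))" for n
  have h: "filterlim h (at 0) sequentially"
    unfolding h_def filterlim_at using LIMSEQ_inverse_real_of_nat by (auto intro!: always_eventually)
  have hn: "h n > 0" for n by (simp add: h_def)
  have "(\<lambda>n. ((LINT y|lborel. \<phi> (z + h n *\<^sub>R e - y) * \<rho> y) - (LINT y|lborel. \<phi> (z - y) * \<rho> y)) / h n) \<longlonglongrightarrow> D"
    using filterlim_compose[OF D h] .
  moreover have "(\<lambda>n. LINT y|lborel. (\<phi> (z - y + h n *\<^sub>R e) - \<phi> (z - y)) / h n * \<rho> y)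
      \<longlonglongrightarrow> (LINT y|lborel. \<phi>e (z - y) * \<rho> y)"
  proof (rule integral_dominated_convergence[where w="\<lambda>y. L * \<rho> y"])
    show "integrable lborel (\<lambda>y. L * \<rho> y)" using \<rho> by simp
    show "AE y in lborel. (\<lambda>n. (\<phi> (z - y + h n *\<^sub>R e) - \<phi> (z - y)) / h n * \<rho> y) \<longlonglongrightarrow> \<phi>e (z - y) * \<rho> y"
      using AE_lborel_reflect[OF d, of z]
    proof eventually_elim
      case (elim y)
      show ?case by (intro tendsto_mult tendsto_const) (rule filterlim_compose[OF elim h])
    qed
    show "AE y in lborel. norm ((\<phi> (z - y + h n *\<^sub>R e) - \<phi> (z - y)) / h n * \<rho> y) \<le> L * \<rho> y" for n
    proof (intro AE_I2)
      fix y
      have "dist (\<phi> (z - y + h n *\<^sub>R e)) (\<phi> (z - y)) \<le> L * dist (z - y + h n *\<^sub>R e) (z - y)"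
        by (rule lipschitz_onD[OF L]) auto
      then have "\<bar>\<phi> (z - y + h n *\<^sub>R e) - \<phi> (z - y)\<bar> \<le> L * h n"
        using e hn[of n] by (simp add: dist_norm)
      then have "\<bar>(\<phi> (z - y + h n *\<^sub>R e) - \<phi> (z - y)) / h n\<bar> \<le> L"
        using hn[of n] by (simp add: abs_divide divide_le_eq)
      then show "norm ((\<phi> (z - y + h n *\<^sub>R e) - \<phi> (z - y)) / h n * \<rho> y) \<le> L * \<rho> y"
        unfolding real_norm_def abs_mult using \<rho>(2)[of y] lipschitz_on_nonneg[OF L] by (intro mult_mono) auto
    qed
  qed measurable
  moreover have "((LINT y|lborel. \<phi> (z + h n *\<^sub>R e - y) * \<rho> y) - (LINT y|lborel. \<phi> (z - y) * \<rho> y)) / h n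
      = (LINT y|lborel. (\<phi> (z - y + h n *\<^sub>R e) - \<phi> (z - y)) / h n * \<rho> y)" for n
  proof -
    have "(LINT y|lborel. \<phi> (z + h n *\<^sub>R e - y) * \<rho> y) - (LINT y|lborel. \<phi> (z - y) * \<rho> y)
       = (LINT y|lborel. \<phi> (z + h n *\<^sub>R e - y) * \<rho> y - \<phi> (z - y) * \<rho> y)"
      by (rule Bochner_Integration.integral_diff[OF i i, symmetric])
    also have "\<dots> / h n = (LINT y|lborel. (\<phi> (z + h n *\<^sub>R e - y) * \<rho> y - \<phi> (z - y) * \<rho> y) / h n)"
      by simp
    also have "\<dots> = (LINT y|lborel. (\<phi> (z - y + h n *\<^sub>R e) - \<phi> (z - y)) / h n * \<rho> y)"
      by (intro Bochner_Integration.integral_cong refl) (simp add: algebra_simps diff_divide_distrib)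
    finally show ?thesis .
  qed
  ultimately show ?thesis using LIMSEQ_unique by simp
qed

lemma norm_le_of_strip_box:
  fixes z :: "real \<times> real"
  assumes "\<bar>fst z\<bar> \<le> a" "\<bar>snd z\<bar> \<le> b"
  shows "norm z \<le> a + b"
  using norm_Pair_le[of "fst z" "snd z"] assms by simp

lemma abs_fst_snd_le_norm: "\<bar>fst z\<bar> \<le> norm z" "\<bar>snd z\<bar> \<le> norm z" for z :: "real \<times> real"
  using norm_fst_le[of "fst z" "snd z"] norm_snd_le[of "snd z" "fst z"] by simp_all

text \<open>Smoothness comes from \<open>\<rho>\<close> and closeness from the Lipschitz constant;
  the support spreads by less than \<open>\<eta>\<close>, and \<open>\<eta> < \<delta>\<close> keeps
  it compact inside the open strip.\<close>

lemma mollify: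
  fixes \<phi> \<phi>t \<phi>x \<rho> :: "real \<times> real \<Rightarrow> real"
  assumes lip: "B-lipschitz_on UNIV \<phi>" and B: "\<And>z. \<bar>\<phi> z\<bar> \<le> B"
    and [measurable]: "\<phi>t \<in> borel_measurable borel" "\<phi>x \<in> borel_measurable borel"
    and dt: "AE z in lborel. ((\<lambda>s. \<phi> (s, snd z)) has_real_derivative \<phi>t z) (at (fst z))"
    and dx: "AE z in lborel. ((\<lambda>y. \<phi> (fst z, y)) has_real_derivative \<phi>x z) (at (snd z))"
    and supp: "\<And>z. \<phi> z \<noteq> 0 \<Longrightarrow> \<delta> \<le> fst z \<and> fst z \<le> T - \<delta> \<and> \<bar>snd z\<bar> \<le> r"
    and \<eta>: "\<eta> < \<delta>" "\<eta> > 0"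
    and \<rho>: "\<And>k. C_k k \<rho>" "\<And>z. 0 \<le> \<rho> z" "\<And>z. \<eta> \<le> norm z \<Longrightarrow> \<rho> z = 0"
      "integrable lborel \<rho>" "(LINT z|lborel. \<rho> z) = 1"
  defines "\<psi> \<equiv> \<lambda>z. LINT y|lborel. \<phi> (z - y) * \<rho> y"
  shows "test_function T \<psi>"
    and "\<bar>\<psi> z - \<phi> z\<bar> \<le> B * \<eta>"
    and "\<psi> z \<noteq> 0 \<Longrightarrow> 0 \<le> fst z \<and> fst z \<le> T \<and> \<bar>snd z\<bar> \<le> r + \<eta>"
    and "deriv (\<lambda>s. \<psi> (s, snd z)) (fst z) = (LINT y|lborel. \<phi>t (z - y) * \<rho> y)"
    and "deriv (\<lambda>y. \<psi> (fst z, y)) (snd z) = (LINT y|lborel. \<phi>x (z - y) * \<rho> y)"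
proof -
  have cont: "continuous_on UNIV \<phi>" using lipschitz_on_continuous_on[OF lip] .
  have \<rho>c: "continuous_on UNIV \<rho>" using C_k_imp_continuous[OF \<rho>(1)] .
  have [measurable]: "\<phi> \<in> borel_measurable borel" "\<rho> \<in> borel_measurable borel"
    using cont \<rho>c by (auto intro: borel_measurable_continuous_onI)
  have B0: "B \<ge> 0" using B[of 0] by linarith
  have i: "integrable lborel (\<lambda>y. \<phi> (z - y) * \<rho> y)" for z
  proof (rule Bochner_Integration.integrable_bound[of lborel "\<lambda>y. B * \<rho> y"])
    show "AE y in lborel. norm (\<phi> (z - y) * \<rho> y) \<le> norm (B * \<rho> y)"
      using B \<rho>(2) B0 by (intro AE_I2) (simp add: abs_mult mult_right_mono)
  qed (use \<rho>(4) in simp_all)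
  define a b :: "real \<times> real" where "a = (\<delta>, - r)" and "b = (T - \<delta>, r)"
  have cb: "z \<in> cbox a b" if "\<phi> z \<noteq> 0" for z
    using supp[OF that] by (cases z) (auto simp: a_def b_def cbox_Pair_eq abs_le_iff)
  \<comment> \<open>Reflection and the bounded support of \<open>\<phi>\<close> turn the convolution
    into an integral over a fixed box, the form treated by \<open>C_k_convolution\<close>.\<close>
  have \<psi>int: "\<psi> z = integral (cbox a b) (\<lambda>w. \<phi> w * \<rho> (z - w))" for z
  proof -
    have "\<psi> z = (LINT w|lborel. \<phi> w * \<rho> (z - w))"
      unfolding \<psi>_def using lborel_integral_reflect[of "\<lambda>w. \<phi> w * \<rho> (z - w)" z] by simp
    also have "\<dots> = (LINT w:cbox a b|lborel. \<phi> w * \<rho> (z - w))"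
      unfolding set_lebesgue_integral_def
      by (intro Bochner_Integration.integral_cong refl) (use cb in \<open>auto simp: indicator_def\<close>)
    also have "\<dots> = integral (cbox a b) (\<lambda>w. \<phi> w * \<rho> (z - w))"
    proof (rule set_borel_integral_eq_integral(2))
      show "set_integrable lborel (cbox a b) (\<lambda>w. \<phi> w * \<rho> (z - w))"
        unfolding set_integrable_def
        by (intro borel_integrable_compact compact_cbox continuous_on_mult continuous_on_subset[OF cont]
            continuous_on_compose2[OF \<rho>c] continuous_intros subset_UNIV)
    qed
    finally show ?thesis .
  qed
  have C: "C_k k \<psi>" for k
  proof -
    have "\<psi> = (\<lambda>z. integral (cbox a b) (\<lambda>w. \<phi> w * \<rho> (z - w)))" using \<psi>int by (simp add: fun_eq_iff)
    then show ?thesis using C_k_convolution[OF cont \<rho>(1)] by simp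
  qed
  have supp\<psi>: "\<delta> - \<eta> \<le> fst z \<and> fst z \<le> T - (\<delta> - \<eta>) \<and> \<bar>snd z\<bar> \<le> r + \<eta>" if "\<psi> z \<noteq> 0" for z
  proof -
    have "\<exists>y. \<phi> (z - y) * \<rho> y \<noteq> 0"
    proof (rule ccontr)
      assume "\<nexists>y. \<phi> (z - y) * \<rho> y \<noteq> 0"
      then have "\<psi> z = (LINT y|(lborel :: (real \<times> real) measure). 0)" unfolding \<psi>_def by (intro Bochner_Integration.integral_cong refl) blast
      then show False using that by simp
    qed
    then obtain y where y: "\<phi> (z - y) \<noteq> 0" "\<rho> y \<noteq> 0" by auto
    then have "norm y < \<eta>" using \<rho>(3)[of y] by (cases "\<eta> \<le> norm y") auto
    then have "\<bar>fst y\<bar> < \<eta>" "\<bar>snd y\<bar> < \<eta>" using abs_fst_snd_le_norm[of y] by simp_all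
    then show ?thesis using supp[OF y(1)] by auto
  qed
  show "\<psi> z \<noteq> 0 \<Longrightarrow> 0 \<le> fst z \<and> fst z \<le> T \<and> \<bar>snd z\<bar> \<le> r + \<eta>"
    using supp\<psi>[of z] \<eta> by linarith
  define K where "K = cbox (\<delta> - \<eta>, - (r + \<eta>)) (T - (\<delta> - \<eta>), r + \<eta>)"
  have "closure {z. \<psi> z \<noteq> 0} \<subseteq> K"
  proof (rule closure_minimal)
    show "{z. \<psi> z \<noteq> 0} \<subseteq> K"
    proof
      fix z assume "z \<in> {z. \<psi> z \<noteq> 0}"
      then have "\<psi> z \<noteq> 0" by simp
      from supp\<psi>[OF this] show "z \<in> K" by (cases z) (auto simp: K_def cbox_Pair_eq abs_le_iff)
    qed
  qed (simp add: K_def closed_cbox)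
  moreover have "compact K" by (simp add: K_def compact_cbox)
  moreover have "K \<subseteq> {0<..<T} \<times> UNIV" using \<eta> by (auto simp: K_def cbox_Pair_eq)
  ultimately show "test_function T \<psi>"
  proof -
    assume K: "closure {z. \<psi> z \<noteq> 0} \<subseteq> K" "compact K" "K \<subseteq> {0<..<T} \<times> UNIV"
    have "compact (K \<inter> closure {z. \<psi> z \<noteq> 0})" using K(2) by (rule compact_Int_closed) simp
    moreover have "K \<inter> closure {z. \<psi> z \<noteq> 0} = closure {z. \<psi> z \<noteq> 0}" using K(1) by blast
    ultimately show ?thesis unfolding test_function_def using C subset_trans[OF K(1,3)] by simp
  qed
  show "\<bar>\<psi> z - \<phi> z\<bar> \<le> B * \<eta>"
  proof -
    have i2: "integrable lborel (\<lambda>y. \<phi> z * \<rho> y)" using \<rho>(4) by simp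
    have "\<psi> z - \<phi> z = (LINT y|lborel. \<phi> (z - y) * \<rho> y) - (LINT y|lborel. \<phi> z * \<rho> y)"
      using \<rho>(5) by (simp add: \<psi>_def)
    also have "\<dots> = (LINT y|lborel. \<phi> (z - y) * \<rho> y - \<phi> z * \<rho> y)"
      by (rule Bochner_Integration.integral_diff[OF i i2, symmetric])
    also have "\<bar>\<dots>\<bar> \<le> (LINT y|lborel. B * \<eta> * \<rho> y)"
    proof (rule order_trans[OF integral_abs_bound integral_mono])
      show "integrable lborel (\<lambda>y. \<bar>\<phi> (z - y) * \<rho> y - \<phi> z * \<rho> y\<bar>)"
        by (intro integrable_abs Bochner_Integration.integrable_diff i i2)
      show "integrable lborel (\<lambda>y. B * \<eta> * \<rho> y)" using \<rho>(4) by simp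
      fix y
      have e: "\<bar>\<phi> (z - y) * \<rho> y - \<phi> z * \<rho> y\<bar> = \<bar>\<phi> (z - y) - \<phi> z\<bar> * \<rho> y"
        using \<rho>(2)[of y] by (simp add: left_diff_distrib[symmetric] abs_mult)
      show "\<bar>\<phi> (z - y) * \<rho> y - \<phi> z * \<rho> y\<bar> \<le> B * \<eta> * \<rho> y"
      proof (cases "\<eta> \<le> norm y")
        case False
        have "dist (\<phi> (z - y)) (\<phi> z) \<le> B * dist (z - y) z" by (rule lipschitz_onD[OF lip]) auto
        also have "\<dots> \<le> B * \<eta>" using False B0 by (intro mult_left_mono) (simp_all add: dist_norm)
        finally show ?thesis unfolding e using \<rho>(2)[of y] by (intro mult_right_mono) (simp_all add: dist_real_def)
      qed (use \<rho>(3) in simp)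
    qed
    also have "\<dots> = B * \<eta>" using \<rho>(5) by simp
    finally show ?thesis .
  qed
  obtain \<psi>t \<psi>x where \<psi>': "\<And>z. (\<psi> has_derivative (\<lambda>w. fst w * \<psi>t z + snd w * \<psi>x z)) (at z)"
    using C_k_SucD[OF C] by blast
  have curve_t: "((\<lambda>s. \<psi> (s, snd z)) has_real_derivative \<psi>t z) (at (fst z))"
    and curve_x: "((\<lambda>y. \<psi> (fst z, y)) has_real_derivative \<psi>x z) (at (snd z))"
  proof -
    have 1: "((\<lambda>s. (s, snd z)) has_derivative (\<lambda>h. (h, 0))) (at (fst z))"
      and 2: "((\<lambda>y. (fst z, y)) has_derivative (\<lambda>h. (0, h))) (at (snd z))"
      by (intro has_derivative_Pair has_derivative_ident has_derivative_const)+
    have "((\<lambda>s. \<psi> (s, snd z)) has_derivative (\<lambda>h. fst (h, 0) * \<psi>t z + snd (h, 0) * \<psi>x z)) (at (fst z))"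
      using has_derivative_compose[OF 1, of \<psi> "\<lambda>w. fst w * \<psi>t z + snd w * \<psi>x z"] \<psi>'[of z] by simp
    then show "((\<lambda>s. \<psi> (s, snd z)) has_real_derivative \<psi>t z) (at (fst z))"
      by (simp add: has_field_derivative_def mult_commute_abs)
    have "((\<lambda>y. \<psi> (fst z, y)) has_derivative (\<lambda>h. fst (0, h) * \<psi>t z + snd (0, h) * \<psi>x z)) (at (snd z))"
      using has_derivative_compose[OF 2, of \<psi> "\<lambda>w. fst w * \<psi>t z + snd w * \<psi>x z"] \<psi>'[of z] by simp
    then show "((\<lambda>y. \<psi> (fst z, y)) has_real_derivative \<psi>x z) (at (snd z))"
      by (simp add: has_field_derivative_def mult_commute_abs)
  qed
  have sh: "z + h *\<^sub>R (1, 0) = (fst z + h, snd z)" "z + h *\<^sub>R (0, 1) = (fst z, snd z + h)" for z :: "real \<times> real" and h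
    by (simp_all add: prod_eq_iff)
  have "\<psi>t z = (LINT y|lborel. \<phi>t (z - y) * \<rho> y)"
  proof (rule mollified_partial[OF lip, of "(1, 0)"])
    show "AE z in lborel. ((\<lambda>h. (\<phi> (z + h *\<^sub>R (1, 0)) - \<phi> z) / h) \<longlongrightarrow> \<phi>t z) (at 0)"
      using dt unfolding sh by (simp add: DERIV_def)
    show "((\<lambda>h. ((LINT y|lborel. \<phi> (z + h *\<^sub>R (1, 0) - y) * \<rho> y) - (LINT y|lborel. \<phi> (z - y) * \<rho> y)) / h) \<longlongrightarrow> \<psi>t z) (at 0)"
      using curve_t unfolding sh DERIV_def by (simp add: \<psi>_def)
  qed (use i \<rho> in \<open>simp_all add: norm_Pair\<close>)
  then show "deriv (\<lambda>s. \<psi> (s, snd z)) (fst z) = (LINT y|lborel. \<phi>t (z - y) * \<rho> y)"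
    using DERIV_imp_deriv[OF curve_t] by simp
  have "\<psi>x z = (LINT y|lborel. \<phi>x (z - y) * \<rho> y)"
  proof (rule mollified_partial[OF lip, of "(0, 1)"])
    show "AE z in lborel. ((\<lambda>h. (\<phi> (z + h *\<^sub>R (0, 1)) - \<phi> z) / h) \<longlongrightarrow> \<phi>x z) (at 0)"
      using dx unfolding sh by (simp add: DERIV_def)
    show "((\<lambda>h. ((LINT y|lborel. \<phi> (z + h *\<^sub>R (0, 1) - y) * \<rho> y) - (LINT y|lborel. \<phi> (z - y) * \<rho> y)) / h) \<longlongrightarrow> \<psi>x z) (at 0)"
      using curve_x unfolding sh DERIV_def by (simp add: \<psi>_def)
  qed (use i \<rho> in \<open>simp_all add: norm_Pair\<close>)
  then show "deriv (\<lambda>y. \<psi> (fst z, y)) (snd z) = (LINT y|lborel. \<phi>x (z - y) * \<rho> y)"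
    using DERIV_imp_deriv[OF curve_x] by simp
qed


text \<open>By Fubini the pairing of \<open>a\<close> with the mollified \<open>k\<close> is the
  average against \<open>\<rho>\<close> of the correlations of \<open>a\<close> with
  \<open>k\<close> at shifts \<open>y\<close>. On the support of \<open>\<rho>\<close> these are
  within \<open>\<epsilon>\<close> of \<open>J\<close>, and averaging preserves the error.\<close>

lemma integral_mollified:
  fixes a k \<rho> :: "real \<times> real \<Rightarrow> real"
  assumes [measurable]: "a \<in> borel_measurable borel" "k \<in> borel_measurable borel" "\<rho> \<in> borel_measurable borel"
    and a: "\<And>z. \<bar>a z\<bar> \<le> A" and k: "\<And>z. \<bar>k z\<bar> \<le> K" "\<And>z. k z \<noteq> 0 \<Longrightarrow> norm z \<le> R"
    and \<rho>: "\<And>z. 0 \<le> \<rho> z" "\<And>z. \<eta> \<le> norm z \<Longrightarrow> \<rho> z = 0"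
      "integrable lborel \<rho>" "(LINT z|lborel. \<rho> z) = 1"
    and \<epsilon>: "\<And>y. norm y < \<eta> \<Longrightarrow> \<bar>(LINT z|lborel. a z * k (z - y)) - J\<bar> \<le> \<epsilon>"
  shows "\<bar>(LINT z|lborel. a z * (LINT y|lborel. k (z - y) * \<rho> y)) - J\<bar> \<le> \<epsilon>"
    "integrable lborel (\<lambda>z. a z * (LINT y|lborel. k (z - y) * \<rho> y))"
proof -
  define \<Theta> where "\<Theta> y = (LINT z|lborel. a z * k (z - y))" for y
  have A: "A \<ge> 0" and K: "K \<ge> 0" using a[of 0] k(1)[of 0] by auto
  let ?I = "indicator (cball 0 (R + \<eta>)) :: real \<times> real \<Rightarrow> real"
  have [measurable]: "cball (0::real \<times> real) (R + \<eta>) \<in> sets borel" by simp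
  have fm: "(fst :: (real \<times> real) \<times> (real \<times> real) \<Rightarrow> _) \<in> borel \<rightarrow>\<^sub>M borel"
    and sm: "(snd :: (real \<times> real) \<times> (real \<times> real) \<Rightarrow> _) \<in> borel \<rightarrow>\<^sub>M borel"
    and dm: "(\<lambda>p :: (real \<times> real) \<times> (real \<times> real). fst p - snd p) \<in> borel \<rightarrow>\<^sub>M borel"
    by (intro borel_measurable_continuous_onI continuous_intros)+
  have int: "integrable (lborel \<Otimes>\<^sub>M lborel) (\<lambda>p. a (fst p) * k (fst p - snd p) * \<rho> (snd p))"
  proof (rule Bochner_Integration.integrable_bound)
    have "integrable (lborel \<Otimes>\<^sub>M lborel) (\<lambda>p. ?I (fst p) * \<rho> (snd p))"
    proof (rule lborel_pair.Fubini_integrable)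
      show "(\<lambda>p. ?I (fst p) * \<rho> (snd p)) \<in> borel_measurable (lborel \<Otimes>\<^sub>M lborel)"
        unfolding lborel_prod measurable_lborel2
        by (intro borel_measurable_times measurable_compose[OF fm] measurable_compose[OF sm]) measurable
      have "(LINT y|lborel. norm (?I z * \<rho> y)) = ?I z" for z
        using \<rho> by (simp add: abs_mult abs_of_nonneg)
      moreover have "integrable lborel ?I"
        by (rule integrable_lborel_bounded_support[where B=1 and R="R+\<eta>"]) (auto simp: indicator_def split: if_splits)
      ultimately show "integrable lborel (\<lambda>z. LINT y|lborel. norm (?I (fst (z, y)) * \<rho> (snd (z, y))))"
        by simp
    qed (use \<rho>(3) in simp)
    then show "integrable (lborel \<Otimes>\<^sub>M lborel) (\<lambda>p. A * K * (?I (fst p) * \<rho> (snd p)))"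
      by (rule integrable_mult_right)
    show "(\<lambda>p. a (fst p) * k (fst p - snd p) * \<rho> (snd p)) \<in> borel_measurable (lborel \<Otimes>\<^sub>M lborel)"
      unfolding lborel_prod measurable_lborel2
      by (intro borel_measurable_times measurable_compose[OF fm] measurable_compose[OF sm] measurable_compose[OF dm]) measurable
    show "AE p in lborel \<Otimes>\<^sub>M lborel. norm (a (fst p) * k (fst p - snd p) * \<rho> (snd p)) \<le> norm (A * K * (?I (fst p) * \<rho> (snd p)))"
    proof (intro AE_I2)
      fix p :: "(real \<times> real) \<times> (real \<times> real)"
      obtain z y where p: "p = (z, y)" by (cases p)
      have nn: "0 \<le> A * K * (?I z * \<rho> y)" using A K \<rho>(1)[of y] by (intro mult_nonneg_nonneg) simp_all
      have "\<bar>a z * k (z - y) * \<rho> y\<bar> \<le> A * K * (?I z * \<rho> y)"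
      proof (cases "k (z - y) = 0 \<or> \<rho> y = 0")
        case False
        then have "norm (z - y) \<le> R" "norm y < \<eta>" using k(2)[of "z - y"] \<rho>(2)[of y] by (auto simp: not_le[symmetric])
        then have "norm z \<le> R + \<eta>" using norm_triangle_sub[of z y] by linarith
        then have "?I z = 1" by simp
        moreover have "\<bar>a z\<bar> * \<bar>k (z - y)\<bar> * \<rho> y \<le> A * K * \<rho> y"
          using a[of z] k(1)[of "z - y"] \<rho>(1)[of y] A by (intro mult_right_mono mult_mono) simp_all
        ultimately show ?thesis using \<rho>(1)[of y] by (simp add: abs_mult)
      next
        case True
        then have "a z * k (z - y) * \<rho> y = 0" by auto
        then show ?thesis using nn by (simp only: abs_zero)
      qed
      then show "norm (a (fst p) * k (fst p - snd p) * \<rho> (snd p)) \<le> norm (A * K * (?I (fst p) * \<rho> (snd p)))"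
        unfolding p fst_conv snd_conv real_norm_def using nn by linarith
    qed
  qed
  have int': "integrable (lborel \<Otimes>\<^sub>M lborel) (\<lambda>(z, y). a z * k (z - y) * \<rho> y)"
    using int by (simp add: case_prod_beta')
  have pull: "(LINT x|lborel. a x * (k (x - y) * \<rho> y)) = (LINT z|lborel. a z * k (z - y)) * \<rho> y" for y
    by (simp add: mult.assoc[symmetric])
  have eq: "(LINT z|lborel. a z * (LINT y|lborel. k (z - y) * \<rho> y)) = (LINT y|lborel. \<Theta> y * \<rho> y)"
    using lborel_pair.Fubini_integral[OF int'] unfolding \<Theta>_def by (simp add: mult.assoc pull)
  show "integrable lborel (\<lambda>z. a z * (LINT y|lborel. k (z - y) * \<rho> y))"
    using lborel_pair.integrable_fst[OF int'] by (simp add: mult.assoc)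
  have i\<Theta>: "integrable lborel (\<lambda>y. \<Theta> y * \<rho> y)"
    using lborel_pair.integrable_snd[OF int'] unfolding \<Theta>_def by simp
  have iJ: "integrable lborel (\<lambda>y. J * \<rho> y)" using \<rho>(3) by simp
  have "(LINT y|lborel. \<Theta> y * \<rho> y) - J = (LINT y|lborel. \<Theta> y * \<rho> y) - (LINT y|lborel. J * \<rho> y)"
    using \<rho>(4) by simp
  also have "\<dots> = (LINT y|lborel. \<Theta> y * \<rho> y - J * \<rho> y)"
    by (rule Bochner_Integration.integral_diff[OF i\<Theta> iJ, symmetric])
  also have "\<bar>\<dots>\<bar> \<le> (LINT y|lborel. \<epsilon> * \<rho> y)"
  proof (rule order_trans[OF integral_abs_bound integral_mono])
    show "integrable lborel (\<lambda>y. \<bar>\<Theta> y * \<rho> y - J * \<rho> y\<bar>)"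
      by (intro integrable_abs Bochner_Integration.integrable_diff i\<Theta> iJ)
    show "integrable lborel (\<lambda>y. \<epsilon> * \<rho> y)" using \<rho>(3) by simp
    fix y
    have e: "\<bar>\<Theta> y * \<rho> y - J * \<rho> y\<bar> = \<bar>\<Theta> y - J\<bar> * \<rho> y"
      using \<rho>(1)[of y] by (simp add: left_diff_distrib[symmetric] abs_mult)
    show "\<bar>\<Theta> y * \<rho> y - J * \<rho> y\<bar> \<le> \<epsilon> * \<rho> y"
    proof (cases "\<eta> \<le> norm y")
      case False
      then show ?thesis unfolding e unfolding \<Theta>_def using \<epsilon>[of y] \<rho>(1)[of y] by (intro mult_right_mono) simp_all
    qed (use \<rho>(2) in simp)
  qed
  also have "\<dots> = \<epsilon>" using \<rho>(4) by simp
  finally show "\<bar>(LINT z|lborel. a z * (LINT y|lborel. k (z - y) * \<rho> y)) - J\<bar> \<le> \<epsilon>" unfolding eq .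
qed

text \<open>Along mollifications of the Lipschitz test function the left side converges by
  continuity of correlations at shift 0, and the right side because the convergence is uniform with
  supports in one ball, which has finite mass for \<open>P\<close> and \<open>N\<close>.\<close>

theorem balance_of_test_functions:
  fixes a b :: "real \<times> real \<Rightarrow> real"
  assumes am[measurable]: "a \<in> borel_measurable borel" "b \<in> borel_measurable borel"
    and ab: "\<And>z. \<bar>a z\<bar> \<le> A" "\<And>z. \<bar>b z\<bar> \<le> A"
    and P: "radon_on_strip T P" "radon_on_strip T N"
    and id: "\<And>\<phi>. test_function T \<phi> \<Longrightarrow>
      - (LINT z|lborel. a z * deriv (\<lambda>s. \<phi> (s, snd z)) (fst z) + b z * deriv (\<lambda>y. \<phi> (fst z, y)) (snd z))
        = (LINT z|P. \<phi> z) - (LINT z|N. \<phi> z)"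
  shows "balance T a b P N"
  unfolding balance_def
proof (intro allI impI)
  fix \<phi> \<phi>t \<phi>x assume lt: "lip_test T \<phi> \<phi>t \<phi>x"
  then have [measurable]: "\<phi>t \<in> borel_measurable borel" "\<phi>x \<in> borel_measurable borel"
    and dt: "AE z in lborel. ((\<lambda>s. \<phi> (s, snd z)) has_real_derivative \<phi>t z) (at (fst z))"
    and dx: "AE z in lborel. ((\<lambda>y. \<phi> (fst z, y)) has_real_derivative \<phi>x z) (at (snd z))"
    unfolding lip_test_def lipD_def by blast+
  obtain B where lip: "B-lipschitz_on UNIV \<phi>" and B: "\<And>z. \<bar>\<phi> z\<bar> \<le> B" "\<And>z. \<bar>\<phi>t z\<bar> \<le> B" "\<And>z. \<bar>\<phi>x z\<bar> \<le> B"
    using lt unfolding lip_test_def lipD_def by blast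
  obtain \<delta> r where \<delta>: "\<delta> > 0" and supp0: "\<And>z. \<phi> z \<noteq> 0 \<or> \<phi>t z \<noteq> 0 \<or> \<phi>x z \<noteq> 0 \<Longrightarrow> \<delta> \<le> fst z \<and> fst z \<le> T - \<delta> \<and> \<bar>snd z\<bar> \<le> r"
    using lt unfolding lip_test_def by blast
  then have supp: "\<And>z. \<phi> z \<noteq> 0 \<Longrightarrow> \<delta> \<le> fst z \<and> fst z \<le> T - \<delta> \<and> \<bar>snd z\<bar> \<le> r" by blast
  have nsupp: "norm z \<le> \<bar>T\<bar> + \<bar>r\<bar>" if "\<phi> z \<noteq> 0 \<or> \<phi>t z \<noteq> 0 \<or> \<phi>x z \<noteq> 0" for z
    using supp0[OF that] \<delta> by (intro norm_le_of_strip_box) auto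
  have cont: "continuous_on UNIV \<phi>" using lipschitz_on_continuous_on[OF lip] .
  have [measurable]: "\<phi> \<in> borel_measurable borel" using cont by (rule borel_measurable_continuous_onI)
  define Jt Jx where "Jt = (LINT z|lborel. a z * \<phi>t z)" and "Jx = (LINT z|lborel. b z * \<phi>x z)"
  define R where "R = \<bar>T\<bar> + \<bar>r\<bar> + \<delta>"
  define mP mN where "mP = measure P (cball 0 R)" and "mN = measure N (cball 0 R)"
  have iM: "integrable M \<phi>" if "radon_on_strip T M" for M
    by (rule integrable_radon_bounded_support[OF that _ B(1), where R="\<bar>T\<bar> + \<bar>r\<bar>"]) (use nsupp in auto)
  have isum: "integrable lborel (\<lambda>z. a z * \<phi>t z)" "integrable lborel (\<lambda>z. b z * \<phi>x z)"
  proof -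
    have "\<bar>a z * \<phi>t z\<bar> \<le> A * B" "\<bar>b z * \<phi>x z\<bar> \<le> A * B" for z
      using ab[of z] B[of z] by (auto simp: abs_mult intro!: mult_mono)
    then show "integrable lborel (\<lambda>z. a z * \<phi>t z)" "integrable lborel (\<lambda>z. b z * \<phi>x z)"
      by (auto intro!: integrable_lborel_bounded_support[where R="\<bar>T\<bar> + \<bar>r\<bar>"] nsupp)
  qed
  \<comment> \<open>The error is \<open>\<epsilon>\<close> for each of the two flux terms, and
    \<open>\<epsilon>\<close> per unit of mass of \<open>P\<close> and of \<open>N\<close>.\<close>
  have "\<bar>- (Jt + Jx) - ((LINT z|P. \<phi> z) - (LINT z|N. \<phi> z))\<bar> \<le> \<epsilon> * (2 + mP + mN)" if e: "\<epsilon> > 0" for \<epsilon>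
  proof -
    have B0: "B \<ge> 0" using B(1)[of 0] by linarith
    have "isCont (\<lambda>y. LINT z|lborel. a z * \<phi>t (z - y)) 0"
      by (rule continuous_correlation[OF am(1) _ ab(1) B(2), where R="\<bar>T\<bar> + \<bar>r\<bar>"]) (use nsupp in simp_all)
    then obtain d1 where d1: "d1 > 0"
      and d1d: "\<forall>y. dist y 0 < d1 \<longrightarrow> dist (LINT z|lborel. a z * \<phi>t (z - y)) (LINT z|lborel. a z * \<phi>t (z - 0)) < \<epsilon>"
      unfolding continuous_at_eps_delta using e by blast
    have d1': "\<bar>(LINT z|lborel. a z * \<phi>t (z - y)) - Jt\<bar> \<le> \<epsilon>" if "norm y < d1" for y
      using d1d[rule_format, of y] that by (simp add: dist_real_def Jt_def)
    have "isCont (\<lambda>y. LINT z|lborel. b z * \<phi>x (z - y)) 0"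
      by (rule continuous_correlation[OF am(2) _ ab(2) B(3), where R="\<bar>T\<bar> + \<bar>r\<bar>"]) (use nsupp in simp_all)
    then obtain d2 where d2: "d2 > 0"
      and d2d: "\<forall>y. dist y 0 < d2 \<longrightarrow> dist (LINT z|lborel. b z * \<phi>x (z - y)) (LINT z|lborel. b z * \<phi>x (z - 0)) < \<epsilon>"
      unfolding continuous_at_eps_delta using e by blast
    have d2': "\<bar>(LINT z|lborel. b z * \<phi>x (z - y)) - Jx\<bar> \<le> \<epsilon>" if "norm y < d2" for y
      using d2d[rule_format, of y] that by (simp add: dist_real_def Jx_def)
    \<comment> \<open>Four demands: both correlations within \<open>\<epsilon>\<close>, mollified
      support inside the open strip, uniform error
      \<open>B * \<eta> \<le> \<epsilon>\<close>.\<close>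
    define \<eta> where "\<eta> = Min {d1, d2, \<delta> / 2, \<epsilon> / (B + 1)}"
    have \<eta>: "\<eta> > 0" "\<eta> \<le> d1" "\<eta> \<le> d2" "\<eta> < \<delta>" "\<eta> \<le> \<epsilon> / (B + 1)"
      using d1 d2 \<delta> e B0 unfolding \<eta>_def by (simp_all add: min_less_iff_disj min_le_iff_disj)
    have "B * \<eta> \<le> (B + 1) * \<eta>" using \<eta> by (simp add: algebra_simps)
    also have "\<dots> \<le> \<epsilon>" using \<eta>(5) B0 by (simp add: pos_le_divide_eq mult.commute)
    finally have B\<eta>: "B * \<eta> \<le> \<epsilon>" .
    obtain \<rho> :: "real \<times> real \<Rightarrow> real" where \<rho>: "\<And>k. C_k k \<rho>" "\<And>z. 0 \<le> \<rho> z" "\<And>z. \<eta> \<le> norm z \<Longrightarrow> \<rho> z = 0"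
      "integrable lborel \<rho>" "(LINT z|lborel. \<rho> z) = 1"
      using obtain_mollifier[OF \<eta>(1)] by blast
    have \<rho>m: "\<rho> \<in> borel_measurable borel"
      using C_k_imp_continuous[OF \<rho>(1)] by (rule borel_measurable_continuous_onI)
    define \<psi> where "\<psi> z = (LINT y|lborel. \<phi> (z - y) * \<rho> y)" for z
    note mol = mollify[OF lip B(1) _ _ dt dx supp \<eta>(4,1) \<rho>, folded \<psi>_def, simplified]
    note m = integral_mollified[OF am(1) _ \<rho>m ab(1) B(2) _ \<rho>(2-5), where R="\<bar>T\<bar> + \<bar>r\<bar>" and J=Jt and \<epsilon>=\<epsilon>]
    have mt: "\<bar>(LINT z|lborel. a z * (LINT y|lborel. \<phi>t (z - y) * \<rho> y)) - Jt\<bar> \<le> \<epsilon>"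
      "integrable lborel (\<lambda>z. a z * (LINT y|lborel. \<phi>t (z - y) * \<rho> y))"
      by (rule m; use nsupp d1' \<eta>(2) in force)+
    note m = integral_mollified[OF am(2) _ \<rho>m ab(2) B(3) _ \<rho>(2-5), where R="\<bar>T\<bar> + \<bar>r\<bar>" and J=Jx and \<epsilon>=\<epsilon>]
    have mx: "\<bar>(LINT z|lborel. b z * (LINT y|lborel. \<phi>x (z - y) * \<rho> y)) - Jx\<bar> \<le> \<epsilon>"
      "integrable lborel (\<lambda>z. b z * (LINT y|lborel. \<phi>x (z - y) * \<rho> y))"
      by (rule m; use nsupp d2' \<eta>(3) in force)+
    have "- ((LINT z|lborel. a z * (LINT y|lborel. \<phi>t (z - y) * \<rho> y)) + (LINT z|lborel. b z * (LINT y|lborel. \<phi>x (z - y) * \<rho> y)))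
        = (LINT z|P. \<psi> z) - (LINT z|N. \<psi> z)"
      using id[OF mol(1)] mt(2) mx(2) by (simp add: mol(4,5))
    note eqn = this
    have close: "\<bar>(LINT z|M. \<psi> z) - (LINT z|M. \<phi> z)\<bar> \<le> \<epsilon> * measure M (cball 0 R)"
      if M: "radon_on_strip T M" for M
    proof -
      have sM: "sets M = sets borel" using M by (simp add: radon_on_strip_def)
      have fM: "emeasure M (cball 0 R) < \<infinity>" using M by (simp add: radon_on_strip_def)
      have n\<psi>: "norm z \<le> R" if "\<psi> z \<noteq> 0 \<or> \<phi> z \<noteq> 0" for z
      proof -
        have "\<bar>fst z\<bar> \<le> \<bar>T\<bar> \<and> \<bar>snd z\<bar> \<le> \<bar>r\<bar> + \<eta>"
          using mol(3)[of z] supp[of z] that \<delta> \<eta>(1) by (cases "\<psi> z \<noteq> 0") auto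
        then show ?thesis using norm_le_of_strip_box[of z "\<bar>T\<bar>" "\<bar>r\<bar> + \<eta>"] \<eta> by (simp add: R_def)
      qed
      have \<psi>m: "\<psi> \<in> borel_measurable borel"
        using mol(1) C_k_imp_continuous unfolding test_function_def by (blast intro: borel_measurable_continuous_onI)
      have \<psi>B: "\<bar>\<psi> z\<bar> \<le> B + B * \<eta>" for z using mol(2)[of z] B(1)[of z] by linarith
      have i\<psi>: "integrable M \<psi>" by (rule integrable_radon_bounded_support[OF M \<psi>m \<psi>B]) (use n\<psi> in blast)
      have i\<phi>: "integrable M \<phi>" by (rule integrable_radon_bounded_support[OF M _ B(1)]) (use n\<psi> in auto)
      have "\<bar>(LINT z|M. \<psi> z) - (LINT z|M. \<phi> z)\<bar> = \<bar>LINT z|M. \<psi> z - \<phi> z\<bar>"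
        using i\<psi> i\<phi> by simp
      also have "\<dots> \<le> (LINT z|M. \<epsilon> * indicator (cball 0 R) z)"
      proof (rule order_trans[OF integral_abs_bound integral_mono])
        show "integrable M (\<lambda>z. \<bar>\<psi> z - \<phi> z\<bar>)" using i\<psi> i\<phi> by simp
        show "integrable M (\<lambda>z. \<epsilon> * indicator (cball 0 R) z)"
          using fM sM by (intro integrable_mult_right integrable_real_indicator) auto
        fix z show "\<bar>\<psi> z - \<phi> z\<bar> \<le> \<epsilon> * indicator (cball 0 R) z"
        proof (cases "\<psi> z \<noteq> 0 \<or> \<phi> z \<noteq> 0")
          case True
          then show ?thesis using n\<psi>[of z] mol(2)[of z] B\<eta> by simp
        qed (use e in simp)
      qed
      also have "\<dots> = \<epsilon> * measure M (cball 0 R)" using sM by simp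
      finally show ?thesis .
    qed
    from close[OF P(1)] close[OF P(2)] mt(1) mx(1) eqn
    show ?thesis unfolding mP_def mN_def by (simp add: algebra_simps abs_le_iff)
  qed
  note close = this
  have "\<bar>- (Jt + Jx) - ((LINT z|P. \<phi> z) - (LINT z|N. \<phi> z))\<bar> \<le> 0"
  proof (rule field_le_epsilon)
    fix e :: real assume "e > 0"
    have m: "2 + mP + mN > 0" by (simp add: mP_def mN_def add_pos_nonneg)
    show "\<bar>- (Jt + Jx) - ((LINT z|P. \<phi> z) - (LINT z|N. \<phi> z))\<bar> \<le> 0 + e"
      using close[of "e / (2 + mP + mN)"] m \<open>e > 0\<close> by simp
  qed
  then show "- (LINT z|lborel. a z * \<phi>t z + b z * \<phi>x z) = (LINT z|P. \<phi> z) - (LINT z|N. \<phi> z)"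
    using isum by (simp add: Jt_def Jx_def)
qed

section \<open>Lipschitz building blocks of cutoffs, and essential limits as limits of means\<close>

section \<open>Cutoffs and essential limits\<close>

lemma AE_lborel_fst:
  assumes "AE t in lborel. Q (t::real)"
  shows "AE z in (lborel :: (real \<times> real) measure). Q (fst z)"
proof -
  obtain N where N: "{t. \<not> Q t} \<subseteq> N" "N \<in> null_sets lborel"
    using assms unfolding eventually_ae_filter by auto
  have "emeasure (lborel \<Otimes>\<^sub>M lborel) (N \<times> (UNIV :: real set)) = emeasure lborel N * emeasure lborel (UNIV :: real set)"
    using N(2) by (intro lborel.emeasure_pair_measure_Times) auto
  also have "\<dots> = 0" using N(2) by (auto dest!: null_setsD1)
  finally have "N \<times> UNIV \<in> null_sets (lborel :: (real \<times> real) measure)"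
    using N(2) by (auto simp: lborel_prod null_sets_def intro!: borel_Times)
  then show ?thesis by (rule AE_I') (use N(1) in auto)
qed

lemma AE_lborel_pair:
  assumes "AE z in (lborel :: (real \<times> real) measure). Q z"
  shows "AE t in lborel. AE x in lborel. Q (t, x)"
proof -
  have "AE z in lborel \<Otimes>\<^sub>M lborel. Q z" using assms unfolding lborel_prod .
  then show ?thesis by (rule lborel_pair.AE_pair)
qed

text \<open>As \<open>b \<noteq> 0\<close>, each vertical line meets the level set in a single
  point, so Fubini makes it null. Such sets carry the kinks of the cutoffs, and the curve itself is
  one of them.\<close>

lemma AE_level_set:
  fixes \<alpha> :: "real \<Rightarrow> real"
  assumes "continuous_on UNIV \<alpha>" "b \<noteq> 0"
  shows "AE z in lborel. \<alpha> (fst z) + b * snd z \<noteq> c"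
proof -
  have "closed {z :: real \<times> real. \<alpha> (fst z) + b * snd z = c}"
    by (intro closed_Collect_eq continuous_intros continuous_on_compose2[OF assms(1)]) auto
  then have "{z :: real \<times> real. \<not> \<alpha> (fst z) + b * snd z = c} \<in> sets borel"
    by (simp add: Collect_neg_eq closed_def)
  then have S: "{z \<in> space (lborel \<Otimes>\<^sub>M lborel). \<alpha> (fst z) + b * snd z \<noteq> c} \<in> sets (lborel \<Otimes>\<^sub>M lborel)"
    unfolding lborel_prod by simp
  have "AE z in lborel \<Otimes>\<^sub>M lborel. \<alpha> (fst z) + b * snd z \<noteq> c"
  proof (rule lborel_pair.AE_pair_measure[OF S])
    show "AE t in lborel. AE x in lborel. \<alpha> (fst (t, x)) + b * snd (t, x) \<noteq> c"
    proof (rule AE_I2)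
      fix t :: real
      show "AE x in lborel. \<alpha> (fst (t, x)) + b * snd (t, x) \<noteq> c"
        using AE_lborel_singleton[of "(c - \<alpha> t) / b"]
        by eventually_elim (use assms(2) in \<open>auto simp: field_simps\<close>)
    qed
  qed
  then show ?thesis unfolding lborel_prod .
qed

lemma lipD_mult:
  assumes "lipD \<phi> \<phi>t \<phi>x" "lipD g gt gx"
  shows "lipD (\<lambda>z. \<phi> z * g z) (\<lambda>z. \<phi>t z * g z + gt z * \<phi> z) (\<lambda>z. \<phi>x z * g z + gx z * \<phi> z)"
proof -
  obtain B where B: "B-lipschitz_on UNIV \<phi>" "\<And>z. \<bar>\<phi> z\<bar> \<le> B" "\<And>z. \<bar>\<phi>t z\<bar> \<le> B" "\<And>z. \<bar>\<phi>x z\<bar> \<le> B"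
    using assms(1) unfolding lipD_def by blast
  obtain C where C: "C-lipschitz_on UNIV g" "\<And>z. \<bar>g z\<bar> \<le> C" "\<And>z. \<bar>gt z\<bar> \<le> C" "\<And>z. \<bar>gx z\<bar> \<le> C"
    using assms(2) unfolding lipD_def by blast
  have B0: "B \<ge> 0" "C \<ge> 0" using B(2)[of 0] C(2)[of 0] by linarith+
  have [measurable]: "\<phi>t \<in> borel_measurable borel" "\<phi>x \<in> borel_measurable borel"
    "gt \<in> borel_measurable borel" "gx \<in> borel_measurable borel" using assms unfolding lipD_def by blast+
  have [measurable]: "\<phi> \<in> borel_measurable borel" "g \<in> borel_measurable borel"
    using lipschitz_on_continuous_on[OF B(1)] lipschitz_on_continuous_on[OF C(1)]
    by (auto intro: borel_measurable_continuous_onI)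
  have two: "\<bar>p * q + r * s\<bar> \<le> 2 * B * C" if "\<bar>p\<bar> \<le> B" "\<bar>q\<bar> \<le> C" "\<bar>r\<bar> \<le> C" "\<bar>s\<bar> \<le> B" for p q r s
  proof -
    have "\<bar>p * q\<bar> \<le> B * C" "\<bar>r * s\<bar> \<le> C * B" unfolding abs_mult using that B0 by (intro mult_mono; simp)+
    then have "\<bar>p * q + r * s\<bar> \<le> B * C + C * B" by linarith
    then show ?thesis by (simp add: mult_ac)
  qed
  have lipc: "(2 * B * C)-lipschitz_on UNIV (\<lambda>z. \<phi> z * g z)"
  proof (rule lipschitz_onI)
    fix z w :: "real \<times> real"
    have 1: "\<bar>\<phi> z - \<phi> w\<bar> \<le> B * dist z w" "\<bar>g z - g w\<bar> \<le> C * dist z w"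
      using lipschitz_onD[OF B(1), of z w] lipschitz_onD[OF C(1), of z w] by (auto simp: dist_real_def)
    have "\<phi> z * g z - \<phi> w * g w = (\<phi> z - \<phi> w) * g z + (g z - g w) * \<phi> w" by (simp add: algebra_simps)
    also have "\<bar>\<dots>\<bar> \<le> \<bar>(\<phi> z - \<phi> w) * g z\<bar> + \<bar>(g z - g w) * \<phi> w\<bar>" by (rule abs_triangle_ineq)
    also have "\<dots> \<le> (B * dist z w) * C + (C * dist z w) * B"
      unfolding abs_mult using 1 B(2)[of w] C(2)[of z] B0 by (intro add_mono mult_mono) simp_all
    finally show "dist (\<phi> z * g z) (\<phi> w * g w) \<le> 2 * B * C * dist z w" by (simp add: dist_real_def algebra_simps)
  qed (use B0 in simp)
  have b1: "\<bar>\<phi> z * g z\<bar> \<le> 2 * B * C" for z using two[of "\<phi> z" "g z" 0 0] B(2) C(2) B0 by simp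
  have b2: "\<bar>\<phi>t z * g z + gt z * \<phi> z\<bar> \<le> 2 * B * C" "\<bar>\<phi>x z * g z + gx z * \<phi> z\<bar> \<le> 2 * B * C" for z
    by (intro two B C)+
  have d1: "AE z in lborel. ((\<lambda>s. \<phi> (s, snd z) * g (s, snd z)) has_real_derivative \<phi>t z * g z + gt z * \<phi> z) (at (fst z))"
  proof -
    have "AE z in lborel. ((\<lambda>s. \<phi> (s, snd z)) has_real_derivative \<phi>t z) (at (fst z))"
      "AE z in lborel. ((\<lambda>s. g (s, snd z)) has_real_derivative gt z) (at (fst z))"
      using assms unfolding lipD_def by blast+
    then show ?thesis
    proof eventually_elim
      case (elim z) from DERIV_mult[OF elim] show ?case by simp
    qed
  qed
  have d2: "AE z in lborel. ((\<lambda>y. \<phi> (fst z, y) * g (fst z, y)) has_real_derivative \<phi>x z * g z + gx z * \<phi> z) (at (snd z))"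
  proof -
    have "AE z in lborel. ((\<lambda>y. \<phi> (fst z, y)) has_real_derivative \<phi>x z) (at (snd z))"
      "AE z in lborel. ((\<lambda>y. g (fst z, y)) has_real_derivative gx z) (at (snd z))"
      using assms unfolding lipD_def by blast+
    then show ?thesis
    proof eventually_elim
      case (elim z) from DERIV_mult[OF elim] show ?case by simp
    qed
  qed
  have m: "(\<lambda>z. \<phi>t z * g z + gt z * \<phi> z) \<in> borel_measurable borel"
    "(\<lambda>z. \<phi>x z * g z + gx z * \<phi> z) \<in> borel_measurable borel" by measurable
  show ?thesis unfolding lipD_def
    by (intro conjI exI[of _ "2 * B * C"] allI lipc b1 b2 d1 d2 m)
qed

lemma lip_test_mult:
  assumes "lip_test T \<phi> \<phi>t \<phi>x" "lipD g gt gx"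
  shows "lip_test T (\<lambda>z. \<phi> z * g z) (\<lambda>z. \<phi>t z * g z + gt z * \<phi> z) (\<lambda>z. \<phi>x z * g z + gx z * \<phi> z)"
proof -
  obtain \<delta> r where \<delta>: "\<delta> > 0" and supp: "\<And>z. \<phi> z \<noteq> 0 \<or> \<phi>t z \<noteq> 0 \<or> \<phi>x z \<noteq> 0 \<Longrightarrow> \<delta> \<le> fst z \<and> fst z \<le> T - \<delta> \<and> \<bar>snd z\<bar> \<le> r"
    using assms(1) unfolding lip_test_def by blast
  have "\<phi> z \<noteq> 0 \<or> \<phi>t z \<noteq> 0 \<or> \<phi>x z \<noteq> 0"
    if "\<phi> z * g z \<noteq> 0 \<or> \<phi>t z * g z + gt z * \<phi> z \<noteq> 0 \<or> \<phi>x z * g z + gx z * \<phi> z \<noteq> 0" for z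
    using that by auto
  then show ?thesis
    using lipD_mult[of \<phi> \<phi>t \<phi>x g gt gx] assms supp \<delta> unfolding lip_test_def by blast
qed

definition ramp :: "real \<Rightarrow> real" where
  "ramp y = max 0 (min 1 y)"

lemma ramp_bounds: "0 \<le> ramp y" "ramp y \<le> 1" "\<bar>ramp y\<bar> \<le> 1"
  by (auto simp: ramp_def)

lemma ramp_lipschitz: "\<bar>ramp y - ramp z\<bar> \<le> \<bar>y - z\<bar>"
  by (auto simp: ramp_def max_def min_def)

lemma continuous_ramp: "continuous_on UNIV ramp"
  unfolding ramp_def by (intro continuous_intros)

lemma ramp_measurable[measurable]: "ramp \<in> borel_measurable borel"
  using continuous_ramp by (rule borel_measurable_continuous_onI)

lemma ramp_simps: "y \<le> 0 \<Longrightarrow> ramp y = 0" "1 \<le> y \<Longrightarrow> ramp y = 1"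
  by (auto simp: ramp_def)

lemma ramp_has_derivative:
  assumes "y \<noteq> 0" "y \<noteq> 1"
  shows "(ramp has_real_derivative indicator {0<..<1} y) (at y)"
proof -
  consider "y < 0" | "0 < y" "y < 1" | "1 < y" using assms by linarith
  then show ?thesis
  proof cases
    case 1
    have ev: "\<forall>\<^sub>F z in nhds y. (0::real) = ramp z"
      using eventually_nhds_in_open[of "{..<0}" y] 1 by (auto simp: ramp_def elim: eventually_mono)
    show ?thesis using DERIV_cong_ev[OF refl ev refl, of 0] 1 by simp
  next
    case 2
    have ev: "\<forall>\<^sub>F z in nhds y. z = ramp z"
      using eventually_nhds_in_open[of "{0<..<1}" y] 2 by (auto simp: ramp_def elim: eventually_mono)
    show ?thesis using DERIV_cong_ev[OF refl ev refl, of 1] 2 by simp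
  next
    case 3
    have ev: "\<forall>\<^sub>F z in nhds y. (1::real) = ramp z"
      using eventually_nhds_in_open[of "{1<..}" y] 3 by (auto simp: ramp_def elim: eventually_mono)
    show ?thesis using DERIV_cong_ev[OF refl ev refl, of 0] 3 by simp
  qed
qed

lemma lipD_time:
  fixes g g' :: "real \<Rightarrow> real"
  assumes L: "L-lipschitz_on UNIV g" and b: "\<And>t. \<bar>g t\<bar> \<le> C" "\<And>t. \<bar>g' t\<bar> \<le> C"
    and m[measurable]: "g' \<in> borel_measurable borel"
    and d: "AE t in lborel. (g has_real_derivative g' t) (at t)"
  shows "lipD (\<lambda>z. g (fst z)) (\<lambda>z. g' (fst z)) (\<lambda>_. 0)"
proof -
  have L0: "L \<ge> 0" "C \<ge> 0" using lipschitz_on_nonneg[OF L] b(1)[of 0] by auto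
  have "(L + C)-lipschitz_on UNIV (\<lambda>z :: real \<times> real. g (fst z))"
  proof (rule lipschitz_onI)
    fix z w :: "real \<times> real"
    have "dist (g (fst z)) (g (fst w)) \<le> L * dist (fst z) (fst w)" by (rule lipschitz_onD[OF L]) auto
    also have "\<dots> \<le> (L + C) * dist z w" using L0 by (intro mult_mono dist_fst_le) auto
    finally show "dist (g (fst z)) (g (fst w)) \<le> (L + C) * dist z w" .
  qed (use L0 in simp)
  moreover have "\<bar>g (fst z)\<bar> \<le> L + C" "\<bar>g' (fst z)\<bar> \<le> L + C" "\<bar>0\<bar> \<le> L + C" for z :: "real \<times> real"
    using b(1)[of "fst z"] b(2)[of "fst z"] L0 by simp_all
  moreover have "(\<lambda>z :: real \<times> real. g' (fst z)) \<in> borel_measurable borel"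
    by (rule measurable_compose[OF _ m]) (intro borel_measurable_continuous_onI continuous_intros)
  ultimately show ?thesis unfolding lipD_def using AE_lborel_fst[OF d]
    by (intro conjI exI[of _ "L + C"] allI) simp_all
qed

text \<open>The ramp has kinks only where its argument is 0 or 1, and these two level curves are
  null sets of the plane; elsewhere the chain rule applies at almost every time.\<close>

lemma lipD_ramp:
  fixes \<alpha> \<alpha>' :: "real \<Rightarrow> real"
  assumes L: "L-lipschitz_on UNIV \<alpha>" and b: "\<And>t. \<bar>\<alpha>' t\<bar> \<le> L" "b \<noteq> 0"
    and m[measurable]: "\<alpha>' \<in> borel_measurable borel"
    and d: "AE t in lborel. (\<alpha> has_real_derivative \<alpha>' t) (at t)"
  shows "lipD (\<lambda>z. ramp (\<alpha> (fst z) + b * snd z))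
     (\<lambda>z. \<alpha>' (fst z) * indicator {0<..<1} (\<alpha> (fst z) + b * snd z))
     (\<lambda>z. b * indicator {0<..<1} (\<alpha> (fst z) + b * snd z))"
proof -
  have L0: "L \<ge> 0" using lipschitz_on_nonneg[OF L] .
  define C where "C = L + \<bar>b\<bar> + 1"
  have cont: "continuous_on UNIV \<alpha>" by (rule lipschitz_on_continuous_on[OF L])
  have am[measurable]: "\<alpha> \<in> borel_measurable borel" using cont by (rule borel_measurable_continuous_onI)
  have fm[measurable]: "(fst :: real \<times> real \<Rightarrow> real) \<in> borel_measurable borel" "(snd :: real \<times> real \<Rightarrow> real) \<in> borel_measurable borel"
    by (intro borel_measurable_continuous_onI continuous_intros)+
  let ?r = "\<lambda>z :: real \<times> real. \<alpha> (fst z) + b * snd z"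
  have rm[measurable]: "?r \<in> borel_measurable borel" by measurable
  have "C-lipschitz_on UNIV (\<lambda>z. ramp (?r z))"
  proof (rule lipschitz_onI)
    fix z w :: "real \<times> real"
    have "dist (\<alpha> (fst z)) (\<alpha> (fst w)) \<le> L * dist (fst z) (fst w)" by (rule lipschitz_onD[OF L]) auto
    also have "\<dots> \<le> L * dist z w" using L0 by (intro mult_left_mono dist_fst_le)
    finally have 1: "\<bar>\<alpha> (fst z) - \<alpha> (fst w)\<bar> \<le> L * dist z w" by (simp add: dist_real_def)
    have 2: "\<bar>b * (snd z - snd w)\<bar> \<le> \<bar>b\<bar> * dist z w"
      unfolding abs_mult using dist_snd_le[of z w] by (intro mult_left_mono) (auto simp: dist_real_def)
    have "\<bar>ramp (?r z) - ramp (?r w)\<bar> \<le> \<bar>?r z - ?r w\<bar>" by (rule ramp_lipschitz)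
    also have "?r z - ?r w = (\<alpha> (fst z) - \<alpha> (fst w)) + b * (snd z - snd w)" by (simp add: algebra_simps)
    also have "\<bar>\<dots>\<bar> \<le> L * dist z w + \<bar>b\<bar> * dist z w" using 1 2 by linarith
    also have "\<dots> \<le> C * dist z w" by (simp add: C_def algebra_simps)
    finally show "dist (ramp (?r z)) (ramp (?r w)) \<le> C * dist z w" by (simp add: dist_real_def)
  qed (use L0 in \<open>simp add: C_def\<close>)
  moreover have "\<bar>ramp (?r z)\<bar> \<le> C" "\<bar>\<alpha>' (fst z) * indicator {0<..<1} (?r z)\<bar> \<le> C"
    "\<bar>b * indicator {0<..<1} (?r z)\<bar> \<le> C" for z
    using ramp_bounds(3)[of "?r z"] b(1)[of "fst z"] L0 by (auto simp: C_def indicator_def)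
  moreover have "AE z in lborel. ((\<lambda>s. ramp (?r (s, snd z))) has_real_derivative \<alpha>' (fst z) * indicator {0<..<1} (?r z)) (at (fst z))"
    using AE_lborel_fst[OF d] AE_level_set[OF cont b(2), of 0] AE_level_set[OF cont b(2), of 1]
  proof eventually_elim
    case (elim z)
    have "((\<lambda>s. \<alpha> s + b * snd z) has_real_derivative \<alpha>' (fst z)) (at (fst z))"
      using elim(1) by (auto intro!: derivative_eq_intros)
    from DERIV_chain2[OF ramp_has_derivative[OF elim(2,3)] this]
    show ?case by (simp add: mult.commute)
  qed
  moreover have "AE z in lborel. ((\<lambda>y. ramp (?r (fst z, y))) has_real_derivative b * indicator {0<..<1} (?r z)) (at (snd z))"
    using AE_level_set[OF cont b(2), of 0] AE_level_set[OF cont b(2), of 1]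
  proof eventually_elim
    case (elim z)
    have "((\<lambda>y. \<alpha> (fst z) + b * y) has_real_derivative b) (at (snd z))"
      by (auto intro!: derivative_eq_intros)
    from DERIV_chain2[OF ramp_has_derivative[OF elim(1,2)] this]
    show ?case by (simp add: mult.commute)
  qed
  moreover have "(\<lambda>z. \<alpha>' (fst z) * indicator {0<..<1} (?r z)) \<in> borel_measurable borel"
    "(\<lambda>z. b * indicator {0<..<1} (?r z)) \<in> borel_measurable borel"
    by measurable
  ultimately show ?thesis unfolding lipD_def
    by (intro conjI exI[of _ C] allI) simp_all
qed

lemma lipD_ramp_time:
  assumes "c \<noteq> 0"
  shows "lipD (\<lambda>z. ramp (c * fst z + d)) (\<lambda>z. c * indicator {0<..<1} (c * fst z + d)) (\<lambda>_. 0)"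
proof (rule lipD_time[where L="\<bar>c\<bar>" and C="\<bar>c\<bar> + 1"])
  show "\<bar>c\<bar>-lipschitz_on UNIV (\<lambda>t. ramp (c * t + d))"
  proof (rule lipschitz_onI)
    fix s t show "dist (ramp (c * s + d)) (ramp (c * t + d)) \<le> \<bar>c\<bar> * dist s t"
      using ramp_lipschitz[of "c * s + d" "c * t + d"]
      by (simp add: dist_real_def abs_mult[symmetric] algebra_simps)
  qed simp
  show "AE t in lborel. ((\<lambda>t. ramp (c * t + d)) has_real_derivative c * indicator {0<..<1} (c * t + d)) (at t)"
    using AE_lborel_singleton[of "- d / c"] AE_lborel_singleton[of "(1 - d) / c"]
  proof eventually_elim
    case (elim t)
    then have ne: "c * t + d \<noteq> 0" "c * t + d \<noteq> 1" using assms by (auto simp: field_simps)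
    have "((\<lambda>t. c * t + d) has_real_derivative c) (at t)" by (auto intro!: derivative_eq_intros)
    from DERIV_chain2[OF ramp_has_derivative[OF ne] this] show ?case by (simp add: mult.commute)
  qed
  show "\<bar>ramp (c * t + d)\<bar> \<le> \<bar>c\<bar> + 1" "\<bar>c * indicator {0<..<1} (c * t + d)\<bar> \<le> \<bar>c\<bar> + 1" for t
    using ramp_bounds(3)[of "c * t + d"] by (auto simp: indicator_def)
qed measurable

lemma eventually_ess_at_right_0:
  "eventually Q ess_at_right_0 \<longleftrightarrow> (\<exists>\<delta>>0. AE y in lborel. 0 < y \<and> y < \<delta> \<longrightarrow> Q y)"
proof
  assume "eventually Q ess_at_right_0"
  then obtain U V where U: "eventually U (at_right 0)" and V: "AE y in lebesgue. V y" and Q: "\<And>y. U y \<Longrightarrow> V y \<Longrightarrow> Q y"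
    unfolding ess_at_right_0_def eventually_inf by blast
  obtain \<delta> where \<delta>: "\<delta> > 0" "\<And>y. 0 < y \<Longrightarrow> y < \<delta> \<Longrightarrow> U y"
    using U by (auto simp: eventually_at_right_field)
  have "AE y in lborel. V y" using V by (simp only: AE_completion_iff)
  then have "AE y in lborel. 0 < y \<and> y < \<delta> \<longrightarrow> Q y" by eventually_elim (use \<delta> Q in blast)
  then show "\<exists>\<delta>>0. AE y in lborel. 0 < y \<and> y < \<delta> \<longrightarrow> Q y" using \<delta>(1) by blast
next
  assume "\<exists>\<delta>>0. AE y in lborel. 0 < y \<and> y < \<delta> \<longrightarrow> Q y"
  then obtain \<delta> where \<delta>: "\<delta> > 0" "AE y in lborel. 0 < y \<and> y < \<delta> \<longrightarrow> Q y" by blast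
  have "AE y in lebesgue. 0 < y \<and> y < \<delta> \<longrightarrow> Q y" using \<delta>(2) by (rule AE_completion)
  moreover have "eventually (\<lambda>y. 0 < y \<and> y < \<delta>) (at_right 0)"
    using \<delta>(1) by (auto simp: eventually_at_right_field)
  ultimately show "eventually Q ess_at_right_0"
    unfolding ess_at_right_0_def eventually_inf by blast
qed

text \<open>Means over \<open>(0, 1 / (n + 1))\<close> do not see null sets and are measurable in
  parameters. Traces are used in this form, both for the limit of cutoffs along a curve and to
  obtain measurable traces.\<close>

lemma ess_limit_average:
  fixes g :: "real \<Rightarrow> real"
  assumes [measurable]: "g \<in> borel_measurable borel" and g: "\<And>y. \<bar>g y\<bar> \<le> B"
    and lim: "(g \<longlongrightarrow> l) ess_at_right_0"
  shows "(\<lambda>n. real (Suc n) * (LINT y|lborel. indicator {0<..<1 / real (Suc n)} y * g y)) \<longlonglongrightarrow> l"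
proof (rule LIMSEQ_I)
  fix e :: real assume e: "e > 0"
  have "eventually (\<lambda>y. dist (g y) l < e / 2) ess_at_right_0" using tendstoD[OF lim, of "e / 2"] e by simp
  then obtain \<delta> where \<delta>: "\<delta> > 0" "AE y in lborel. 0 < y \<and> y < \<delta> \<longrightarrow> dist (g y) l < e / 2"
    unfolding eventually_ess_at_right_0 by blast
  obtain N where N: "1 / real (Suc N) < \<delta>" using reals_Archimedean[OF \<delta>(1)] by (auto simp: inverse_eq_divide)
  show "\<exists>no. \<forall>n\<ge>no. norm (real (Suc n) * (LINT y|lborel. indicator {0<..<1 / real (Suc n)} y * g y) - l) < e"
  proof (intro exI allI impI)
    fix n assume n: "n \<ge> N"
    define h where "h = 1 / real (Suc n)"
    have h: "h > 0" "h < \<delta>"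
    proof -
      have "h \<le> 1 / real (Suc N)" unfolding h_def using n by (intro divide_left_mono) auto
      then show "h < \<delta>" using N by simp
    qed (simp add: h_def)
    have ig: "integrable lborel (\<lambda>y. indicator {0<..<h} y * g y)"
    proof (rule integrable_lborel_bounded_support[where B=B and R=h])
      fix y show "\<bar>indicator {0<..<h} y * g y\<bar> \<le> B" using g[of y] by (auto simp: indicator_def)
    qed (use h in \<open>auto simp: indicator_def split: if_splits\<close>)
    have ic: "integrable lborel (\<lambda>y. c * indicator {0<..<h} y)" for c :: real
      using h by (intro integrable_mult_right integrable_real_indicator) auto
    have c: "(LINT y|lborel. c * indicator {0<..<h} y) = c * h" for c :: real using h by simp
    have "(LINT y|lborel. indicator {0<..<h} y * g y) - l * h
        = (LINT y|lborel. indicator {0<..<h} y * g y - l * indicator {0<..<h} y)"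
      by (simp only: Bochner_Integration.integral_diff[OF ig ic[of l]] c)
    also have "\<bar>\<dots>\<bar> \<le> (LINT y|lborel. e / 2 * indicator {0<..<h} y)"
    proof (rule order_trans[OF integral_abs_bound integral_mono_AE])
      show "integrable lborel (\<lambda>y. \<bar>indicator {0<..<h} y * g y - l * indicator {0<..<h} y\<bar>)"
        by (intro integrable_abs Bochner_Integration.integrable_diff ig ic)
      show "integrable lborel (\<lambda>y. e / 2 * indicator {0<..<h} y)" by (rule ic)
      show "AE y in lborel. \<bar>indicator {0<..<h} y * g y - l * indicator {0<..<h} y\<bar> \<le> e / 2 * indicator {0<..<h} y"
        using \<delta>(2) by eventually_elim (use h in \<open>auto simp: indicator_def dist_real_def\<close>)
    qed
    also have "\<dots> = e / 2 * h" by (rule c)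
    finally have "\<bar>(LINT y|lborel. indicator {0<..<h} y * g y) - l * h\<bar> \<le> e / 2 * h" .
    then have "\<bar>((LINT y|lborel. indicator {0<..<h} y * g y) - l * h) / h\<bar> \<le> e / 2"
      using h by (simp add: abs_divide divide_le_eq)
    moreover have "((LINT y|lborel. indicator {0<..<h} y * g y) - l * h) / h
        = real (Suc n) * (LINT y|lborel. indicator {0<..<h} y * g y) - l"
      using h by (simp add: diff_divide_distrib) (simp add: h_def field_simps)
    ultimately have "\<bar>real (Suc n) * (LINT y|lborel. indicator {0<..<h} y * g y) - l\<bar> \<le> e / 2" by simp
    then show "norm (real (Suc n) * (LINT y|lborel. indicator {0<..<1 / real (Suc n)} y * g y) - l) < e"
      using e unfolding h_def real_norm_def by linarith
  qed
qed

section \<open>Localising a balance law to one side of a Lipschitz curve\<close>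

section \<open>Balance laws on one side of a curve\<close>

text \<open>\<open>s\<close> is 1 for the trace from the right and -1 for the trace from the left.
  Measurability of the trace is included because traces are integrated along the curve.\<close>

definition has_trace :: "real \<Rightarrow> (real \<Rightarrow> real) \<Rightarrow> real \<Rightarrow> (real \<times> real \<Rightarrow> real) \<Rightarrow> (real \<Rightarrow> real) \<Rightarrow> bool" where
  "has_trace T x s a A \<longleftrightarrow> A \<in> borel_measurable borel \<and>
     (AE t in lborel. 0 < t \<and> t < T \<longrightarrow> ((\<lambda>y. a (t, x t + s * y)) \<longlongrightarrow> A t) ess_at_right_0)"

lemma measurable_slice:
  assumes "G \<in> borel_measurable (borel :: (real \<times> real) measure)" "f \<in> borel_measurable borel" "g \<in> borel_measurable borel"
  shows "(\<lambda>t. G (f t, g t)) \<in> borel_measurable (borel :: real measure)"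
proof -
  have "(\<lambda>t. (f t, g t)) \<in> borel \<rightarrow>\<^sub>M borel \<Otimes>\<^sub>M borel" using assms(2,3) by measurable
  then have "(\<lambda>t. (f t, g t)) \<in> borel \<rightarrow>\<^sub>M borel" by (simp add: borel_prod)
  then show ?thesis using assms(1) by (rule measurable_compose)
qed

text \<open>Slicing in time and substituting \<open>x t + s * y\<close> for the space variable turns
  the normalised layer of width \<open>1 / (n + 1)\<close> beside the curve into the means whose
  limit is the trace. The bound on \<open>G\<close> over its time support supplies the
  domination.\<close>

lemma strip_average:
  fixes G :: "real \<times> real \<Rightarrow> real" and x :: "real \<Rightarrow> real"
  assumes Gm[measurable]: "G \<in> borel_measurable borel" and G: "\<And>z. \<bar>G z\<bar> \<le> B" "\<And>z. G z \<noteq> 0 \<Longrightarrow> \<bar>fst z\<bar> \<le> \<tau>"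
    and x: "continuous_on UNIV x" and s: "s = 1 \<or> s = -1"
    and g[measurable]: "g \<in> borel_measurable borel"
    and tr: "AE t in lborel. ((\<lambda>y. G (t, x t + s * y)) \<longlongrightarrow> g t) ess_at_right_0"
  shows "(\<lambda>n. LINT z|lborel. real (Suc n) * indicator {0<..<1} (real (Suc n) * (s * (snd z - x (fst z)))) * G z)
     \<longlonglongrightarrow> (LINT t|lborel. g t)"
proof -
  have xm[measurable]: "x \<in> borel_measurable borel" using x by (rule borel_measurable_continuous_onI)
  have fm[measurable]: "(fst :: real \<times> real \<Rightarrow> real) \<in> borel_measurable borel" "(snd :: real \<times> real \<Rightarrow> real) \<in> borel_measurable borel"
    by (intro borel_measurable_continuous_onI continuous_intros)+
  define k where "k n z = real (Suc n) * indicator {0<..<1} (real (Suc n) * (s * (snd z - x (fst z)))) * G z" for n z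
  have km[measurable]: "k n \<in> borel_measurable borel" for n unfolding k_def by measurable
  have B0: "B \<ge> 0" using G(1)[of 0] by linarith
  \<comment> \<open>The curve is bounded over the time support, so each layer integrand has bounded
    support and is integrable.\<close>
  obtain X where X: "\<And>t. \<bar>t\<bar> \<le> \<tau> \<Longrightarrow> \<bar>x t\<bar> \<le> X"
  proof -
    have "compact (x ` {-\<tau>..\<tau>})" by (intro compact_continuous_image continuous_on_subset[OF x]) auto
    then obtain X where X: "\<forall>y\<in>x ` {-\<tau>..\<tau>}. norm y \<le> X" using compact_imp_bounded bounded_iff by blast
    have "\<bar>x t\<bar> \<le> X" if "\<bar>t\<bar> \<le> \<tau>" for t
    proof -
      have "t \<in> {-\<tau>..\<tau>}" using that by (simp add: abs_le_iff)
      then show ?thesis using X by simp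
    qed
    then show thesis by (rule that)
  qed
  have kint: "integrable lborel (k n)" for n
  proof (rule integrable_lborel_bounded_support[where B="real (Suc n) * B" and R="\<tau> + (X + 1)"])
    show "\<bar>k n z\<bar> \<le> real (Suc n) * B" for z
      using G(1)[of z] B0 by (auto simp: k_def abs_mult indicator_def intro!: mult_left_mono)
    show "norm z \<le> \<tau> + (X + 1)" if "k n z \<noteq> 0" for z
    proof (rule norm_le_of_strip_box)
      have ne: "G z \<noteq> 0" "real (Suc n) * (s * (snd z - x (fst z))) \<in> {0<..<1}"
        using that by (auto simp: k_def indicator_def split: if_splits)
      show 1: "\<bar>fst z\<bar> \<le> \<tau>" by (rule G(2)[OF ne(1)])
      have "0 < s * (snd z - x (fst z))" using ne(2) by (simp add: zero_less_mult_iff)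
      moreover have "s * (snd z - x (fst z)) \<le> real (Suc n) * (s * (snd z - x (fst z)))"
        using mult_right_mono[of 1 "real (Suc n)" "s * (snd z - x (fst z))"] calculation by simp
      ultimately have "\<bar>s * (snd z - x (fst z))\<bar> \<le> 1" using ne(2) by simp
      then have "\<bar>snd z - x (fst z)\<bar> \<le> 1" using s by auto
      then show "\<bar>snd z\<bar> \<le> X + 1" using X[OF 1] by linarith
    qed
  qed simp
  define A where "A n t = real (Suc n) * (LINT y|lborel. indicator {0<..<1 / real (Suc n)} y * G (t, x t + s * y))" for n t
  have slice: "(LINT y|lborel. k n (t, y)) = A n t" for n t
  proof -
    have "(LINT y|lborel. k n (t, y)) = \<bar>s\<bar> *\<^sub>R (LINT y|lborel. k n (t, x t + s * y))"
      using s by (intro lborel_integral_real_affine) auto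
    also have "\<dots> = (LINT y|lborel. real (Suc n) * (indicator {0<..<1 / real (Suc n)} y * G (t, x t + s * y)))"
    proof -
      have "k n (t, x t + s * y) = real (Suc n) * (indicator {0<..<1 / real (Suc n)} y * G (t, x t + s * y))" for y
      proof -
        have d: "s * (snd (t, x t + s * y) - x (fst (t, x t + s * y))) = y" using s by auto
        have "real (Suc n) * y \<in> {0<..<1} \<longleftrightarrow> y \<in> {0<..<1 / real (Suc n)}"
          by (simp add: zero_less_mult_iff pos_less_divide_eq mult.commute del: of_nat_Suc)
        then have "indicat_real {0<..<1} (real (Suc n) * y) = indicator {0<..<1 / real (Suc n)} y"
          by (simp only: indicator_def)
        then show ?thesis unfolding k_def d by (simp only: mult.assoc)
      qed
      then show ?thesis using s by auto
    qed
    also have "\<dots> = A n t" unfolding A_def by simp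
    finally show ?thesis .
  qed
  have eq: "(LINT z|lborel. k n z) = (LINT t|lborel. A n t)" for n
  proof -
    have i: "integrable (lborel \<Otimes>\<^sub>M lborel) (\<lambda>(t, y). k n (t, y))" using kint[of n] by (simp add: lborel_prod)
    have "(LINT z|lborel. k n z) = integral\<^sup>L (lborel \<Otimes>\<^sub>M lborel) (k n)" unfolding lborel_prod ..
    also have "\<dots> = (LINT t|lborel. LINT y|lborel. k n (t, y))"
      using lborel_pair.integral_fst'[of "k n"] i by simp
    finally show ?thesis unfolding slice .
  qed
  have Am: "A n \<in> borel_measurable borel" for n
  proof -
    have "(\<lambda>t. LINT y|lborel. k n (t, y)) \<in> borel_measurable lborel"
    proof (rule lborel.borel_measurable_lebesgue_integral)
      have "k n \<in> borel_measurable (lborel \<Otimes>\<^sub>M lborel)" unfolding lborel_prod using km by simp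
      then show "(\<lambda>(t, y). k n (t, y)) \<in> borel_measurable (lborel \<Otimes>\<^sub>M lborel)" by simp
    qed
    then show ?thesis unfolding slice by simp
  qed
  have sl: "(\<lambda>y. G (t, x t + s * y)) \<in> borel_measurable borel" for t
    by (rule measurable_slice[OF Gm]) measurable
  have Ab: "\<bar>A n t\<bar> \<le> B * indicator {-\<tau>..\<tau>} t" for n t
  proof (cases "\<bar>t\<bar> \<le> \<tau>")
    case True
    have ii: "integrable lborel (\<lambda>y. B * indicator {0<..<1 / real (Suc n)} y)"
      by (intro integrable_mult_right integrable_real_indicator) auto
    have i1: "integrable lborel (\<lambda>y. indicator {0<..<1 / real (Suc n)} y * G (t, x t + s * y))"
      by (rule Bochner_Integration.integrable_bound[OF ii])
         (use sl[of t] G(1) B0 in \<open>auto simp: indicator_def\<close>)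
    have "\<bar>LINT y|lborel. indicator {0<..<1 / real (Suc n)} y * G (t, x t + s * y)\<bar>
        \<le> (LINT y|lborel. B * indicator {0<..<1 / real (Suc n)} y)"
      by (rule order_trans[OF integral_abs_bound integral_mono]; (rule ii | rule integrable_abs[OF i1])?)
         (use G(1) B0 in \<open>auto simp: indicator_def\<close>)
    also have "\<dots> = B * (1 / real (Suc n))" by simp
    finally have "real (Suc n) * \<bar>LINT y|lborel. indicator {0<..<1 / real (Suc n)} y * G (t, x t + s * y)\<bar>
        \<le> real (Suc n) * (B * (1 / real (Suc n)))" by (intro mult_left_mono) auto
    then show ?thesis using True by (simp add: A_def abs_mult abs_le_iff indicator_def)
  next
    case False
    then have "G (t, y) = 0" for y using G(2)[of "(t, y)"] by auto
    then show ?thesis using B0 by (simp add: A_def)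
  qed
  have "(\<lambda>n. LINT t|lborel. A n t) \<longlonglongrightarrow> (LINT t|lborel. g t)"
  proof (rule integral_dominated_convergence[where w="\<lambda>t. B * indicator {-\<tau>..\<tau>} t"])
    show "integrable lborel (\<lambda>t. B * indicator {-\<tau>..\<tau>} t)"
      by (intro integrable_mult_right integrable_real_indicator) (auto simp: emeasure_lborel_Icc_eq)
    show "AE t in lborel. (\<lambda>n. A n t) \<longlonglongrightarrow> g t"
      using tr
    proof eventually_elim
      case (elim t)
      show ?case unfolding A_def by (rule ess_limit_average[OF sl G(1) elim])
    qed
  qed (use Am Ab in auto)
  then show ?thesis unfolding eq[symmetric] k_def .
qed

text \<open>Test with \<open>\<psi>\<close> times a ramp climbing from 0 to 1 in a layer of width
  \<open>1 / (n + 1)\<close> next to the curve. The time derivative of the ramp carries the factor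
  \<open>- v\<close>, so its two derivatives concentrate to the flux \<open>b - v * a\<close>
  relative to the moving curve. The ramp itself tends to the indicator of the open side, hence
  production sitting on the curve is left out.\<close>

theorem one_sided_balance:
  fixes a b \<psi> \<psi>t \<psi>x :: "real \<times> real \<Rightarrow> real" and x v :: "real \<Rightarrow> real"
  assumes bal: "balance T a b P N"
    and PN: "radon_on_strip T P" "radon_on_strip T N"
    and ab[measurable]: "a \<in> borel_measurable borel" "b \<in> borel_measurable borel"
    and abb: "\<And>z. \<bar>a z\<bar> \<le> A" "\<And>z. \<bar>b z\<bar> \<le> A"
    and x: "S-lipschitz_on UNIV x" and v[measurable]: "v \<in> borel_measurable borel" "\<And>t. \<bar>v t\<bar> \<le> S"
      "AE t in lborel. (x has_real_derivative v t) (at t)"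
    and s: "s = 1 \<or> s = -1"
    and tra: "has_trace T x s a ta" "has_trace T x s b tb"
    and \<psi>: "lip_test T \<psi> \<psi>t \<psi>x"
  shows "- (LINT z|lborel. indicator {0<..} (s * (snd z - x (fst z))) * (a z * \<psi>t z + b z * \<psi>x z))
      - s * (LINT t|lborel. \<psi> (t, x t) * (tb t - v t * ta t))
     = (LINT z|P. indicator {0<..} (s * (snd z - x (fst z))) * \<psi> z)
       - (LINT z|N. indicator {0<..} (s * (snd z - x (fst z))) * \<psi> z)"
proof -
  have xc: "continuous_on UNIV x" by (rule lipschitz_on_continuous_on[OF x])
  have xm[measurable]: "x \<in> borel_measurable borel" using xc by (rule borel_measurable_continuous_onI)
  have fm[measurable]: "(fst :: real \<times> real \<Rightarrow> real) \<in> borel_measurable borel" "(snd :: real \<times> real \<Rightarrow> real) \<in> borel_measurable borel"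
    by (intro borel_measurable_continuous_onI continuous_intros)+
  have [measurable]: "ta \<in> borel_measurable borel" "tb \<in> borel_measurable borel"
    using tra by (auto simp: has_trace_def)
  have [measurable]: "\<psi>t \<in> borel_measurable borel" "\<psi>x \<in> borel_measurable borel"
    using \<psi> unfolding lip_test_def lipD_def by blast+
  obtain B where lip: "B-lipschitz_on UNIV \<psi>" and B: "\<And>z. \<bar>\<psi> z\<bar> \<le> B" "\<And>z. \<bar>\<psi>t z\<bar> \<le> B" "\<And>z. \<bar>\<psi>x z\<bar> \<le> B"
    using \<psi> unfolding lip_test_def lipD_def by blast
  obtain \<delta> r where \<delta>: "\<delta> > 0" and supp: "\<And>z. \<psi> z \<noteq> 0 \<or> \<psi>t z \<noteq> 0 \<or> \<psi>x z \<noteq> 0 \<Longrightarrow> \<delta> \<le> fst z \<and> fst z \<le> T - \<delta> \<and> \<bar>snd z\<bar> \<le> r"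
    using \<psi> unfolding lip_test_def by blast
  have nsupp: "norm z \<le> \<bar>T\<bar> + \<bar>r\<bar>" if "\<psi> z \<noteq> 0 \<or> \<psi>t z \<noteq> 0 \<or> \<psi>x z \<noteq> 0" for z
    using supp[OF that] \<delta> by (intro norm_le_of_strip_box) auto
  have \<psi>c: "continuous_on UNIV \<psi>" by (rule lipschitz_on_continuous_on[OF lip])
  have \<psi>m[measurable]: "\<psi> \<in> borel_measurable borel" using \<psi>c by (rule borel_measurable_continuous_onI)
  have A0: "A \<ge> 0" "B \<ge> 0" "S \<ge> 0" using abb(1)[of 0] B(1)[of 0] lipschitz_on_nonneg[OF x] by linarith+
  let ?d = "\<lambda>z. s * (snd z - x (fst z))"
  define m where "m n = real (Suc n)" for n
  have m0: "m n > 0" for n by (simp add: m_def)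
  have dm[measurable]: "?d \<in> borel_measurable borel" by measurable
  define \<kappa> where "\<kappa> n z = ramp (m n * ?d z)" for n z
  define I where "I n z = indicat_real {0<..<1} (m n * ?d z)" for n and z :: "real \<times> real"
  have [measurable]: "\<kappa> n \<in> borel_measurable borel" "I n \<in> borel_measurable borel" for n
    unfolding \<kappa>_def I_def by measurable
  have lipD\<kappa>: "lipD (\<kappa> n) (\<lambda>z. - (m n * s * v (fst z)) * I n z) (\<lambda>z. (m n * s) * I n z)" for n
  proof -
    have e: "m n * ?d z = - (m n * s * x (fst z)) + (m n * s) * snd z" for z by (simp add: algebra_simps)
    show ?thesis unfolding \<kappa>_def I_def e
    proof (rule lipD_ramp[where \<alpha>="\<lambda>t. - (m n * s * x t)" and \<alpha>'="\<lambda>t. - (m n * s * v t)" and L="m n * S"])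
      show "(m n * S)-lipschitz_on UNIV (\<lambda>t. - (m n * s * x t))"
      proof (rule lipschitz_onI)
        fix t u
        have "dist (x t) (x u) \<le> S * dist t u" by (rule lipschitz_onD[OF x]) auto
        then have "m n * \<bar>x t - x u\<bar> \<le> m n * (S * dist t u)" using m0[of n] by (intro mult_left_mono) (auto simp: dist_real_def)
        moreover have "dist (- (m n * s * x t)) (- (m n * s * x u)) = m n * \<bar>x t - x u\<bar>"
        proof -
          have "- (m n * s * x t) - - (m n * s * x u) = - (m n * s) * (x t - x u)" by (simp add: algebra_simps)
          then show ?thesis using s m0[of n] by (auto simp: dist_real_def abs_mult)
        qed
        ultimately show "dist (- (m n * s * x t)) (- (m n * s * x u)) \<le> m n * S * dist t u" by simp
      qed (use m0[of n] A0 in simp)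
      show "\<bar>- (m n * s * v t)\<bar> \<le> m n * S" for t
        using s v(2)[of t] m0[of n] by (auto simp: abs_mult)
      show "m n * s \<noteq> 0" using s m0[of n] by auto
      show "AE t in lborel. ((\<lambda>t. - (m n * s * x t)) has_real_derivative - (m n * s * v t)) (at t)"
        using v(3) by eventually_elim (auto intro!: derivative_eq_intros)
    qed measurable
  qed
  note test = lip_test_mult[OF \<psi> lipD\<kappa>]
  have \<kappa>b: "0 \<le> \<kappa> n z" "\<kappa> n z \<le> 1" "\<bar>\<kappa> n z\<bar> \<le> 1" for n z using ramp_bounds by (simp_all add: \<kappa>_def)
  have Ib: "0 \<le> I n z" "I n z \<le> 1" for n z by (simp_all add: I_def indicator_def)
  define F where "F z = a z * \<psi>t z + b z * \<psi>x z" for z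
  \<comment> \<open>Collects the terms in which the ramp is differentiated; \<open>F\<close>
    collects those in which \<open>\<psi>\<close> is.\<close>
  define G where "G z = \<psi> z * (s * (b z - v (fst z) * a z))" for z
  have [measurable]: "F \<in> borel_measurable borel" "G \<in> borel_measurable borel" unfolding F_def G_def by measurable
  have Fb: "\<bar>F z\<bar> \<le> 2 * A * B" for z
  proof -
    have "\<bar>a z * \<psi>t z\<bar> \<le> A * B" "\<bar>b z * \<psi>x z\<bar> \<le> A * B"
      unfolding abs_mult using abb[of z] B[of z] A0 by (intro mult_mono; simp)+
    then show ?thesis unfolding F_def by linarith
  qed
  have Gb: "\<bar>G z\<bar> \<le> B * (A + S * A)" for z
  proof -
    have "\<bar>v (fst z) * a z\<bar> \<le> S * A" unfolding abs_mult using abb[of z] v(2)[of "fst z"] A0 by (intro mult_mono) auto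
    then have "\<bar>b z - v (fst z) * a z\<bar> \<le> A + S * A" using abb(2)[of z] by linarith
    then have "\<bar>s * (b z - v (fst z) * a z)\<bar> \<le> A + S * A" using s by (elim disjE) simp_all
    then show ?thesis unfolding G_def abs_mult[of "\<psi> z"] using B(1)[of z] A0 by (intro mult_mono) auto
  qed
  have Fs: "norm z \<le> \<bar>T\<bar> + \<bar>r\<bar>" if "F z \<noteq> 0" for z
    by (rule nsupp) (use that in \<open>auto simp: F_def\<close>)
  have iF: "integrable lborel F"
    by (rule integrable_lborel_bounded_support[OF _ Fb Fs]) measurable
  have iG: "integrable lborel G"
    by (rule integrable_lborel_bounded_support[OF _ Gb, where R="\<bar>T\<bar> + \<bar>r\<bar>"]) (use nsupp in \<open>auto simp: G_def\<close>)
  have iF\<kappa>: "integrable lborel (\<lambda>z. \<kappa> n z * F z)" for n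
  proof (rule Bochner_Integration.integrable_bound[OF iF])
    show "AE z in lborel. norm (\<kappa> n z * F z) \<le> norm (F z)"
      using \<kappa>b(3)[of n] by (intro AE_I2) (simp add: abs_mult mult_left_le_one_le)
  qed measurable
  have iGI: "integrable lborel (\<lambda>z. m n * I n z * G z)" for n
  proof -
    have "integrable lborel (\<lambda>z. I n z * G z)"
    proof (rule Bochner_Integration.integrable_bound[OF iG])
      show "AE z in lborel. norm (I n z * G z) \<le> norm (G z)"
        using Ib[of n] by (intro AE_I2) (simp add: abs_mult mult_left_le_one_le)
    qed measurable
    then have "integrable lborel (\<lambda>z. m n * (I n z * G z))" by (rule integrable_mult_right)
    then show ?thesis by (simp add: mult.assoc)
  qed
  have id: "- (LINT z|lborel. \<kappa> n z * F z) - (LINT z|lborel. m n * I n z * G z)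
      = (LINT z|P. \<kappa> n z * \<psi> z) - (LINT z|N. \<kappa> n z * \<psi> z)" for n
  proof -
    have "(LINT z|lborel. a z * (\<psi>t z * \<kappa> n z + - (m n * s * v (fst z)) * I n z * \<psi> z) + b z * (\<psi>x z * \<kappa> n z + m n * s * I n z * \<psi> z))
        = (LINT z|lborel. \<kappa> n z * F z + m n * I n z * G z)"
      by (intro Bochner_Integration.integral_cong refl) (simp add: F_def G_def algebra_simps)
    also have "\<dots> = (LINT z|lborel. \<kappa> n z * F z) + (LINT z|lborel. m n * I n z * G z)"
      by (rule Bochner_Integration.integral_add[OF iF\<kappa> iGI])
    finally show ?thesis
      using bal[unfolded balance_def, rule_format, OF test[of n]] by (simp add: mult.commute)
  qed
  have \<kappa>lim: "(\<lambda>n. \<kappa> n z) \<longlonglongrightarrow> indicator {0<..} (?d z)" for z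
  proof (cases "?d z > 0")
    case True
    obtain n0 where n0: "1 / ?d z < real n0" using reals_Archimedean2 by blast
    have "\<forall>\<^sub>F n in sequentially. \<kappa> n z = 1"
      unfolding eventually_sequentially
    proof (intro exI allI impI)
      fix n assume "n \<ge> n0"
      then have "1 / ?d z < m n" using n0 by (simp add: m_def)
      then have "1 \<le> m n * ?d z" using True by (simp add: divide_less_eq)
      then show "\<kappa> n z = 1" unfolding \<kappa>_def by (rule ramp_simps)
    qed
    then show ?thesis using True by (simp add: tendsto_eventually)
  next
    case False
    then have "m n * ?d z \<le> 0" for n using m0[of n] by (simp add: mult_nonneg_nonpos)
    then have "\<kappa> n z = 0" for n unfolding \<kappa>_def by (rule ramp_simps)
    then show ?thesis using False by simp
  qed
  have lim1: "(\<lambda>n. LINT z|lborel. \<kappa> n z * F z) \<longlonglongrightarrow> (LINT z|lborel. indicator {0<..} (?d z) * F z)"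
  proof (rule integral_dominated_convergence[where w="\<lambda>z. \<bar>F z\<bar>"])
    show "AE z in lborel. (\<lambda>n. \<kappa> n z * F z) \<longlonglongrightarrow> indicator {0<..} (?d z) * F z"
      by (intro AE_I2 tendsto_mult \<kappa>lim tendsto_const)
    show "AE z in lborel. norm (\<kappa> n z * F z) \<le> \<bar>F z\<bar>" for n
      using \<kappa>b(3)[of n] by (intro AE_I2) (simp add: abs_mult mult_left_le_one_le)
  qed (use iF in \<open>simp_all, measurable\<close>)
  have limM: "(\<lambda>n. LINT z|M. \<kappa> n z * \<psi> z) \<longlonglongrightarrow> (LINT z|M. indicator {0<..} (?d z) * \<psi> z)" if M: "radon_on_strip T M" for M
  proof (rule integral_dominated_convergence[where w="\<lambda>z. \<bar>\<psi> z\<bar>"])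
    have sM: "sets M = sets borel" using M by (simp add: radon_on_strip_def)
    have "(\<lambda>z. indicator {0<..} (?d z) * \<psi> z) \<in> borel_measurable borel" by measurable
    then show "(\<lambda>z. indicator {0<..} (?d z) * \<psi> z) \<in> borel_measurable M"
      using measurable_cong_sets[OF sM refl] by blast
    have "(\<lambda>z. \<kappa> n z * \<psi> z) \<in> borel_measurable borel" for n by measurable
    then show "(\<lambda>z. \<kappa> n z * \<psi> z) \<in> borel_measurable M" for n
      using measurable_cong_sets[OF sM refl] by blast
    have "integrable M \<psi>"
      by (rule integrable_radon_bounded_support[OF M _ B(1), where R="\<bar>T\<bar> + \<bar>r\<bar>"]) (use nsupp in auto)
    then show "integrable M (\<lambda>z. \<bar>\<psi> z\<bar>)" by simp
    show "AE z in M. (\<lambda>n. \<kappa> n z * \<psi> z) \<longlonglongrightarrow> indicator {0<..} (?d z) * \<psi> z"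
      by (intro AE_I2 tendsto_mult \<kappa>lim tendsto_const)
    show "AE z in M. norm (\<kappa> n z * \<psi> z) \<le> \<bar>\<psi> z\<bar>" for n
      using \<kappa>b(3)[of n] by (intro AE_I2) (simp add: abs_mult mult_left_le_one_le)
  qed
  define g where "g t = \<psi> (t, x t) * (s * (tb t - v t * ta t))" for t
  have \<psi>x: "(\<lambda>t. \<psi> (t, x t)) \<in> borel_measurable borel" by (rule measurable_slice[OF \<psi>m]) measurable
  have gm: "g \<in> borel_measurable borel" unfolding g_def using \<psi>x by measurable
  have lim2: "(\<lambda>n. LINT z|lborel. m n * I n z * G z) \<longlonglongrightarrow> (LINT t|lborel. g t)"
    unfolding m_def I_def
  proof (rule strip_average[where B="B * (A + S * A)" and \<tau>="\<bar>T\<bar>"])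
    show "\<bar>fst z\<bar> \<le> \<bar>T\<bar>" if "G z \<noteq> 0" for z
      using supp[of z] that \<delta> by (auto simp: G_def)
    have tr: "AE t in lborel. 0 < t \<and> t < T \<longrightarrow> ((\<lambda>y. a (t, x t + s * y)) \<longlongrightarrow> ta t) ess_at_right_0"
      "AE t in lborel. 0 < t \<and> t < T \<longrightarrow> ((\<lambda>y. b (t, x t + s * y)) \<longlongrightarrow> tb t) ess_at_right_0"
      using tra unfolding has_trace_def by blast+
    show "AE t in lborel. ((\<lambda>y. G (t, x t + s * y)) \<longlongrightarrow> g t) ess_at_right_0"
      using tr
    proof eventually_elim
      case (elim t)
      show ?case
      proof (cases "0 < t \<and> t < T")
        case True
        have "isCont (\<lambda>y. \<psi> (t, x t + s * y)) 0"
          by (rule continuous_on_interior[of UNIV]) (auto intro!: continuous_intros continuous_on_compose2[OF \<psi>c])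
        then have "((\<lambda>y. \<psi> (t, x t + s * y)) \<longlongrightarrow> \<psi> (t, x t)) (at 0)" by (simp add: isCont_def)
        then have "((\<lambda>y. \<psi> (t, x t + s * y)) \<longlongrightarrow> \<psi> (t, x t)) (at_right 0)"
          by (rule filterlim_mono) (simp_all add: at_le)
        then have "((\<lambda>y. \<psi> (t, x t + s * y)) \<longlongrightarrow> \<psi> (t, x t)) ess_at_right_0"
          by (rule filterlim_mono) (simp_all add: ess_at_right_0_def)
        then show ?thesis unfolding G_def g_def fst_conv
          using elim True by (intro tendsto_intros) auto
      next
        case False
        have "\<psi> (t, y) = 0" for y
        proof (rule ccontr)
          assume "\<psi> (t, y) \<noteq> 0"
          then have "\<delta> \<le> t \<and> t \<le> T - \<delta>" using supp[of "(t, y)"] by simp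
          then show False using False \<delta> by linarith
        qed
        then show ?thesis by (simp add: G_def g_def)
      qed
    qed
  qed (use Gb xc s gm in auto)
  have "(\<lambda>n. - (LINT z|lborel. \<kappa> n z * F z) - (LINT z|lborel. m n * I n z * G z))
      \<longlonglongrightarrow> - (LINT z|lborel. indicator {0<..} (?d z) * F z) - (LINT t|lborel. g t)"
    by (intro tendsto_intros lim1 lim2)
  moreover have "(\<lambda>n. (LINT z|P. \<kappa> n z * \<psi> z) - (LINT z|N. \<kappa> n z * \<psi> z))
     \<longlonglongrightarrow> (LINT z|P. indicator {0<..} (?d z) * \<psi> z) - (LINT z|N. indicator {0<..} (?d z) * \<psi> z)"
    by (intro tendsto_intros limM PN)
  ultimately have "- (LINT z|lborel. indicator {0<..} (?d z) * F z) - (LINT t|lborel. g t)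
     = (LINT z|P. indicator {0<..} (?d z) * \<psi> z) - (LINT z|N. indicator {0<..} (?d z) * \<psi> z)"
    unfolding id by (rule LIMSEQ_unique)
  moreover have "(LINT t|lborel. g t) = s * (LINT t|lborel. \<psi> (t, x t) * (tb t - v t * ta t))"
    unfolding g_def by (simp add: mult.left_commute)
  ultimately show ?thesis by (simp add: F_def)
qed

section \<open>Mass of the production measure on a curve\<close>

section \<open>Production on a curve\<close>

locale lipschitz_curve =
  fixes S :: real and x v :: "real \<Rightarrow> real"
  assumes lip: "S-lipschitz_on UNIV x"
    and v_measurable[measurable]: "v \<in> borel_measurable borel"
    and v_bound: "\<And>t. \<bar>v t\<bar> \<le> S"
    and v_deriv: "AE t in lborel. (x has_real_derivative v t) (at t)"
begin

lemma x_continuous: "continuous_on UNIV x"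
  by (rule lipschitz_on_continuous_on[OF lip])

lemma x_measurable[measurable]: "x \<in> borel_measurable borel"
  using x_continuous by (rule borel_measurable_continuous_onI)

lemma S_nonneg: "0 \<le> S"
  using lipschitz_on_nonneg[OF lip] .

lemma offset_measurable[measurable]: "(\<lambda>z. snd z - x (fst z)) \<in> borel_measurable borel"
proof -
  have [measurable]: "(fst :: real \<times> real \<Rightarrow> real) \<in> borel_measurable borel" "(snd :: real \<times> real \<Rightarrow> real) \<in> borel_measurable borel"
    by (intro borel_measurable_continuous_onI continuous_intros)+
  show ?thesis by measurable
qed

lemma AE_offset: "AE z in lborel. snd z - x (fst z) \<noteq> 0"
proof -
  have "AE z in lborel. - x (fst z) + 1 * snd z \<noteq> 0"
    by (rule AE_level_set) (intro continuous_intros x_continuous, simp)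
  then show ?thesis by simp
qed

end

locale traced_balance = lipschitz_curve +
  fixes T A :: real and a b :: "real \<times> real \<Rightarrow> real" and P N :: "(real \<times> real) measure"
    and ap am bp bm :: "real \<Rightarrow> real"
  assumes bal: "balance T a b P N"
    and PN: "radon_on_strip T P" "radon_on_strip T N"
    and ab_measurable[measurable]: "a \<in> borel_measurable borel" "b \<in> borel_measurable borel"
    and ab_bound: "\<And>z. \<bar>a z\<bar> \<le> A" "\<And>z. \<bar>b z\<bar> \<le> A"
    and traces: "has_trace T x 1 a ap" "has_trace T x (-1) a am" "has_trace T x 1 b bp" "has_trace T x (-1) b bm"
    and trace_bound: "\<And>t. \<bar>ap t\<bar> \<le> A" "\<And>t. \<bar>am t\<bar> \<le> A" "\<And>t. \<bar>bp t\<bar> \<le> A" "\<And>t. \<bar>bm t\<bar> \<le> A"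
begin

text \<open>The Rankine-Hugoniot defect of the curve. By \<open>path_balance\<close> it is the
  density in time of the production carried by the curve.\<close>

definition jump :: "real \<Rightarrow> real" where
  "jump t = (bp t - v t * ap t) - (bm t - v t * am t)"

lemma trace_measurable[measurable]:
  "ap \<in> borel_measurable borel" "am \<in> borel_measurable borel" "bp \<in> borel_measurable borel" "bm \<in> borel_measurable borel"
  using traces by (auto simp: has_trace_def)

lemma jump_measurable[measurable]: "jump \<in> borel_measurable borel"
  unfolding jump_def by measurable

lemma side_bound:
  "\<bar>bp t - v t * ap t\<bar> \<le> A + S * A" "\<bar>bm t - v t * am t\<bar> \<le> A + S * A"
proof -
  have "A \<ge> 0" using ab_bound(1)[of 0] by linarith
  then have "\<bar>v t * ap t\<bar> \<le> S * A" "\<bar>v t * am t\<bar> \<le> S * A"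
    unfolding abs_mult using v_bound[of t] trace_bound(1,2)[of t] S_nonneg by (intro mult_mono; simp)+
  then show "\<bar>bp t - v t * ap t\<bar> \<le> A + S * A" "\<bar>bm t - v t * am t\<bar> \<le> A + S * A"
    using trace_bound(3,4)[of t] by linarith+
qed

lemma jump_bound: "\<bar>jump t\<bar> \<le> 2 * (A + S * A)"
proof -
  have "\<bar>jump t\<bar> \<le> (A + S * A) + (A + S * A)"
    unfolding jump_def by (rule order_trans[OF abs_triangle_ineq4 add_mono[OF side_bound]])
  then show ?thesis by (simp only: mult_2)
qed

lemma test_data:
  assumes "lip_test T \<psi> \<psi>t \<psi>x"
  obtains B R where "continuous_on UNIV \<psi>" "\<And>z. \<bar>\<psi> z\<bar> \<le> B" "0 \<le> B" "\<And>z. \<psi> z \<noteq> 0 \<Longrightarrow> 0 < fst z \<and> fst z < T \<and> norm z \<le> R"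
    "\<psi>t \<in> borel_measurable borel" "\<psi>x \<in> borel_measurable borel"
    "\<And>z. \<bar>\<psi>t z\<bar> \<le> B" "\<And>z. \<bar>\<psi>x z\<bar> \<le> B" "\<And>z. \<psi>t z \<noteq> 0 \<or> \<psi>x z \<noteq> 0 \<Longrightarrow> norm z \<le> R"
    "\<And>t. \<psi> (t, x t) \<noteq> 0 \<Longrightarrow> norm t \<le> R"
proof -
  obtain B where B: "B-lipschitz_on UNIV \<psi>" "\<And>z. \<bar>\<psi> z\<bar> \<le> B" "\<And>z. \<bar>\<psi>t z\<bar> \<le> B" "\<And>z. \<bar>\<psi>x z\<bar> \<le> B"
    using assms unfolding lip_test_def lipD_def by blast
  obtain \<delta> r where \<delta>: "\<delta> > 0" and supp: "\<And>z. \<psi> z \<noteq> 0 \<or> \<psi>t z \<noteq> 0 \<or> \<psi>x z \<noteq> 0 \<Longrightarrow> \<delta> \<le> fst z \<and> fst z \<le> T - \<delta> \<and> \<bar>snd z\<bar> \<le> r"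
    using assms unfolding lip_test_def by blast
  have n: "norm z \<le> \<bar>T\<bar> + \<bar>r\<bar>" if "\<psi> z \<noteq> 0 \<or> \<psi>t z \<noteq> 0 \<or> \<psi>x z \<noteq> 0" for z
    using supp[OF that] \<delta> by (intro norm_le_of_strip_box) auto
  show thesis
  proof (rule that)
    show "continuous_on UNIV \<psi>" by (rule lipschitz_on_continuous_on[OF B(1)])
    show "0 \<le> B" using B(2)[of 0] by linarith
    show "0 < fst z \<and> fst z < T \<and> norm z \<le> \<bar>T\<bar> + \<bar>r\<bar>" if "\<psi> z \<noteq> 0" for z
      using supp[of z] n[of z] that \<delta> by simp
    show "norm z \<le> \<bar>T\<bar> + \<bar>r\<bar>" if "\<psi>t z \<noteq> 0 \<or> \<psi>x z \<noteq> 0" for z using n[of z] that by blast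
    show "norm t \<le> \<bar>T\<bar> + \<bar>r\<bar>" if "\<psi> (t, x t) \<noteq> 0" for t
      using n[of "(t, x t)"] that abs_fst_snd_le_norm(1)[of "(t, x t)"] by simp
    show "\<psi>t \<in> borel_measurable borel" "\<psi>x \<in> borel_measurable borel"
      using assms unfolding lip_test_def lipD_def by blast+
  qed (rule B)+
qed

lemma integrable_on_path:
  assumes "lip_test T \<psi> \<psi>t \<psi>x" and [measurable]: "g \<in> borel_measurable borel" and g: "\<And>t. \<bar>g t\<bar> \<le> C"
  shows "integrable lborel (\<lambda>t. \<psi> (t, x t) * g t)"
proof -
  obtain B R where B: "continuous_on UNIV \<psi>" "\<And>z. \<bar>\<psi> z\<bar> \<le> B" "0 \<le> B" "\<And>t. \<psi> (t, x t) \<noteq> 0 \<Longrightarrow> norm t \<le> R"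
    using test_data[OF assms(1)] by metis
  have [measurable]: "\<psi> \<in> borel_measurable borel" using B(1) by (rule borel_measurable_continuous_onI)
  have [measurable]: "(\<lambda>t. \<psi> (t, x t)) \<in> borel_measurable borel" by (rule measurable_slice) measurable
  show ?thesis
  proof (rule integrable_lborel_bounded_support[where B="B * C" and R=R])
    show "\<bar>\<psi> (t, x t) * g t\<bar> \<le> B * C" for t
      unfolding abs_mult using B(2)[of "(t, x t)"] g[of t] B(3) by (intro mult_mono) simp_all
    show "norm t \<le> R" if "\<psi> (t, x t) * g t \<noteq> 0" for t using B(4)[of t] that by auto
  qed measurable
qed

text \<open>Subtract the two one-sided balances from the full one. The area integrals cancel because
  the curve is a Lebesgue null set, whereas \<open>P\<close> and \<open>N\<close> may charge
  it.\<close>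

lemma path_balance:
  assumes \<psi>: "lip_test T \<psi> \<psi>t \<psi>x"
  shows "(LINT t|lborel. \<psi> (t, x t) * jump t)
    = (LINT z|P. indicator {0} (snd z - x (fst z)) * \<psi> z) - (LINT z|N. indicator {0} (snd z - x (fst z)) * \<psi> z)"
proof -
  obtain B R where B: "continuous_on UNIV \<psi>" "\<And>z. \<bar>\<psi> z\<bar> \<le> B" "0 \<le> B" "\<And>z. \<psi> z \<noteq> 0 \<Longrightarrow> 0 < fst z \<and> fst z < T \<and> norm z \<le> R"
    and [measurable]: "\<psi>t \<in> borel_measurable borel" "\<psi>x \<in> borel_measurable borel"
    and Bd: "\<And>z. \<bar>\<psi>t z\<bar> \<le> B" "\<And>z. \<bar>\<psi>x z\<bar> \<le> B" "\<And>z. \<psi>t z \<noteq> 0 \<or> \<psi>x z \<noteq> 0 \<Longrightarrow> norm z \<le> R"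
    by (rule test_data[OF \<psi>]) blast
  have [measurable]: "\<psi> \<in> borel_measurable borel" using B(1) by (rule borel_measurable_continuous_onI)
  let ?d = "\<lambda>z. snd z - x (fst z)"
  define F where "F z = a z * \<psi>t z + b z * \<psi>x z" for z
  have [measurable]: "F \<in> borel_measurable borel" unfolding F_def by measurable
  have A0: "A \<ge> 0" using ab_bound(1)[of 0] by linarith
  have Fb: "\<bar>F z\<bar> \<le> 2 * A * B" for z
  proof -
    have "\<bar>a z * \<psi>t z\<bar> \<le> A * B" "\<bar>b z * \<psi>x z\<bar> \<le> A * B"
      unfolding abs_mult using ab_bound(1)[of z] ab_bound(2)[of z] Bd(1,2)[of z] A0 by (intro mult_mono; simp)+
    then show ?thesis unfolding F_def by linarith
  qed
  have Fs: "norm z \<le> R" if "F z \<noteq> 0" for z by (rule Bd(3)) (use that in \<open>auto simp: F_def\<close>)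
  have iF: "integrable lborel (\<lambda>z. indicator E (f z) * F z)" if "f \<in> borel_measurable borel" "E \<in> sets borel" for E and f :: "real \<times> real \<Rightarrow> real"
  proof (rule integrable_lborel_bounded_support[where B="2 * A * B" and R=R])
    show "\<bar>indicator E (f z) * F z\<bar> \<le> 2 * A * B" for z using Fb[of z] A0 B(3) by (auto simp: indicator_def)
    show "norm z \<le> R" if "indicator E (f z) * F z \<noteq> 0" for z using Fs[of z] that by auto
  qed (use that in measurable)
  have iM: "integrable M (\<lambda>z. indicator E (f z) * \<psi> z)"
    if "radon_on_strip T M" "f \<in> borel_measurable borel" "E \<in> sets borel" for E M and f :: "real \<times> real \<Rightarrow> real"
  proof (rule integrable_radon_bounded_support[OF that(1), where B=B and R=R])
    show "\<bar>indicator E (f z) * \<psi> z\<bar> \<le> B" for z using B(2)[of z] B(3) by (auto simp: indicator_def)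
    show "norm z \<le> R" if "indicator E (f z) * \<psi> z \<noteq> 0" for z using B(4)[of z] that by auto
  qed (use that in measurable)
  have ms[measurable]: "(\<lambda>z. c * ?d z) \<in> borel_measurable borel" for c by measurable
  have splitF: "(LINT z|lborel. F z) = (LINT z|lborel. indicator {0<..} (1 * ?d z) * F z) + (LINT z|lborel. indicator {0<..} (-1 * ?d z) * F z)"
  proof -
    have "(LINT z|lborel. F z) = (LINT z|lborel. indicator {0<..} (1 * ?d z) * F z + indicator {0<..} (-1 * ?d z) * F z)"
    proof (rule integral_cong_AE)
      show "AE z in lborel. F z = indicator {0<..} (1 * ?d z) * F z + indicator {0<..} (-1 * ?d z) * F z"
        using AE_offset by eventually_elim (auto simp: indicator_def)
    qed measurable
    also have "\<dots> = (LINT z|lborel. indicator {0<..} (1 * ?d z) * F z) + (LINT z|lborel. indicator {0<..} (-1 * ?d z) * F z)"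
      by (rule Bochner_Integration.integral_add) (intro iF ms; simp)+
    finally show ?thesis .
  qed
  have splitM: "(LINT z|M. \<psi> z) = (LINT z|M. indicator {0<..} (1 * ?d z) * \<psi> z) + (LINT z|M. indicator {0<..} (-1 * ?d z) * \<psi> z)
      + (LINT z|M. indicator {0} (?d z) * \<psi> z)" if M: "radon_on_strip T M" for M
  proof -
    have "(LINT z|M. \<psi> z) = (LINT z|M. (indicator {0<..} (1 * ?d z) * \<psi> z + indicator {0<..} (-1 * ?d z) * \<psi> z) + indicator {0} (?d z) * \<psi> z)"
      by (intro Bochner_Integration.integral_cong refl) (auto simp: indicator_def)
    also have "\<dots> = (LINT z|M. indicator {0<..} (1 * ?d z) * \<psi> z + indicator {0<..} (-1 * ?d z) * \<psi> z) + (LINT z|M. indicator {0} (?d z) * \<psi> z)"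
      by (rule Bochner_Integration.integral_add) (intro Bochner_Integration.integrable_add iM M ms offset_measurable; simp)+
    also have "(LINT z|M. indicator {0<..} (1 * ?d z) * \<psi> z + indicator {0<..} (-1 * ?d z) * \<psi> z)
      = (LINT z|M. indicator {0<..} (1 * ?d z) * \<psi> z) + (LINT z|M. indicator {0<..} (-1 * ?d z) * \<psi> z)"
      by (rule Bochner_Integration.integral_add) (intro iM M ms; simp)+
    finally show ?thesis .
  qed
  have r: "- (LINT z|lborel. indicator {0<..} (1 * ?d z) * F z) - 1 * (LINT t|lborel. \<psi> (t, x t) * (bp t - v t * ap t))
     = (LINT z|P. indicator {0<..} (1 * ?d z) * \<psi> z) - (LINT z|N. indicator {0<..} (1 * ?d z) * \<psi> z)"
    unfolding F_def
    by (rule one_sided_balance[OF bal PN ab_measurable ab_bound lip v_measurable v_bound v_deriv _ traces(1,3) \<psi>]) simp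
  have l: "- (LINT z|lborel. indicator {0<..} (-1 * ?d z) * F z) - (-1) * (LINT t|lborel. \<psi> (t, x t) * (bm t - v t * am t))
     = (LINT z|P. indicator {0<..} (-1 * ?d z) * \<psi> z) - (LINT z|N. indicator {0<..} (-1 * ?d z) * \<psi> z)"
    unfolding F_def
    by (rule one_sided_balance[OF bal PN ab_measurable ab_bound lip v_measurable v_bound v_deriv _ traces(2,4) \<psi>]) simp
  have tot: "- (LINT z|lborel. F z) = (LINT z|P. \<psi> z) - (LINT z|N. \<psi> z)"
    using bal[unfolded balance_def, rule_format, OF \<psi>] by (simp add: F_def)
  have "(LINT t|lborel. \<psi> (t, x t) * jump t) = (LINT t|lborel. \<psi> (t, x t) * (bp t - v t * ap t) - \<psi> (t, x t) * (bm t - v t * am t))"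
    by (intro Bochner_Integration.integral_cong refl) (simp add: jump_def right_diff_distrib)
  also have "\<dots> = (LINT t|lborel. \<psi> (t, x t) * (bp t - v t * ap t)) - (LINT t|lborel. \<psi> (t, x t) * (bm t - v t * am t))"
    by (rule Bochner_Integration.integral_diff; rule integrable_on_path[OF \<psi>]; (rule side_bound | measurable))
  finally show ?thesis using r l tot splitF splitM[OF PN(1)] splitM[OF PN(2)] by linarith
qed

text \<open>\<open>path_balance\<close> controls only signed integrals, so the test function has to
  be localised to times where \<open>jump\<close> is positive. Lipschitz functions of time
  decreasing to the indicator of a closed set \<open>K\<close> allow this for every
  \<open>K\<close>; they are at most 1, and dropping the contribution of \<open>N\<close> leaves the
  mass of \<open>P\<close>. Inner regularity exhausts the set of positive \<open>jump\<close> by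
  closed sets.\<close>

lemma path_production_le:
  assumes \<psi>: "lip_test T \<psi> \<psi>t \<psi>x" and pos: "\<And>z. 0 \<le> \<psi> z"
  shows "(LINT t|lborel. \<psi> (t, x t) * max 0 (jump t)) \<le> (LINT z|P. indicator {0} (snd z - x (fst z)) * \<psi> z)"
proof -
  obtain B R where B: "continuous_on UNIV \<psi>" "\<And>z. \<bar>\<psi> z\<bar> \<le> B" "0 \<le> B" "\<And>z. \<psi> z \<noteq> 0 \<Longrightarrow> 0 < fst z \<and> fst z < T \<and> norm z \<le> R"
    by (rule test_data[OF \<psi>]) blast
  have [measurable]: "\<psi> \<in> borel_measurable borel" using B(1) by (rule borel_measurable_continuous_onI)
  define C where "C = 2 * (A + S * A)"
  have C: "\<bar>jump t\<bar> \<le> C" "0 \<le> C" for t using jump_bound[of t] unfolding C_def by linarith+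
  define X where "X = (LINT z|P. indicator {0} (snd z - x (fst z)) * \<psi> z)"
  define E where "E = {t. jump t > 0}"
  have Em[measurable]: "E \<in> sets borel" unfolding E_def by measurable
  have key: "(LINT t|lborel. \<psi> (t, x t) * (indicator K t * jump t)) \<le> X" if K: "closed K" "K \<noteq> {}" for K
  proof -
    define g where "g n t = ramp (1 - real n * infdist t K)" for n t
    have glip: "(real n)-lipschitz_on UNIV (g n)" for n
    proof (rule lipschitz_onI)
      fix s t
      have "\<bar>g n s - g n t\<bar> \<le> \<bar>(1 - real n * infdist s K) - (1 - real n * infdist t K)\<bar>"
        unfolding g_def by (rule ramp_lipschitz)
      also have "\<dots> = real n * \<bar>infdist s K - infdist t K\<bar>"
        by (simp add: right_diff_distrib[symmetric] abs_mult abs_minus_commute)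
      also have "\<dots> \<le> real n * dist s t" by (intro mult_left_mono infdist_triangle_abs) simp
      finally show "dist (g n s) (g n t) \<le> real n * dist s t" by (simp add: dist_real_def)
    qed simp
    have gb: "0 \<le> g n t" "g n t \<le> 1" "\<bar>g n t\<bar> \<le> 1" for n t unfolding g_def by (rule ramp_bounds)+
    have le: "(LINT t|lborel. \<psi> (t, x t) * (g n t * jump t)) \<le> X" for n
    proof -
      \<comment> \<open>The distance to \<open>K\<close> is Lipschitz without being differentiable
        everywhere; the almost everywhere derivative makes \<open>g n\<close> an admissible
        factor.\<close>
      obtain g' where g': "g' \<in> borel_measurable borel" "\<And>t. \<bar>g' t\<bar> \<le> real n" "AE t in lborel. (g n has_real_derivative g' t) (at t)"
        using lipschitz_AE_differentiable[OF glip] by blast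
      have D: "lipD (\<lambda>z. g n (fst z)) (\<lambda>z. g' (fst z)) (\<lambda>_. 0)"
      proof (rule lipD_time[OF glip _ _ g'(1,3), of "real n + 1"])
        show "\<bar>g n t\<bar> \<le> real n + 1" for t using gb(3)[of n t] by simp
        show "\<bar>g' t\<bar> \<le> real n + 1" for t using g'(2)[of t] by simp
      qed
      have nn: "0 \<le> (LINT z|N. indicator {0} (snd z - x (fst z)) * (\<psi> z * g n (fst z)))"
        by (intro integral_nonneg_AE AE_I2 mult_nonneg_nonneg pos gb) simp
      have PX: "(LINT z|P. indicator {0} (snd z - x (fst z)) * (\<psi> z * g n (fst z))) \<le> X"
        unfolding X_def
      proof (rule integral_mono)
        have fm: "(\<lambda>z :: real \<times> real. g n (fst z)) \<in> borel_measurable borel"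
          using lipschitz_on_continuous_on[OF glip]
          by (intro borel_measurable_continuous_onI continuous_on_compose2[OF lipschitz_on_continuous_on[OF glip]] continuous_intros) auto
        show "integrable P (\<lambda>z. indicator {0} (snd z - x (fst z)) * \<psi> z)"
        proof (rule integrable_radon_bounded_support[OF PN(1), where B=B and R=R])
          show "\<bar>indicator {0} (snd z - x (fst z)) * \<psi> z\<bar> \<le> B" for z using B(2)[of z] B(3) by (auto simp: indicator_def)
          show "norm z \<le> R" if "indicator {0} (snd z - x (fst z)) * \<psi> z \<noteq> 0" for z using B(4)[of z] that by auto
        qed measurable
        show "integrable P (\<lambda>z. indicator {0} (snd z - x (fst z)) * (\<psi> z * g n (fst z)))"
        proof (rule integrable_radon_bounded_support[OF PN(1), where B=B and R=R])
          show "\<bar>indicator {0} (snd z - x (fst z)) * (\<psi> z * g n (fst z))\<bar> \<le> B" for z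
          proof -
            have "\<bar>\<psi> z\<bar> * \<bar>g n (fst z)\<bar> \<le> B * 1" using B(2)[of z] gb(3)[of n "fst z"] B(3) by (intro mult_mono) simp_all
            then show ?thesis using B(3) by (simp add: indicator_def abs_mult)
          qed
          show "norm z \<le> R" if "indicator {0} (snd z - x (fst z)) * (\<psi> z * g n (fst z)) \<noteq> 0" for z using B(4)[of z] that by auto
          show "(\<lambda>z. indicator {0} (snd z - x (fst z)) * (\<psi> z * g n (fst z))) \<in> borel_measurable borel"
            using fm by measurable
        qed
        show "indicator {0} (snd z - x (fst z)) * (\<psi> z * g n (fst z)) \<le> indicator {0} (snd z - x (fst z)) * \<psi> z" for z
          using mult_left_le[OF gb(2)[of n "fst z"] pos[of z]] by (simp add: indicator_def)
      qed
      have "(LINT t|lborel. \<psi> (t, x t) * (g n t * jump t)) = (LINT t|lborel. (\<psi> (t, x t) * g n (fst (t, x t))) * jump t)"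
        by (simp add: mult.assoc)
      also have "\<dots> = (LINT z|P. indicator {0} (snd z - x (fst z)) * (\<psi> z * g n (fst z))) - (LINT z|N. indicator {0} (snd z - x (fst z)) * (\<psi> z * g n (fst z)))"
        by (rule path_balance[OF lip_test_mult[OF \<psi> D]])
      finally show ?thesis using nn PX by linarith
    qed
    have gm[measurable]: "g n \<in> borel_measurable borel" for n
      using lipschitz_on_continuous_on[OF glip] by (rule borel_measurable_continuous_onI)
    have [measurable]: "K \<in> sets borel" using K(1) by simp
    have \<psi>x[measurable]: "(\<lambda>t. \<psi> (t, x t)) \<in> borel_measurable borel" by (rule measurable_slice) measurable
    have "(\<lambda>n. LINT t|lborel. \<psi> (t, x t) * (g n t * jump t)) \<longlonglongrightarrow> (LINT t|lborel. \<psi> (t, x t) * (indicator K t * jump t))"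
    proof (rule integral_dominated_convergence[where w="\<lambda>t. \<bar>\<psi> (t, x t) * jump t\<bar>"])
      show "integrable lborel (\<lambda>t. \<bar>\<psi> (t, x t) * jump t\<bar>)"
        by (intro integrable_abs integrable_on_path[OF \<psi> _ jump_bound] jump_measurable)
      show "AE t in lborel. (\<lambda>n. \<psi> (t, x t) * (g n t * jump t)) \<longlonglongrightarrow> \<psi> (t, x t) * (indicator K t * jump t)"
      proof (intro AE_I2 tendsto_intros)
        fix t
        show "(\<lambda>n. g n t) \<longlonglongrightarrow> indicator K t"
        proof (cases "t \<in> K")
          case True then show ?thesis by (simp add: g_def ramp_def)
        next
          case False
          then have d: "infdist t K > 0"
            using in_closed_iff_infdist_zero[OF K] infdist_nonneg[of t K] by (metis order_le_less)
          obtain n0 where n0: "1 / infdist t K < real n0" using reals_Archimedean2 by blast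
          have "\<forall>\<^sub>F n in sequentially. g n t = 0"
            unfolding eventually_sequentially
          proof (intro exI allI impI)
            fix n assume "n \<ge> n0"
            then have "1 / infdist t K \<le> real n" using n0 by linarith
            then have "1 \<le> real n * infdist t K" using d by (simp add: pos_divide_le_eq)
            then show "g n t = 0" unfolding g_def by (intro ramp_simps) simp
          qed
          then show ?thesis using False by (simp add: tendsto_eventually)
        qed
      qed
      show "AE t in lborel. norm (\<psi> (t, x t) * (g n t * jump t)) \<le> \<bar>\<psi> (t, x t) * jump t\<bar>" for n
      proof (intro AE_I2)
        fix t
        have "\<bar>g n t\<bar> * \<bar>\<psi> (t, x t) * jump t\<bar> \<le> 1 * \<bar>\<psi> (t, x t) * jump t\<bar>" by (intro mult_right_mono gb) simp
        then show "norm (\<psi> (t, x t) * (g n t * jump t)) \<le> \<bar>\<psi> (t, x t) * jump t\<bar>" by (simp add: abs_mult mult_ac)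
      qed
    qed measurable
    then show ?thesis by (rule LIMSEQ_le_const2) (use le in blast)
  qed
  have \<psi>x[measurable]: "(\<lambda>t. \<psi> (t, x t)) \<in> borel_measurable borel" by (rule measurable_slice) measurable
  have "(LINT t|lborel. \<psi> (t, x t) * max 0 (jump t)) \<le> X"
  proof (rule field_le_epsilon)
    fix e :: real assume e: "e > 0"
    define \<epsilon> where "\<epsilon> = e / (B * C + 1)"
    have BC: "B * C \<ge> 0" using B(3) C(2) by simp
    have \<epsilon>: "\<epsilon> > 0" using e BC by (simp add: \<epsilon>_def add_nonneg_pos)
    have El: "E \<in> sets lebesgue" using Em by simp
    obtain K where K: "closed K" "K \<subseteq> E" "emeasure lebesgue (E - K) < ennreal \<epsilon>"
      using sets_lebesgue_inner_closed[OF El \<epsilon>] by metis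
    have [measurable]: "K \<in> sets borel" using K(1) by simp
    \<comment> \<open>\<open>infdist\<close> to the empty set is 0 by convention. The added point
      keeps the set nonempty and is invisible to the integral.\<close>
    define K' where "K' = insert 0 K"
    have K': "closed K'" "K' \<noteq> {}" using K(1) by (auto simp: K'_def)
    have [measurable]: "K' \<in> sets borel" using K'(1) by simp
    have em: "emeasure lborel (E - K) < ennreal \<epsilon>" using K(3) by simp
    then have fin: "emeasure lborel (E - K) < \<infinity>" using ennreal_less_top order_less_trans by (metis infinity_ennreal_def)
    have iE: "integrable lborel (\<lambda>t. B * C * indicator (E - K) t)"
      using fin by (intro integrable_mult_right integrable_real_indicator) auto
    have iK: "integrable lborel (\<lambda>t. \<psi> (t, x t) * (indicator K' t * jump t))"
    proof (rule integrable_on_path[OF \<psi>])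
      show "\<bar>indicator K' t * jump t\<bar> \<le> C" for t using C(1)[of t] C(2) by (auto simp: indicator_def)
    qed measurable
    have "(LINT t|lborel. \<psi> (t, x t) * max 0 (jump t)) \<le> (LINT t|lborel. \<psi> (t, x t) * (indicator K' t * jump t) + B * C * indicator (E - K) t)"
    proof (rule integral_mono_AE)
      show "integrable lborel (\<lambda>t. \<psi> (t, x t) * max 0 (jump t))"
      proof (rule integrable_on_path[OF \<psi>])
        show "\<bar>max 0 (jump t)\<bar> \<le> C" for t using C(1)[of t] by linarith
      qed measurable
      show "integrable lborel (\<lambda>t. \<psi> (t, x t) * (indicator K' t * jump t) + B * C * indicator (E - K) t)"
        by (rule Bochner_Integration.integrable_add[OF iK iE])
      show "AE t in lborel. \<psi> (t, x t) * max 0 (jump t) \<le> \<psi> (t, x t) * (indicator K' t * jump t) + B * C * indicator (E - K) t"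
        using AE_lborel_singleton[of 0]
      proof eventually_elim
        case (elim t)
        consider "t \<in> K" | "t \<in> E - K" | "t \<notin> E" by blast
        then show ?case
        proof cases
          case 1
          then have "jump t > 0" using K(2) by (auto simp: E_def)
          then show ?thesis using 1 by (simp add: K'_def)
        next
          case 2
          then have j: "jump t > 0" "t \<notin> K'" using elim by (auto simp: E_def K'_def)
          have "\<psi> (t, x t) * jump t \<le> B * C"
            using B(2)[of "(t, x t)"] C(1)[of t] pos[of "(t, x t)"] B(3) j(1) by (intro mult_mono) auto
          then show ?thesis using 2 j by simp
        next
          case 3
          then have "jump t \<le> 0" "t \<notin> K'" using K(2) elim by (auto simp: E_def K'_def)
          then show ?thesis using 3 by simp
        qed
      qed
    qed
    also have "\<dots> = (LINT t|lborel. \<psi> (t, x t) * (indicator K' t * jump t)) + (LINT t|lborel. B * C * indicator (E - K) t)"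
      by (rule Bochner_Integration.integral_add[OF iK iE])
    also have "\<dots> \<le> X + B * C * \<epsilon>"
    proof (rule add_mono[OF key[OF K']])
      have "measure lborel (E - K) \<le> \<epsilon>"
        unfolding measure_def by (rule enn2real_leI) (use em \<epsilon> in \<open>simp_all add: less_imp_le\<close>)
      then show "(LINT t|lborel. B * C * indicator (E - K) t) \<le> B * C * \<epsilon>"
        using BC by (simp add: mult_left_mono)
    qed
    also have "B * C * \<epsilon> \<le> e"
    proof -
      have "B * C * \<epsilon> \<le> (B * C + 1) * \<epsilon>" using \<epsilon> by (simp add: algebra_simps)
      also have "\<dots> = e" using BC by (simp add: \<epsilon>_def)
      finally show ?thesis .
    qed
    finally show "(LINT t|lborel. \<psi> (t, x t) * max 0 (jump t)) \<le> X + e" by simp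
  qed
  then show ?thesis unfolding X_def .
qed

end

section \<open>Trapezoids in time and shrinking cones in space\<close>

section \<open>Space-time cutoffs\<close>

text \<open>For \<open>4 \<le> n * t1\<close> a trapezoid, rising on \<open>(1 / n, 2 / n)\<close>
  and falling on \<open>(t1 - 2 / n, t1 - 1 / n)\<close>. It vanishes near both ends so that
  products with it are admissible in the open strip.\<close>

definition time_cutoff :: "real \<Rightarrow> real \<Rightarrow> real \<times> real \<Rightarrow> real" where
  "time_cutoff n t1 z = ramp (n * fst z + (-1)) * ramp (- n * fst z + (n * t1 - 1))"

definition time_cutoff' :: "real \<Rightarrow> real \<Rightarrow> real \<times> real \<Rightarrow> real" where
  "time_cutoff' n t1 z = n * indicator {0<..<1} (n * fst z + (-1)) * ramp (- n * fst z + (n * t1 - 1))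
     + - n * indicator {0<..<1} (- n * fst z + (n * t1 - 1)) * ramp (n * fst z + (-1))"

text \<open>A Lipschitz version of the indicator of \<open>\<bar>y\<bar> < R - S * t\<close>: one
  ramp for each lateral side of the cone, both sides moving inwards with speed
  \<open>S\<close>.\<close>

definition cone_cutoff :: "real \<Rightarrow> real \<Rightarrow> real \<Rightarrow> real \<times> real \<Rightarrow> real" where
  "cone_cutoff k S R z = ramp (k * (R - S * fst z) + - k * snd z) * ramp (k * (R - S * fst z) + k * snd z)"

definition cone_cutoff_t :: "real \<Rightarrow> real \<Rightarrow> real \<Rightarrow> real \<times> real \<Rightarrow> real" where
  "cone_cutoff_t k S R z = - k * S * indicator {0<..<1} (k * (R - S * fst z) + - k * snd z) * ramp (k * (R - S * fst z) + k * snd z)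
     + - k * S * indicator {0<..<1} (k * (R - S * fst z) + k * snd z) * ramp (k * (R - S * fst z) + - k * snd z)"

definition cone_cutoff_x :: "real \<Rightarrow> real \<Rightarrow> real \<Rightarrow> real \<times> real \<Rightarrow> real" where
  "cone_cutoff_x k S R z = - k * indicator {0<..<1} (k * (R - S * fst z) + - k * snd z) * ramp (k * (R - S * fst z) + k * snd z)
     + k * indicator {0<..<1} (k * (R - S * fst z) + k * snd z) * ramp (k * (R - S * fst z) + - k * snd z)"

lemma lipD_time_cutoff:
  assumes "n > 0"
  shows "lipD (time_cutoff n t1) (time_cutoff' n t1) (\<lambda>_. 0)"
proof -
  have "lipD (\<lambda>z. ramp (n * fst z + (-1))) (\<lambda>z. n * indicator {0<..<1} (n * fst z + (-1))) (\<lambda>_. 0)"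
    "lipD (\<lambda>z. ramp (- n * fst z + (n * t1 - 1))) (\<lambda>z. - n * indicator {0<..<1} (- n * fst z + (n * t1 - 1))) (\<lambda>_. 0)"
    by (rule lipD_ramp_time; use assms in simp)+
  from lipD_mult[OF this] show ?thesis
    unfolding time_cutoff_def[abs_def] time_cutoff'_def[abs_def] by simp
qed

lemma lipD_cone_cutoff:
  assumes "k > 0" "S \<ge> 0"
  shows "lipD (cone_cutoff k S R) (cone_cutoff_t k S R) (cone_cutoff_x k S R)"
proof -
  have L: "(k * S)-lipschitz_on UNIV (\<lambda>t. k * (R - S * t))"
  proof (rule lipschitz_onI)
    fix s t
    have "k * (R - S * s) - k * (R - S * t) = - (k * S) * (s - t)" by (simp add: algebra_simps)
    then show "dist (k * (R - S * s)) (k * (R - S * t)) \<le> k * S * dist s t"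
      using assms by (simp add: dist_real_def abs_mult)
  qed (use assms in simp)
  have d: "AE t in lborel. ((\<lambda>t. k * (R - S * t)) has_real_derivative - k * S) (at t)"
    by (intro AE_I2) (auto intro!: derivative_eq_intros)
  have r: "lipD (\<lambda>z. ramp (k * (R - S * fst z) + c * snd z))
     (\<lambda>z. - k * S * indicator {0<..<1} (k * (R - S * fst z) + c * snd z))
     (\<lambda>z. c * indicator {0<..<1} (k * (R - S * fst z) + c * snd z))" if "c \<noteq> 0" for c
    by (rule lipD_ramp[OF L _ that _ d]) (use assms in simp_all)
  have "lipD (\<lambda>z. ramp (k * (R - S * fst z) + - k * snd z))
     (\<lambda>z. - k * S * indicator {0<..<1} (k * (R - S * fst z) + - k * snd z))
     (\<lambda>z. - k * indicator {0<..<1} (k * (R - S * fst z) + - k * snd z))"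
    "lipD (\<lambda>z. ramp (k * (R - S * fst z) + k * snd z))
     (\<lambda>z. - k * S * indicator {0<..<1} (k * (R - S * fst z) + k * snd z))
     (\<lambda>z. k * indicator {0<..<1} (k * (R - S * fst z) + k * snd z))"
    by (rule r; use assms in simp)+
  from lipD_mult[OF this] show ?thesis
    unfolding cone_cutoff_def[abs_def] cone_cutoff_t_def[abs_def] cone_cutoff_x_def[abs_def] .
qed

lemma cutoff_bounds:
  "0 \<le> time_cutoff n t1 z" "time_cutoff n t1 z \<le> 1" "0 \<le> cone_cutoff k S R z" "cone_cutoff k S R z \<le> 1"
  unfolding time_cutoff_def cone_cutoff_def by (auto intro!: mult_nonneg_nonneg mult_le_one ramp_bounds)

lemma cone_cutoff_nz:
  assumes "cone_cutoff k S R z \<noteq> 0 \<or> cone_cutoff_t k S R z \<noteq> 0 \<or> cone_cutoff_x k S R z \<noteq> 0" "k > 0"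
  shows "\<bar>snd z\<bar> < R - S * fst z"
proof (rule ccontr)
  assume "\<not> \<bar>snd z\<bar> < R - S * fst z"
  then consider "R - S * fst z - snd z \<le> 0" | "R - S * fst z + snd z \<le> 0" by (auto simp: abs_less_iff not_less)
  then have "k * (R - S * fst z) + - k * snd z \<le> 0 \<or> k * (R - S * fst z) + k * snd z \<le> 0"
  proof cases
    case 1
    then have "k * (R - S * fst z - snd z) \<le> 0" using assms(2) by (simp add: mult_nonneg_nonpos)
    then show ?thesis by (simp add: algebra_simps)
  next
    case 2
    then have "k * (R - S * fst z + snd z) \<le> 0" using assms(2) by (simp add: mult_nonneg_nonpos)
    then show ?thesis by (simp add: algebra_simps)
  qed
  then have "cone_cutoff k S R z = 0 \<and> cone_cutoff_t k S R z = 0 \<and> cone_cutoff_x k S R z = 0"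
    unfolding cone_cutoff_def cone_cutoff_t_def cone_cutoff_x_def
    by (elim disjE) (simp_all add: ramp_simps indicator_def)
  then show False using assms(1) by blast
qed

lemma time_cutoff_nz:
  assumes "time_cutoff n t1 z \<noteq> 0 \<or> time_cutoff' n t1 z \<noteq> 0" "n > 0"
  shows "1 / n < fst z \<and> fst z < t1 - 1 / n"
proof (rule ccontr)
  assume "\<not> (1 / n < fst z \<and> fst z < t1 - 1 / n)"
  then have "fst z \<le> 1 / n \<or> t1 - fst z \<le> 1 / n" by auto
  then have "n * fst z \<le> 1 \<or> n * (t1 - fst z) \<le> 1" using assms(2) by (simp add: pos_le_divide_eq mult.commute)
  then have "n * fst z + (-1) \<le> 0 \<or> - n * fst z + (n * t1 - 1) \<le> 0" by (simp add: algebra_simps)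
  then have "time_cutoff n t1 z = 0 \<and> time_cutoff' n t1 z = 0"
    unfolding time_cutoff_def time_cutoff'_def by (elim disjE) (simp_all add: ramp_simps indicator_def)
  then show False using assms(1) by blast
qed

lemma cutoff_lip_test:
  assumes "n > 0" "k > 0" "S \<ge> 0" "t1 \<le> T"
  shows "lip_test T (\<lambda>z. time_cutoff n t1 z * cone_cutoff k S R z)
    (\<lambda>z. time_cutoff' n t1 z * cone_cutoff k S R z + cone_cutoff_t k S R z * time_cutoff n t1 z)
    (\<lambda>z. cone_cutoff_x k S R z * time_cutoff n t1 z)"
proof -
  have "lipD (\<lambda>z. time_cutoff n t1 z * cone_cutoff k S R z)
    (\<lambda>z. time_cutoff' n t1 z * cone_cutoff k S R z + cone_cutoff_t k S R z * time_cutoff n t1 z)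
    (\<lambda>z. cone_cutoff_x k S R z * time_cutoff n t1 z)"
    using lipD_mult[OF lipD_time_cutoff[OF assms(1), of t1] lipD_cone_cutoff[OF assms(2,3), of R]] by simp
  moreover have "1 / n \<le> fst z \<and> fst z \<le> T - 1 / n \<and> \<bar>snd z\<bar> \<le> R"
    if "time_cutoff n t1 z * cone_cutoff k S R z \<noteq> 0 \<or>
      time_cutoff' n t1 z * cone_cutoff k S R z + cone_cutoff_t k S R z * time_cutoff n t1 z \<noteq> 0 \<or>
      cone_cutoff_x k S R z * time_cutoff n t1 z \<noteq> 0" for z
  proof -
    have "time_cutoff n t1 z \<noteq> 0 \<or> time_cutoff' n t1 z \<noteq> 0"
      "cone_cutoff k S R z \<noteq> 0 \<or> cone_cutoff_t k S R z \<noteq> 0 \<or> cone_cutoff_x k S R z \<noteq> 0"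
      using that by auto
    then have 1: "1 / n < fst z \<and> fst z < t1 - 1 / n" and 2: "\<bar>snd z\<bar> < R - S * fst z"
      using time_cutoff_nz cone_cutoff_nz assms by blast+
    have "1 / n > 0" using assms by simp
    then have "0 \<le> S * fst z" using 1 assms by (intro mult_nonneg_nonneg) linarith+
    then show ?thesis using 1 2 assms(4) by linarith
  qed
  moreover have "1 / n > 0" using assms by simp
  ultimately show ?thesis unfolding lip_test_def by blast
qed

text \<open>On the right side of the cone the derivatives combine to \<open>S * e + q\<close>, on
  the left to \<open>S * e - q\<close>, each with a nonpositive factor: a flux bounded by
  \<open>S * e\<close> cannot enter through sides that retreat with speed \<open>S\<close>.\<close>

lemma cone_flux_le:
  assumes "\<bar>q\<bar> \<le> S * e" "k > 0"
  shows "e * cone_cutoff_t k S R z + q * cone_cutoff_x k S R z \<le> 0"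
proof -
  let ?i1 = "indicat_real {0<..<1} (k * (R - S * fst z) + - k * snd z)" and ?i2 = "indicat_real {0<..<1} (k * (R - S * fst z) + k * snd z)"
  let ?r1 = "ramp (k * (R - S * fst z) + - k * snd z)" and ?r2 = "ramp (k * (R - S * fst z) + k * snd z)"
  have "0 \<le> k * ?i1 * ?r2 * (S * e + q)" "0 \<le> k * ?i2 * ?r1 * (S * e - q)"
    using assms ramp_bounds(1) by (intro mult_nonneg_nonneg; simp add: abs_le_iff)+
  moreover have "e * cone_cutoff_t k S R z + q * cone_cutoff_x k S R z
    = - (k * ?i1 * ?r2 * (S * e + q)) - k * ?i2 * ?r1 * (S * e - q)"
    unfolding cone_cutoff_t_def cone_cutoff_x_def by (simp add: algebra_simps)
  ultimately show ?thesis by linarith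
qed

lemma radon_null_measure: "radon_on_strip T (null_measure borel)"
  by (simp add: radon_on_strip_def)

section \<open>The Rankine-Hugoniot condition for a balance law without production\<close>

lemma balance_uminus:
  assumes "balance T a b P N"
  shows "balance T (\<lambda>z. - a z) (\<lambda>z. - b z) N P"
  unfolding balance_def
proof (intro allI impI)
  fix \<phi> \<phi>t \<phi>x assume "lip_test T \<phi> \<phi>t \<phi>x"
  from assms[unfolded balance_def, rule_format, OF this]
  have "- (LINT z|lborel. a z * \<phi>t z + b z * \<phi>x z) = (LINT z|P. \<phi> z) - (LINT z|N. \<phi> z)" .
  moreover have "(LINT z|lborel. - a z * \<phi>t z + - b z * \<phi>x z) = - (LINT z|lborel. a z * \<phi>t z + b z * \<phi>x z)"
    by (subst Bochner_Integration.integral_minus[symmetric]) (simp add: algebra_simps)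
  ultimately show "- (LINT z|lborel. - a z * \<phi>t z + - b z * \<phi>x z) = (LINT z|N. \<phi> z) - (LINT z|P. \<phi> z)" by linarith
qed

lemma has_trace_uminus: "has_trace T x s a A \<Longrightarrow> has_trace T x s (\<lambda>z. - a z) (\<lambda>t. - A t)"
  unfolding has_trace_def
proof (elim conjE, intro conjI)
  assume [measurable]: "A \<in> borel_measurable borel"
  show "(\<lambda>t. - A t) \<in> borel_measurable borel" by measurable
  assume "AE t in lborel. 0 < t \<and> t < T \<longrightarrow> ((\<lambda>y. a (t, x t + s * y)) \<longlongrightarrow> A t) ess_at_right_0"
  then show "AE t in lborel. 0 < t \<and> t < T \<longrightarrow> ((\<lambda>y. - a (t, x t + s * y)) \<longlongrightarrow> - A t) ess_at_right_0"
    by eventually_elim (auto intro: tendsto_minus)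
qed

lemma (in traced_balance) traced_balance_uminus:
  "traced_balance S x v T A (\<lambda>z. - a z) (\<lambda>z. - b z) N P (\<lambda>t. - ap t) (\<lambda>t. - am t) (\<lambda>t. - bp t) (\<lambda>t. - bm t)"
proof
  show "balance T (\<lambda>z. - a z) (\<lambda>z. - b z) N P" by (rule balance_uminus[OF bal])
qed (use PN ab_bound trace_bound has_trace_uminus traces in simp_all)

text \<open>Without production \<open>path_production_le\<close> makes the integral of the positive
  part of \<open>jump\<close> nonpositive. Negating \<open>a\<close> and \<open>b\<close>, which
  exchanges \<open>P\<close> and \<open>N\<close>, does the same for the negative part.\<close>

lemma (in traced_balance) rankine_hugoniot:
  assumes P: "P = null_measure borel" and N: "N = null_measure borel"
  shows "AE t in lborel. 0 < t \<and> t < T \<longrightarrow> jump t = 0"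
proof -
  interpret neg: traced_balance S x v T A "\<lambda>z. - a z" "\<lambda>z. - b z" N P "\<lambda>t. - ap t" "\<lambda>t. - am t" "\<lambda>t. - bp t" "\<lambda>t. - bm t"
    by (rule traced_balance_uminus)
  have nj: "neg.jump t = - jump t" for t unfolding neg.jump_def jump_def by simp
  \<comment> \<open>The curve stays within \<open>R - 1\<close> for the times in question, so the
    spatial cutoff with ramp parameter 1 and cone speed 0 equals 1 along it.\<close>
  define R where "R = \<bar>x 0\<bar> + S * \<bar>T\<bar> + 1"
  have one: "AE t in lborel. 1 / real (Suc n) < t \<and> t < T - 1 / real (Suc n) \<longrightarrow> jump t = 0" for n
  proof -
    let ?n = "real (Suc n)"
    define \<psi> where "\<psi> z = time_cutoff ?n T z * cone_cutoff 1 0 R z" for z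
    have test: "lip_test T \<psi> (\<lambda>z. time_cutoff' ?n T z * cone_cutoff 1 0 R z + cone_cutoff_t 1 0 R z * time_cutoff ?n T z)
      (\<lambda>z. cone_cutoff_x 1 0 R z * time_cutoff ?n T z)"
      unfolding \<psi>_def by (rule cutoff_lip_test) simp_all
    have pos: "0 \<le> \<psi> z" for z unfolding \<psi>_def by (intro mult_nonneg_nonneg cutoff_bounds)
    have i1: "integrable lborel (\<lambda>t. \<psi> (t, x t) * max 0 (jump t))" "integrable lborel (\<lambda>t. \<psi> (t, x t) * max 0 (- jump t))"
    proof -
      have "\<bar>max 0 (jump t)\<bar> \<le> 2 * (A + S * A)" "\<bar>max 0 (- jump t)\<bar> \<le> 2 * (A + S * A)" for t
        using jump_bound[of t] by linarith+
      then show "integrable lborel (\<lambda>t. \<psi> (t, x t) * max 0 (jump t))" "integrable lborel (\<lambda>t. \<psi> (t, x t) * max 0 (- jump t))"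
        by (intro integrable_on_path[OF test]; measurable)+
    qed
    have "(LINT t|lborel. \<psi> (t, x t) * max 0 (jump t)) \<le> 0"
      using path_production_le[OF test pos] by (simp add: P)
    moreover have "(LINT t|lborel. \<psi> (t, x t) * max 0 (- jump t)) \<le> 0"
      using neg.path_production_le[OF test pos] by (simp add: N nj)
    moreover have "(LINT t|lborel. \<psi> (t, x t) * \<bar>jump t\<bar>) = (LINT t|lborel. \<psi> (t, x t) * max 0 (jump t)) + (LINT t|lborel. \<psi> (t, x t) * max 0 (- jump t))"
      by (subst Bochner_Integration.integral_add[OF i1, symmetric])
         (intro Bochner_Integration.integral_cong refl, auto simp: max_def)
    ultimately have "(LINT t|lborel. \<psi> (t, x t) * \<bar>jump t\<bar>) \<le> 0" by linarith
    moreover have "0 \<le> (LINT t|lborel. \<psi> (t, x t) * \<bar>jump t\<bar>)"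
      using pos by (intro integral_nonneg_AE AE_I2 mult_nonneg_nonneg) simp_all
    ultimately have "(LINT t|lborel. \<psi> (t, x t) * \<bar>jump t\<bar>) = 0" by linarith
    moreover have "integrable lborel (\<lambda>t. \<psi> (t, x t) * \<bar>jump t\<bar>)"
      by (rule integrable_on_path[OF test, where C="2 * (A + S * A)"]) (use jump_bound in simp_all)
    ultimately have "AE t in lborel. \<psi> (t, x t) * \<bar>jump t\<bar> = 0"
      using integral_nonneg_eq_0_iff_AE[of lborel "\<lambda>t. \<psi> (t, x t) * \<bar>jump t\<bar>"] pos by simp
    then show ?thesis
    proof eventually_elim
      case (elim t)
      show ?case
      proof
        assume t: "1 / ?n < t \<and> t < T - 1 / ?n"
        then have tt: "1 / ?n < t" "1 / ?n < T - t" by linarith+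
        have "0 < 1 / ?n" by simp
        then have tT: "0 < t" "t < T" using tt by linarith+
        have "1 < ?n * t" "1 < ?n * (T - t)" using tt by (simp_all add: pos_divide_less_eq mult.commute del: of_nat_Suc)
        then have "time_cutoff ?n T (t, x t) > 0"
          unfolding time_cutoff_def by (intro mult_pos_pos) (simp_all add: ramp_def algebra_simps)
        moreover have "cone_cutoff 1 0 R (t, x t) = 1"
        proof -
          have "dist (x t) (x 0) \<le> S * dist t 0" by (rule lipschitz_onD[OF lip]) auto
          also have "\<dots> \<le> S * \<bar>T\<bar>"
            using tT by (intro mult_left_mono S_nonneg) simp
          finally have "\<bar>x t\<bar> \<le> R - 1" unfolding R_def dist_real_def by linarith
          then show ?thesis unfolding cone_cutoff_def by (simp add: ramp_simps abs_le_iff)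
        qed
        ultimately have "\<psi> (t, x t) > 0" by (simp add: \<psi>_def)
        then show "jump t = 0" using elim by simp
      qed
    qed
  qed
  then have "AE t in lborel. \<forall>n. 1 / real (Suc n) < t \<and> t < T - 1 / real (Suc n) \<longrightarrow> jump t = 0"
    by (intro AE_all_countable[THEN iffD2] allI one)
  then show ?thesis
  proof eventually_elim
    case (elim t)
    show ?case
    proof
      assume t: "0 < t \<and> t < T"
      obtain n where n: "1 / real (Suc n) < min t (T - t)"
        using reals_Archimedean[of "min t (T - t)"] t by (auto simp: inverse_eq_divide)
      then have "1 / real (Suc n) < t" "t < T - 1 / real (Suc n)" by linarith+
      then show "jump t = 0" using elim by blast
    qed
  qed
qed

section \<open>Filippov characteristics as limits of averaged Euler polygons\<close>

section \<open>Generalized characteristics\<close>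

lemma set_integrable_bounded_Ioc:
  fixes g :: "real \<Rightarrow> real"
  assumes [measurable]: "g \<in> borel_measurable borel" and "\<And>t. \<bar>g t\<bar> \<le> B"
  shows "set_integrable lborel {a<..b} g"
  by (rule set_integrable_subset[OF set_integrable_bounded_Icc[OF assms, of a b]]) auto

lemma Icc_Ioc_integral:
  fixes g :: "real \<Rightarrow> real"
  assumes [measurable]: "g \<in> borel_measurable borel"
  shows "(LINT s:{a..b}|lborel. g s) = (LINT s:{a<..b}|lborel. g s)"
  unfolding set_lebesgue_integral_def
proof (rule integral_cong_AE)
  show "AE s in lborel. indicator {a..b} s *\<^sub>R g s = indicator {a<..b} s *\<^sub>R g s"
    using AE_lborel_singleton[of a] by eventually_elim (auto simp: indicator_def)
qed measurable

lemma Ioc_integral_combine: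
  fixes g :: "real \<Rightarrow> real"
  assumes "g \<in> borel_measurable borel" "\<And>t. \<bar>g t\<bar> \<le> B" "a \<le> b" "b \<le> c"
  shows "(LINT s:{a<..c}|lborel. g s) = (LINT s:{a<..b}|lborel. g s) + (LINT s:{b<..c}|lborel. g s)"
proof -
  have "{a<..c} = {a<..b} \<union> {b<..c}" using assms by auto
  then show ?thesis
    using set_integral_Un[of "{a<..b}" "{b<..c}" lborel g] set_integrable_bounded_Ioc[OF assms(1,2)] by auto
qed

lemma Ioc_integral_mono:
  fixes f g :: "real \<Rightarrow> real"
  assumes "f \<in> borel_measurable borel" "\<And>t. \<bar>f t\<bar> \<le> B" "g \<in> borel_measurable borel" "\<And>t. \<bar>g t\<bar> \<le> C"
    "\<And>t. a < t \<Longrightarrow> t \<le> b \<Longrightarrow> f t \<le> g t"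
  shows "(LINT s:{a<..b}|lborel. f s) \<le> (LINT s:{a<..b}|lborel. g s)"
  by (rule set_integral_mono[OF set_integrable_bounded_Ioc[OF assms(1,2)] set_integrable_bounded_Ioc[OF assms(3,4)]])
     (use assms(5) in auto)

lemma Ioc_integral_bound:
  fixes g :: "real \<Rightarrow> real"
  assumes "g \<in> borel_measurable borel" "\<And>t. \<bar>g t\<bar> \<le> B" "a \<le> b"
  shows "\<bar>LINT s:{a<..b}|lborel. g s\<bar> \<le> B * (b - a)"
proof -
  have B: "B \<ge> 0" using assms(2)[of 0] by linarith
  have c: "(LINT s:{a<..b}|lborel. c) = c * (b - a)" for c :: real
    using assms(3) by (simp add: set_lebesgue_integral_def)
  have "(LINT s:{a<..b}|lborel. g s) \<le> (LINT s:{a<..b}|lborel. B)"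
    by (rule Ioc_integral_mono[OF assms(1,2), where C=B]) (use assms(2) B in \<open>auto simp: abs_le_iff\<close>)
  moreover have "(LINT s:{a<..b}|lborel. - B) \<le> (LINT s:{a<..b}|lborel. g s)"
    by (rule Ioc_integral_mono[OF _ _ assms(1,2), where B=B]) (use assms(2) B in \<open>auto simp: abs_le_iff minus_le_iff\<close>)
  ultimately show ?thesis by (simp add: c abs_le_iff)
qed

text \<open>Only the integrals of \<open>w j\<close> converge, so the bound has to pass through
  increments: the positive parts of \<open>w j - hi\<close> are bounded and tend to 0, hence
  increments of \<open>x\<close> are at most those of an antiderivative \<open>H\<close> of
  \<open>hi\<close>. Comparing difference quotients where both are differentiable gives the
  pointwise bound.\<close>

lemma derivative_le_limsup:
  fixes w :: "nat \<Rightarrow> real \<Rightarrow> real" and x v hi :: "real \<Rightarrow> real"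
  assumes w[measurable]: "\<And>j. w j \<in> borel_measurable borel" and wb: "\<And>j t. \<bar>w j t\<bar> \<le> S"
    and hi[measurable]: "hi \<in> borel_measurable borel" and hib: "\<And>t. \<bar>hi t\<bar> \<le> S"
    and conv: "\<And>a b. 0 \<le> a \<Longrightarrow> a \<le> b \<Longrightarrow> b \<le> T \<Longrightarrow> (\<lambda>j. LINT s:{a<..b}|lborel. w j s) \<longlonglongrightarrow> x b - x a"
    and up: "AE s in lborel. 0 < s \<and> s < T \<longrightarrow> (\<forall>e>0. \<forall>\<^sub>F j in sequentially. w j s \<le> hi s + e)"
    and v: "AE t in lborel. (x has_real_derivative v t) (at t)"
  shows "AE t in lborel. 0 < t \<and> t < T \<longrightarrow> v t \<le> hi t"
proof -
  have S: "S \<ge> 0" using hib[of 0] by linarith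
  \<comment> \<open>Extended to negative times so that the differentiation theorem applies on the
    whole line.\<close>
  define H where "H t = (if t < 0 then - (LINT s:{t<..0}|lborel. hi s) else (LINT s:{0<..t}|lborel. hi s))" for t
  have H: "H b - H a = (LINT s:{a..b}|lborel. hi s)" if "a \<le> b" for a b
  proof -
    consider "b < 0" | "a < 0" "0 \<le> b" | "0 \<le> a" using that by linarith
    then show ?thesis
    proof cases
      case 1
      then show ?thesis using Ioc_integral_combine[OF hi hib, of a b 0] that by (simp add: H_def Icc_Ioc_integral)
    next
      case 2
      then show ?thesis using Ioc_integral_combine[OF hi hib, of a 0 b] by (simp add: H_def Icc_Ioc_integral)
    next
      case 3
      then show ?thesis using Ioc_integral_combine[OF hi hib, of 0 a b] that by (simp add: H_def Icc_Ioc_integral)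
    qed
  qed
  have H': "AE t in lborel. (H has_real_derivative hi t) (at t)"
    by (rule lebesgue_differentiation[OF hi hib H])
  have le: "x b - x a \<le> H b - H a" if ab: "0 < a" "a \<le> b" "b < T" for a b
  proof -
    define p where "p j s = max 0 (w j s - hi s)" for j s
    have pm[measurable]: "p j \<in> borel_measurable borel" for j unfolding p_def by measurable
    have pb: "\<bar>p j s\<bar> \<le> 2 * S" for j s using wb[of j s] hib[of s] S unfolding p_def by linarith
    have "(\<lambda>j. LINT s|lborel. indicator {a<..b} s *\<^sub>R p j s) \<longlonglongrightarrow> (LINT s|(lborel :: real measure). (0::real))"
    proof (rule integral_dominated_convergence[where w="\<lambda>s. 2 * S * indicator {a<..b} s"])
      show "integrable lborel (\<lambda>s. 2 * S * indicator {a<..b} s)"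
        by (intro integrable_mult_right integrable_real_indicator) (auto simp: emeasure_lborel_Ioc ab)
      show "AE s in lborel. (\<lambda>j. indicator {a<..b} s *\<^sub>R p j s) \<longlonglongrightarrow> 0"
        using up
      proof eventually_elim
        case (elim s)
        show ?case
        proof (cases "s \<in> {a<..b}")
          case True
          then have ev: "\<forall>e>0. \<forall>\<^sub>F j in sequentially. w j s \<le> hi s + e" using elim ab by auto
          have "(\<lambda>j. p j s) \<longlonglongrightarrow> 0"
          proof (rule tendstoI)
            fix e :: real assume e: "e > 0"
            then have "\<forall>\<^sub>F j in sequentially. w j s \<le> hi s + e / 2" using ev by simp
            then show "\<forall>\<^sub>F j in sequentially. dist (p j s) 0 < e"
              by eventually_elim (use e in \<open>auto simp: p_def\<close>)
          qed
          then show ?thesis using True by simp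
        qed simp
      qed
      show "AE s in lborel. norm (indicator {a<..b} s *\<^sub>R p j s) \<le> 2 * S * indicator {a<..b} s" for j
        using pb[of j] by (intro AE_I2) (auto simp: indicator_def)
    qed measurable
    then have "(\<lambda>j. LINT s:{a<..b}|lborel. p j s) \<longlonglongrightarrow> 0" by (simp add: set_lebesgue_integral_def)
    then have lim: "(\<lambda>j. (LINT s:{a<..b}|lborel. hi s) + (LINT s:{a<..b}|lborel. p j s)) \<longlonglongrightarrow> (LINT s:{a<..b}|lborel. hi s) + 0"
      by (intro tendsto_intros)
    have "(LINT s:{a<..b}|lborel. w j s) \<le> (LINT s:{a<..b}|lborel. hi s) + (LINT s:{a<..b}|lborel. p j s)" for j
    proof -
      have "(LINT s:{a<..b}|lborel. w j s) \<le> (LINT s:{a<..b}|lborel. hi s + p j s)"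
      proof (rule Ioc_integral_mono[OF w wb])
        show "\<bar>hi t + p j t\<bar> \<le> S + 2 * S" for t using hib[of t] pb[of j t] by linarith
        show "w j t \<le> hi t + p j t" for t unfolding p_def by linarith
      qed measurable
      also have "\<dots> = (LINT s:{a<..b}|lborel. hi s) + (LINT s:{a<..b}|lborel. p j s)"
        by (rule set_integral_add; rule set_integrable_bounded_Ioc[OF _ hib] set_integrable_bounded_Ioc[OF _ pb]; measurable)
      finally show ?thesis .
    qed
    then have "x b - x a \<le> (LINT s:{a<..b}|lborel. hi s) + 0"
      using LIMSEQ_le[OF conv lim] ab by auto
    then show ?thesis using H[OF ab(2)] Icc_Ioc_integral[OF hi] by simp
  qed
  show ?thesis
    using v H'
  proof eventually_elim
    case (elim t)
    show ?case
    proof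
      assume t: "0 < t \<and> t < T"
      have "((\<lambda>h. (x (t + h) - x t) / h) \<longlongrightarrow> v t) (at_right 0)" "((\<lambda>h. (H (t + h) - H t) / h) \<longlongrightarrow> hi t) (at_right 0)"
        by (rule tendsto_mono[OF at_le[OF subset_UNIV] elim(1)[unfolded DERIV_def]],
            rule tendsto_mono[OF at_le[OF subset_UNIV] elim(2)[unfolded DERIV_def]])
      moreover have "\<forall>\<^sub>F h in at_right 0. (x (t + h) - x t) / h \<le> (H (t + h) - H t) / h"
        unfolding eventually_at_right_field
      proof (intro exI[of _ "T - t"] conjI allI impI)
        fix h assume "0 < h" "h < T - t"
        then show "(x (t + h) - x t) / h \<le> (H (t + h) - H t) / h"
          using t by (intro divide_right_mono le) auto
      qed (use t in simp)
      ultimately show "v t \<le> hi t" by (intro tendsto_le[OF trivial_limit_at_right_real])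
    qed
  qed
qed

locale filippov =
  fixes F :: "real \<times> real \<Rightarrow> real" and S T :: real
  assumes F_measurable[measurable]: "F \<in> borel_measurable borel"
    and F_bound: "\<And>z. \<bar>F z\<bar> \<le> S"
    and T_pos: "0 < T"
begin

lemma S_nonneg: "0 \<le> S"
  using F_bound[of 0] by linarith

text \<open>\<open>F\<close> is meaningful only up to null sets, so its value at a point is replaced
  by its mean over the interval of half-width \<open>1 / (n + 1)\<close> around it.\<close>

definition window :: "nat \<Rightarrow> real \<Rightarrow> real \<Rightarrow> real" where
  "window n t y = real (Suc n) / 2 * (LINT z|lborel. indicator {y - 1 / real (Suc n)<..<y + 1 / real (Suc n)} z * F (t, z))"

lemma F_slice[measurable]: "(\<lambda>z. F (t, z)) \<in> borel_measurable borel"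
  by (rule measurable_slice) measurable

lemma window_integrable:
  "integrable lborel (\<lambda>z. indicator {y - h<..<y + h} z * F (t, z))"
proof (rule integrable_lborel_bounded_support[where B=S and R="\<bar>y\<bar> + \<bar>h\<bar>"])
  show "\<bar>indicator {y - h<..<y + h} z * F (t, z)\<bar> \<le> S" for z
    using F_bound[of "(t, z)"] S_nonneg by (auto simp: indicator_def)
qed (measurable, auto simp: indicator_def split: if_splits)

lemma window_le:
  assumes "AE z in lborel. y - 1 / real (Suc n) < z \<and> z < y + 1 / real (Suc n) \<longrightarrow> F (t, z) \<le> c"
  shows "window n t y \<le> c"
proof -
  define h where "h = 1 / real (Suc n)"
  have h: "h > 0" by (simp add: h_def)
  have "(LINT z|lborel. indicator {y - h<..<y + h} z * F (t, z)) \<le> (LINT z|lborel. c * indicator {y - h<..<y + h} z)"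
  proof (rule integral_mono_AE[OF window_integrable])
    show "integrable lborel (\<lambda>z. c * indicator {y - h<..<y + h} z)"
      using h by (intro integrable_mult_right integrable_real_indicator) auto
    show "AE z in lborel. indicator {y - h<..<y + h} z * F (t, z) \<le> c * indicator {y - h<..<y + h} z"
      using assms unfolding h_def by eventually_elim (auto simp: indicator_def)
  qed
  also have "\<dots> = c * (2 * h)" using h by simp
  finally have "real (Suc n) / 2 * (LINT z|lborel. indicator {y - h<..<y + h} z * F (t, z)) \<le> real (Suc n) / 2 * (c * (2 * h))"
    by (rule mult_left_mono) simp
  also have "\<dots> = c" by (simp add: h_def)
  finally show ?thesis unfolding window_def h_def .
qed

lemma window_bound: "\<bar>window n t y\<bar> \<le> S"
proof -
  interpret neg: filippov "\<lambda>z. - F z" S T by unfold_locales (use F_bound T_pos in auto)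
  have "window n t y \<le> S" using F_bound by (intro window_le AE_I2) (auto simp: abs_le_iff)
  moreover have "neg.window n t y \<le> S" using F_bound by (intro neg.window_le AE_I2) (auto simp: abs_le_iff minus_le_iff)
  moreover have "neg.window n t y = - window n t y" unfolding neg.window_def window_def by simp
  ultimately show ?thesis by linarith
qed

lemma window_measurable:
  assumes [measurable]: "c \<in> borel_measurable borel"
  shows "(\<lambda>t. window n t (c t)) \<in> borel_measurable borel"
proof -
  have fm[measurable]: "(fst :: real \<times> real \<Rightarrow> real) \<in> borel_measurable borel" "(snd :: real \<times> real \<Rightarrow> real) \<in> borel_measurable borel"
    by (intro borel_measurable_continuous_onI continuous_intros)+
  have "(\<lambda>p. indicator {-1 / real (Suc n)<..<1 / real (Suc n)} (snd p - c (fst p)) * F p) \<in> borel_measurable borel"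
    by measurable
  then have m: "(\<lambda>(t, z). indicator {-1 / real (Suc n)<..<1 / real (Suc n)} (z - c t) * F (t, z)) \<in> borel_measurable (lborel \<Otimes>\<^sub>M lborel)"
    unfolding lborel_prod by (simp add: case_prod_beta')
  have "(\<lambda>t. LINT z|lborel. indicator {-1 / real (Suc n)<..<1 / real (Suc n)} (z - c t) * F (t, z)) \<in> borel_measurable lborel"
    by (rule lborel.borel_measurable_lebesgue_integral[OF m])
  moreover have "indicator {-1 / real (Suc n)<..<1 / real (Suc n)} (z - c t) = indicat_real {c t - 1 / real (Suc n)<..<c t + 1 / real (Suc n)} z" for z t
    by (auto simp: indicator_def)
  ultimately have [measurable]: "(\<lambda>t. LINT z|lborel. indicator {c t - 1 / real (Suc n)<..<c t + 1 / real (Suc n)} z * F (t, z)) \<in> borel_measurable borel"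
    by (simp only: measurable_lborel2)
  show ?thesis unfolding window_def by measurable
qed

text \<open>Euler polygon with time step \<open>1 / (n + 1)\<close>. During a step the position is
  frozen at the last node, so a step is a plain integral in time and no solution theory for a
  differential equation is involved.\<close>

primrec node :: "nat \<Rightarrow> nat \<Rightarrow> real" where
  "node n 0 = 0"
| "node n (Suc k) = node n k + (LINT s:{real k / real (Suc n)<..real (Suc k) / real (Suc n)}|lborel. window n s (node n k))"

definition speed :: "nat \<Rightarrow> real \<Rightarrow> real" where
  "speed n s = window n s (node n (nat \<lfloor>real (Suc n) * s\<rfloor>))"

lemma speed_measurable[measurable]: "speed n \<in> borel_measurable borel"
  unfolding speed_def[abs_def] by (rule window_measurable) measurable

lemma speed_bound: "\<bar>speed n s\<bar> \<le> S"
  unfolding speed_def by (rule window_bound)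

definition approx :: "nat \<Rightarrow> real \<Rightarrow> real" where
  "approx n t = (LINT s:{0<..t}|lborel. speed n s)"

lemma approx_diff:
  assumes "0 \<le> a" "a \<le> b"
  shows "approx n b - approx n a = (LINT s:{a<..b}|lborel. speed n s)"
  using Ioc_integral_combine[OF speed_measurable speed_bound assms, of n] by (simp add: approx_def)

lemma approx_lipschitz:
  assumes "0 \<le> a" "0 \<le> b"
  shows "\<bar>approx n a - approx n b\<bar> \<le> S * \<bar>a - b\<bar>"
proof -
  have 1: "\<bar>approx n d - approx n c\<bar> \<le> S * (d - c)" if "0 \<le> c" "c \<le> d" for c d
    unfolding approx_diff[OF that] by (rule Ioc_integral_bound[OF speed_measurable speed_bound that(2)])
  show ?thesis
    using 1[of a b] 1[of b a] assms by (cases "a \<le> b") (simp_all add: abs_minus_commute)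
qed

lemma approx_node: "approx n (real k / real (Suc n)) = node n k"
proof (induction k)
  case 0
  then show ?case by (simp add: approx_def set_lebesgue_integral_def)
next
  case (Suc k)
  let ?a = "real k / real (Suc n)" and ?b = "real (Suc k) / real (Suc n)"
  have ab: "0 \<le> ?a" "?a \<le> ?b" by (auto intro: divide_right_mono)
  have "(LINT s:{?a<..?b}|lborel. speed n s) = (LINT s:{?a<..?b}|lborel. window n s (node n k))"
    unfolding set_lebesgue_integral_def
  proof (rule integral_cong_AE)
    show "AE s in lborel. indicator {?a<..?b} s *\<^sub>R speed n s = indicator {?a<..?b} s *\<^sub>R window n s (node n k)"
      using AE_lborel_singleton[of ?b]
    proof eventually_elim
      case (elim s)
      show ?case
      proof (cases "s \<in> {?a<..?b}")
        case True
        then have "?a < s" "s < ?b" using elim by auto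
        then have "real k < real (Suc n) * s" "real (Suc n) * s < real (Suc k)"
          by (simp_all add: pos_divide_less_eq pos_less_divide_eq mult.commute del: of_nat_Suc)
        then have "\<lfloor>real (Suc n) * s\<rfloor> = int k" by (intro floor_unique) simp_all
        then show ?thesis by (simp add: speed_def)
      qed simp
    qed
    have "(\<lambda>s. window n s (node n k)) \<in> borel_measurable borel" by (rule window_measurable) simp
    then show "(\<lambda>s. indicator {?a<..?b} s *\<^sub>R window n s (node n k)) \<in> borel_measurable lborel" by simp
  qed simp
  then show ?case using approx_diff[OF ab, of n] Suc by simp
qed

lemma node_close:
  assumes "0 \<le> s"
  shows "\<bar>node n (nat \<lfloor>real (Suc n) * s\<rfloor>) - approx n s\<bar> \<le> S / real (Suc n)"
proof -
  define k where "k = nat \<lfloor>real (Suc n) * s\<rfloor>"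
  have "0 \<le> real (Suc n) * s" using assms by simp
  then have k: "real k \<le> real (Suc n) * s" "real (Suc n) * s < real k + 1"
    unfolding k_def by linarith+
  have "real k / real (Suc n) \<le> s" "s - real k / real (Suc n) \<le> 1 / real (Suc n)"
    using k by (simp_all add: pos_divide_le_eq pos_le_divide_eq mult.commute diff_le_eq add_divide_distrib[symmetric] del: of_nat_Suc)
  then have "\<bar>real k / real (Suc n) - s\<bar> \<le> 1 / real (Suc n)" by linarith
  then have "S * \<bar>real k / real (Suc n) - s\<bar> \<le> S * (1 / real (Suc n))" by (rule mult_left_mono) (rule S_nonneg)
  moreover have "\<bar>approx n (real k / real (Suc n)) - approx n s\<bar> \<le> S * \<bar>real k / real (Suc n) - s\<bar>"
    by (rule approx_lipschitz) (use assms in simp_all)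
  ultimately show ?thesis unfolding approx_node k_def by simp
qed

text \<open>The polygons are uniformly Lipschitz, so a subsequence converges uniformly. At a time
  with both traces, almost all values of \<open>F\<close> near the path lie within \<open>e\<close>
  of the hull of the traces; eventually the windows fit into that neighbourhood, so the polygon
  speeds do as well, and the bound passes to the limit. The traces are quantified after
  \<open>x\<close> because they become available only once the path is fixed.\<close>

theorem generalized_characteristic:
  obtains x where "S-lipschitz_on UNIV x" "x 0 = 0"
    "\<And>v Fp Fm. AE t in lborel. (x has_real_derivative v t) (at t) \<Longrightarrow>
      has_trace T x 1 F Fp \<Longrightarrow> has_trace T x (-1) F Fm \<Longrightarrow> (\<And>t. \<bar>Fp t\<bar> \<le> S) \<Longrightarrow> (\<And>t. \<bar>Fm t\<bar> \<le> S) \<Longrightarrow>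
      AE t in lborel. 0 < t \<and> t < T \<longrightarrow> min (Fp t) (Fm t) \<le> v t \<and> v t \<le> max (Fp t) (Fm t)"
proof -
  obtain g k where g: "continuous_on {0..T} g" and k: "strict_mono (k :: nat \<Rightarrow> nat)"
    and conv: "\<And>e. 0 < e \<Longrightarrow> \<exists>N. \<forall>n t. n \<ge> N \<and> t \<in> {0..T} \<longrightarrow> norm (approx (k n) t - g t) < e"
  proof (rule Arzela_Ascoli[of "{0..T}" approx "S * T"])
    show "norm (approx n t) \<le> S * T" if "t \<in> {0..T}" for n t
    proof -
      have "\<bar>approx n t - approx n 0\<bar> \<le> S * \<bar>t - 0\<bar>" using that by (intro approx_lipschitz) auto
      also have "\<dots> \<le> S * T" using that S_nonneg by (intro mult_left_mono) auto
      finally show ?thesis by (simp add: approx_def set_lebesgue_integral_def)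
    qed
    show "\<exists>d>0. \<forall>n y. y \<in> {0..T} \<and> norm (t - y) < d \<longrightarrow> norm (approx n t - approx n y) < e"
      if "t \<in> {0..T}" "0 < e" for t e
    proof (intro exI[of _ "e / (S + 1)"] conjI allI impI)
      show "0 < e / (S + 1)" using that S_nonneg by simp
      fix n y assume y: "y \<in> {0..T} \<and> norm (t - y) < e / (S + 1)"
      have "norm (approx n t - approx n y) \<le> S * \<bar>t - y\<bar>" using approx_lipschitz[of t y n] that y by simp
      also have "\<dots> \<le> (S + 1) * \<bar>t - y\<bar>" by (simp add: mult_right_mono)
      also have "\<dots> < e" using y S_nonneg by (simp add: pos_less_divide_eq mult.commute)
      finally show "norm (approx n t - approx n y) < e" .
    qed
  qed auto
  have lim: "(\<lambda>n. approx (k n) t) \<longlonglongrightarrow> g t" if "t \<in> {0..T}" for t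
  proof (rule LIMSEQ_I)
    fix e :: real assume "e > 0"
    then show "\<exists>no. \<forall>n\<ge>no. norm (approx (k n) t - g t) < e" using conv[of e] that by blast
  qed
  \<comment> \<open>Clamping time extends the limit path to the whole line with the same Lipschitz
    constant.\<close>
  define c where "c t = max 0 (min T t)" for t
  have c: "c t \<in> {0..T}" "\<bar>c s - c t\<bar> \<le> \<bar>s - t\<bar>" for s t using T_pos by (auto simp: c_def)
  have cid: "c t = t" if "t \<in> {0..T}" for t using that by (simp add: c_def)
  define x where "x t = g (c t)" for t
  have xlim: "(\<lambda>n. approx (k n) t) \<longlonglongrightarrow> x t" if "t \<in> {0..T}" for t
    using lim[OF that] cid[OF that] by (simp add: x_def)
  show thesis
  proof (rule that)
    show "S-lipschitz_on UNIV x"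
    proof (rule lipschitz_onI)
      fix s t
      have A: "(\<lambda>n. \<bar>approx (k n) (c s) - approx (k n) (c t)\<bar>) \<longlonglongrightarrow> \<bar>x s - x t\<bar>"
        unfolding x_def by (intro tendsto_intros lim c)
      have B: "\<bar>approx (k n) (c s) - approx (k n) (c t)\<bar> \<le> S * \<bar>s - t\<bar>" for n
      proof -
        have "\<bar>approx (k n) (c s) - approx (k n) (c t)\<bar> \<le> S * \<bar>c s - c t\<bar>"
          using c(1)[of s] c(1)[of t] by (intro approx_lipschitz) auto
        also have "\<dots> \<le> S * \<bar>s - t\<bar>" by (intro mult_left_mono c S_nonneg)
        finally show ?thesis .
      qed
      have "\<bar>x s - x t\<bar> \<le> S * \<bar>s - t\<bar>" by (rule LIMSEQ_le_const2[OF A]) (use B in blast)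
      then show "dist (x s) (x t) \<le> S * dist s t" by (simp add: dist_real_def)
    qed (rule S_nonneg)
    have "(\<lambda>n. approx (k n) 0) \<longlonglongrightarrow> x 0" by (rule xlim) (use T_pos in simp)
    moreover have "approx n 0 = 0" for n by (simp add: approx_def set_lebesgue_integral_def)
    ultimately show "x 0 = 0" by (simp add: LIMSEQ_const_iff)
    fix v Fp Fm
    assume v: "AE t in lborel. (x has_real_derivative v t) (at t)"
      and tr: "has_trace T x 1 F Fp" "has_trace T x (-1) F Fm"
      and b: "\<And>t. \<bar>Fp t\<bar> \<le> S" "\<And>t. \<bar>Fm t\<bar> \<le> S"
    have [measurable]: "Fp \<in> borel_measurable borel" "Fm \<in> borel_measurable borel"
      using tr by (auto simp: has_trace_def)
    have sconv: "(\<lambda>j. LINT s:{a<..b}|lborel. speed (k j) s) \<longlonglongrightarrow> x b - x a" if "0 \<le> a" "a \<le> b" "b \<le> T" for a b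
      using tendsto_diff[OF xlim[of b] xlim[of a]] that by (simp add: approx_diff)
    have nconv: "(\<lambda>j. node (k j) (nat \<lfloor>real (Suc (k j)) * s\<rfloor>)) \<longlonglongrightarrow> x s" if s: "0 < s" "s < T" for s
    proof -
      have ri: "(\<lambda>j. S / real (Suc (k j))) \<longlonglongrightarrow> 0"
      proof -
        have "(\<lambda>n. S * inverse (real (Suc n))) \<longlonglongrightarrow> S * 0" by (intro tendsto_intros LIMSEQ_inverse_real_of_nat)
        from LIMSEQ_subseq_LIMSEQ[OF this k] show ?thesis by (simp add: o_def divide_inverse)
      qed
      have "(\<lambda>j. node (k j) (nat \<lfloor>real (Suc (k j)) * s\<rfloor>) - approx (k j) s) \<longlonglongrightarrow> 0"
        by (rule Lim_null_comparison[OF _ ri]) (use node_close s in simp)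
      from tendsto_add[OF this xlim[of s]] show ?thesis using s by simp
    qed
    have width: "(\<lambda>j. 1 / real (Suc (k j))) \<longlonglongrightarrow> 0"
      using LIMSEQ_subseq_LIMSEQ[OF LIMSEQ_inverse_real_of_nat k] by (simp add: o_def inverse_eq_divide)
    have ae: "AE t in lborel. 0 < t \<and> t < T \<longrightarrow> ((\<lambda>y. F (t, x t + 1 * y)) \<longlongrightarrow> Fp t) ess_at_right_0"
      "AE t in lborel. 0 < t \<and> t < T \<longrightarrow> ((\<lambda>y. F (t, x t + (-1) * y)) \<longlongrightarrow> Fm t) ess_at_right_0"
      using tr unfolding has_trace_def by blast+
    have near: "\<exists>\<delta>>0. AE z in lborel. \<bar>z - x t\<bar> < \<delta> \<longrightarrow> min (Fp t) (Fm t) - e \<le> F (t, z) \<and> F (t, z) \<le> max (Fp t) (Fm t) + e"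
      if e: "e > 0" and lims: "((\<lambda>y. F (t, x t + 1 * y)) \<longlongrightarrow> Fp t) ess_at_right_0" "((\<lambda>y. F (t, x t + (-1) * y)) \<longlongrightarrow> Fm t) ess_at_right_0" for t e
    proof -
      obtain d1 where d1: "d1 > 0" "AE y in lborel. 0 < y \<and> y < d1 \<longrightarrow> dist (F (t, x t + 1 * y)) (Fp t) < e"
        using tendstoD[OF lims(1) e] unfolding eventually_ess_at_right_0 by blast
      obtain d2 where d2: "d2 > 0" "AE y in lborel. 0 < y \<and> y < d2 \<longrightarrow> dist (F (t, x t + (-1) * y)) (Fm t) < e"
        using tendstoD[OF lims(2) e] unfolding eventually_ess_at_right_0 by blast
      have "AE z in lborel. 0 < z - x t \<and> z - x t < d1 \<longrightarrow> dist (F (t, x t + 1 * (z - x t))) (Fp t) < e"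
      proof -
        have "AE z in distr lborel borel ((+) (- x t)). 0 < z \<and> z < d1 \<longrightarrow> dist (F (t, x t + 1 * z)) (Fp t) < e"
          unfolding lborel_distr_plus by (rule d1(2))
        from AE_distrD[OF _ this] show ?thesis by simp
      qed
      moreover have "AE z in lborel. 0 < x t - z \<and> x t - z < d2 \<longrightarrow> dist (F (t, x t + (-1) * (x t - z))) (Fm t) < e"
        using AE_lborel_reflect[OF d2(2), of "x t"] .
      ultimately have "AE z in lborel. \<bar>z - x t\<bar> < min d1 d2 \<longrightarrow> min (Fp t) (Fm t) - e \<le> F (t, z) \<and> F (t, z) \<le> max (Fp t) (Fm t) + e"
        using AE_lborel_singleton[of "x t"]
      proof eventually_elim
        case (elim z)
        show ?case
        proof
          assume z: "\<bar>z - x t\<bar> < min d1 d2"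
          show "min (Fp t) (Fm t) - e \<le> F (t, z) \<and> F (t, z) \<le> max (Fp t) (Fm t) + e"
          proof (cases "z > x t")
            case True
            then have "\<bar>F (t, z) - Fp t\<bar> < e" using elim(1) z by (simp add: dist_real_def)
            then show ?thesis by linarith
          next
            case False
            then have "\<bar>F (t, z) - Fm t\<bar> < e" using elim(2,3) z by (simp add: dist_real_def)
            then show ?thesis by linarith
          qed
        qed
      qed
      then show ?thesis using d1(1) d2(1) by (intro exI[of _ "min d1 d2"]) simp
    qed
    \<comment> \<open>Lower bounds for windows of \<open>F\<close> are upper bounds for windows of
      the reflected field.\<close>
    interpret neg: filippov "\<lambda>z. - F z" S T by unfold_locales (use F_bound T_pos in auto)
    have nw: "neg.window n t y = - window n t y" for n t y unfolding neg.window_def window_def by simp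
    have squeeze: "AE s in lborel. 0 < s \<and> s < T \<longrightarrow> (\<forall>e>0. \<forall>\<^sub>F j in sequentially.
        min (Fp s) (Fm s) - e \<le> speed (k j) s \<and> speed (k j) s \<le> max (Fp s) (Fm s) + e)"
      using ae
    proof eventually_elim
      case (elim t)
      show ?case
      proof (intro impI allI)
        fix e :: real assume t: "0 < t \<and> t < T" and e: "e > 0"
        obtain \<delta> where \<delta>: "\<delta> > 0" "AE z in lborel. \<bar>z - x t\<bar> < \<delta> \<longrightarrow> min (Fp t) (Fm t) - e \<le> F (t, z) \<and> F (t, z) \<le> max (Fp t) (Fm t) + e"
          using near[OF e, of t] elim t by blast
        have "\<forall>\<^sub>F j in sequentially. dist (node (k j) (nat \<lfloor>real (Suc (k j)) * t\<rfloor>)) (x t) < \<delta> / 2"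
          using tendstoD[OF nconv, of t "\<delta> / 2"] t \<delta>(1) by simp
        moreover have "\<forall>\<^sub>F j in sequentially. 1 / real (Suc (k j)) < \<delta> / 2"
          using order_tendstoD(2)[OF width, of "\<delta> / 2"] \<delta>(1) by simp
        ultimately show "\<forall>\<^sub>F j in sequentially. min (Fp t) (Fm t) - e \<le> speed (k j) t \<and> speed (k j) t \<le> max (Fp t) (Fm t) + e"
        proof eventually_elim
          case (elim j)
          let ?y = "node (k j) (nat \<lfloor>real (Suc (k j)) * t\<rfloor>)"
          have in\<delta>: "\<bar>z - x t\<bar> < \<delta>" if "?y - 1 / real (Suc (k j)) < z \<and> z < ?y + 1 / real (Suc (k j))" for z
            using that elim unfolding dist_real_def by linarith
          have "window (k j) t ?y \<le> max (Fp t) (Fm t) + e"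
            using \<delta>(2) by (intro window_le, eventually_elim) (use in\<delta> in blast)
          moreover have "neg.window (k j) t ?y \<le> - (min (Fp t) (Fm t) - e)"
          proof (rule neg.window_le)
            show "AE z in lborel. ?y - 1 / real (Suc (k j)) < z \<and> z < ?y + 1 / real (Suc (k j)) \<longrightarrow> - F (t, z) \<le> - (min (Fp t) (Fm t) - e)"
              using \<delta>(2)
            proof eventually_elim
              case (elim z)
              show ?case
              proof
                assume "?y - 1 / real (Suc (k j)) < z \<and> z < ?y + 1 / real (Suc (k j))"
                then have "min (Fp t) (Fm t) - e \<le> F (t, z)" using elim in\<delta> by blast
                then show "- F (t, z) \<le> - (min (Fp t) (Fm t) - e)" by linarith
              qed
            qed
          qed
          ultimately show ?case unfolding nw speed_def by linarith
        qed
      qed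
    qed
    have "AE t in lborel. 0 < t \<and> t < T \<longrightarrow> v t \<le> max (Fp t) (Fm t)"
    proof (rule derivative_le_limsup[OF _ speed_bound[of "k _"] _ _ sconv _ v])
      show "AE s in lborel. 0 < s \<and> s < T \<longrightarrow> (\<forall>e>0. \<forall>\<^sub>F j in sequentially. speed (k j) s \<le> max (Fp s) (Fm s) + e)"
        using squeeze
      proof eventually_elim
        case (elim s)
        then show ?case by (auto elim: eventually_mono)
      qed
      show "\<bar>max (Fp t) (Fm t)\<bar> \<le> S" for t using b[of t] by linarith
    qed measurable
    moreover have "AE t in lborel. 0 < t \<and> t < T \<longrightarrow> - v t \<le> - min (Fp t) (Fm t)"
    proof (rule derivative_le_limsup[where w="\<lambda>j s. - speed (k j) s" and x="\<lambda>t. - x t" and S=S])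
      show "AE s in lborel. 0 < s \<and> s < T \<longrightarrow> (\<forall>e>0. \<forall>\<^sub>F j in sequentially. - speed (k j) s \<le> - min (Fp s) (Fm s) + e)"
        using squeeze
      proof eventually_elim
        case (elim s)
        show ?case
        proof (intro impI allI)
          fix e :: real assume s: "0 < s \<and> s < T" and e: "e > 0"
          have "\<forall>\<^sub>F j in sequentially. min (Fp s) (Fm s) - e \<le> speed (k j) s \<and> speed (k j) s \<le> max (Fp s) (Fm s) + e"
            using elim s e by blast
          then show "\<forall>\<^sub>F j in sequentially. - speed (k j) s \<le> - min (Fp s) (Fm s) + e"
            by eventually_elim linarith
        qed
      qed
      show "\<bar>- min (Fp t) (Fm t)\<bar> \<le> S" for t using b[of t] by linarith
      show "\<bar>- speed (k j) t\<bar> \<le> S" for j t using speed_bound[of "k j" t] by simp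
      show "(\<lambda>j. LINT s:{a<..b}|lborel. - speed (k j) s) \<longlonglongrightarrow> - x b - - x a" if "0 \<le> a" "a \<le> b" "b \<le> T" for a b
        using tendsto_minus[OF sconv[OF that]] by (simp add: set_lebesgue_integral_def)
      show "AE t in lborel. ((\<lambda>t. - x t) has_real_derivative - v t) (at t)"
        using v by eventually_elim (rule DERIV_minus)
    qed measurable
    ultimately show "AE t in lborel. 0 < t \<and> t < T \<longrightarrow> min (Fp t) (Fm t) \<le> v t \<and> v t \<le> max (Fp t) (Fm t)"
      by eventually_elim linarith
  qed
qed

end

section \<open>Borel versions of the solution and of its traces; balance laws on the whole
  plane\<close>

section \<open>Representatives and traces of the solution\<close>

lemma AE_strip:
  "(AE z in strip T. Q z) \<longleftrightarrow> (AE z in lborel. fst z \<in> {0..T} \<longrightarrow> Q z)"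
proof -
  have m: "{0..T} \<times> (UNIV :: real set) \<in> sets lebesgue"
    by (intro lborelD sets_completionI_sets) (auto intro: borel_Times)
  have "(AE z in strip T. Q z) \<longleftrightarrow> (AE z in lebesgue. z \<in> {0..T} \<times> UNIV \<longrightarrow> Q z)"
    using m by (intro AE_restrict_space_iff) auto
  also have "\<dots> \<longleftrightarrow> (AE z in lborel. z \<in> {0..T} \<times> UNIV \<longrightarrow> Q z)" by (rule AE_completion_iff)
  also have "\<dots> \<longleftrightarrow> (AE z in lborel. fst z \<in> {0..T} \<longrightarrow> Q z)" by (simp add: mem_Times_iff)
  finally show ?thesis .
qed

lemma strip_positive:
  assumes "T > 0" "AE z in strip T. Q z"
  shows "\<exists>z. Q z"
proof (rule ccontr)
  assume "\<nexists>z. Q z"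
  define V where "V = {0<..<T} \<times> {0<..<(1::real)}"
  have "AE z in lborel. z \<notin> V"
    using assms(2)[unfolded AE_strip]
  proof eventually_elim
    case (elim z)
    then show ?case using \<open>\<nexists>z. Q z\<close> by (cases z) (auto simp: V_def)
  qed
  moreover have V: "open V" "V \<noteq> {}" using assms(1) by (auto simp: V_def open_Times)
  ultimately have "V \<in> null_sets lborel" by (subst (asm) AE_iff_null_sets[symmetric]) auto
  then have "negligible V" by (simp add: negligible_iff_null_sets null_sets_completionI)
  then show False using open_not_negligible[OF V] by blast
qed

lemma ess_bounded_uminus: "ess_bounded T u \<Longrightarrow> ess_bounded T (\<lambda>t x. - u t x)"
  unfolding ess_bounded_def by (auto simp: case_prod_beta')

text \<open>\<open>real_of_ereal\<close> sends infinite values to 0, so the essential supremum has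
  to be shown finite. Its bound from below relies on the strip having positive measure.\<close>

lemma AE_le_sup_u:
  assumes T: "T > 0" and u: "ess_bounded T u"
  shows "AE z in strip T. u (fst z) (snd z) \<le> sup_u T u"
proof -
  obtain B where m: "(\<lambda>(t, x). u t x) \<in> borel_measurable (strip T)" and B: "AE (t, x) in strip T. \<bar>u t x\<bar> \<le> B"
    using u unfolding ess_bounded_def by blast
  define g where "g = (\<lambda>(t, x). ereal (u t x))"
  have gm: "g \<in> borel_measurable (strip T)" using m unfolding g_def by (simp add: case_prod_beta')
  have up: "esssup (strip T) g \<le> ereal B"
  proof (rule esssup_I[OF gm])
    show "AE z in strip T. g z \<le> ereal B" using B by eventually_elim (auto simp: g_def abs_le_iff)
  qed
  have ae: "AE z in strip T. g z \<le> esssup (strip T) g" by (rule esssup_AE)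
  have "AE z in strip T. ereal (- B) \<le> esssup (strip T) g"
    using ae B by eventually_elim (auto simp: g_def abs_le_iff intro: order_trans[rotated])
  then have lo: "ereal (- B) \<le> esssup (strip T) g" using strip_positive[OF T] by blast
  have fin: "ereal (sup_u T u) = esssup (strip T) g"
    using up lo unfolding sup_u_def g_def by (intro ereal_real') auto
  show ?thesis using ae unfolding fin[symmetric] by eventually_elim (auto simp: g_def)
qed

lemma AE_inf_u_le:
  assumes T: "T > 0" and u: "ess_bounded T u"
  shows "AE z in strip T. inf_u T u \<le> u (fst z) (snd z)"
  using AE_le_sup_u[OF T ess_bounded_uminus[OF u]] unfolding inf_u_def by eventually_elim simp

text \<open>\<open>[lo, hi]\<close> contains the essential range of \<open>u\<close>, so clipping a
  Borel version to it changes nothing almost everywhere in the strip. All later bounds then hold at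
  every point of the plane.\<close>

lemma borel_representative:
  assumes T: "T > 0" and u: "ess_bounded T u"
    and lo: "lo \<le> inf_u T u" and hi: "sup_u T u \<le> hi" "lo \<le> hi"
  obtains w :: "real \<times> real \<Rightarrow> real" where "w \<in> borel_measurable borel" "\<And>z. w z \<in> {lo..hi}"
    "AE z in lborel. fst z \<in> {0..T} \<longrightarrow> w z = u (fst z) (snd z)"
proof -
  have m: "(\<lambda>z. u (fst z) (snd z)) \<in> borel_measurable (strip T)"
    using u unfolding ess_bounded_def by (simp add: case_prod_beta')
  have St: "{0..T} \<times> (UNIV :: real set) \<in> sets lebesgue"
    by (intro lborelD sets_completionI_sets) (auto intro: borel_Times)
  have "(\<lambda>z. if z \<in> {0..T} \<times> UNIV then u (fst z) (snd z) else 0) \<in> borel_measurable lebesgue"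
    using m by (intro borel_measurable_if_I[OF _ St])
  from completion_ex_borel_measurable_real[OF this]
  obtain g where g: "g \<in> borel_measurable lborel" "AE z in lborel. (if z \<in> {0..T} \<times> UNIV then u (fst z) (snd z) else 0) = g z"
    by blast
  have [measurable]: "g \<in> borel_measurable borel" using g(1) by simp
  show thesis
  proof (rule that)
    show "(\<lambda>z. max lo (min hi (g z))) \<in> borel_measurable borel" by measurable
    show "max lo (min hi (g z)) \<in> {lo..hi}" for z using hi(2) by auto
    show "AE z in lborel. fst z \<in> {0..T} \<longrightarrow> max lo (min hi (g z)) = u (fst z) (snd z)"
      using g(2) AE_le_sup_u[OF T u, unfolded AE_strip] AE_inf_u_le[OF T u, unfolded AE_strip]
    proof eventually_elim
      case (elim z)
      show ?case
      proof
        assume z: "fst z \<in> {0..T}"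
        then have "g z = u (fst z) (snd z)" using elim(1) by (simp add: mem_Times_iff split: if_splits)
        then show "max lo (min hi (g z)) = u (fst z) (snd z)" using elim(2,3) z lo hi by simp
      qed
    qed
  qed
qed

lemma lebesgue_integral_AE_borel:
  fixes f g :: "'a::euclidean_space \<Rightarrow> real"
  assumes g: "g \<in> borel_measurable borel" and "AE z in lborel. f z = g z"
  shows "(LINT z|lebesgue. f z) = (LINT z|lborel. g z)" "f \<in> borel_measurable lebesgue"
proof -
  have ae: "AE z in lebesgue. f z = g z" using assms(2) by (rule AE_completion)
  have gl: "g \<in> borel_measurable lebesgue" using g by (intro measurable_completion) simp
  have eq: "AE z in lebesgue. g z = f z" using ae by eventually_elim simp
  show fm: "f \<in> borel_measurable lebesgue"
    using borel_measurable_AE[OF gl eq] .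
  have "(LINT z|lebesgue. f z) = (LINT z|lebesgue. g z)" by (rule integral_cong_AE[OF fm gl ae])
  also have "\<dots> = (LINT z|lborel. g z)" using g by (intro integral_completion) simp
  finally show "(LINT z|lebesgue. f z) = (LINT z|lborel. g z)" .
qed

text \<open>A point outside the open strip has a neighbourhood where \<open>\<phi>\<close> is zero,
  as the closed support stays inside. The vanishing derivatives let an integral over the strip be
  written over the whole plane.\<close>

lemma test_function_derivs:
  assumes "test_function T \<phi>"
  obtains \<phi>t \<phi>x where "continuous_on UNIV \<phi>t" "continuous_on UNIV \<phi>x"
    "\<And>z. deriv (\<lambda>s. \<phi> (s, snd z)) (fst z) = \<phi>t z" "\<And>z. deriv (\<lambda>y. \<phi> (fst z, y)) (snd z) = \<phi>x z"
    "\<And>z. fst z \<notin> {0<..<T} \<Longrightarrow> \<phi>t z = 0 \<and> \<phi>x z = 0"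
proof -
  have "C_k (Suc 0) \<phi>" using assms unfolding test_function_def by blast
  from C_k_SucD[OF this] obtain \<phi>t \<phi>x
    where d: "\<forall>z. (\<phi> has_derivative (\<lambda>w. fst w * \<phi>t z + snd w * \<phi>x z)) (at z)" and c: "C_k 0 \<phi>t" "C_k 0 \<phi>x" by blast
  have dt: "((\<lambda>s. \<phi> (s, snd z)) has_real_derivative \<phi>t z) (at (fst z))"
    and dx: "((\<lambda>y. \<phi> (fst z, y)) has_real_derivative \<phi>x z) (at (snd z))" for z
  proof -
    have 1: "((\<lambda>s. (s, snd z)) has_derivative (\<lambda>h. (h, 0))) (at (fst z))"
      and 2: "((\<lambda>y. (fst z, y)) has_derivative (\<lambda>h. (0, h))) (at (snd z))"
      by (intro has_derivative_Pair has_derivative_ident has_derivative_const)+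
    have "((\<lambda>s. \<phi> (s, snd z)) has_derivative (\<lambda>h. fst (h, 0) * \<phi>t z + snd (h, 0) * \<phi>x z)) (at (fst z))"
      using has_derivative_compose[OF 1, of \<phi> "\<lambda>w. fst w * \<phi>t z + snd w * \<phi>x z"] d[rule_format, of z] by simp
    then show "((\<lambda>s. \<phi> (s, snd z)) has_real_derivative \<phi>t z) (at (fst z))"
      by (simp add: has_field_derivative_def mult_commute_abs)
    have "((\<lambda>y. \<phi> (fst z, y)) has_derivative (\<lambda>h. fst (0, h) * \<phi>t z + snd (0, h) * \<phi>x z)) (at (snd z))"
      using has_derivative_compose[OF 2, of \<phi> "\<lambda>w. fst w * \<phi>t z + snd w * \<phi>x z"] d[rule_format, of z] by simp
    then show "((\<lambda>y. \<phi> (fst z, y)) has_real_derivative \<phi>x z) (at (snd z))"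
      by (simp add: has_field_derivative_def mult_commute_abs)
  qed
  show thesis
  proof (rule that)
    show "continuous_on UNIV \<phi>t" "continuous_on UNIV \<phi>x" using c by simp_all
    show "deriv (\<lambda>s. \<phi> (s, snd z)) (fst z) = \<phi>t z" "deriv (\<lambda>y. \<phi> (fst z, y)) (snd z) = \<phi>x z" for z
      by (rule DERIV_imp_deriv[OF dt], rule DERIV_imp_deriv[OF dx])
    fix z :: "real \<times> real" assume z: "fst z \<notin> {0<..<T}"
    define V where "V = - closure {z. \<phi> z \<noteq> 0}"
    have V: "open V" "z \<in> V" using assms z unfolding V_def test_function_def by auto
    have zero: "\<phi> y = 0" if "y \<in> V" for y
      using that closure_subset[of "{z. \<phi> z \<noteq> 0}"] unfolding V_def by auto
    have "(\<phi> has_derivative (\<lambda>_. 0)) (at z)"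
      by (rule has_derivative_transform_within_open[OF _ V(1,2), of "\<lambda>_. 0"]) (use zero in auto)
    from has_derivative_unique[OF d[rule_format, of z] this]
    have e: "fst w * \<phi>t z + snd w * \<phi>x z = 0" for w by (meson fun_cong)
    show "\<phi>t z = 0 \<and> \<phi>x z = 0" using e[of "(1, 0)"] e[of "(0, 1)"] by simp
  qed
qed

lemma divergence_eq_lborel:
  fixes w :: "real \<times> real \<Rightarrow> real"
  assumes w[measurable]: "w \<in> borel_measurable borel"
    and wu: "AE z in lborel. fst z \<in> {0..T} \<longrightarrow> w z = u (fst z) (snd z)"
    and m: "(\<lambda>z. a (w z)) \<in> borel_measurable borel" "(\<lambda>z. b (w z)) \<in> borel_measurable borel"
    and \<phi>: "test_function T \<phi>"
  shows "divergence T u a b \<phi> =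
    - (LINT z|lborel. a (w z) * deriv (\<lambda>s. \<phi> (s, snd z)) (fst z) + b (w z) * deriv (\<lambda>y. \<phi> (fst z, y)) (snd z))"
proof -
  obtain \<phi>t \<phi>x where c: "continuous_on UNIV \<phi>t" "continuous_on UNIV \<phi>x"
    and d: "\<And>z. deriv (\<lambda>s. \<phi> (s, snd z)) (fst z) = \<phi>t z" "\<And>z. deriv (\<lambda>y. \<phi> (fst z, y)) (snd z) = \<phi>x z"
    and z: "\<And>z. fst z \<notin> {0<..<T} \<Longrightarrow> \<phi>t z = 0 \<and> \<phi>x z = 0"
    by (rule test_function_derivs[OF \<phi>]) blast
  note [measurable] = m
  have [measurable]: "\<phi>t \<in> borel_measurable borel" "\<phi>x \<in> borel_measurable borel"
    using c by (auto intro: borel_measurable_continuous_onI)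
  define F where "F z = indicator ({0<..<T} \<times> UNIV) z * (a (u (fst z) (snd z)) * \<phi>t z + b (u (fst z) (snd z)) * \<phi>x z)" for z
  define G where "G z = a (w z) * \<phi>t z + b (w z) * \<phi>x z" for z
  have "AE x in lborel. F x = G x"
    using wu
  proof eventually_elim
    case (elim y)
    then show ?case using z[of y] by (auto simp: F_def G_def indicator_def mem_Times_iff)
  qed
  moreover have "G \<in> borel_measurable borel" unfolding G_def by measurable
  ultimately have "(LINT z|lebesgue. F z) = (LINT z|lborel. G z)" by (intro lebesgue_integral_AE_borel)
  moreover have "divergence T u a b \<phi> = - (LINT z|lebesgue. F z)"
    unfolding divergence_def set_lebesgue_integral_def F_def using d by (simp add: case_prod_beta')
  ultimately show ?thesis unfolding G_def d by simp
qed

text \<open>Difference quotients of \<open>\<phi>\<close> integrate to 0 by translation invariance,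
  and they converge dominatedly to the partial derivative.\<close>

lemma lip_test_integral_zero:
  assumes "lip_test T \<phi> \<phi>t \<phi>x"
  shows "(LINT z|lborel. \<phi>t z) = 0" "(LINT z|lborel. \<phi>x z) = 0"
proof -
  have [measurable]: "\<phi>t \<in> borel_measurable borel" "\<phi>x \<in> borel_measurable borel"
    and dt: "AE z in lborel. ((\<lambda>s. \<phi> (s, snd z)) has_real_derivative \<phi>t z) (at (fst z))"
    and dx: "AE z in lborel. ((\<lambda>y. \<phi> (fst z, y)) has_real_derivative \<phi>x z) (at (snd z))"
    using assms unfolding lip_test_def lipD_def by blast+
  obtain B where lip: "B-lipschitz_on UNIV \<phi>" and B: "\<And>z. \<bar>\<phi> z\<bar> \<le> B"
    using assms unfolding lip_test_def lipD_def by blast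
  obtain \<delta> r where \<delta>: "\<delta> > 0" and supp: "\<And>z. \<phi> z \<noteq> 0 \<or> \<phi>t z \<noteq> 0 \<or> \<phi>x z \<noteq> 0 \<Longrightarrow> \<delta> \<le> fst z \<and> fst z \<le> T - \<delta> \<and> \<bar>snd z\<bar> \<le> r"
    using assms unfolding lip_test_def by blast
  have ns: "norm z \<le> \<bar>T\<bar> + \<bar>r\<bar>" if "\<phi> z \<noteq> 0" for z
    using supp[of z] that \<delta> by (intro norm_le_of_strip_box) auto
  have [measurable]: "\<phi> \<in> borel_measurable borel"
    using lipschitz_on_continuous_on[OF lip] by (rule borel_measurable_continuous_onI)
  have i: "integrable lborel \<phi>" by (rule integrable_lborel_bounded_support[OF _ B ns]) measurable
  define R where "R = \<bar>T\<bar> + \<bar>r\<bar> + 1"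
  have main: "(LINT z|lborel. \<phi>e z) = 0"
    if e: "norm e = 1" and d: "AE z in lborel. ((\<lambda>h. (\<phi> (z + h *\<^sub>R e) - \<phi> z) / h) \<longlongrightarrow> \<phi>e z) (at 0)"
      and [measurable]: "\<phi>e \<in> borel_measurable borel" for \<phi>e and e :: "real \<times> real"
  proof -
    define h where "h n = inverse (real (Suc n))" for n
    have hn: "h n > 0" "h n \<le> 1" for n by (simp_all add: h_def inverse_eq_divide)
    have h: "filterlim h (at 0) sequentially"
      unfolding h_def filterlim_at using LIMSEQ_inverse_real_of_nat by (auto intro!: always_eventually)
    have s[measurable]: "(\<lambda>z. \<phi> (z + c)) \<in> borel_measurable borel" for c by measurable
    have "(\<lambda>n. LINT z|lborel. (\<phi> (z + h n *\<^sub>R e) - \<phi> z) / h n) \<longlonglongrightarrow> (LINT z|lborel. \<phi>e z)"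
    proof (rule integral_dominated_convergence[where w="\<lambda>z. B * indicator (cball 0 R) z"])
      show "integrable lborel (\<lambda>z :: real \<times> real. B * indicator (cball 0 R) z)"
        using emeasure_lborel_cball_finite[of "0 :: real \<times> real" R] by (intro integrable_mult_right integrable_real_indicator) auto
      show "AE z in lborel. (\<lambda>n. (\<phi> (z + h n *\<^sub>R e) - \<phi> z) / h n) \<longlonglongrightarrow> \<phi>e z"
        using d by eventually_elim (rule filterlim_compose[OF _ h])
      show "AE z in lborel. norm ((\<phi> (z + h n *\<^sub>R e) - \<phi> z) / h n) \<le> B * indicator (cball 0 R) z" for n
      proof (intro AE_I2)
        fix z :: "real \<times> real"
        show "norm ((\<phi> (z + h n *\<^sub>R e) - \<phi> z) / h n) \<le> B * indicator (cball 0 R) z"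
        proof (cases "norm z \<le> R")
          case True
          have "dist (\<phi> (z + h n *\<^sub>R e)) (\<phi> z) \<le> B * dist (z + h n *\<^sub>R e) z" by (rule lipschitz_onD[OF lip]) auto
          then have "\<bar>\<phi> (z + h n *\<^sub>R e) - \<phi> z\<bar> \<le> B * h n" using e hn[of n] by (simp add: dist_norm)
          then show ?thesis using True hn[of n] by (simp add: abs_divide divide_le_eq)
        next
          case False
          have "\<phi> z = 0" using ns[of z] False by (auto simp: R_def)
          moreover have "\<phi> (z + h n *\<^sub>R e) = 0"
          proof (rule ccontr)
            assume "\<phi> (z + h n *\<^sub>R e) \<noteq> 0"
            then have "norm (z + h n *\<^sub>R e) \<le> \<bar>T\<bar> + \<bar>r\<bar>" by (rule ns)
            moreover have "norm z \<le> norm (z + h n *\<^sub>R e) + norm (h n *\<^sub>R e)" using norm_triangle_ineq4[of "z + h n *\<^sub>R e" "h n *\<^sub>R e"] by simp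
            moreover have "norm (h n *\<^sub>R e) \<le> 1" using e hn[of n] by simp
            ultimately show False using False unfolding R_def by linarith
          qed
          ultimately show ?thesis using False by simp
        qed
      qed
    qed measurable
    moreover have "(LINT z|lborel. (\<phi> (z + h n *\<^sub>R e) - \<phi> z) / h n) = 0" for n
    proof -
      have i2: "integrable lborel (\<lambda>z. \<phi> (z + h n *\<^sub>R e))"
      proof (rule integrable_lborel_bounded_support[OF s B])
        fix z :: "real \<times> real" assume "\<phi> (z + h n *\<^sub>R e) \<noteq> 0"
        then have "norm (z + h n *\<^sub>R e) \<le> \<bar>T\<bar> + \<bar>r\<bar>" by (rule ns)
        then show "norm z \<le> \<bar>T\<bar> + \<bar>r\<bar> + norm (h n *\<^sub>R e)" using norm_triangle_ineq4[of "z + h n *\<^sub>R e" "h n *\<^sub>R e"] by simp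
      qed
      have "(LINT z|lborel. \<phi> (z + h n *\<^sub>R e) - \<phi> z) = (LINT z|lborel. \<phi> (z + h n *\<^sub>R e)) - (LINT z|lborel. \<phi> z)"
        by (rule Bochner_Integration.integral_diff[OF i2 i])
      also have "\<dots> = 0" using lborel_integral_shift[of \<phi> "h n *\<^sub>R e"] by simp
      finally show ?thesis by simp
    qed
    ultimately have "(\<lambda>n. 0::real) \<longlonglongrightarrow> (LINT z|lborel. \<phi>e z)" by (simp only:)
    then show ?thesis by (simp add: LIMSEQ_const_iff)
  qed
  have sh: "z + h *\<^sub>R (1, 0) = (fst z + h, snd z)" "z + h *\<^sub>R (0, 1) = (fst z, snd z + h)" for z :: "real \<times> real" and h
    by (simp_all add: prod_eq_iff)
  show "(LINT z|lborel. \<phi>t z) = 0"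
  proof (rule main[of "(1, 0)"])
    show "AE z in lborel. ((\<lambda>h. (\<phi> (z + h *\<^sub>R (1, 0)) - \<phi> z) / h) \<longlongrightarrow> \<phi>t z) (at 0)"
      using dt unfolding sh by (simp add: DERIV_def)
  qed (simp_all add: norm_Pair)
  show "(LINT z|lborel. \<phi>x z) = 0"
  proof (rule main[of "(0, 1)"])
    show "AE z in lborel. ((\<lambda>h. (\<phi> (z + h *\<^sub>R (0, 1)) - \<phi> z) / h) \<longlongrightarrow> \<phi>x z) (at 0)"
      using dx unfolding sh by (simp add: DERIV_def)
  qed (simp_all add: norm_Pair)
qed

lemma lip_test_integrable:
  assumes \<phi>: "lip_test T \<phi> \<phi>t \<phi>x" and [measurable]: "a \<in> borel_measurable borel" and a: "\<And>z. \<bar>a z\<bar> \<le> A"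
  shows "integrable lborel (\<lambda>z. a z * \<phi>t z)" "integrable lborel (\<lambda>z. a z * \<phi>x z)"
proof -
  have [measurable]: "\<phi>t \<in> borel_measurable borel" "\<phi>x \<in> borel_measurable borel"
    using \<phi> unfolding lip_test_def lipD_def by blast+
  obtain B where B: "\<And>z. \<bar>\<phi>t z\<bar> \<le> B" "\<And>z. \<bar>\<phi>x z\<bar> \<le> B"
    using \<phi> unfolding lip_test_def lipD_def by blast
  obtain \<delta> r where \<delta>: "\<delta> > 0" and supp: "\<And>z. \<phi> z \<noteq> 0 \<or> \<phi>t z \<noteq> 0 \<or> \<phi>x z \<noteq> 0 \<Longrightarrow> \<delta> \<le> fst z \<and> fst z \<le> T - \<delta> \<and> \<bar>snd z\<bar> \<le> r"
    using \<phi> unfolding lip_test_def by blast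
  have ns: "norm z \<le> \<bar>T\<bar> + \<bar>r\<bar>" if "\<phi>t z \<noteq> 0 \<or> \<phi>x z \<noteq> 0" for z
    using supp[of z] that \<delta> by (intro norm_le_of_strip_box) auto
  have A: "A \<ge> 0" using a[of 0] by linarith
  have b: "\<bar>a z * \<phi>t z\<bar> \<le> A * B" "\<bar>a z * \<phi>x z\<bar> \<le> A * B" for z
    unfolding abs_mult using a[of z] B[of z] A by (intro mult_mono; simp)+
  show "integrable lborel (\<lambda>z. a z * \<phi>t z)"
    by (rule integrable_lborel_bounded_support[OF _ b(1)]) (measurable, rule ns, simp)
  show "integrable lborel (\<lambda>z. a z * \<phi>x z)"
    by (rule integrable_lborel_bounded_support[OF _ b(2)]) (measurable, rule ns, simp)
qed

text \<open>The constants \<open>p\<close> and \<open>r\<close> pair to 0 with derivatives of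
  compactly supported functions, and the second law is free of production, so the right side is that
  of the first law alone.\<close>

lemma balance_combine:
  assumes 1: "balance T a1 b1 P N" and 2: "balance T a2 b2 (null_measure borel) (null_measure borel)"
    and m: "a1 \<in> borel_measurable borel" "b1 \<in> borel_measurable borel" "a2 \<in> borel_measurable borel" "b2 \<in> borel_measurable borel"
    and b: "\<And>z. \<bar>a1 z\<bar> \<le> A" "\<And>z. \<bar>b1 z\<bar> \<le> A" "\<And>z. \<bar>a2 z\<bar> \<le> A" "\<And>z. \<bar>b2 z\<bar> \<le> A"
  shows "balance T (\<lambda>z. a1 z - c * a2 z + p) (\<lambda>z. b1 z - c * b2 z + r) P N"
  unfolding balance_def
proof (intro allI impI)
  fix \<phi> \<phi>t \<phi>x assume \<phi>: "lip_test T \<phi> \<phi>t \<phi>x"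
  note i1 = lip_test_integrable[OF \<phi> m(1) b(1)] lip_test_integrable[OF \<phi> m(2) b(2)]
    and i2 = lip_test_integrable[OF \<phi> m(3) b(3)] lip_test_integrable[OF \<phi> m(4) b(4)]
  have i0: "integrable lborel \<phi>t" "integrable lborel \<phi>x"
    using lip_test_integrable[OF \<phi>, of "\<lambda>_. 1" 1] by simp_all
  have I1: "integrable lborel (\<lambda>z. a1 z * \<phi>t z + b1 z * \<phi>x z)" using i1 by simp
  have I2: "integrable lborel (\<lambda>z. c * (a2 z * \<phi>t z + b2 z * \<phi>x z))" using i2 by simp
  have I3: "integrable lborel (\<lambda>z. p * \<phi>t z + r * \<phi>x z)" using i0 by simp
  have "(LINT z|lborel. (a1 z - c * a2 z + p) * \<phi>t z + (b1 z - c * b2 z + r) * \<phi>x z)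
     = (LINT z|lborel. ((a1 z * \<phi>t z + b1 z * \<phi>x z) - c * (a2 z * \<phi>t z + b2 z * \<phi>x z)) + (p * \<phi>t z + r * \<phi>x z))"
    by (intro Bochner_Integration.integral_cong refl) (simp add: algebra_simps)
  also have "\<dots> = (LINT z|lborel. (a1 z * \<phi>t z + b1 z * \<phi>x z) - c * (a2 z * \<phi>t z + b2 z * \<phi>x z)) + (LINT z|lborel. p * \<phi>t z + r * \<phi>x z)"
    by (intro Bochner_Integration.integral_add Bochner_Integration.integrable_diff I1 I2 I3)
  also have "(LINT z|lborel. p * \<phi>t z + r * \<phi>x z) = 0"
    using i0 lip_test_integral_zero[OF \<phi>] by simp
  also have "(LINT z|lborel. (a1 z * \<phi>t z + b1 z * \<phi>x z) - c * (a2 z * \<phi>t z + b2 z * \<phi>x z))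
     = (LINT z|lborel. a1 z * \<phi>t z + b1 z * \<phi>x z) - c * (LINT z|lborel. a2 z * \<phi>t z + b2 z * \<phi>x z)"
    using Bochner_Integration.integral_diff[OF I1 I2] by simp
  also have "(LINT z|lborel. a2 z * \<phi>t z + b2 z * \<phi>x z) = 0"
    using 2[unfolded balance_def, rule_format, OF \<phi>] by simp
  finally show "- (LINT z|lborel. (a1 z - c * a2 z + p) * \<phi>t z + (b1 z - c * b2 z + r) * \<phi>x z) = (LINT z|P. \<phi> z) - (LINT z|N. \<phi> z)"
    using 1[unfolded balance_def, rule_format, OF \<phi>] by simp
qed

lemma has_trace_compose:
  assumes tr: "has_trace T x s w U" and A: "continuous_on UNIV A"
  shows "has_trace T x s (\<lambda>z. A (w z)) (\<lambda>t. A (U t))"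
  unfolding has_trace_def
proof
  have [measurable]: "U \<in> borel_measurable borel" "A \<in> borel_measurable borel"
    using tr A by (auto simp: has_trace_def intro: borel_measurable_continuous_onI)
  show "(\<lambda>t. A (U t)) \<in> borel_measurable borel" by measurable
  have "AE t in lborel. 0 < t \<and> t < T \<longrightarrow> ((\<lambda>y. w (t, x t + s * y)) \<longlongrightarrow> U t) ess_at_right_0"
    using tr by (simp add: has_trace_def)
  then show "AE t in lborel. 0 < t \<and> t < T \<longrightarrow> ((\<lambda>y. A (w (t, x t + s * y))) \<longlongrightarrow> A (U t)) ess_at_right_0"
  proof eventually_elim
    case (elim t)
    have "isCont A (U t)" using A by (simp add: continuous_on_eq_continuous_at)
    then show ?case using elim by (auto intro: isCont_tendsto_compose)
  qed
qed

text \<open>\<open>up\<close> is not assumed measurable. The means over shrinking intervals are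
  measurable in \<open>t\<close>, hence so is their limit, which agrees with \<open>up\<close>
  wherever the essential limit exists; clipping keeps the values in \<open>[lo, hi]\<close> at all
  other times.\<close>

lemma trace_of_ess_limit:
  fixes w :: "real \<times> real \<Rightarrow> real"
  assumes w[measurable]: "w \<in> borel_measurable borel" and wb: "\<And>z. w z \<in> {lo..hi}"
    and x: "continuous_on UNIV x"
    and lim: "AE t in lborel. 0 < t \<and> t < T \<longrightarrow> ((\<lambda>y. w (t, x t + s * y)) \<longlongrightarrow> up t) ess_at_right_0"
  obtains U where "has_trace T x s w U" "\<And>t. U t \<in> {lo..hi}"
proof -
  have xm[measurable]: "x \<in> borel_measurable borel" using x by (rule borel_measurable_continuous_onI)
  have lh: "lo \<le> hi" using wb[of 0] by auto
  have b: "\<bar>w z\<bar> \<le> \<bar>lo\<bar> + \<bar>hi\<bar>" for z using wb[of z] by auto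
  define A where "A n t = real (Suc n) * (LINT y|lborel. indicator {0<..<1 / real (Suc n)} y * w (t, x t + s * y))" for n t
  have [measurable]: "A n \<in> borel_measurable borel" for n
  proof -
    have fm[measurable]: "(fst :: real \<times> real \<Rightarrow> real) \<in> borel_measurable borel" "(snd :: real \<times> real \<Rightarrow> real) \<in> borel_measurable borel"
      by (intro borel_measurable_continuous_onI continuous_intros)+
    have "(\<lambda>p. (fst p, x (fst p) + s * snd p)) \<in> borel \<rightarrow>\<^sub>M borel \<Otimes>\<^sub>M borel" by measurable
    then have "(\<lambda>p. (fst p, x (fst p) + s * snd p)) \<in> borel \<rightarrow>\<^sub>M borel" by (simp add: borel_prod)
    from measurable_compose[OF this w]
    have [measurable]: "(\<lambda>p. w (fst p, x (fst p) + s * snd p)) \<in> borel_measurable borel" .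
    have "(\<lambda>p. indicator {0<..<1 / real (Suc n)} (snd p) * w (fst p, x (fst p) + s * snd p)) \<in> borel_measurable borel"
      by measurable
    then have "(\<lambda>(t, y). indicator {0<..<1 / real (Suc n)} y * w (t, x t + s * y)) \<in> borel_measurable (lborel \<Otimes>\<^sub>M lborel)"
      unfolding lborel_prod by (simp add: case_prod_beta')
    from lborel.borel_measurable_lebesgue_integral[OF this] show ?thesis unfolding A_def by simp
  qed
  define U where "U t = max lo (min hi (lim (\<lambda>n. A n t)))" for t
  have Um: "U \<in> borel_measurable borel" unfolding U_def by (intro borel_measurable_max borel_measurable_min borel_measurable_const borel_measurable_lim_metric) measurable
  show thesis
  proof (rule that)
    show "U t \<in> {lo..hi}" for t using lh by (auto simp: U_def)
    show "has_trace T x s w U"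
      unfolding has_trace_def
    proof (intro conjI Um)
      show "AE t in lborel. 0 < t \<and> t < T \<longrightarrow> ((\<lambda>y. w (t, x t + s * y)) \<longlongrightarrow> U t) ess_at_right_0"
        using lim
      proof eventually_elim
        case (elim t)
        show ?case
        proof
          assume t: "0 < t \<and> t < T"
          have sl: "(\<lambda>y. w (t, x t + s * y)) \<in> borel_measurable borel" by (rule measurable_slice[OF w]) measurable
          have L: "((\<lambda>y. w (t, x t + s * y)) \<longlongrightarrow> up t) ess_at_right_0" using elim t by blast
          have "(\<lambda>n. A n t) \<longlonglongrightarrow> up t" unfolding A_def by (rule ess_limit_average[OF sl b L])
          then have "lim (\<lambda>n. A n t) = up t" by (rule limI)
          \<comment> \<open>No interval \<open>(0, \<delta>)\<close> is a null set, so the filter is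
            proper and bounds pass to the limit.\<close>
          moreover have nb: "ess_at_right_0 \<noteq> bot"
          proof
            assume "ess_at_right_0 = bot"
            then have "eventually (\<lambda>_. False) ess_at_right_0" by simp
            then obtain \<delta> :: real where \<delta>: "\<delta> > 0" "AE y in lborel. \<not> (0 < y \<and> y < \<delta>)"
              unfolding eventually_ess_at_right_0 by auto
            then have "AE y in lborel. y \<notin> {0<..<\<delta>}" by simp
            then have "{0<..<\<delta>} \<in> null_sets lborel" by (subst (asm) AE_iff_null_sets[symmetric]) auto
            then show False using \<delta>(1) by (auto dest: null_setsD1)
          qed
          moreover have "lo \<le> up t" by (rule tendsto_lowerbound[OF L _ nb]) (use wb in \<open>auto intro: always_eventually\<close>)
          moreover have "up t \<le> hi" by (rule tendsto_upperbound[OF L _ nb]) (use wb in \<open>auto intro: always_eventually\<close>)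
          ultimately have "U t = up t" by (simp add: U_def)
          then show "((\<lambda>y. w (t, x t + s * y)) \<longlongrightarrow> U t) ess_at_right_0" using L by simp
        qed
      qed
    qed
  qed
qed

lemma ess_tendsto_AE_cong:
  assumes "(f \<longlongrightarrow> l) ess_at_right_0" "AE y in lborel. f y = g y"
  shows "(g \<longlongrightarrow> l) ess_at_right_0"
proof (rule Lim_transform_eventually[OF assms(1)])
  show "\<forall>\<^sub>F y in ess_at_right_0. f y = g y"
    unfolding eventually_ess_at_right_0 using assms(2) by (intro exI[of _ 1]) auto
qed

text \<open>The trace hypothesis speaks of a representative \<open>v\<close> that may depend on the
  path. Both \<open>v\<close> and \<open>w\<close> equal \<open>u\<close> almost everywhere in the
  strip, so at almost every time their slices agree almost everywhere, which is all that an
  essential limit sees.\<close>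

lemma traces_of_representative:
  fixes w :: "real \<times> real \<Rightarrow> real"
  assumes vst: "very_strong_traces T u"
    and w[measurable]: "w \<in> borel_measurable borel" and wb: "\<And>z. w z \<in> {lo..hi}"
    and wu: "AE z in lborel. fst z \<in> {0..T} \<longrightarrow> w z = u (fst z) (snd z)"
    and x: "L-lipschitz_on UNIV x"
  obtains Up Um where "has_trace T x 1 w Up" "\<And>t. Up t \<in> {lo..hi}" "has_trace T x (-1) w Um" "\<And>t. Um t \<in> {lo..hi}"
proof -
  have xc: "continuous_on UNIV x" by (rule lipschitz_on_continuous_on[OF x])
  have "lipschitz_path T x" unfolding lipschitz_path_def using lipschitz_on_subset[OF x] by blast
  then obtain up um v where v: "AE (t, y) in strip T. v t y = u t y"
    and tr: "AE t in lebesgue_on {0..T}. ((\<lambda>y. v t (x t + y)) \<longlongrightarrow> up t) ess_at_right_0 \<and> ((\<lambda>y. v t (x t - y)) \<longlongrightarrow> um t) ess_at_right_0"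
    using vst unfolding very_strong_traces_def by blast
  have v': "AE z in lborel. fst z \<in> {0..T} \<longrightarrow> v (fst z) (snd z) = u (fst z) (snd z)"
    using v unfolding AE_strip by (simp add: case_prod_beta')
  have vw: "AE z in lborel. fst z \<in> {0..T} \<longrightarrow> v (fst z) (snd z) = w z"
    using v' wu by eventually_elim simp
  have vw2: "AE t in lborel. AE y in lborel. t \<in> {0..T} \<longrightarrow> v t y = w (t, y)"
    using AE_lborel_pair[OF vw] by simp
  have "AE t in lebesgue. t \<in> {0..T} \<longrightarrow> ((\<lambda>y. v t (x t + y)) \<longlongrightarrow> up t) ess_at_right_0 \<and> ((\<lambda>y. v t (x t - y)) \<longlongrightarrow> um t) ess_at_right_0"
    using tr by (subst (asm) AE_restrict_space_iff) auto
  then have tr': "AE t in lborel. t \<in> {0..T} \<longrightarrow> ((\<lambda>y. v t (x t + y)) \<longlongrightarrow> up t) ess_at_right_0 \<and> ((\<lambda>y. v t (x t - y)) \<longlongrightarrow> um t) ess_at_right_0"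
    by (simp only: AE_completion_iff)
  have "AE t in lborel. 0 < t \<and> t < T \<longrightarrow> ((\<lambda>y. w (t, x t + 1 * y)) \<longlongrightarrow> up t) ess_at_right_0"
    using tr' vw2
  proof eventually_elim
    case (elim t)
    show ?case
    proof
      assume t: "0 < t \<and> t < T"
      then have ae: "AE y in lborel. v t y = w (t, y)" using elim(2) by simp
      have "AE y in distr lborel borel ((+) (x t)). v t y = w (t, y)" unfolding lborel_distr_plus by (rule ae)
      from AE_distrD[OF _ this] have "AE y in lborel. v t (x t + y) = w (t, x t + 1 * y)" by simp
      then show "((\<lambda>y. w (t, x t + 1 * y)) \<longlongrightarrow> up t) ess_at_right_0"
      proof (rule ess_tendsto_AE_cong[rotated])
        show "((\<lambda>y. v t (x t + y)) \<longlongrightarrow> up t) ess_at_right_0" using elim(1) t by simp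
      qed
    qed
  qed
  from trace_of_ess_limit[OF w wb xc this] obtain Up where Up: "has_trace T x 1 w Up" "\<And>t. Up t \<in> {lo..hi}" by blast
  have "AE t in lborel. 0 < t \<and> t < T \<longrightarrow> ((\<lambda>y. w (t, x t + (-1) * y)) \<longlongrightarrow> um t) ess_at_right_0"
    using tr' vw2
  proof eventually_elim
    case (elim t)
    show ?case
    proof
      assume t: "0 < t \<and> t < T"
      then have ae: "AE y in lborel. v t y = w (t, y)" using elim(2) by simp
      have "AE y in lborel. v t (x t - y) = w (t, x t + (-1) * y)"
        using AE_lborel_reflect[OF ae, of "x t"] by simp
      then show "((\<lambda>y. w (t, x t + (-1) * y)) \<longlongrightarrow> um t) ess_at_right_0"
      proof (rule ess_tendsto_AE_cong[rotated])
        show "((\<lambda>y. v t (x t - y)) \<longlongrightarrow> um t) ess_at_right_0" using elim(1) t by simp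
      qed
    qed
  qed
  from trace_of_ess_limit[OF w wb xc this] obtain Um where "has_trace T x (-1) w Um" "\<And>t. Um t \<in> {lo..hi}" by blast
  with Up show thesis using that by blast
qed

section \<open>Energy balance of the shifted shock inside a cone\<close>

section \<open>The localized energy inequality\<close>

text \<open>The derivative of \<open>S * rel_entropy c y - s * rel_flux f q c y\<close> is
  \<open>(y - c) * (S - s * f1 y)\<close>, which has the sign of \<open>y - c\<close> or vanishes;
  the function therefore has its minimum at \<open>y = c\<close>, where it is 0.\<close>

lemma rel_flux_le:
  fixes f f1 q :: "real \<Rightarrow> real"
  assumes f: "\<And>v. (f has_real_derivative f1 v) (at v)"
    and q: "\<And>v. (q has_real_derivative v * f1 v) (at v)"
    and S: "\<And>v. v \<in> {lo..hi} \<Longrightarrow> \<bar>f1 v\<bar> \<le> S"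
    and cv: "c \<in> {lo..hi}" "v \<in> {lo..hi}"
  shows "\<bar>rel_flux f q c v\<bar> \<le> S * rel_entropy c v"
proof -
  have le: "0 \<le> S * rel_entropy c v - s * rel_flux f q c v" if s: "s = 1 \<or> s = -1" for s
  proof -
    define g where "g y = S * rel_entropy c y - s * rel_flux f q c y" for y
    have g: "(g has_real_derivative (y - c) * (S - s * f1 y)) (at y)" for y
      unfolding g_def rel_entropy_def rel_flux_def
      by (auto intro!: derivative_eq_intros f q simp: field_simps)
    have pos: "0 \<le> S - s * f1 y" if "y \<in> {lo..hi}" for y using S[OF that] s by auto
    have "g c \<le> g v"
    proof (cases "c \<le> v")
      case True
      show ?thesis
      proof (rule deriv_sign_imp_mono[where lo=c and hi=v, OF g])
        fix y assume "c \<le> y" "y \<le> v"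
        then show "0 \<le> (y - c) * (S - s * f1 y)" using pos[of y] cv by (intro mult_nonneg_nonneg) auto
      qed (use True in auto)
    next
      case False
      show ?thesis
      proof (rule deriv_sign_imp_antimono[where lo=v and hi=c, OF g])
        fix y assume "v \<le> y" "y \<le> c"
        then show "(y - c) * (S - s * f1 y) \<le> 0" using pos[of y] cv by (intro mult_nonpos_nonneg) auto
      qed (use False in auto)
    qed
    moreover have "g c = 0" by (simp add: g_def rel_entropy_def rel_flux_def)
    ultimately show ?thesis by (simp add: g_def)
  qed
  show ?thesis using le[of 1] le[of "-1"] by (simp add: abs_le_iff)
qed

lemma continuous_bounded_Icc:
  fixes g :: "real \<Rightarrow> real"
  assumes "continuous_on UNIV g"
  shows "\<exists>B. \<forall>v\<in>{a..b}. \<bar>g v\<bar> \<le> B"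
proof -
  have "compact (g ` {a..b})" using assms by (intro compact_continuous_image continuous_on_subset[OF assms]) auto
  then show ?thesis using compact_imp_bounded[of "g ` {a..b}"] unfolding bounded_iff by auto
qed

locale shock_setting =
  fixes f f1 f2 q :: "real \<Rightarrow> real" and \<alpha> T ul ur lo hi M S :: real
    and w :: "real \<times> real \<Rightarrow> real" and P N :: "(real \<times> real) measure"
  assumes f: "\<And>v. (f has_real_derivative f1 v) (at v)"
    and f1: "\<And>v. (f1 has_real_derivative f2 v) (at v)"
    and q: "\<And>v. (q has_real_derivative v * f1 v) (at v)"
    and f2: "\<And>v. v \<in> {lo..hi} \<Longrightarrow> \<alpha> \<le> f2 v \<and> f2 v \<le> M"
    and \<alpha>: "0 < \<alpha>" and T: "0 < T"
    and speed_bound: "\<And>v. v \<in> {lo..hi} \<Longrightarrow> \<bar>f1 v\<bar> \<le> S"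
    and states: "ul \<in> {lo..hi}" "ur \<in> {lo..hi}" "ur < ul"
    and w[measurable]: "w \<in> borel_measurable borel" and w_mem: "\<And>z. w z \<in> {lo..hi}"
    and PN: "radon_on_strip T P" "radon_on_strip T N"
    and bal_u: "balance T w (\<lambda>z. f (w z)) (null_measure borel) (null_measure borel)"
    and bal_e: "balance T (\<lambda>z. (w z)\<^sup>2 / 2) (\<lambda>z. q (w z)) P N"
begin

definition \<sigma> :: real where "\<sigma> = (f ur - f ul) / (ur - ul)"

definition \<kappa> :: real where "\<kappa> = \<alpha> / (12 * M\<^sup>2) * (ul - ur)"

lemma M_pos: "0 < M" using f2[OF states(1)] \<alpha> by linarith

lemma \<kappa>_pos: "0 < \<kappa>" unfolding \<kappa>_def using M_pos \<alpha> states by simp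

lemma f_continuous: "continuous_on UNIV f" "continuous_on UNIV f1" "continuous_on UNIV q"
  using DERIV_isCont[OF f] DERIV_isCont[OF f1] DERIV_isCont[OF q] by (simp_all add: continuous_at_imp_continuous_on)

text \<open>The trace framework works with a single bound for entropy and flux, so one constant is
  fixed for all pairs that occur.\<close>

lemma bound_on_states:
  obtains A where "0 \<le> A" "\<And>v. v \<in> {lo..hi} \<Longrightarrow> \<bar>v\<bar> \<le> A" "\<And>v. v \<in> {lo..hi} \<Longrightarrow> \<bar>f v\<bar> \<le> A"
    "\<And>v. v \<in> {lo..hi} \<Longrightarrow> \<bar>v\<^sup>2 / 2\<bar> \<le> A" "\<And>v. v \<in> {lo..hi} \<Longrightarrow> \<bar>q v\<bar> \<le> A"
    "\<And>c v. c \<in> {ul, ur} \<Longrightarrow> v \<in> {lo..hi} \<Longrightarrow> \<bar>rel_entropy c v\<bar> \<le> A"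
    "\<And>c v. c \<in> {ul, ur} \<Longrightarrow> v \<in> {lo..hi} \<Longrightarrow> \<bar>rel_flux f q c v\<bar> \<le> A"
proof -
  have cr: "continuous_on UNIV (rel_entropy c)" "continuous_on UNIV (rel_flux f q c)" for c
    unfolding rel_entropy_def[abs_def] rel_flux_def[abs_def] by (intro continuous_intros f_continuous; simp)+
  have id: "continuous_on UNIV (\<lambda>v::real. v)" "continuous_on UNIV (\<lambda>v::real. v\<^sup>2 / 2)" by (intro continuous_intros; simp)+
  obtain B1 where B1: "\<forall>v\<in>{lo..hi}. \<bar>v\<bar> \<le> B1" using continuous_bounded_Icc[OF id(1)] by blast
  obtain B2 where B2: "\<forall>v\<in>{lo..hi}. \<bar>f v\<bar> \<le> B2" using continuous_bounded_Icc[OF f_continuous(1)] by blast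
  obtain B3 where B3: "\<forall>v\<in>{lo..hi}. \<bar>v\<^sup>2 / 2\<bar> \<le> B3" using continuous_bounded_Icc[OF id(2)] by blast
  obtain B4 where B4: "\<forall>v\<in>{lo..hi}. \<bar>q v\<bar> \<le> B4" using continuous_bounded_Icc[OF f_continuous(3)] by blast
  obtain B5 where B5: "\<forall>v\<in>{lo..hi}. \<bar>rel_entropy ul v\<bar> \<le> B5" using continuous_bounded_Icc[OF cr(1)] by blast
  obtain B6 where B6: "\<forall>v\<in>{lo..hi}. \<bar>rel_entropy ur v\<bar> \<le> B6" using continuous_bounded_Icc[OF cr(1)] by blast
  obtain B7 where B7: "\<forall>v\<in>{lo..hi}. \<bar>rel_flux f q ul v\<bar> \<le> B7" using continuous_bounded_Icc[OF cr(2)] by blast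
  obtain B8 where B8: "\<forall>v\<in>{lo..hi}. \<bar>rel_flux f q ur v\<bar> \<le> B8" using continuous_bounded_Icc[OF cr(2)] by blast
  define A where "A = Max {0, B1, B2, B3, B4, B5, B6, B7, B8}"
  have BA: "0 \<le> A" "B1 \<le> A" "B2 \<le> A" "B3 \<le> A" "B4 \<le> A" "B5 \<le> A" "B6 \<le> A" "B7 \<le> A" "B8 \<le> A"
    unfolding A_def by (intro Max_ge; simp)+
  show thesis
  proof (rule that[of A])
    show "0 \<le> A" by (rule BA)
    fix v assume v: "v \<in> {lo..hi}"
    note Bs = B1[rule_format, OF v] B2[rule_format, OF v] B3[rule_format, OF v] B4[rule_format, OF v]
      B5[rule_format, OF v] B6[rule_format, OF v] B7[rule_format, OF v] B8[rule_format, OF v]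
    show "\<bar>v\<bar> \<le> A" "\<bar>f v\<bar> \<le> A" "\<bar>v\<^sup>2 / 2\<bar> \<le> A" "\<bar>q v\<bar> \<le> A" 
      using order_trans[OF Bs(1) BA(2)] order_trans[OF Bs(2) BA(3)] order_trans[OF Bs(3) BA(4)] order_trans[OF Bs(4) BA(5)] by simp_all
    fix c assume c: "c \<in> {ul, ur}"
    show "\<bar>rel_entropy c v\<bar> \<le> A" using c order_trans[OF Bs(5) BA(6)] order_trans[OF Bs(6) BA(7)] by auto
    show "\<bar>rel_flux f q c v\<bar> \<le> A" using c order_trans[OF Bs(7) BA(8)] order_trans[OF Bs(8) BA(9)] by auto
  qed
qed

lemma bal_rel:
  assumes "c \<in> {ul, ur}"
  shows "balance T (\<lambda>z. rel_entropy c (w z)) (\<lambda>z. rel_flux f q c (w z)) P N"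
proof -
  obtain A where A: "\<And>v. v \<in> {lo..hi} \<Longrightarrow> \<bar>v\<bar> \<le> A" "\<And>v. v \<in> {lo..hi} \<Longrightarrow> \<bar>f v\<bar> \<le> A"
    "\<And>v. v \<in> {lo..hi} \<Longrightarrow> \<bar>v\<^sup>2 / 2\<bar> \<le> A" "\<And>v. v \<in> {lo..hi} \<Longrightarrow> \<bar>q v\<bar> \<le> A"
    by (rule bound_on_states) blast
  have [measurable]: "f \<in> borel_measurable borel" "q \<in> borel_measurable borel"
    using f_continuous by (auto intro: borel_measurable_continuous_onI)
  have "balance T (\<lambda>z. (w z)\<^sup>2 / 2 - c * w z + c\<^sup>2 / 2) (\<lambda>z. q (w z) - c * f (w z) + (c * f c - q c)) P N"
  proof (rule balance_combine[OF bal_e bal_u])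
    show "(\<lambda>z. (w z)\<^sup>2 / 2) \<in> borel_measurable borel" "(\<lambda>z. q (w z)) \<in> borel_measurable borel"
      "w \<in> borel_measurable borel" "(\<lambda>z. f (w z)) \<in> borel_measurable borel" by measurable
  qed (rule A w_mem)+
  moreover have "v\<^sup>2 / 2 - c * v + c\<^sup>2 / 2 = rel_entropy c v" "q v - c * f v + (c * f c - q c) = rel_flux f q c v" for v
    by (simp_all add: rel_entropy_def rel_flux_def power2_diff algebra_simps diff_divide_distrib add_divide_distrib)
  ultimately show ?thesis by simp
qed

end

locale shock_path = shock_setting + lipschitz_curve S x v for x v +
  fixes Up Um :: "real \<Rightarrow> real"
  assumes x0: "x 0 = 0"
    and tr: "has_trace T x 1 w Up" "has_trace T x (-1) w Um"
    and U_mem: "\<And>t. Up t \<in> {lo..hi}" "\<And>t. Um t \<in> {lo..hi}"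
    and hull: "AE t in lborel. 0 < t \<and> t < T \<longrightarrow> min (f1 (Up t)) (f1 (Um t)) \<le> v t \<and> v t \<le> max (f1 (Up t)) (f1 (Um t))"
begin

lemma traced:
  assumes "balance T (\<lambda>z. a (w z)) (\<lambda>z. b (w z)) P' N'" "radon_on_strip T P'" "radon_on_strip T N'"
    "continuous_on UNIV a" "continuous_on UNIV b"
    and A: "\<And>v. v \<in> {lo..hi} \<Longrightarrow> \<bar>a v\<bar> \<le> A" "\<And>v. v \<in> {lo..hi} \<Longrightarrow> \<bar>b v\<bar> \<le> A"
  shows "traced_balance S x v T A (\<lambda>z. a (w z)) (\<lambda>z. b (w z)) P' N' (\<lambda>t. a (Up t)) (\<lambda>t. a (Um t)) (\<lambda>t. b (Up t)) (\<lambda>t. b (Um t))"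
proof
  have [measurable]: "a \<in> borel_measurable borel" "b \<in> borel_measurable borel"
    using assms by (auto intro: borel_measurable_continuous_onI)
  show "(\<lambda>z. a (w z)) \<in> borel_measurable borel" "(\<lambda>z. b (w z)) \<in> borel_measurable borel" by measurable
  show "has_trace T x 1 (\<lambda>z. a (w z)) (\<lambda>t. a (Up t))" "has_trace T x (-1) (\<lambda>z. a (w z)) (\<lambda>t. a (Um t))"
    "has_trace T x 1 (\<lambda>z. b (w z)) (\<lambda>t. b (Up t))" "has_trace T x (-1) (\<lambda>z. b (w z)) (\<lambda>t. b (Um t))"
    by (rule has_trace_compose; rule tr assms)+
qed (use assms in blast | rule A w_mem U_mem)+

lemma U_measurable[measurable]: "Up \<in> borel_measurable borel" "Um \<in> borel_measurable borel"
  using tr by (auto simp: has_trace_def)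

text \<open>The rate at which the moving path feeds relative entropy into the two sides: the left
  region loses or gains through its right end, the right region through its left end.\<close>

definition D :: "real \<Rightarrow> real" where
  "D t = v t * rel_entropy ul (Um t) - rel_flux f q ul (Um t) - (v t * rel_entropy ur (Up t) - rel_flux f q ur (Up t))"

definition m :: "real \<Rightarrow> real" where
  "m t = (q (Up t) - v t * ((Up t)\<^sup>2 / 2)) - (q (Um t) - v t * ((Um t)\<^sup>2 / 2))"

text \<open>Where the traces differ, the jump condition for \<open>u\<close> determines the speed.
  Where they coincide that condition is void, but the hull of the two characteristic speeds is a
  single point and forces \<open>v t = f1 (Um t)\<close>, which is the tangent case of
  \<open>shock_dissipation\<close>.\<close>

lemma dissipation: "AE t in lborel. 0 < t \<and> t < T \<longrightarrow> D t \<le> 2 * max 0 (m t) - \<kappa> * (v t - \<sigma>)\<^sup>2"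
proof -
  obtain A where A: "\<And>v. v \<in> {lo..hi} \<Longrightarrow> \<bar>v\<bar> \<le> A" "\<And>v. v \<in> {lo..hi} \<Longrightarrow> \<bar>f v\<bar> \<le> A"
    by (rule bound_on_states) blast
  \<comment> \<open>The conservation law itself, with zero measures as production, to which
    \<open>rankine_hugoniot\<close> applies.\<close>
  interpret u: traced_balance S x v T A w "\<lambda>z. f (w z)" "null_measure borel" "null_measure borel" Up Um "\<lambda>t. f (Up t)" "\<lambda>t. f (Um t)"
    using traced[of "\<lambda>v. v" f "null_measure borel" "null_measure borel" A] bal_u radon_null_measure f_continuous(1) A by auto
  have "AE t in lborel. 0 < t \<and> t < T \<longrightarrow> u.jump t = 0" by (rule u.rankine_hugoniot) simp_all
  then show ?thesis
    using hull
  proof eventually_elim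
    case (elim t)
    show ?case
    proof
      assume t: "0 < t \<and> t < T"
      then have "f (Up t) - v t * Up t - (f (Um t) - v t * Um t) = 0" using elim(1) unfolding u.jump_def by blast
      then have rh: "f (Up t) - f (Um t) = v t * (Up t - Um t)" by (simp add: algebra_simps)
      have tg: "v t = f1 (Um t)" if "Um t = Up t" using elim(2) t that by auto
      have mem: "{Um t, Up t, ul, ur} \<subseteq> {lo..hi}" using U_mem[of t] states by blast
      have "D t \<le> 2 * max 0 (q (Up t) - q (Um t) - v t * ((Up t)\<^sup>2 - (Um t)\<^sup>2) / 2) - \<kappa> * (v t - \<sigma>)\<^sup>2"
        unfolding D_def \<kappa>_def \<sigma>_def by (rule shock_dissipation[OF f f1 f2 q \<alpha> rh tg mem states(3)])
      moreover have "q (Up t) - q (Um t) - v t * ((Up t)\<^sup>2 - (Um t)\<^sup>2) / 2 = m t"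
        by (simp add: m_def algebra_simps diff_divide_distrib)
      ultimately show "D t \<le> 2 * max 0 (m t) - \<kappa> * (v t - \<sigma>)\<^sup>2" by simp
    qed
  qed
qed

text \<open>Off the path this is \<open>rel_entropy ul\<close> on the left and
  \<open>rel_entropy ur\<close> on the right, so one function replaces the two entropies after the
  path has been dealt with.\<close>

definition dist2 :: "real \<times> real \<Rightarrow> real" where
  "dist2 z = (w z - shock_data ul ur (snd z - x (fst z)))\<^sup>2 / 2"

lemma shock_data_measurable[measurable]: "shock_data ul ur \<in> borel_measurable borel"
  unfolding shock_data_def[abs_def] by measurable

lemma dist2_measurable[measurable]: "dist2 \<in> borel_measurable borel"
  unfolding dist2_def by measurable

lemma shock_data_bound: "\<bar>shock_data ul ur y\<bar> \<le> \<bar>ul\<bar> + \<bar>ur\<bar>"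
  by (auto simp: shock_data_def indicator_def)

lemma dist2_bound: "\<bar>dist2 z\<bar> \<le> (\<bar>lo\<bar> + \<bar>hi\<bar> + \<bar>ul\<bar> + \<bar>ur\<bar>)\<^sup>2"
proof -
  have "\<bar>w z\<bar> \<le> \<bar>lo\<bar> + \<bar>hi\<bar>" using w_mem[of z] by auto
  then have "\<bar>w z - shock_data ul ur (snd z - x (fst z))\<bar> \<le> \<bar>lo\<bar> + \<bar>hi\<bar> + \<bar>ul\<bar> + \<bar>ur\<bar>"
    using abs_triangle_ineq4[of "w z" "shock_data ul ur (snd z - x (fst z))"] shock_data_bound[of "snd z - x (fst z)"] by linarith
  then have "\<bar>w z - shock_data ul ur (snd z - x (fst z))\<bar>\<^sup>2 \<le> (\<bar>lo\<bar> + \<bar>hi\<bar> + \<bar>ul\<bar> + \<bar>ur\<bar>)\<^sup>2" by (rule power_mono) simp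
  moreover have "0 \<le> (w z - shock_data ul ur (snd z - x (fst z)))\<^sup>2" by simp
  ultimately show ?thesis unfolding dist2_def power2_abs by linarith
qed

lemma dist2_cutoff_integrable:
  assumes n: "n > 0" and k: "k > 0"
  shows "integrable lborel (\<lambda>z. dist2 z * (time_cutoff' n t1 z * cone_cutoff k S R z))"
proof -
  have tm: "(\<lambda>z. time_cutoff' n t1 z * cone_cutoff k S R z) \<in> borel_measurable borel"
    and tb: "\<exists>C. \<forall>z. \<bar>time_cutoff' n t1 z * cone_cutoff k S R z\<bar> \<le> C"
  proof -
    have 1: "time_cutoff' n t1 \<in> borel_measurable borel" and 2: "cone_cutoff k S R \<in> borel_measurable borel"
      and 3: "\<exists>C. \<forall>z. \<bar>time_cutoff' n t1 z\<bar> \<le> C"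
      using lipD_time_cutoff[OF n, of t1] lipD_cone_cutoff[OF k S_nonneg, of R] lipschitz_on_continuous_on unfolding lipD_def
      by (blast intro: borel_measurable_continuous_onI)+
    show "(\<lambda>z. time_cutoff' n t1 z * cone_cutoff k S R z) \<in> borel_measurable borel" using 1 2 by measurable
    obtain C where C: "\<And>z. \<bar>time_cutoff' n t1 z\<bar> \<le> C" using 3 by blast
    have "\<bar>time_cutoff' n t1 z * cone_cutoff k S R z\<bar> \<le> C * 1" for z
      unfolding abs_mult using C[of z] cutoff_bounds(3,4)[of k S R z] order_trans[OF abs_ge_zero C] by (intro mult_mono) simp_all
    then show "\<exists>C. \<forall>z. \<bar>time_cutoff' n t1 z * cone_cutoff k S R z\<bar> \<le> C" by blast
  qed
  obtain C where C: "\<And>z. \<bar>time_cutoff' n t1 z * cone_cutoff k S R z\<bar> \<le> C" using tb by blast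
  show ?thesis
  proof (rule integrable_lborel_bounded_support[where R="t1 + R"])
    show "(\<lambda>z. dist2 z * (time_cutoff' n t1 z * cone_cutoff k S R z)) \<in> borel_measurable borel" using tm by measurable
    show "\<bar>dist2 z * (time_cutoff' n t1 z * cone_cutoff k S R z)\<bar> \<le> (\<bar>lo\<bar> + \<bar>hi\<bar> + \<bar>ul\<bar> + \<bar>ur\<bar>)\<^sup>2 * C" for z
      unfolding abs_mult[of "dist2 z"] by (intro mult_mono dist2_bound C) simp_all
    fix z assume "dist2 z * (time_cutoff' n t1 z * cone_cutoff k S R z) \<noteq> 0"
    then have "time_cutoff' n t1 z \<noteq> 0" "cone_cutoff k S R z \<noteq> 0" by auto
    then have 1: "1 / n < fst z \<and> fst z < t1 - 1 / n" and 2: "\<bar>snd z\<bar> < R - S * fst z"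
      using time_cutoff_nz[of n t1 z] cone_cutoff_nz[of k S R z] n k by blast+
    have "0 < 1 / n" using n by simp
    then have p: "0 < fst z" "fst z < t1" using 1 by linarith+
    moreover have "0 \<le> S * fst z" using p S_nonneg by simp
    ultimately show "norm z \<le> t1 + R" using 2 by (intro norm_le_of_strip_box) auto
  qed
qed

text \<open>Add the left balance for \<open>ul\<close> and the right balance for \<open>ur\<close>.
  The two path terms combine to the integral of \<open>D\<close>, the measure \<open>N\<close>
  enters with a favourable sign, and the lateral terms drop out by \<open>cone_flux_le\<close>. The
  mass of \<open>P\<close> is counted once on each open side and, through
  \<open>path_production_le\<close>, twice on the path; the larger weight gives the factor
  2.\<close>

lemma energy_inequality:
  assumes n: "n > 0" and k: "k > 0" and t1: "0 < t1" "t1 \<le> T"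
  shows "- (LINT z|lborel. dist2 z * (time_cutoff' n t1 z * cone_cutoff k S R z))
      + \<kappa> * (LINT t|lborel. time_cutoff n t1 (t, x t) * cone_cutoff k S R (t, x t) * (v t - \<sigma>)\<^sup>2)
    \<le> 2 * measure P ({0..t1} \<times> {-R..R})"
proof -
  obtain A where A0: "0 \<le> A" and A: "\<And>v. v \<in> {lo..hi} \<Longrightarrow> \<bar>v\<^sup>2 / 2\<bar> \<le> A" "\<And>v. v \<in> {lo..hi} \<Longrightarrow> \<bar>q v\<bar> \<le> A"
    "\<And>c v. c \<in> {ul, ur} \<Longrightarrow> v \<in> {lo..hi} \<Longrightarrow> \<bar>rel_entropy c v\<bar> \<le> A"
    "\<And>c v. c \<in> {ul, ur} \<Longrightarrow> v \<in> {lo..hi} \<Longrightarrow> \<bar>rel_flux f q c v\<bar> \<le> A"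
    by (rule bound_on_states) blast
  have cr: "continuous_on UNIV (rel_entropy c)" "continuous_on UNIV (rel_flux f q c)" for c
    unfolding rel_entropy_def[abs_def] rel_flux_def[abs_def] by (intro continuous_intros f_continuous; simp)+
  have ul: "ul \<in> {ul, ur}" and ur: "ur \<in> {ul, ur}" by auto
  interpret e: traced_balance S x v T A "\<lambda>z. (w z)\<^sup>2 / 2" "\<lambda>z. q (w z)" P N "\<lambda>t. (Up t)\<^sup>2 / 2" "\<lambda>t. (Um t)\<^sup>2 / 2" "\<lambda>t. q (Up t)" "\<lambda>t. q (Um t)"
  proof (rule traced[OF bal_e PN _ f_continuous(3) A(1,2)])
    show "continuous_on UNIV (\<lambda>v::real. v\<^sup>2 / 2)" by (intro continuous_intros) simp
  qed
  interpret l: traced_balance S x v T A "\<lambda>z. rel_entropy ul (w z)" "\<lambda>z. rel_flux f q ul (w z)" P N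
    "\<lambda>t. rel_entropy ul (Up t)" "\<lambda>t. rel_entropy ul (Um t)" "\<lambda>t. rel_flux f q ul (Up t)" "\<lambda>t. rel_flux f q ul (Um t)"
    by (rule traced[OF bal_rel[OF ul] PN cr A(3)[OF ul] A(4)[OF ul]])
  interpret r: traced_balance S x v T A "\<lambda>z. rel_entropy ur (w z)" "\<lambda>z. rel_flux f q ur (w z)" P N
    "\<lambda>t. rel_entropy ur (Up t)" "\<lambda>t. rel_entropy ur (Um t)" "\<lambda>t. rel_flux f q ur (Up t)" "\<lambda>t. rel_flux f q ur (Um t)"
    by (rule traced[OF bal_rel[OF ur] PN cr A(3)[OF ur] A(4)[OF ur]])
  define \<psi> where "\<psi> z = time_cutoff n t1 z * cone_cutoff k S R z" for z
  define \<psi>t where "\<psi>t z = time_cutoff' n t1 z * cone_cutoff k S R z + cone_cutoff_t k S R z * time_cutoff n t1 z" for z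
  define \<psi>x where "\<psi>x z = cone_cutoff_x k S R z * time_cutoff n t1 z" for z
  have test: "lip_test T \<psi> \<psi>t \<psi>x"
    unfolding \<psi>_def[abs_def] \<psi>t_def[abs_def] \<psi>x_def[abs_def] by (rule cutoff_lip_test[OF n k S_nonneg t1(2)])
  have pos: "0 \<le> \<psi> z" and le1: "\<psi> z \<le> 1" for z
    unfolding \<psi>_def by (intro mult_nonneg_nonneg mult_le_one cutoff_bounds)+
  obtain B R' where B: "continuous_on UNIV \<psi>" "\<And>z. \<bar>\<psi> z\<bar> \<le> B" "0 \<le> B" "\<And>z. \<psi> z \<noteq> 0 \<Longrightarrow> 0 < fst z \<and> fst z < T \<and> norm z \<le> R'"
    and [measurable]: "\<psi>t \<in> borel_measurable borel" "\<psi>x \<in> borel_measurable borel"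
    and Bd: "\<And>z. \<bar>\<psi>t z\<bar> \<le> B" "\<And>z. \<bar>\<psi>x z\<bar> \<le> B" "\<And>z. \<psi>t z \<noteq> 0 \<or> \<psi>x z \<noteq> 0 \<Longrightarrow> norm z \<le> R'"
    by (rule e.test_data[OF test]) blast
  have [measurable]: "\<psi> \<in> borel_measurable borel" using B(1) by (rule borel_measurable_continuous_onI)
  let ?d = "\<lambda>z. snd z - x (fst z)"
  have ms[measurable]: "(\<lambda>z. c * ?d z) \<in> borel_measurable borel" for c by measurable
  define FL where "FL z = rel_entropy ul (w z) * \<psi>t z + rel_flux f q ul (w z) * \<psi>x z" for z
  define FR where "FR z = rel_entropy ur (w z) * \<psi>t z + rel_flux f q ur (w z) * \<psi>x z" for z
  have [measurable]: "FL \<in> borel_measurable borel" "FR \<in> borel_measurable borel"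
    unfolding FL_def FR_def using l.ab_measurable r.ab_measurable by measurable
  have FLR: "integrable lborel FL" "integrable lborel FR"
    unfolding FL_def FR_def
    using lip_test_integrable[OF test l.ab_measurable(1) l.ab_bound(1)] lip_test_integrable[OF test l.ab_measurable(2) l.ab_bound(2)]
      lip_test_integrable[OF test r.ab_measurable(1) r.ab_bound(1)] lip_test_integrable[OF test r.ab_measurable(2) r.ab_bound(2)]
    by simp_all
  have ind: "integrable lborel (\<lambda>z. indicator {0<..} (c * ?d z) * F z)"
    if "integrable lborel F" for c and F :: "real \<times> real \<Rightarrow> real"
  proof (rule Bochner_Integration.integrable_bound[OF that])
    show "(\<lambda>z. indicator {0<..} (c * ?d z) * F z) \<in> borel_measurable lborel"
      using borel_measurable_integrable[OF that] by measurable
  qed (auto simp: indicator_def)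
  have L: "- (LINT z|lborel. indicator {0<..} (-1 * ?d z) * FL z) - (-1) * (LINT t|lborel. \<psi> (t, x t) * (rel_flux f q ul (Um t) - v t * rel_entropy ul (Um t)))
     = (LINT z|P. indicator {0<..} (-1 * ?d z) * \<psi> z) - (LINT z|N. indicator {0<..} (-1 * ?d z) * \<psi> z)"
    unfolding FL_def
    by (rule one_sided_balance[OF l.bal PN l.ab_measurable l.ab_bound lip v_measurable v_bound v_deriv _ l.traces(2,4) test]) simp
  have R: "- (LINT z|lborel. indicator {0<..} (1 * ?d z) * FR z) - 1 * (LINT t|lborel. \<psi> (t, x t) * (rel_flux f q ur (Up t) - v t * rel_entropy ur (Up t)))
     = (LINT z|P. indicator {0<..} (1 * ?d z) * \<psi> z) - (LINT z|N. indicator {0<..} (1 * ?d z) * \<psi> z)"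
    unfolding FR_def
    by (rule one_sided_balance[OF r.bal PN r.ab_measurable r.ab_bound lip v_measurable v_bound v_deriv _ r.traces(1,3) test]) simp
  have rm[measurable]: "(\<lambda>t. rel_flux f q ul (Um t) - v t * rel_entropy ul (Um t)) \<in> borel_measurable borel"
    "(\<lambda>t. rel_flux f q ur (Up t) - v t * rel_entropy ur (Up t)) \<in> borel_measurable borel"
    using l.trace_measurable r.trace_measurable by measurable
  have intL: "integrable lborel (\<lambda>t. \<psi> (t, x t) * (rel_flux f q ul (Um t) - v t * rel_entropy ul (Um t)))"
    by (rule e.integrable_on_path[OF test rm(1) l.side_bound(2)])
  have intR: "integrable lborel (\<lambda>t. \<psi> (t, x t) * (rel_flux f q ur (Up t) - v t * rel_entropy ur (Up t)))"
    by (rule e.integrable_on_path[OF test rm(2) r.side_bound(1)])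
  have Dint: "(LINT t|lborel. \<psi> (t, x t) * D t)
     = (LINT t|lborel. \<psi> (t, x t) * (rel_flux f q ur (Up t) - v t * rel_entropy ur (Up t)))
       - (LINT t|lborel. \<psi> (t, x t) * (rel_flux f q ul (Um t) - v t * rel_entropy ul (Um t)))"
    and iD: "integrable lborel (\<lambda>t. \<psi> (t, x t) * D t)"
  proof -
    have e: "\<psi> (t, x t) * D t = \<psi> (t, x t) * (rel_flux f q ur (Up t) - v t * rel_entropy ur (Up t))
        - \<psi> (t, x t) * (rel_flux f q ul (Um t) - v t * rel_entropy ul (Um t))" for t
      by (simp add: D_def algebra_simps)
    show "(LINT t|lborel. \<psi> (t, x t) * D t)
     = (LINT t|lborel. \<psi> (t, x t) * (rel_flux f q ur (Up t) - v t * rel_entropy ur (Up t)))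
       - (LINT t|lborel. \<psi> (t, x t) * (rel_flux f q ul (Um t) - v t * rel_entropy ul (Um t)))"
      unfolding e by (rule Bochner_Integration.integral_diff[OF intR intL])
    show "integrable lborel (\<lambda>t. \<psi> (t, x t) * D t)"
      unfolding e by (rule Bochner_Integration.integrable_diff[OF intR intL])
  qed
  have mj: "e.jump t = m t" for t by (simp add: e.jump_def m_def)
  have im: "integrable lborel (\<lambda>t. \<psi> (t, x t) * max 0 (m t))"
  proof (rule e.integrable_on_path[OF test])
    show "(\<lambda>t. max 0 (m t)) \<in> borel_measurable borel" using e.jump_measurable unfolding mj[abs_def] by measurable
    show "\<bar>max 0 (m t)\<bar> \<le> 2 * (A + S * A)" for t using e.jump_bound[of t] unfolding mj by linarith
  qed
  have iv: "integrable lborel (\<lambda>t. \<psi> (t, x t) * (v t - \<sigma>)\<^sup>2)"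
  proof (rule e.integrable_on_path[OF test])
    show "\<bar>(v t - \<sigma>)\<^sup>2\<bar> \<le> (S + \<bar>\<sigma>\<bar>)\<^sup>2" for t
    proof -
      have "\<bar>v t - \<sigma>\<bar> \<le> S + \<bar>\<sigma>\<bar>" using v_bound[of t] by linarith
      then have "\<bar>v t - \<sigma>\<bar>\<^sup>2 \<le> (S + \<bar>\<sigma>\<bar>)\<^sup>2" by (rule power_mono) simp
      then show ?thesis by simp
    qed
  qed measurable
  have "(LINT t|lborel. \<psi> (t, x t) * D t) \<le> (LINT t|lborel. 2 * (\<psi> (t, x t) * max 0 (m t)) - \<kappa> * (\<psi> (t, x t) * (v t - \<sigma>)\<^sup>2))"
  proof (rule integral_mono_AE[OF iD])
    show "integrable lborel (\<lambda>t. 2 * (\<psi> (t, x t) * max 0 (m t)) - \<kappa> * (\<psi> (t, x t) * (v t - \<sigma>)\<^sup>2))"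
      by (intro Bochner_Integration.integrable_diff integrable_mult_right im iv)
    show "AE t in lborel. \<psi> (t, x t) * D t \<le> 2 * (\<psi> (t, x t) * max 0 (m t)) - \<kappa> * (\<psi> (t, x t) * (v t - \<sigma>)\<^sup>2)"
      using dissipation
    proof eventually_elim
      case (elim t)
      show ?case
      proof (cases "\<psi> (t, x t) = 0")
        case False
        then have "0 < t \<and> t < T" using B(4)[of "(t, x t)"] by simp
        then have "\<psi> (t, x t) * D t \<le> \<psi> (t, x t) * (2 * max 0 (m t) - \<kappa> * (v t - \<sigma>)\<^sup>2)"
          using elim pos by (intro mult_left_mono) auto
        then show ?thesis by (simp add: algebra_simps)
      qed simp
    qed
  qed
  also have "\<dots> = 2 * (LINT t|lborel. \<psi> (t, x t) * max 0 (m t)) - \<kappa> * (LINT t|lborel. \<psi> (t, x t) * (v t - \<sigma>)\<^sup>2)"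
    using im iv by simp
  also have "(LINT t|lborel. \<psi> (t, x t) * max 0 (m t)) \<le> (LINT z|P. indicator {0} (?d z) * \<psi> z)"
    using e.path_production_le[OF test pos] unfolding mj .
  finally have path: "(LINT t|lborel. \<psi> (t, x t) * D t)
     \<le> 2 * (LINT z|P. indicator {0} (?d z) * \<psi> z) - \<kappa> * (LINT t|lborel. \<psi> (t, x t) * (v t - \<sigma>)\<^sup>2)" by linarith
  define K where "K = {0..t1} \<times> {-R..R}"
  have sK: "\<psi> z \<le> indicator K z" for z
  proof (cases "\<psi> z = 0")
    case False
    then have "time_cutoff n t1 z \<noteq> 0" "cone_cutoff k S R z \<noteq> 0" by (auto simp: \<psi>_def)
    then have 1: "1 / n < fst z \<and> fst z < t1 - 1 / n" and 2: "\<bar>snd z\<bar> < R - S * fst z"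
      using time_cutoff_nz[of n t1 z] cone_cutoff_nz[of k S R z] n k by blast+
    have "0 < 1 / n" using n by simp
    then have "0 < fst z" "fst z < t1" using 1 by linarith+
    moreover have "0 \<le> S * fst z" using \<open>0 < fst z\<close> S_nonneg by simp
    ultimately have "z \<in> K" using 2 unfolding K_def mem_Times_iff by auto
    then show ?thesis using le1 by simp
  qed simp
  have Kc: "compact K" unfolding K_def by (intro compact_Times) simp_all
  have sP: "sets P = sets borel" using PN(1) by (simp add: radon_on_strip_def)
  have iK: "integrable P (indicat_real K)"
  proof (rule integrable_real_indicator)
    show "K \<in> sets P" using sP Kc by (simp add: compact_imp_closed borel_closed)
    show "emeasure P K < \<infinity>" using PN(1) Kc by (simp add: radon_on_strip_def)
  qed
  have iE: "integrable M' (\<lambda>z. indicator E (g z) * \<psi> z)"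
    if "radon_on_strip T M'" "g \<in> borel_measurable borel" "E \<in> sets borel" for E M' and g :: "real \<times> real \<Rightarrow> real"
  proof (rule integrable_radon_bounded_support[OF that(1), where B=B and R=R'])
    show "\<bar>indicator E (g z) * \<psi> z\<bar> \<le> B" for z using B(2)[of z] B(3) by (auto simp: indicator_def)
    show "norm z \<le> R'" if "indicator E (g z) * \<psi> z \<noteq> 0" for z using B(4)[of z] that by auto
  qed (use that in measurable)
  have prod: "(LINT z|P. indicator {0<..} (-1 * ?d z) * \<psi> z) + (LINT z|P. indicator {0<..} (1 * ?d z) * \<psi> z) + 2 * (LINT z|P. indicator {0} (?d z) * \<psi> z)
     \<le> 2 * measure P K"
  proof -
    have i: "integrable P (\<lambda>z. indicator {0<..} (-1 * ?d z) * \<psi> z)" "integrable P (\<lambda>z. indicator {0<..} (1 * ?d z) * \<psi> z)"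
      "integrable P (\<lambda>z. indicator {0} (?d z) * \<psi> z)"
      by (intro iE PN ms offset_measurable; simp)+
    have "(LINT z|P. indicator {0<..} (-1 * ?d z) * \<psi> z) + (LINT z|P. indicator {0<..} (1 * ?d z) * \<psi> z) + 2 * (LINT z|P. indicator {0} (?d z) * \<psi> z)
      = (LINT z|P. indicator {0<..} (-1 * ?d z) * \<psi> z + indicator {0<..} (1 * ?d z) * \<psi> z + 2 * (indicator {0} (?d z) * \<psi> z))"
      using i by simp
    also have "\<dots> \<le> (LINT z|P. 2 * indicator K z)"
    proof (rule integral_mono)
      show "integrable P (\<lambda>z. indicator {0<..} (-1 * ?d z) * \<psi> z + indicator {0<..} (1 * ?d z) * \<psi> z + 2 * (indicator {0} (?d z) * \<psi> z))"
        by (intro Bochner_Integration.integrable_add integrable_mult_right i)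
      show "integrable P (\<lambda>z. 2 * indicat_real K z)" by (intro integrable_mult_right iK)
      fix z
      have "indicator {0<..} (-1 * ?d z) * \<psi> z + indicator {0<..} (1 * ?d z) * \<psi> z + 2 * (indicator {0} (?d z) * \<psi> z) \<le> 2 * \<psi> z"
        using pos[of z] by (auto simp: indicator_def)
      also have "\<dots> \<le> 2 * indicator K z" using sK[of z] by simp
      finally show "indicator {0<..} (-1 * ?d z) * \<psi> z + indicator {0<..} (1 * ?d z) * \<psi> z + 2 * (indicator {0} (?d z) * \<psi> z) \<le> 2 * indicator K z" .
    qed
    also have "\<dots> = 2 * measure P K" using sP Kc by (simp add: compact_imp_closed borel_closed)
    finally show ?thesis .
  qed
  have Nnn: "0 \<le> (LINT z|N. indicator {0<..} (c * ?d z) * \<psi> z)" for c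
    using pos by (intro integral_nonneg_AE AE_I2 mult_nonneg_nonneg) simp_all
  note iT = dist2_cutoff_integrable[OF n k, of t1 R]
  have "(LINT z|lborel. indicator {0<..} (-1 * ?d z) * FL z) + (LINT z|lborel. indicator {0<..} (1 * ?d z) * FR z)
      = (LINT z|lborel. indicator {0<..} (-1 * ?d z) * FL z + indicator {0<..} (1 * ?d z) * FR z)"
    by (rule Bochner_Integration.integral_add[OF ind[OF FLR(1)] ind[OF FLR(2)], symmetric])
  also have "\<dots> \<le> (LINT z|lborel. dist2 z * (time_cutoff' n t1 z * cone_cutoff k S R z))"
  proof (rule integral_mono_AE[OF _ iT])
    show "integrable lborel (\<lambda>z. indicator {0<..} (-1 * ?d z) * FL z + indicator {0<..} (1 * ?d z) * FR z)"
      by (intro Bochner_Integration.integrable_add ind FLR)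
    show "AE z in lborel. indicator {0<..} (-1 * ?d z) * FL z + indicator {0<..} (1 * ?d z) * FR z
        \<le> dist2 z * (time_cutoff' n t1 z * cone_cutoff k S R z)"
      using AE_offset
    proof eventually_elim
      case (elim z)
      have F: "rel_entropy c (w z) * \<psi>t z + rel_flux f q c (w z) * \<psi>x z \<le> rel_entropy c (w z) * (time_cutoff' n t1 z * cone_cutoff k S R z)"
        if "c \<in> {lo..hi}" for c
      proof -
        have "rel_entropy c (w z) * cone_cutoff_t k S R z + rel_flux f q c (w z) * cone_cutoff_x k S R z \<le> 0"
          by (rule cone_flux_le[OF rel_flux_le[OF f q speed_bound that w_mem] k])
        then have "time_cutoff n t1 z * (rel_entropy c (w z) * cone_cutoff_t k S R z + rel_flux f q c (w z) * cone_cutoff_x k S R z) \<le> 0"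
          using cutoff_bounds(1)[of n t1 z] by (rule mult_nonneg_nonpos[rotated])
        then show ?thesis unfolding \<psi>t_def \<psi>x_def by (simp add: algebra_simps)
      qed
      show ?case
      proof (cases "?d z > 0")
        case True
        then have "dist2 z = rel_entropy ur (w z)" by (simp add: dist2_def rel_entropy_def shock_data_def)
        then show ?thesis using F[OF states(2)] True by (simp add: FR_def)
      next
        case False
        then have "?d z < 0" using elim by linarith
        then have "dist2 z = rel_entropy ul (w z)" by (simp add: dist2_def rel_entropy_def shock_data_def)
        then show ?thesis using F[OF states(1)] \<open>?d z < 0\<close> by (simp add: FL_def)
      qed
    qed
  qed
  finally have flux: "(LINT z|lborel. indicator {0<..} (-1 * ?d z) * FL z) + (LINT z|lborel. indicator {0<..} (1 * ?d z) * FR z)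
      \<le> (LINT z|lborel. dist2 z * (time_cutoff' n t1 z * cone_cutoff k S R z))" .
  have "- (LINT z|lborel. dist2 z * (time_cutoff' n t1 z * cone_cutoff k S R z)) + \<kappa> * (LINT t|lborel. \<psi> (t, x t) * (v t - \<sigma>)\<^sup>2) \<le> 2 * measure P K"
    using flux L R Dint path prod Nnn[of 1] Nnn[of "-1"] by linarith
  then show ?thesis unfolding \<psi>_def K_def .
qed

end

section \<open>From almost every time to every time\<close>

section \<open>Time slices\<close>

text \<open>A punctured neighbourhood of \<open>t\<close> in \<open>[0, T]\<close> has positive
  measure, also when \<open>t\<close> is an endpoint, so it contains a time at which an almost
  everywhere property holds.\<close>

lemma eventually_within_meets_AE:
  fixes t T :: real
  assumes T: "0 < T" and t: "t \<in> {0..T}" and ev: "eventually Q (at t within {0..T})"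
    and ae: "AE s in lborel. s \<in> {0..T} \<longrightarrow> G s"
  shows "\<exists>s\<in>{0..T}. Q s \<and> G s"
proof (rule ccontr)
  assume neg: "\<not> (\<exists>s\<in>{0..T}. Q s \<and> G s)"
  obtain d where d: "d > 0" "\<And>s. s \<in> {0..T} \<Longrightarrow> s \<noteq> t \<Longrightarrow> dist s t < d \<Longrightarrow> Q s"
    using ev unfolding eventually_at by blast
  define a b where "a = max 0 (t - d)" and "b = min T (t + d)"
  have ab: "a < b" using T t d(1) by (auto simp: a_def b_def)
  have "AE s in lborel. s \<noteq> t" by (rule AE_lborel_singleton)
  with ae have "AE s in lborel. s \<notin> {a<..<b}"
  proof eventually_elim
    case (elim s)
    show ?case
    proof
      assume "s \<in> {a<..<b}"
      then have s: "s \<in> {0..T}" "dist s t < d" by (auto simp: a_def b_def dist_real_def)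
      then have "Q s" "G s" using d(2) elim by blast+
      then show False using neg s by blast
    qed
  qed
  then have "emeasure lborel {a<..<b} = 0" by (subst (asm) AE_iff_measurable[OF _ refl]) (auto simp: greaterThanLessThan_def greaterThan_def lessThan_def Int_def)
  then show False using ab by simp
qed

lemma lebesgue_measurable_of_set_integrable:
  fixes g :: "real \<Rightarrow> real"
  assumes "\<And>R. set_integrable lebesgue {-R..R} g"
  shows "g \<in> borel_measurable lebesgue"
proof (rule borel_measurable_LIMSEQ_real)
  show "(\<lambda>y. indicator {- real n..real n} y * g y) \<in> borel_measurable lebesgue" for n
    using borel_measurable_integrable[OF assms[of "real n", unfolded set_integrable_def]] by simp
  show "(\<lambda>n. indicator {- real n..real n} y * g y) \<longlonglongrightarrow> g y" for y
  proof (rule tendsto_eventually)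
    obtain m where m: "\<bar>y\<bar> \<le> real m" using real_arch_simple by blast
    show "\<forall>\<^sub>F n in sequentially. indicator {- real n..real n} y * g y = g y"
      unfolding eventually_sequentially
    proof (intro exI allI impI)
      fix n assume "m \<le> n"
      then have "\<bar>y\<bar> \<le> real n" using m by linarith
      then show "indicator {- real n..real n} y * g y = g y" by (auto simp: indicator_def)
    qed
  qed
qed

text \<open>Let \<open>d\<close> measure how far a value lies outside \<open>[lo, hi]\<close>. If
  the slice at time \<open>s\<close> has values in the interval, then
  \<open>d (u t) \<le> \<bar>u s - u t\<bar>\<close>, and continuity in time makes the integral of
  the right side over bounded sets arbitrarily small for such \<open>s\<close> near
  \<open>t\<close>.\<close>

lemma slice_mem_interval:
  assumes T: "0 < T" and L: "L1loc_continuous T u"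
    and good: "AE t in lborel. t \<in> {0..T} \<longrightarrow> (AE y in lborel. u t y \<in> {lo..hi})" and t: "t \<in> {0..T}"
  shows "AE y in lborel. u t y \<in> {lo..hi}"
proof -
  have um: "u s \<in> borel_measurable lebesgue" and ui: "set_integrable lebesgue {-R..R} (u s)" if "s \<in> {0..T}" for s R
    using L that lebesgue_measurable_of_set_integrable unfolding L1loc_continuous_def by blast+
  have lim: "((\<lambda>s. LINT x:{-R..R}|lebesgue. \<bar>u s x - u t x\<bar>) \<longlongrightarrow> 0) (at t within {0..T})" for R
    using L t unfolding L1loc_continuous_def by blast
  define d where "d y = max 0 (lo - y) + max 0 (y - hi)" for y :: real
  have dm[measurable]: "d \<in> borel_measurable borel" unfolding d_def by measurable
  have d0: "0 \<le> d y" for y by (simp add: d_def)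
  have "AE y in lebesgue. indicator {- real n..real n} y * d (u t y) = 0" for n
  proof -
    let ?K = "{- real n..real n}"
    have est: "indicator ?K y * d (u t y) \<le> indicator ?K y * \<bar>u s y - u t y\<bar>" if "u s y \<in> {lo..hi}" for s y
      using that by (auto simp: d_def indicator_def)
    have ii: "integrable lebesgue (\<lambda>y. indicator ?K y * \<bar>u s y - u t y\<bar>)" if "s \<in> {0..T}" for s
    proof -
      have "set_integrable lebesgue ?K (\<lambda>y. \<bar>u s y - u t y\<bar>)"
        by (intro set_integrable_abs set_integral_diff ui t that)
      then show ?thesis by (simp add: set_integrable_def)
    qed
    have gl: "AE s in lborel. s \<in> {0..T} \<longrightarrow> (AE y in lebesgue. u s y \<in> {lo..hi})"
      using good by eventually_elim (auto intro: AE_completion)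
    have dmt: "(\<lambda>y. indicator ?K y * d (u t y)) \<in> borel_measurable lebesgue"
      by (intro borel_measurable_times borel_measurable_indicator measurable_compose[OF um[OF t] dm]) simp
    \<comment> \<open>Any single good time dominates \<open>d (u t)\<close> and so makes it
      integrable on bounded sets.\<close>
    obtain s0 where s0: "s0 \<in> {0..T}" "AE y in lebesgue. u s0 y \<in> {lo..hi}"
      using eventually_within_meets_AE[OF T t _ gl, of "\<lambda>_. True"] by auto
    have id: "integrable lebesgue (\<lambda>y. indicator ?K y * d (u t y))"
    proof (rule Bochner_Integration.integrable_bound[OF ii[OF s0(1)] dmt])
      show "AE y in lebesgue. norm (indicator ?K y * d (u t y)) \<le> norm (indicator ?K y * \<bar>u s0 y - u t y\<bar>)"
        using s0(2)
      proof eventually_elim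
        case (elim y)
        show ?case using est[OF elim] d0[of "u t y"] by (auto simp: abs_mult indicator_def)
      qed
    qed
    have "(LINT y|lebesgue. indicator ?K y * d (u t y)) \<le> 0"
    proof (rule field_le_epsilon)
      fix e :: real assume "0 < e"
      then have "\<forall>\<^sub>F s in at t within {0..T}. (LINT x:?K|lebesgue. \<bar>u s x - u t x\<bar>) < e"
        by (rule order_tendstoD(2)[OF lim])
      from eventually_within_meets_AE[OF T t this gl]
      obtain s where s: "s \<in> {0..T}" "(LINT x:?K|lebesgue. \<bar>u s x - u t x\<bar>) < e" "AE y in lebesgue. u s y \<in> {lo..hi}" by blast
      have "(LINT y|lebesgue. indicator ?K y * d (u t y)) \<le> (LINT y|lebesgue. indicator ?K y * \<bar>u s y - u t y\<bar>)"
        by (rule integral_mono_AE[OF id ii[OF s(1)]]) (use s(3) in eventually_elim, rule est)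
      also have "\<dots> = (LINT x:?K|lebesgue. \<bar>u s x - u t x\<bar>)" by (simp add: set_lebesgue_integral_def)
      finally show "(LINT y|lebesgue. indicator ?K y * d (u t y)) \<le> 0 + e" using s(2) by linarith
    qed
    moreover have nn: "AE y in lebesgue. 0 \<le> indicator ?K y * d (u t y)" using d0 by simp
    ultimately have "(LINT y|lebesgue. indicator ?K y * d (u t y)) = 0"
      using integral_nonneg_AE[OF nn] by linarith
    then show ?thesis using integral_nonneg_eq_0_iff_AE[OF id nn] by blast
  qed
  then have "AE y in lebesgue. \<forall>n. indicator {- real n..real n} y * d (u t y) = 0" unfolding AE_all_countable by blast
  then have "AE y in lebesgue. u t y \<in> {lo..hi}"
  proof eventually_elim
    case (elim y)
    obtain m where m: "\<bar>y\<bar> \<le> real m" using real_arch_simple by blast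
    then have "d (u t y) = 0" using elim[rule_format, of m] by (auto simp: indicator_def split: if_splits)
    then show ?case by (auto simp: d_def max_def split: if_splits)
  qed
  then show ?thesis by (simp add: AE_completion_iff)
qed

text \<open>\<open>w\<close> describes the solution at almost every time only. A Borel version
  \<open>U t\<close> of each slice of \<open>u\<close> is available at every time and inherits
  continuity in \<open>t\<close>; joint measurability is left to \<open>w\<close>, and the two agree
  at almost every time.\<close>

lemma slice_representatives:
  assumes T: "0 < T" and L: "L1loc_continuous T u" and lh: "lo \<le> hi"
    and w: "\<And>z. w z \<in> {lo..hi}" and wu: "AE z in lborel. fst z \<in> {0..T} \<longrightarrow> w z = u (fst z) (snd z)"
  obtains U :: "real \<Rightarrow> real \<Rightarrow> real" where "\<And>t. U t \<in> borel_measurable borel" "\<And>t y. U t y \<in> {lo..hi}"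
    "\<And>t. t \<in> {0..T} \<Longrightarrow> AE y in lborel. u t y = U t y"
    "AE t in lborel. t \<in> {0..T} \<longrightarrow> (AE y in lborel. w (t, y) = U t y)"
    "\<And>t R. t \<in> {0..T} \<Longrightarrow> ((\<lambda>s. LINT y|lborel. indicator {-R..R} y * \<bar>U s y - U t y\<bar>) \<longlongrightarrow> 0) (at t within {0..T})"
proof -
  have wt: "AE t in lborel. t \<in> {0..T} \<longrightarrow> (AE y in lborel. w (t, y) = u t y)"
    using AE_lborel_pair[OF wu]
  proof eventually_elim
    case (elim t)
    show ?case
    proof
      assume "t \<in> {0..T}"
      then show "AE y in lborel. w (t, y) = u t y" using elim by simp
    qed
  qed
  have good: "AE t in lborel. t \<in> {0..T} \<longrightarrow> (AE y in lborel. u t y \<in> {lo..hi})"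
    using wt
  proof eventually_elim
    case (elim t)
    show ?case
    proof
      assume "t \<in> {0..T}"
      then have "AE y in lborel. w (t, y) = u t y" using elim by blast
      then show "AE y in lborel. u t y \<in> {lo..hi}"
      proof eventually_elim
        case (elim y)
        then show ?case using w[of "(t, y)"] by simp
      qed
    qed
  qed
  have ex: "\<exists>V. V \<in> borel_measurable borel \<and> (\<forall>y. V y \<in> {lo..hi}) \<and> (t \<in> {0..T} \<longrightarrow> (AE y in lborel. u t y = V y))" for t
  proof (cases "t \<in> {0..T}")
    case True
    have "u t \<in> borel_measurable lebesgue"
      using L True lebesgue_measurable_of_set_integrable unfolding L1loc_continuous_def by blast
    then obtain V where V: "V \<in> borel_measurable lborel" "AE y in lborel. u t y = V y"
      using completion_ex_borel_measurable_real by blast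
    have [measurable]: "V \<in> borel_measurable borel" using V(1) by simp
    show ?thesis
    proof (intro exI[of _ "\<lambda>y. max lo (min hi (V y))"] conjI impI allI)
      show "(\<lambda>y. max lo (min hi (V y))) \<in> borel_measurable borel" by measurable
      show "max lo (min hi (V y)) \<in> {lo..hi}" for y using lh by auto
      show "AE y in lborel. u t y = max lo (min hi (V y))"
        using V(2) slice_mem_interval[OF T L good True] by eventually_elim auto
    qed
  next
    case False
    then show ?thesis using lh by (intro exI[of _ "\<lambda>_. lo"]) auto
  qed
  define U where "U t = (SOME V. V \<in> borel_measurable borel \<and> (\<forall>y. V y \<in> {lo..hi}) \<and> (t \<in> {0..T} \<longrightarrow> (AE y in lborel. u t y = V y)))" for t
  have U: "U t \<in> borel_measurable borel \<and> (\<forall>y. U t y \<in> {lo..hi}) \<and> (t \<in> {0..T} \<longrightarrow> (AE y in lborel. u t y = U t y))" for t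
    unfolding U_def by (rule someI_ex[OF ex])
  show thesis
  proof (rule that[of U])
    show "U t \<in> borel_measurable borel" "U t y \<in> {lo..hi}" for t y using U by blast+
    show Ut: "AE y in lborel. u t y = U t y" if "t \<in> {0..T}" for t using U that by blast
    show "AE t in lborel. t \<in> {0..T} \<longrightarrow> (AE y in lborel. w (t, y) = U t y)"
      using wt
    proof eventually_elim
      case (elim t)
      show ?case
      proof
        assume t: "t \<in> {0..T}"
        then have "AE y in lborel. w (t, y) = u t y" using elim by blast
        then show "AE y in lborel. w (t, y) = U t y" using Ut[OF t] by eventually_elim simp
      qed
    qed
    fix t R assume t: "t \<in> {0..T}"
    have "((\<lambda>s. LINT x:{-R..R}|lebesgue. \<bar>u s x - u t x\<bar>) \<longlongrightarrow> 0) (at t within {0..T})"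
      using L t unfolding L1loc_continuous_def by blast
    then show "((\<lambda>s. LINT y|lborel. indicator {-R..R} y * \<bar>U s y - U t y\<bar>) \<longlongrightarrow> 0) (at t within {0..T})"
    proof (rule Lim_transform_within[OF _ zero_less_one])
      fix s assume s: "s \<in> {0..T}"
      have "(LINT x|lebesgue. indicator {-R..R} x * \<bar>u s x - u t x\<bar>) = (LINT y|lborel. indicator {-R..R} y * \<bar>U s y - U t y\<bar>)"
      proof (rule lebesgue_integral_AE_borel(1))
        have [measurable]: "U s \<in> borel_measurable borel" "U t \<in> borel_measurable borel" using U by blast+
        show "(\<lambda>y. indicator {-R..R} y * \<bar>U s y - U t y\<bar>) \<in> borel_measurable borel" by measurable
        show "AE y in lborel. indicator {-R..R} y * \<bar>u s y - u t y\<bar> = indicator {-R..R} y * \<bar>U s y - U t y\<bar>"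
          using Ut[OF s] Ut[OF t] by eventually_elim simp
      qed
      then show "(LINT x:{-R..R}|lebesgue. \<bar>u s x - u t x\<bar>) = (LINT y|lborel. indicator {-R..R} y * \<bar>U s y - U t y\<bar>)"
        by (simp add: set_lebesgue_integral_def)
    qed
  qed
qed

text \<open>The derivative of the trapezoid is \<open>n\<close> on its rising part and
  \<open>- n\<close> on its falling part, each of length \<open>1 / n\<close>, so the integral is a
  mean of \<open>h\<close> near 0 minus a mean near \<open>t1\<close>. The condition
  \<open>4 \<le> n * t1\<close> makes each ramp equal to 1 where the other one varies.\<close>

lemma time_cutoff'_integral_le:
  fixes h :: "real \<Rightarrow> real"
  assumes n: "n > 0" "4 \<le> n * t1" and int: "integrable lborel (\<lambda>t. time_cutoff' n t1 (t, y) * h t)"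
    and a: "AE t in lborel. 0 < t \<and> t < 2 / n \<longrightarrow> h t \<le> a" and b: "AE t in lborel. t1 - 2 / n < t \<and> t < t1 \<longrightarrow> b \<le> h t"
  shows "(LINT t|lborel. time_cutoff' n t1 (t, y) * h t) \<le> a - b"
proof -
  have eq: "time_cutoff' n t1 (t, y) = n * indicator {1 / n<..<2 / n} t - n * indicator {t1 - 2 / n<..<t1 - 1 / n} t" for t
  proof -
    have i1: "indicat_real {0<..<1} (n * t + (-1)) = indicator {1 / n<..<2 / n} t"
      using n by (auto simp: indicator_def field_simps)
    have i2: "indicat_real {0<..<1} (- n * t + (n * t1 - 1)) = indicator {t1 - 2 / n<..<t1 - 1 / n} t"
      using n by (auto simp: indicator_def field_simps)
    have r1: "ramp (- n * t + (n * t1 - 1)) = 1" if "t \<in> {1 / n<..<2 / n}"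
    proof -
      have "n * t < 2" using that n by (simp add: pos_less_divide_eq mult.commute)
      then show ?thesis using n by (intro ramp_simps) simp
    qed
    have r2: "ramp (n * t + (-1)) = 1" if "t \<in> {t1 - 2 / n<..<t1 - 1 / n}"
    proof -
      have "n * (t1 - 2 / n) < n * t" using that n by (intro mult_strict_left_mono) auto
      then have "n * t1 - 2 < n * t" using n by (simp add: algebra_simps)
      then show ?thesis using n by (intro ramp_simps) simp
    qed
    have e: "indicat_real {1 / n<..<2 / n} t * ramp (- n * t + (n * t1 - 1)) = indicator {1 / n<..<2 / n} t"
      "indicat_real {t1 - 2 / n<..<t1 - 1 / n} t * ramp (n * t + (-1)) = indicator {t1 - 2 / n<..<t1 - 1 / n} t"
      using r1 r2 by (auto simp: indicator_def)
    show ?thesis unfolding time_cutoff'_def fst_conv i1 i2 mult.assoc e by simp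
  qed
  have iI: "integrable lborel (\<lambda>t. c * indicat_real {p<..<q} t)" for c p q :: real
    by (cases "p \<le> q") (auto intro!: integrable_mult_right integrable_real_indicator)
  have "(LINT t|lborel. time_cutoff' n t1 (t, y) * h t)
      \<le> (LINT t|lborel. a * n * indicator {1 / n<..<2 / n} t - b * n * indicator {t1 - 2 / n<..<t1 - 1 / n} t)"
  proof (rule integral_mono_AE[OF int])
    show "integrable lborel (\<lambda>t. a * n * indicator {1 / n<..<2 / n} t - b * n * indicator {t1 - 2 / n<..<t1 - 1 / n} t)"
      by (intro Bochner_Integration.integrable_diff iI)
    show "AE t in lborel. time_cutoff' n t1 (t, y) * h t \<le> a * n * indicator {1 / n<..<2 / n} t - b * n * indicator {t1 - 2 / n<..<t1 - 1 / n} t"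
      using a b
    proof eventually_elim
      case (elim t)
      have p: "0 < 1 / n" using n by simp
      have "indicator {1 / n<..<2 / n} t * h t \<le> indicator {1 / n<..<2 / n} t * a"
        using elim(1) p by (auto simp: indicator_def)
      then have 1: "n * (indicator {1 / n<..<2 / n} t * h t) \<le> n * (indicator {1 / n<..<2 / n} t * a)"
        by (rule mult_left_mono) (use n in simp)
      have "indicator {t1 - 2 / n<..<t1 - 1 / n} t * b \<le> indicator {t1 - 2 / n<..<t1 - 1 / n} t * h t"
        using elim(2) p by (auto simp: indicator_def)
      then have 2: "n * (indicator {t1 - 2 / n<..<t1 - 1 / n} t * b) \<le> n * (indicator {t1 - 2 / n<..<t1 - 1 / n} t * h t)"
        by (rule mult_left_mono) (use n in simp)
      show ?case unfolding eq using 1 2 by (simp add: algebra_simps)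
    qed
  qed
  also have "\<dots> = a * n * (1 / n) - b * n * (1 / n)"
    using n by (subst Bochner_Integration.integral_diff[OF iI iI]) (simp add: divide_right_mono diff_divide_distrib[symmetric])
  also have "\<dots> = a - b" using n by simp
  finally show ?thesis .
qed

lemma shock_data_shift_diff:
  "\<bar>shock_data ul ur (y - a) - shock_data ul ur (y - b)\<bar> \<le> (\<bar>ul\<bar> + \<bar>ur\<bar>) * indicator {min a b..max a b} y"
proof -
  consider "y < a \<and> y < b" | "a < y \<and> b < y" | "min a b \<le> y \<and> y \<le> max a b" by linarith
  then show ?thesis
  proof cases
    case 3
    have "\<bar>shock_data ul ur c - shock_data ul ur d\<bar> \<le> \<bar>ul\<bar> + \<bar>ur\<bar>" for c d
      by (auto simp: shock_data_def indicator_def)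
    then show ?thesis using 3 by (simp add: indicator_def)
  qed (simp_all add: shock_data_def indicator_def)
qed

lemma cone_cutoff_measurable[measurable]: "cone_cutoff k S R \<in> borel_measurable borel"
  unfolding cone_cutoff_def[abs_def]
  by (intro borel_measurable_continuous_onI continuous_intros continuous_on_compose2[OF continuous_ramp] subset_UNIV)

locale shock_slices = shock_path +
  fixes U :: "real \<Rightarrow> real \<Rightarrow> real"
  assumes U_borel[measurable]: "\<And>t. U t \<in> borel_measurable borel" and U_in: "\<And>t y. U t y \<in> {lo..hi}"
    and wU: "AE t in lborel. t \<in> {0..T} \<longrightarrow> (AE y in lborel. w (t, y) = U t y)"
    and U_cont: "\<And>t R. t \<in> {0..T} \<Longrightarrow> ((\<lambda>s. LINT y|lborel. indicator {-R..R} y * \<bar>U s y - U t y\<bar>) \<longlongrightarrow> 0) (at t within {0..T})"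
begin

definition A :: real where "A = \<bar>lo\<bar> + \<bar>hi\<bar> + \<bar>ul\<bar> + \<bar>ur\<bar>"

definition dev :: "real \<Rightarrow> real \<Rightarrow> real" where "dev t y = U t y - shock_data ul ur (y - x t)"

definition E :: "real \<Rightarrow> real \<Rightarrow> real \<Rightarrow> real" where
  "E k R t = (LINT y|lborel. cone_cutoff k S R (t, y) * ((dev t y)\<^sup>2 / 2))"

lemma A_nonneg: "0 \<le> A" by (simp add: A_def)

lemma dev_bound: "\<bar>dev t y\<bar> \<le> A"
proof -
  have "\<bar>U t y\<bar> \<le> \<bar>lo\<bar> + \<bar>hi\<bar>" using U_in[of t y] by auto
  then show ?thesis unfolding dev_def A_def using shock_data_bound[of "y - x t"] by linarith
qed

lemma dev_square_bound: "(dev t y)\<^sup>2 \<le> A\<^sup>2"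
  using power_mono[OF dev_bound abs_ge_zero, of t y 2] by simp

lemma dev_measurable[measurable]: "dev t \<in> borel_measurable borel"
  unfolding dev_def[abs_def] by measurable

lemma cone_cutoff_eq_0:
  assumes "0 \<le> t" "k > 0" "y \<notin> {-R..R}"
  shows "cone_cutoff k S R (t, y) = 0"
proof (rule ccontr)
  assume "cone_cutoff k S R (t, y) \<noteq> 0"
  then have "\<bar>y\<bar> < R - S * t" using cone_cutoff_nz[of k S R "(t, y)"] assms by simp
  moreover have "0 \<le> S * t" using assms S_nonneg by simp
  ultimately show False using assms by auto
qed

lemma integrable_indicator_Icc: "integrable lborel (\<lambda>y. c * indicat_real {a..(b::real)} y)"
  by (cases "a \<le> b") (auto intro!: integrable_mult_right integrable_real_indicator)

lemma cone_integrand_bound: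
  assumes "0 \<le> t" "k > 0"
  shows "norm (cone_cutoff k S R (t, y) * ((dev t y)\<^sup>2 / 2)) \<le> A\<^sup>2 * indicator {-R..R} y"
proof (cases "y \<in> {-R..R}")
  case True
  have "(dev t y)\<^sup>2 / 2 \<le> A\<^sup>2" using dev_square_bound[of t y] zero_le_power2[of A] by linarith
  then have "cone_cutoff k S R (t, y) * ((dev t y)\<^sup>2 / 2) \<le> 1 * A\<^sup>2"
    using cutoff_bounds by (intro mult_mono) auto
  moreover have "0 \<le> cone_cutoff k S R (t, y) * ((dev t y)\<^sup>2 / 2)" using cutoff_bounds by (intro mult_nonneg_nonneg) auto
  ultimately show ?thesis using True by simp
qed (simp add: cone_cutoff_eq_0[OF assms])

lemma integrable_cone:
  assumes "0 \<le> t" "k > 0"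
  shows "integrable lborel (\<lambda>y. cone_cutoff k S R (t, y) * ((dev t y)\<^sup>2 / 2))"
proof (rule Bochner_Integration.integrable_bound[OF integrable_indicator_Icc[of "A\<^sup>2" "-R" R]])
  show "AE y in lborel. norm (cone_cutoff k S R (t, y) * ((dev t y)\<^sup>2 / 2)) \<le> norm (A\<^sup>2 * indicat_real {- R..R} y)"
    by (intro AE_I2 order_trans[OF cone_integrand_bound[OF assms]]) simp
qed measurable

text \<open>Three things vary with time: the cone cutoff, which is Lipschitz; the slice, continuous
  in \<open>L^1\<close> on bounded sets; and the position of the shock, which moves by at most
  \<open>S * \<bar>s - t\<bar>\<close>. Since \<open>dev\<close> is bounded by \<open>A\<close>,
  differences of its squares are controlled by differences of \<open>dev\<close>.\<close>

lemma E_tendsto: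
  assumes t: "t \<in> {0..T}" and k: "k > 0" and R: "0 \<le> R"
  shows "(E k R \<longlongrightarrow> E k R t) (at t within {0..T})"
proof -
  obtain L where L: "L-lipschitz_on UNIV (cone_cutoff k S R)"
    using lipD_cone_cutoff[OF k S_nonneg, of R] unfolding lipD_def by blast
  have L0: "0 \<le> L" using L by (rule lipschitz_on_nonneg)
  define I where "I s = (LINT y|lborel. indicator {-R..R} y * \<bar>U s y - U t y\<bar>)" for s
  define J where "J s = 2 * R * (A\<^sup>2 * L * \<bar>s - t\<bar>) + A * I s + A * (\<bar>ul\<bar> + \<bar>ur\<bar>) * (S * \<bar>s - t\<bar>)" for s
  have "(J \<longlongrightarrow> 2 * R * (A\<^sup>2 * L * \<bar>t - t\<bar>) + A * 0 + A * (\<bar>ul\<bar> + \<bar>ur\<bar>) * (S * \<bar>t - t\<bar>)) (at t within {0..T})"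
    unfolding J_def I_def by (intro tendsto_intros U_cont t)
  then have J0: "(J \<longlongrightarrow> 0) (at t within {0..T})" by simp
  have est: "\<bar>E k R s - E k R t\<bar> \<le> J s" if s: "s \<in> {0..T}" for s
  proof -
    let ?\<zeta> = "\<lambda>s y. cone_cutoff k S R (s, y)"
    let ?X = "{min (x s) (x t)..max (x s) (x t)}"
    define F where "F y = A\<^sup>2 * L * \<bar>s - t\<bar> * indicator {-R..R} y + A * (indicator {-R..R} y * \<bar>U s y - U t y\<bar>)
      + A * (\<bar>ul\<bar> + \<bar>ur\<bar>) * indicator ?X y" for y
    have iU: "integrable lborel (\<lambda>y. indicator {-R..R} y * \<bar>U s y - U t y\<bar>)"
    proof (rule Bochner_Integration.integrable_bound[OF integrable_indicator_Icc[of "hi - lo" "-R" R]])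
      have "\<bar>U s y - U t y\<bar> \<le> \<bar>hi - lo\<bar>" for y using U_in[of s y] U_in[of t y] by auto
      then show "AE y in lborel. norm (indicator {-R..R} y * \<bar>U s y - U t y\<bar>) \<le> norm ((hi - lo) * indicat_real {-R..R} y)"
        by (simp add: indicator_def)
    qed measurable
    have iF: "integrable lborel F"
      unfolding F_def by (intro Bochner_Integration.integrable_add integrable_indicator_Icc integrable_mult_right iU)
    have "\<bar>?\<zeta> s y * ((dev s y)\<^sup>2 / 2) - ?\<zeta> t y * ((dev t y)\<^sup>2 / 2)\<bar> \<le> F y" for y
    proof (cases "y \<in> {-R..R}")
      case True
      have "dist (?\<zeta> s y) (?\<zeta> t y) \<le> L * dist (s, y) (t, y)" using L by (rule lipschitz_onD) auto
      then have z: "\<bar>?\<zeta> s y - ?\<zeta> t y\<bar> \<le> L * \<bar>s - t\<bar>" by (simp add: dist_real_def dist_Pair_Pair)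
      have "\<bar>dev s y - dev t y\<bar> \<le> \<bar>U s y - U t y\<bar> + \<bar>shock_data ul ur (y - x s) - shock_data ul ur (y - x t)\<bar>"
        unfolding dev_def by linarith
      then have d: "\<bar>dev s y - dev t y\<bar> \<le> \<bar>U s y - U t y\<bar> + (\<bar>ul\<bar> + \<bar>ur\<bar>) * indicator ?X y"
        using shock_data_shift_diff[of ul ur y "x s" "x t"] by linarith
      have p: "\<bar>dev s y + dev t y\<bar> \<le> 2 * A" using dev_bound[of s y] dev_bound[of t y] by linarith
      have e: "?\<zeta> s y * ((dev s y)\<^sup>2 / 2) - ?\<zeta> t y * ((dev t y)\<^sup>2 / 2)
          = (?\<zeta> s y - ?\<zeta> t y) * ((dev s y)\<^sup>2 / 2) + ?\<zeta> t y * ((dev s y - dev t y) * (dev s y + dev t y) / 2)"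
        by (simp add: field_simps power2_eq_square)
      have e1: "\<bar>(?\<zeta> s y - ?\<zeta> t y) * ((dev s y)\<^sup>2 / 2)\<bar> \<le> L * \<bar>s - t\<bar> * A\<^sup>2"
        unfolding abs_mult
      proof (rule mult_mono[OF z])
        show "\<bar>(dev s y)\<^sup>2 / 2\<bar> \<le> A\<^sup>2" using dev_square_bound[of s y] zero_le_power2[of "dev s y"] by linarith
      qed (use L0 in simp_all)
      have "\<bar>dev s y - dev t y\<bar> * \<bar>dev s y + dev t y\<bar> \<le> \<bar>dev s y - dev t y\<bar> * (2 * A)"
        by (rule mult_left_mono[OF p]) simp
      then have "\<bar>(dev s y - dev t y) * (dev s y + dev t y) / 2\<bar> \<le> A * \<bar>dev s y - dev t y\<bar>"
        by (simp add: abs_mult mult.commute mult.left_commute)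
      then have "?\<zeta> t y * \<bar>(dev s y - dev t y) * (dev s y + dev t y) / 2\<bar> \<le> 1 * (A * \<bar>dev s y - dev t y\<bar>)"
        by (rule mult_mono[OF cutoff_bounds(4)]) simp_all
      then have e2: "\<bar>?\<zeta> t y * ((dev s y - dev t y) * (dev s y + dev t y) / 2)\<bar> \<le> A * \<bar>dev s y - dev t y\<bar>"
        unfolding abs_mult[of "?\<zeta> t y"] using cutoff_bounds(3)[of k S R "(t, y)"] by simp
      have e3: "A * \<bar>dev s y - dev t y\<bar> \<le> A * (\<bar>U s y - U t y\<bar> + (\<bar>ul\<bar> + \<bar>ur\<bar>) * indicator ?X y)"
        by (rule mult_left_mono[OF d A_nonneg])
      have "\<bar>?\<zeta> s y * ((dev s y)\<^sup>2 / 2) - ?\<zeta> t y * ((dev t y)\<^sup>2 / 2)\<bar>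
         \<le> L * \<bar>s - t\<bar> * A\<^sup>2 + A * (\<bar>U s y - U t y\<bar> + (\<bar>ul\<bar> + \<bar>ur\<bar>) * indicator ?X y)"
        unfolding e by (rule order_trans[OF abs_triangle_ineq add_mono[OF e1 order_trans[OF e2 e3]]])
      then show ?thesis using True by (simp add: F_def algebra_simps)
    next
      case False
      then show ?thesis using s t k A_nonneg by (simp add: F_def cone_cutoff_eq_0)
    qed note pt = this
    have i: "integrable lborel (\<lambda>y. ?\<zeta> s y * ((dev s y)\<^sup>2 / 2))" "integrable lborel (\<lambda>y. ?\<zeta> t y * ((dev t y)\<^sup>2 / 2))"
      by (rule integrable_cone; use s t k in simp)+
    have "\<bar>E k R s - E k R t\<bar> = \<bar>LINT y|lborel. ?\<zeta> s y * ((dev s y)\<^sup>2 / 2) - ?\<zeta> t y * ((dev t y)\<^sup>2 / 2)\<bar>"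
      unfolding E_def using i by simp
    also have "\<dots> \<le> (LINT y|lborel. \<bar>?\<zeta> s y * ((dev s y)\<^sup>2 / 2) - ?\<zeta> t y * ((dev t y)\<^sup>2 / 2)\<bar>)"
      by (rule integral_abs_bound)
    also have "\<dots> \<le> (LINT y|lborel. F y)"
      by (rule integral_mono[OF integrable_abs[OF Bochner_Integration.integrable_diff[OF i]] iF]) (rule pt)
    also have "\<dots> = A\<^sup>2 * L * \<bar>s - t\<bar> * (2 * R) + A * I s + A * (\<bar>ul\<bar> + \<bar>ur\<bar>) * \<bar>x s - x t\<bar>"
    proof -
      have 1: "(LINT y|lborel. F y) = (LINT y|lborel. A\<^sup>2 * L * \<bar>s - t\<bar> * indicator {-R..R} y)
        + (LINT y|lborel. A * (indicator {-R..R} y * \<bar>U s y - U t y\<bar>)) + (LINT y|lborel. A * (\<bar>ul\<bar> + \<bar>ur\<bar>) * indicator ?X y)"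
        unfolding F_def
        by (simp only: Bochner_Integration.integral_add Bochner_Integration.integrable_add integrable_indicator_Icc integrable_mult_right[OF iU])
      have min_max_le: "min (x s) (x t) \<le> max (x s) (x t)" by simp
      have "(LINT y|lborel. c * indicat_real {a..b} y) = c * (b - a)" if "a \<le> b" for a b c :: real
        using that by simp
      note 2 = this[of "-R" R] this[of "min (x s) (x t)" "max (x s) (x t)", OF min_max_le]
      have 3: "max (x s) (x t) - min (x s) (x t) = \<bar>x s - x t\<bar>" by (auto simp: max_def min_def)
      show ?thesis unfolding 1 I_def using 2 R 3 by simp
    qed
    also have "\<dots> \<le> J s"
    proof -
      have "dist (x s) (x t) \<le> S * dist s t" using lip by (rule lipschitz_onD) auto
      then have "A * (\<bar>ul\<bar> + \<bar>ur\<bar>) * \<bar>x s - x t\<bar> \<le> A * (\<bar>ul\<bar> + \<bar>ur\<bar>) * (S * \<bar>s - t\<bar>)"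
        using A_nonneg by (intro mult_left_mono) (auto simp: dist_real_def)
      then show ?thesis by (simp add: J_def)
    qed
    finally show ?thesis .
  qed
  have "((\<lambda>s. E k R s - E k R t) \<longlongrightarrow> 0) (at t within {0..T})"
  proof (rule Lim_null_comparison[OF _ J0])
    show "\<forall>\<^sub>F s in at t within {0..T}. norm (E k R s - E k R t) \<le> J s"
      unfolding eventually_at by (intro exI[of _ 1]) (simp add: est)
  qed
  then show ?thesis by (rule LIM_zero_cancel)
qed

end

section \<open>Letting the cutoffs become sharp\<close>

lemma time_cutoff_tendsto:
  "(\<lambda>j. time_cutoff (real (Suc j)) t1 (t, y)) \<longlonglongrightarrow> indicator {0<..<t1} t"
proof (rule tendsto_eventually)
  show "\<forall>\<^sub>F j in sequentially. time_cutoff (real (Suc j)) t1 (t, y) = indicator {0<..<t1} t"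
  proof (cases "t \<in> {0<..<t1}")
    case True
    obtain m where m: "2 / min t (t1 - t) \<le> real m" using real_arch_simple by blast
    show ?thesis
      unfolding eventually_sequentially
    proof (intro exI allI impI)
      fix j assume "m \<le> j"
      then have "2 / min t (t1 - t) \<le> real (Suc j)" using m by simp
      moreover have p: "0 < min t (t1 - t)" using True by auto
      ultimately have "2 \<le> real (Suc j) * min t (t1 - t)" by (simp only: pos_divide_le_eq)
      moreover have "real (Suc j) * min t (t1 - t) \<le> real (Suc j) * t" "real (Suc j) * min t (t1 - t) \<le> real (Suc j) * (t1 - t)"
        by (intro mult_left_mono; simp)+
      ultimately have "2 \<le> real (Suc j) * t" "2 \<le> real (Suc j) * t1 - real (Suc j) * t"
        by (simp_all only: right_diff_distrib)
      then have "ramp (real (Suc j) * t + (-1)) = 1" "ramp (- real (Suc j) * t + (real (Suc j) * t1 - 1)) = 1"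
        by (intro ramp_simps; linarith)+
      then show "time_cutoff (real (Suc j)) t1 (t, y) = indicator {0<..<t1} t"
        unfolding time_cutoff_def fst_conv using True by simp
    qed
  next
    case False
    have "time_cutoff (real (Suc j)) t1 (t, y) = 0" for j
    proof (rule ccontr)
      assume "time_cutoff (real (Suc j)) t1 (t, y) \<noteq> 0"
      then have "1 / real (Suc j) < t \<and> t < t1 - 1 / real (Suc j)"
        using time_cutoff_nz[of "real (Suc j)" t1 "(t, y)"] by simp
      moreover have "0 < 1 / real (Suc j)" by simp
      ultimately have "0 < t \<and> t < t1" by linarith
      then show False using False by simp
    qed
    then show ?thesis using False by simp
  qed
qed

lemma cone_cutoff_tendsto:
  "(\<lambda>j. cone_cutoff (real (Suc j)) S R (t, y)) \<longlonglongrightarrow> indicator {y. \<bar>y\<bar> < R - S * t} y"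
proof (rule tendsto_eventually)
  show "\<forall>\<^sub>F j in sequentially. cone_cutoff (real (Suc j)) S R (t, y) = indicator {y. \<bar>y\<bar> < R - S * t} y"
  proof (cases "\<bar>y\<bar> < R - S * t")
    case True
    let ?p = "R - S * t - \<bar>y\<bar>"
    obtain m where m: "1 / ?p \<le> real m" using real_arch_simple by blast
    show ?thesis
      unfolding eventually_sequentially
    proof (intro exI allI impI)
      fix j assume "m \<le> j"
      then have "1 / ?p \<le> real (Suc j)" using m by simp
      moreover have p: "0 < ?p" using True by simp
      ultimately have 1: "1 \<le> real (Suc j) * ?p" by (simp only: pos_divide_le_eq)
      have "real (Suc j) * ?p \<le> real (Suc j) * (R - S * t - y)" "real (Suc j) * ?p \<le> real (Suc j) * (R - S * t + y)"
        by (intro mult_left_mono; linarith)+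
      then have "1 \<le> real (Suc j) * (R - S * t - y)" "1 \<le> real (Suc j) * (R - S * t + y)" using 1 by linarith+
      moreover have "real (Suc j) * (R - S * t - y) = real (Suc j) * (R - S * t) + - real (Suc j) * y"
        "real (Suc j) * (R - S * t + y) = real (Suc j) * (R - S * t) + real (Suc j) * y"
        by (simp_all only: right_diff_distrib distrib_left)
      ultimately have "ramp (real (Suc j) * (R - S * t) + - real (Suc j) * y) = 1" "ramp (real (Suc j) * (R - S * t) + real (Suc j) * y) = 1"
        by (intro ramp_simps; simp only:)+
      then show "cone_cutoff (real (Suc j)) S R (t, y) = indicator {y. \<bar>y\<bar> < R - S * t} y"
        unfolding cone_cutoff_def fst_conv snd_conv using True by simp
    qed
  next
    case False
    have "cone_cutoff (real (Suc j)) S R (t, y) = 0" for j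
      using cone_cutoff_nz[of "real (Suc j)" S R "(t, y)"] False by auto
    then show ?thesis using False by simp
  qed
qed

lemma time_cutoff_measurable[measurable]: "time_cutoff n t1 \<in> borel_measurable borel"
  unfolding time_cutoff_def[abs_def]
  by (intro borel_measurable_continuous_onI continuous_intros continuous_on_compose2[OF continuous_ramp] subset_UNIV)

context shock_slices
begin

lemma path_square_bound: "(v t - \<sigma>)\<^sup>2 \<le> (S + \<bar>\<sigma>\<bar>)\<^sup>2"
proof -
  have "\<bar>v t - \<sigma>\<bar> \<le> S + \<bar>\<sigma>\<bar>" using v_bound[of t] by linarith
  then have "\<bar>v t - \<sigma>\<bar>\<^sup>2 \<le> (S + \<bar>\<sigma>\<bar>)\<^sup>2" by (rule power_mono) simp
  then show ?thesis by simp
qed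

text \<open>As the time cutoff steepens, the term with its derivative is asymptotically at most
  \<open>E\<close> at time 0 minus \<open>E\<close> at time \<open>t1\<close>. The cone parameter
  \<open>k\<close> stays fixed meanwhile, since continuity of \<open>E\<close> was derived from the
  Lipschitz constant of the cone cutoff.\<close>

lemma energy_slices:
  assumes k: "k > 0" and t1: "0 < t1" "t1 \<le> T" and R: "0 \<le> R"
  shows "E k R t1 - E k R 0 + \<kappa> * (LINT t|lborel. indicator {0<..<t1} t * cone_cutoff k S R (t, x t) * (v t - \<sigma>)\<^sup>2)
    \<le> 2 * measure P ({0..t1} \<times> {-R..R})"
proof (rule field_le_epsilon)
  fix \<epsilon>' :: real assume "0 < \<epsilon>'"
  \<comment> \<open>Half of the error for each end of the time interval.\<close>
  define \<epsilon> where "\<epsilon> = \<epsilon>' / 2"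
  have \<epsilon>: "0 < \<epsilon>" using \<open>0 < \<epsilon>'\<close> by (simp add: \<epsilon>_def)
  define G where "G t = (LINT y|lborel. dist2 (t, y) * cone_cutoff k S R (t, y))" for t
  \<comment> \<open>\<open>G\<close> comes from slicing the area integral of \<open>dist2\<close>,
    while \<open>E\<close> is built from the slices \<open>U t\<close>. Agreement at almost every
    time lets the continuity of \<open>E\<close> act on the integral of \<open>G\<close>.\<close>
  have GE: "AE t in lborel. t \<in> {0..T} \<longrightarrow> G t = E k R t"
    using wU
  proof eventually_elim
    case (elim t)
    show ?case
    proof
      assume "t \<in> {0..T}"
      then have ae: "AE y in lborel. w (t, y) = U t y" using elim by blast
      have m: "(\<lambda>y. dist2 (t, y) * cone_cutoff k S R (t, y)) \<in> borel_measurable lborel"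
        "(\<lambda>y. cone_cutoff k S R (t, y) * ((dev t y)\<^sup>2 / 2)) \<in> borel_measurable lborel" by measurable
      show "G t = E k R t"
        unfolding G_def E_def
      proof (rule integral_cong_AE[OF m])
        show "AE y in lborel. dist2 (t, y) * cone_cutoff k S R (t, y) = cone_cutoff k S R (t, y) * ((dev t y)\<^sup>2 / 2)"
          using ae by eventually_elim (simp add: dist2_def dev_def)
      qed
    qed
  qed
  have t0: "0 \<in> {0..T}" and t1': "t1 \<in> {0..T}" using t1 by auto
  have "\<forall>\<^sub>F t in at 0 within {0..T}. E k R t < E k R 0 + \<epsilon>"
    by (rule order_tendstoD(2)[OF E_tendsto[OF t0 k R]]) (use \<epsilon> in simp)
  then obtain d0 where d0: "d0 > 0" "\<forall>t\<in>{0..T}. t \<noteq> 0 \<and> dist t 0 < d0 \<longrightarrow> E k R t < E k R 0 + \<epsilon>"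
    unfolding eventually_at by blast
  have "\<forall>\<^sub>F t in at t1 within {0..T}. E k R t1 - \<epsilon> < E k R t"
    by (rule order_tendstoD(1)[OF E_tendsto[OF t1' k R]]) (use \<epsilon> in simp)
  then obtain d1 where d1: "d1 > 0" "\<forall>t\<in>{0..T}. t \<noteq> t1 \<and> dist t t1 < d1 \<longrightarrow> E k R t1 - \<epsilon> < E k R t"
    unfolding eventually_at by blast
  have bd: "(LINT z|lborel. dist2 z * (time_cutoff' n t1 z * cone_cutoff k S R z)) \<le> (E k R 0 + \<epsilon>) - (E k R t1 - \<epsilon>)"
    if n: "n > 0" "4 \<le> n * t1" "2 / n < d0" "2 / n < d1" for n
  proof -
    let ?f = "\<lambda>z. dist2 z * (time_cutoff' n t1 z * cone_cutoff k S R z)"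
    have i: "integrable (lborel \<Otimes>\<^sub>M lborel) ?f"
      using dist2_cutoff_integrable[OF n(1) k, of t1 R] unfolding lborel_prod .
    have tt: "time_cutoff' n t1 (t, y) = time_cutoff' n t1 (t, 0)" for t y by (simp add: time_cutoff'_def)
    have s: "(LINT y|lborel. ?f (t, y)) = time_cutoff' n t1 (t, 0) * G t" for t
    proof -
      have "(LINT y|lborel. ?f (t, y)) = (LINT y|lborel. time_cutoff' n t1 (t, 0) * (dist2 (t, y) * cone_cutoff k S R (t, y)))"
      proof (rule Bochner_Integration.integral_cong[OF refl])
        fix y
        show "?f (t, y) = time_cutoff' n t1 (t, 0) * (dist2 (t, y) * cone_cutoff k S R (t, y))"
          unfolding tt[of t y] by (simp only: mult_ac)
      qed
      then show ?thesis by (simp add: G_def)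
    qed
    have "(LINT z|lborel. ?f z) = (LINT t|lborel. time_cutoff' n t1 (t, 0) * G t)"
      using lborel_pair.integral_fst'[OF i] unfolding s lborel_prod by simp
    also have "\<dots> \<le> (E k R 0 + \<epsilon>) - (E k R t1 - \<epsilon>)"
    proof (rule time_cutoff'_integral_le[OF n(1,2)])
      show "integrable lborel (\<lambda>t. time_cutoff' n t1 (t, 0) * G t)"
        using lborel_pair.integrable_fst'[OF i] unfolding s .
      have h: "2 / n \<le> t1 / 2" using n by (simp add: field_simps)
      show "AE t in lborel. 0 < t \<and> t < 2 / n \<longrightarrow> G t \<le> E k R 0 + \<epsilon>"
        using GE
      proof eventually_elim
        case (elim t)
        show ?case
        proof
          assume t: "0 < t \<and> t < 2 / n"
          then have m: "t \<in> {0..T}" using h t1 by auto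
          have "E k R t < E k R 0 + \<epsilon>" using d0(2)[rule_format, OF m] t n(3) by (simp add: dist_real_def)
          then show "G t \<le> E k R 0 + \<epsilon>" using elim m by simp
        qed
      qed
      show "AE t in lborel. t1 - 2 / n < t \<and> t < t1 \<longrightarrow> E k R t1 - \<epsilon> \<le> G t"
        using GE
      proof eventually_elim
        case (elim t)
        show ?case
        proof
          assume t: "t1 - 2 / n < t \<and> t < t1"
          then have m: "t \<in> {0..T}" using h t1 by auto
          have "E k R t1 - \<epsilon> < E k R t" using d1(2)[rule_format, OF m] t n(4) by (simp add: dist_real_def)
          then show "E k R t1 - \<epsilon> \<le> G t" using elim m by simp
        qed
      qed
    qed
    finally show ?thesis .
  qed
  define I where "I j = (LINT t|lborel. time_cutoff (real (Suc j)) t1 (t, x t) * cone_cutoff k S R (t, x t) * (v t - \<sigma>)\<^sup>2)" for j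
  define J where "J = (LINT t|lborel. indicator {0<..<t1} t * cone_cutoff k S R (t, x t) * (v t - \<sigma>)\<^sup>2)"
  have IJ: "I \<longlonglongrightarrow> J"
    unfolding I_def[abs_def] J_def
  proof (rule integral_dominated_convergence[where w="\<lambda>t. (S + \<bar>\<sigma>\<bar>)\<^sup>2 * indicator {0..t1} t"])
    show "AE t in lborel. (\<lambda>j. time_cutoff (real (Suc j)) t1 (t, x t) * cone_cutoff k S R (t, x t) * (v t - \<sigma>)\<^sup>2)
        \<longlonglongrightarrow> indicator {0<..<t1} t * cone_cutoff k S R (t, x t) * (v t - \<sigma>)\<^sup>2"
      by (intro AE_I2 tendsto_mult time_cutoff_tendsto tendsto_const)
    fix j
    show "AE t in lborel. norm (time_cutoff (real (Suc j)) t1 (t, x t) * cone_cutoff k S R (t, x t) * (v t - \<sigma>)\<^sup>2)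
        \<le> (S + \<bar>\<sigma>\<bar>)\<^sup>2 * indicator {0..t1} t"
    proof (rule AE_I2)
      fix t
      show "norm (time_cutoff (real (Suc j)) t1 (t, x t) * cone_cutoff k S R (t, x t) * (v t - \<sigma>)\<^sup>2) \<le> (S + \<bar>\<sigma>\<bar>)\<^sup>2 * indicator {0..t1} t"
      proof (cases "time_cutoff (real (Suc j)) t1 (t, x t) = 0")
        case False
        have "1 / real (Suc j) < t \<and> t < t1 - 1 / real (Suc j)"
          using time_cutoff_nz[of "real (Suc j)" t1 "(t, x t)"] False by simp
        moreover have "0 < 1 / real (Suc j)" by simp
        ultimately have "0 < t \<and> t < t1" by linarith
        then have t: "t \<in> {0..t1}" by simp
        have c: "0 \<le> time_cutoff (real (Suc j)) t1 (t, x t) * cone_cutoff k S R (t, x t)"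
          "time_cutoff (real (Suc j)) t1 (t, x t) * cone_cutoff k S R (t, x t) \<le> 1"
          by (intro mult_nonneg_nonneg mult_le_one cutoff_bounds)+
        have "time_cutoff (real (Suc j)) t1 (t, x t) * cone_cutoff k S R (t, x t) * (v t - \<sigma>)\<^sup>2 \<le> 1 * (S + \<bar>\<sigma>\<bar>)\<^sup>2"
          by (rule mult_mono[OF c(2) path_square_bound]) simp_all
        moreover have "0 \<le> time_cutoff (real (Suc j)) t1 (t, x t) * cone_cutoff k S R (t, x t) * (v t - \<sigma>)\<^sup>2"
          by (rule mult_nonneg_nonneg[OF c(1)]) simp
        ultimately show ?thesis using t by simp
      qed simp
    qed
  qed (measurable, rule integrable_indicator_Icc)
  \<comment> \<open>Separates the two ramps of the trapezoid and places them where \<open>E\<close>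
    is within \<open>\<epsilon>\<close> of its values at 0 and at \<open>t1\<close>.\<close>
  obtain j0 where j0: "max (4 / t1) (max (2 / d0) (2 / d1)) \<le> real j0" using real_arch_simple by blast
  have "- ((E k R 0 + \<epsilon>) - (E k R t1 - \<epsilon>)) + \<kappa> * I j \<le> 2 * measure P ({0..t1} \<times> {-R..R})" if j: "j \<ge> j0" for j
  proof -
    let ?n = "real (Suc j)"
    have n: "?n > 0" by simp
    have "4 / t1 \<le> real j0" "2 / d0 \<le> real j0" "2 / d1 \<le> real j0" using j0 by simp_all
    then have "4 / t1 \<le> ?n" "2 / d0 < ?n" "2 / d1 < ?n" using j by linarith+
    then have "4 \<le> ?n * t1" "2 / ?n < d0" "2 / ?n < d1"
      using t1 d0(1) d1(1) n by (simp_all only: pos_divide_le_eq pos_divide_less_eq mult.commute)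
    from bd[OF n this] energy_inequality[OF n k t1, of R] show ?thesis unfolding I_def by linarith
  qed
  then have "\<forall>j\<ge>j0. - ((E k R 0 + \<epsilon>) - (E k R t1 - \<epsilon>)) + \<kappa> * I j \<le> 2 * measure P ({0..t1} \<times> {-R..R})" by blast
  moreover have "(\<lambda>j. - ((E k R 0 + \<epsilon>) - (E k R t1 - \<epsilon>)) + \<kappa> * I j) \<longlonglongrightarrow> - ((E k R 0 + \<epsilon>) - (E k R t1 - \<epsilon>)) + \<kappa> * J"
    by (intro tendsto_intros IJ)
  ultimately have "- ((E k R 0 + \<epsilon>) - (E k R t1 - \<epsilon>)) + \<kappa> * J \<le> 2 * measure P ({0..t1} \<times> {-R..R})"
    by (intro LIMSEQ_le_const2) blast+
  then show "E k R t1 - E k R 0 + \<kappa> * (LINT t|lborel. indicator {0<..<t1} t * cone_cutoff k S R (t, x t) * (v t - \<sigma>)\<^sup>2)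
    \<le> 2 * measure P ({0..t1} \<times> {-R..R}) + \<epsilon>'"
    unfolding J_def[symmetric] \<epsilon>_def by linarith
qed

text \<open>Now \<open>k\<close> grows and the cone cutoff tends to the indicator of the open cone,
  at time \<open>t1\<close> and along the path; at time 0 it is simply bounded by the indicator of
  the base.\<close>

lemma slice_estimate:
  assumes t1: "0 < t1" "t1 \<le> T" and R: "0 \<le> R"
  shows "(LINT y|lborel. indicator {y. \<bar>y\<bar> < R - S * t1} y * ((dev t1 y)\<^sup>2 / 2))
      + \<kappa> * (LINT t|lborel. indicator {0<..<t1} t * indicator {y. \<bar>y\<bar> < R - S * t} (x t) * (v t - \<sigma>)\<^sup>2)
    \<le> (LINT y|lborel. indicator {-R..R} y * ((dev 0 y)\<^sup>2 / 2)) + 2 * measure P ({0..t1} \<times> {-R..R})"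
proof -
  let ?k = "\<lambda>j. real (Suc j)"
  have E1: "(\<lambda>j. E (?k j) R t1) \<longlonglongrightarrow> (LINT y|lborel. indicator {y. \<bar>y\<bar> < R - S * t1} y * ((dev t1 y)\<^sup>2 / 2))"
    unfolding E_def
  proof (rule integral_dominated_convergence[where w="\<lambda>y. A\<^sup>2 * indicator {-R..R} y"])
    show "AE y in lborel. (\<lambda>j. cone_cutoff (?k j) S R (t1, y) * ((dev t1 y)\<^sup>2 / 2))
        \<longlonglongrightarrow> indicator {y. \<bar>y\<bar> < R - S * t1} y * ((dev t1 y)\<^sup>2 / 2)"
      by (intro AE_I2 tendsto_mult cone_cutoff_tendsto tendsto_const)
    show "AE y in lborel. norm (cone_cutoff (?k j) S R (t1, y) * ((dev t1 y)\<^sup>2 / 2)) \<le> A\<^sup>2 * indicator {-R..R} y" for j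
      by (intro AE_I2 cone_integrand_bound) (use t1 in simp_all)
  qed (measurable, rule integrable_indicator_Icc)
  have J: "(\<lambda>j. LINT t|lborel. indicator {0<..<t1} t * cone_cutoff (?k j) S R (t, x t) * (v t - \<sigma>)\<^sup>2)
      \<longlonglongrightarrow> (LINT t|lborel. indicator {0<..<t1} t * indicator {y. \<bar>y\<bar> < R - S * t} (x t) * (v t - \<sigma>)\<^sup>2)"
  proof (rule integral_dominated_convergence[where w="\<lambda>t. (S + \<bar>\<sigma>\<bar>)\<^sup>2 * indicator {0..t1} t"])
    show "AE t in lborel. (\<lambda>j. indicator {0<..<t1} t * cone_cutoff (?k j) S R (t, x t) * (v t - \<sigma>)\<^sup>2)
        \<longlonglongrightarrow> indicator {0<..<t1} t * indicator {y. \<bar>y\<bar> < R - S * t} (x t) * (v t - \<sigma>)\<^sup>2"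
      by (intro AE_I2 tendsto_mult cone_cutoff_tendsto tendsto_const)
    have "norm (indicator {0<..<t1} t * cone_cutoff (?k j) S R (t, x t) * (v t - \<sigma>)\<^sup>2) \<le> (S + \<bar>\<sigma>\<bar>)\<^sup>2 * indicator {0..t1} t" for j t
    proof (cases "t \<in> {0<..<t1}")
      case True
      have "cone_cutoff (?k j) S R (t, x t) * (v t - \<sigma>)\<^sup>2 \<le> 1 * (S + \<bar>\<sigma>\<bar>)\<^sup>2"
        by (rule mult_mono[OF cutoff_bounds(4) path_square_bound]) simp_all
      moreover have "0 \<le> cone_cutoff (?k j) S R (t, x t) * (v t - \<sigma>)\<^sup>2"
        by (rule mult_nonneg_nonneg[OF cutoff_bounds(3)]) simp
      ultimately show ?thesis using True by (simp del: of_nat_Suc)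
    qed simp
    then show "AE t in lborel. norm (indicator {0<..<t1} t * cone_cutoff (?k j) S R (t, x t) * (v t - \<sigma>)\<^sup>2) \<le> (S + \<bar>\<sigma>\<bar>)\<^sup>2 * indicator {0..t1} t" for j
      by (rule AE_I2)
  qed (measurable, rule integrable_indicator_Icc)
  have E0: "E (?k j) R 0 \<le> (LINT y|lborel. indicator {-R..R} y * ((dev 0 y)\<^sup>2 / 2))" for j
    unfolding E_def
  proof (rule integral_mono)
    show "integrable lborel (\<lambda>y. cone_cutoff (?k j) S R (0, y) * ((dev 0 y)\<^sup>2 / 2))" by (rule integrable_cone) simp_all
    show "integrable lborel (\<lambda>y. indicator {-R..R} y * ((dev 0 y)\<^sup>2 / 2))"
    proof (rule Bochner_Integration.integrable_bound[OF integrable_indicator_Icc[of "A\<^sup>2" "-R" R]])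
      have "(dev 0 y)\<^sup>2 / 2 \<le> A\<^sup>2" for y using dev_square_bound[of 0 y] zero_le_power2[of A] by linarith
      then show "AE y in lborel. norm (indicator {-R..R} y * ((dev 0 y)\<^sup>2 / 2)) \<le> norm (A\<^sup>2 * indicat_real {-R..R} y)"
        by (simp add: indicator_def)
    qed measurable
    fix y
    show "cone_cutoff (?k j) S R (0, y) * ((dev 0 y)\<^sup>2 / 2) \<le> indicator {-R..R} y * ((dev 0 y)\<^sup>2 / 2)"
      using cone_cutoff_eq_0[of 0 "?k j" y R] cutoff_bounds(4)[of "?k j" S R "(0, y)"]
      by (intro mult_right_mono) (auto simp: indicator_def simp del: of_nat_Suc)
  qed
  have "E (?k j) R t1 + \<kappa> * (LINT t|lborel. indicator {0<..<t1} t * cone_cutoff (?k j) S R (t, x t) * (v t - \<sigma>)\<^sup>2)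
    \<le> (LINT y|lborel. indicator {-R..R} y * ((dev 0 y)\<^sup>2 / 2)) + 2 * measure P ({0..t1} \<times> {-R..R})" for j
    using energy_slices[of "?k j", OF _ t1 R] E0[of j] by (simp del: of_nat_Suc)
  then have "\<forall>j\<ge>0. E (?k j) R t1 + \<kappa> * (LINT t|lborel. indicator {0<..<t1} t * cone_cutoff (?k j) S R (t, x t) * (v t - \<sigma>)\<^sup>2)
    \<le> (LINT y|lborel. indicator {-R..R} y * ((dev 0 y)\<^sup>2 / 2)) + 2 * measure P ({0..t1} \<times> {-R..R})" by blast
  moreover note tendsto_add[OF E1 tendsto_mult[OF tendsto_const[of \<kappa>] J]]
  ultimately show ?thesis by (intro LIMSEQ_le_const2) blast+
qed

end

section \<open>Choice of the cone radius and assembly\<close>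

section \<open>The main theorem\<close>

context shock_slices
begin

lemma indicator_dev_measurable[measurable]: "(\<lambda>y. indicator {a..b} y * (dev t y)\<^sup>2) \<in> borel_measurable borel"
  by measurable

lemma path_dissipation_measurable[measurable]: "(\<lambda>t. indicator {0..t1} t * (v t - \<sigma>)\<^sup>2) \<in> borel_measurable borel"
  by measurable

text \<open>With base radius \<open>R + t1 * S\<close> the cone has radius \<open>R\<close> at time
  \<open>t1\<close>. Discarding the dissipation and doubling removes the half in the energy and
  turns the factor 2 before \<open>P\<close> into 4. At time 0 only the nonnegativity of the measure
  is needed.\<close>

lemma shift_estimate:
  assumes t1: "0 \<le> t1" "t1 \<le> T" and R: "0 < R"
  shows "(LINT y|lborel. indicator {-R..R} y * (dev t1 y)\<^sup>2)
    \<le> (LINT y|lborel. indicator {- R - t1 * S..R + t1 * S} y * (dev 0 y)\<^sup>2) + 4 * measure P ({0..t1} \<times> {- R - t1 * S..R + t1 * S})"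
proof (cases "t1 = 0")
  case False
  define R' where "R' = R + t1 * S"
  have R': "0 \<le> R'" and e: "- R - t1 * S = - R'" "R' - S * t1 = R" using R t1 S_nonneg by (simp_all add: R'_def)
  have "0 \<le> \<kappa> * (LINT t|lborel. indicator {0<..<t1} t * indicator {y. \<bar>y\<bar> < R' - S * t} (x t) * (v t - \<sigma>)\<^sup>2)"
    using \<kappa>_pos by (intro mult_nonneg_nonneg integral_nonneg_AE AE_I2) (auto simp: indicator_def)
  then have "(LINT y|lborel. indicator {y. \<bar>y\<bar> < R} y * ((dev t1 y)\<^sup>2 / 2))
    \<le> (LINT y|lborel. indicator {-R'..R'} y * ((dev 0 y)\<^sup>2 / 2)) + 2 * measure P ({0..t1} \<times> {-R'..R'})"
    using slice_estimate[OF _ t1(2) R'] False t1 unfolding e by simp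
  moreover have "(LINT y|lborel. indicator {y. \<bar>y\<bar> < R} y * ((dev t1 y)\<^sup>2 / 2)) = (LINT y|lborel. indicator {-R..R} y * (dev t1 y)\<^sup>2 / 2)"
  proof (rule integral_cong_AE)
    show "(\<lambda>y. indicator {y. \<bar>y\<bar> < R} y * ((dev t1 y)\<^sup>2 / 2)) \<in> borel_measurable lborel" by measurable
    show "(\<lambda>y. indicator {-R..R} y * (dev t1 y)\<^sup>2 / 2) \<in> borel_measurable lborel" by measurable
    show "AE y in lborel. indicator {y. \<bar>y\<bar> < R} y * ((dev t1 y)\<^sup>2 / 2) = indicator {-R..R} y * (dev t1 y)\<^sup>2 / 2"
      using AE_lborel_singleton[of R] AE_lborel_singleton[of "-R"] by eventually_elim (auto simp: indicator_def)
  qed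
  moreover have "(LINT y|lborel. indicator {-R'..R'} y * ((dev 0 y)\<^sup>2 / 2)) = (LINT y|lborel. indicator {-R'..R'} y * (dev 0 y)\<^sup>2 / 2)" by simp
  ultimately show ?thesis unfolding e R'_def[symmetric] by simp
qed simp

text \<open>A path from the origin with speed at most \<open>S\<close> satisfies
  \<open>\<bar>x t\<bar> \<le> S * t\<close>, hence for \<open>t < t1\<close> it lies strictly
  inside the cone of base radius \<open>2 * S * t1\<close>, and the cone indicator disappears from
  the dissipation integral. The energy at time \<open>t1\<close> is discarded instead.\<close>

lemma path_estimate:
  assumes t1: "0 \<le> t1" "t1 \<le> T" and S: "0 < S"
  shows "2 * \<kappa> * (LINT t|lborel. indicator {0..t1} t * (v t - \<sigma>)\<^sup>2)
    \<le> (LINT y|lborel. indicator {- 2 * S * t1..2 * S * t1} y * (dev 0 y)\<^sup>2) + 4 * measure P ({0..t1} \<times> {- 2 * S * t1..2 * S * t1})"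
proof (cases "t1 = 0")
  case True
  have "(LINT t|lborel. indicator {0..t1} t * (v t - \<sigma>)\<^sup>2) = (LINT t|(lborel :: real measure). 0)"
  proof (rule integral_cong_AE)
    show "AE t in lborel. indicator {0..t1} t * (v t - \<sigma>)\<^sup>2 = 0"
      using AE_lborel_singleton[of "0 :: real"] by eventually_elim (simp add: True indicator_def)
  qed simp_all
  moreover have "0 \<le> (LINT y|lborel. indicator {- 2 * S * t1..2 * S * t1} y * (dev 0 y)\<^sup>2)"
    by (intro integral_nonneg_AE AE_I2) simp
  moreover have "0 \<le> measure P ({0..t1} \<times> {- 2 * S * t1..2 * S * t1})" by simp
  ultimately show ?thesis by simp
next
  case False
  have t: "0 < t1" using False t1 by simp
  define R' where "R' = 2 * S * t1"
  have R': "0 \<le> R'" and e: "- 2 * S * t1 = - R'" using S t1 by (simp_all add: R'_def)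
  have "0 \<le> (LINT y|lborel. indicator {y. \<bar>y\<bar> < R' - S * t1} y * ((dev t1 y)\<^sup>2 / 2))"
    by (intro integral_nonneg_AE AE_I2) (simp add: indicator_def)
  then have main: "\<kappa> * (LINT t|lborel. indicator {0<..<t1} t * indicator {y. \<bar>y\<bar> < R' - S * t} (x t) * (v t - \<sigma>)\<^sup>2)
    \<le> (LINT y|lborel. indicator {-R'..R'} y * ((dev 0 y)\<^sup>2 / 2)) + 2 * measure P ({0..t1} \<times> {-R'..R'})"
    using slice_estimate[OF t t1(2) R'] by linarith
  have cone: "\<bar>x t\<bar> < R' - S * t" if "t \<in> {0<..<t1}" for t
  proof -
    have "dist (x t) (x 0) \<le> S * dist t 0" using lip by (rule lipschitz_onD) auto
    then have "\<bar>x t\<bar> \<le> S * t" using that by (simp add: x0 dist_real_def)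
    moreover have "S * t < S * t1" using that S by simp
    ultimately show ?thesis by (simp add: R'_def)
  qed
  have "(LINT t|lborel. indicator {0<..<t1} t * indicator {y. \<bar>y\<bar> < R' - S * t} (x t) * (v t - \<sigma>)\<^sup>2)
      = (LINT t|lborel. indicator {0..t1} t * (v t - \<sigma>)\<^sup>2)"
  proof (rule integral_cong_AE)
    show "AE t in lborel. indicator {0<..<t1} t * indicator {y. \<bar>y\<bar> < R' - S * t} (x t) * (v t - \<sigma>)\<^sup>2 = indicator {0..t1} t * (v t - \<sigma>)\<^sup>2"
      using AE_lborel_singleton[of "0 :: real"] AE_lborel_singleton[of t1]
    proof eventually_elim
      case (elim t)
      then show ?case using cone[of t] by (cases "t \<in> {0<..<t1}") (auto simp: indicator_def)
    qed
    have "{t. \<bar>x t\<bar> < R' - S * t} \<in> sets borel" by measurable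
    then have [measurable]: "(\<lambda>t. indicat_real {t. \<bar>x t\<bar> < R' - S * t} t) \<in> borel_measurable borel" by measurable
    have "indicator {y. \<bar>y\<bar> < R' - S * t} (x t) = indicat_real {t. \<bar>x t\<bar> < R' - S * t} t" for t by (simp add: indicator_def)
    then show "(\<lambda>t. indicator {0<..<t1} t * indicator {y. \<bar>y\<bar> < R' - S * t} (x t) * (v t - \<sigma>)\<^sup>2) \<in> borel_measurable lborel"
      by simp
  qed simp
  moreover have "(LINT y|lborel. indicator {-R'..R'} y * ((dev 0 y)\<^sup>2 / 2)) = (LINT y|lborel. indicator {-R'..R'} y * (dev 0 y)\<^sup>2 / 2)" by simp
  ultimately show ?thesis using main unfolding e R'_def[symmetric] by simp
qed

end

lemma square_flux_has_derivative:
  assumes "continuous_on UNIV (deriv f)"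
  shows "(square_flux f has_real_derivative v * deriv f v) (at v)"
proof -
  \<comment> \<open>The padding by 1 puts \<open>v\<close> into the interior, so that the derivative
    within the interval is a full derivative.\<close>
  define a b where "a = min 0 v - 1" and "b = max 0 v + 1"
  have "((\<lambda>u. LBINT s=ereal 0..ereal u. s * deriv f s) has_vector_derivative v * deriv f v) (at v within {a..b})"
  proof (rule interval_integral_FTC2)
    show "continuous_on {a..b} (\<lambda>s. s * deriv f s)"
      by (intro continuous_intros continuous_on_subset[OF assms]) simp
  qed (auto simp: a_def b_def)
  moreover have "at v within {a..b} = at v" by (rule at_within_Icc_at) (auto simp: a_def b_def)
  moreover have "(\<lambda>u. LBINT s=ereal 0..ereal u. s * deriv f s) = square_flux f" by (simp add: square_flux_def fun_eq_iff zero_ereal_def)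
  ultimately show ?thesis by (simp add: has_real_derivative_iff_has_vector_derivative)
qed

text \<open>The estimates with the constants that the dissipation delivers directly, before powers
  of \<open>M / \<alpha>\<close> are introduced: \<open>1 / 6\<close> is twice the
  \<open>1 / 12\<close> of \<open>shock_dissipation\<close>. All hypotheses on \<open>u\<close> are
  converted here into the Borel representative, its balance laws, its traces and its slices.\<close>

lemma shift_of_generalized_characteristic:
  fixes u :: "real \<Rightarrow> real \<Rightarrow> real"
  assumes f: "twice_differentiable f" and \<alpha>: "0 < \<alpha>" "\<And>v. \<alpha> \<le> deriv (deriv f) v" and T: "0 < T"
    and sol: "finite_entropy_solution T f u" and L1: "L1loc_continuous T u" and u0: "AE y in lebesgue. u 0 y = u0 y"
    and vst: "very_strong_traces T u" and ep: "entropy_production T u (\<lambda>v. v\<^sup>2 / 2) (square_flux f) P N"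
    and ulr: "ur < ul"
    and bdd: "bdd_above (deriv (deriv f) ` state_interval T u ul ur)"
    and M_def: "M = (SUP v\<in>state_interval T u ul ur. deriv (deriv f) v)"
    and S_def: "S = (SUP v\<in>state_interval T u ul ur. \<bar>deriv f v\<bar>)"
  obtains h where "lipschitz_path T h" "h 0 = 0"
    "\<And>t R. t \<in> {0..T} \<Longrightarrow> R > 0 \<Longrightarrow> (LINT x:{-R..R}|lebesgue. \<bar>u t x - shock f ul ur t (x - h t)\<bar>\<^sup>2)
      \<le> (LINT x:{-R - t * S..R + t * S}|lebesgue. \<bar>u0 x - shock_data ul ur x\<bar>\<^sup>2) + 4 * measure P ({0..t} \<times> {-R - t * S..R + t * S})"
    "\<And>t. t \<in> {0..T} \<Longrightarrow> \<alpha> / (6 * M\<^sup>2) * (ul - ur) * (LINT \<tau>:{0..t}|lebesgue. (deriv h \<tau>)\<^sup>2)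
      \<le> (LINT x:{-2 * S * t..2 * S * t}|lebesgue. (u0 x - shock_data ul ur x)\<^sup>2) + 4 * measure P ({0..t} \<times> {-2 * S * t..2 * S * t})"
    "\<alpha> \<le> M"
proof -
  define lo hi where "lo = min ur (inf_u T u)" and "hi = max ul (sup_u T u)"
  have I: "state_interval T u ul ur = {lo..hi}" by (simp add: state_interval_def lo_def hi_def)
  let ?f1 = "deriv f" and ?f2 = "deriv (deriv f)" and ?q = "square_flux f"
  have states: "ul \<in> {lo..hi}" "ur \<in> {lo..hi}" and lh: "lo \<le> hi" using ulr by (auto simp: lo_def hi_def)
  have df: "(f has_real_derivative ?f1 v) (at v)" and df1: "(?f1 has_real_derivative ?f2 v) (at v)" for v
    using f unfolding twice_differentiable_def by (simp_all add: DERIV_deriv_iff_field_differentiable)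
  have c1: "continuous_on UNIV ?f1" using DERIV_isCont[OF df1] by (simp add: continuous_at_imp_continuous_on)
  have cf: "continuous_on UNIV f" using DERIV_isCont[OF df] by (simp add: continuous_at_imp_continuous_on)
  have dq: "(?q has_real_derivative v * ?f1 v) (at v)" for v by (rule square_flux_has_derivative[OF c1])
  have cq: "continuous_on UNIV ?q" using DERIV_isCont[OF dq] by (simp add: continuous_at_imp_continuous_on)
  have M: "?f2 v \<le> M" if "v \<in> {lo..hi}" for v
    using cSUP_upper[OF _ bdd] that unfolding M_def I by blast
  have \<alpha>M: "\<alpha> \<le> M" using \<alpha>(2)[of ur] M[OF states(2)] by linarith
  \<comment> \<open>Continuity of \<open>f'\<close> bounds it on the compact state interval, so
    \<open>S\<close> is a genuine supremum and dominates \<open>\<bar>f'\<bar>\<close> there; for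
    \<open>f''\<close> the corresponding bound is a hypothesis.\<close>
  obtain B where B: "\<forall>v\<in>{lo..hi}. \<bar>?f1 v\<bar> \<le> B" using continuous_bounded_Icc[OF c1] by blast
  have S: "\<bar>?f1 v\<bar> \<le> S" if "v \<in> {lo..hi}" for v
  proof -
    have "bdd_above ((\<lambda>v. \<bar>?f1 v\<bar>) ` {lo..hi})" using B by (intro bdd_aboveI2[where M=B]) blast
    from cSUP_upper[OF that this] show ?thesis unfolding S_def I .
  qed
  \<comment> \<open>\<open>f'\<close> is strictly increasing, so it cannot vanish at both
    \<open>ul\<close> and \<open>ur\<close>; this yields \<open>S > 0\<close>, by which the path
    stays strictly inside its cone.\<close>
  have "?f1 ur < ?f1 ul"
  proof (rule DERIV_pos_imp_increasing[OF ulr])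
    show "\<exists>y. DERIV ?f1 v :> y \<and> 0 < y" for v using df1[of v] \<alpha>(2)[of v] \<alpha>(1) by (intro exI[of _ "?f2 v"]) auto
  qed
  then have Spos: "0 < S" using S[OF states(1)] S[OF states(2)] by linarith
  have eb: "ess_bounded T u" and ws: "weak_solution T f u" using sol unfolding finite_entropy_solution_def by blast+
  obtain w where w[measurable]: "w \<in> borel_measurable borel" and w_mem: "\<And>z. w z \<in> {lo..hi}"
    and wu: "AE z in lborel. fst z \<in> {0..T} \<longrightarrow> w z = u (fst z) (snd z)"
  proof (rule borel_representative[OF T eb _ _ lh])
    show "lo \<le> inf_u T u" "sup_u T u \<le> hi" by (auto simp: lo_def hi_def)
  qed blast
  have comp: "(\<lambda>z. g (w z)) \<in> borel_measurable borel" if "continuous_on UNIV g" for g :: "real \<Rightarrow> real"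
    by (rule measurable_compose[OF w borel_measurable_continuous_onI[OF that]])
  have cid: "continuous_on UNIV (\<lambda>v::real. v)" and csq: "continuous_on UNIV (\<lambda>v::real. v\<^sup>2 / 2)" by (intro continuous_intros; simp)+
  have balance: "balance T (\<lambda>z. a (w z)) (\<lambda>z. b (w z)) P' N'"
    if c: "continuous_on UNIV a" "continuous_on UNIV b" and PN: "radon_on_strip T P'" "radon_on_strip T N'"
      and d: "\<And>\<phi>. test_function T \<phi> \<Longrightarrow> divergence T u a b \<phi> = (LINT z|P'. \<phi> z) - (LINT z|N'. \<phi> z)" for a b P' N'
  proof -
    obtain B1 where B1: "\<forall>v\<in>{lo..hi}. \<bar>a v\<bar> \<le> B1" using continuous_bounded_Icc[OF c(1)] by blast
    obtain B2 where B2: "\<forall>v\<in>{lo..hi}. \<bar>b v\<bar> \<le> B2" using continuous_bounded_Icc[OF c(2)] by blast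
    show ?thesis
    proof (rule balance_of_test_functions[OF comp[OF c(1)] comp[OF c(2)] _ _ PN, where A="max B1 B2"])
      show "\<bar>a (w z)\<bar> \<le> max B1 B2" for z using B1[rule_format, OF w_mem[of z]] by simp
      show "\<bar>b (w z)\<bar> \<le> max B1 B2" for z using B2[rule_format, OF w_mem[of z]] by simp
      show "- (LINT z|lborel. a (w z) * deriv (\<lambda>s. \<phi> (s, snd z)) (fst z) + b (w z) * deriv (\<lambda>y. \<phi> (fst z, y)) (snd z))
        = (LINT z|P'. \<phi> z) - (LINT z|N'. \<phi> z)" if "test_function T \<phi>" for \<phi>
        using d[OF that] divergence_eq_lborel[OF w wu comp[OF c(1)] comp[OF c(2)] that] by simp
    qed
  qed
  have PN: "radon_on_strip T P" "radon_on_strip T N" using ep unfolding entropy_production_def signed_radon_on_strip_def by blast+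
  have bal_u: "balance T w (\<lambda>z. f (w z)) (null_measure borel) (null_measure borel)"
  proof (rule balance[OF cid cf radon_null_measure radon_null_measure])
    show "divergence T u (\<lambda>v. v) f \<phi> = (LINT z|null_measure borel. \<phi> z) - (LINT z|null_measure borel. \<phi> z)"
      if "test_function T \<phi>" for \<phi> using ws that unfolding weak_solution_def by simp
  qed
  have bal_e: "balance T (\<lambda>z. (w z)\<^sup>2 / 2) (\<lambda>z. ?q (w z)) P N"
    by (rule balance[OF csq cq PN]) (use ep in \<open>simp add: entropy_production_def\<close>)
  interpret fil: filippov "\<lambda>z. ?f1 (w z)" S T
    by unfold_locales (rule comp[OF c1] S w_mem T)+
  obtain x where lip: "S-lipschitz_on UNIV x" and x0: "x 0 = 0"
    and hullx: "\<And>v Fp Fm. AE t in lborel. (x has_real_derivative v t) (at t) \<Longrightarrow>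
      has_trace T x 1 (\<lambda>z. ?f1 (w z)) Fp \<Longrightarrow> has_trace T x (-1) (\<lambda>z. ?f1 (w z)) Fm \<Longrightarrow> (\<And>t. \<bar>Fp t\<bar> \<le> S) \<Longrightarrow> (\<And>t. \<bar>Fm t\<bar> \<le> S) \<Longrightarrow>
      AE t in lborel. 0 < t \<and> t < T \<longrightarrow> min (Fp t) (Fm t) \<le> v t \<and> v t \<le> max (Fp t) (Fm t)"
    by (rule fil.generalized_characteristic) blast
  obtain v where v: "v \<in> borel_measurable borel" "\<And>t. \<bar>v t\<bar> \<le> S" "AE t in lborel. (x has_real_derivative v t) (at t)"
    by (rule lipschitz_AE_differentiable[OF lip]) blast
  obtain Up Um where tr: "has_trace T x 1 w Up" "has_trace T x (-1) w Um" and U_mem: "\<And>t. Up t \<in> {lo..hi}" "\<And>t. Um t \<in> {lo..hi}"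
    by (rule traces_of_representative[OF vst w w_mem wu lip]) blast
  have hull: "AE t in lborel. 0 < t \<and> t < T \<longrightarrow> min (?f1 (Up t)) (?f1 (Um t)) \<le> v t \<and> v t \<le> max (?f1 (Up t)) (?f1 (Um t))"
    by (rule hullx[OF v(3) has_trace_compose[OF tr(1) c1] has_trace_compose[OF tr(2) c1]]) (rule S U_mem)+
  obtain U :: "real \<Rightarrow> real \<Rightarrow> real" where U: "\<And>t. U t \<in> borel_measurable borel" "\<And>t y. U t y \<in> {lo..hi}"
    and uU: "\<And>t. t \<in> {0..T} \<Longrightarrow> AE y in lborel. u t y = U t y"
    and wU: "AE t in lborel. t \<in> {0..T} \<longrightarrow> (AE y in lborel. w (t, y) = U t y)"
    and U_cont: "\<And>t R. t \<in> {0..T} \<Longrightarrow> ((\<lambda>s. LINT y|lborel. indicator {-R..R} y * \<bar>U s y - U t y\<bar>) \<longlongrightarrow> 0) (at t within {0..T})"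
    by (rule slice_representatives[OF T L1 lh w_mem wu]) blast
  interpret s: shock_slices f ?f1 ?f2 ?q \<alpha> T ul ur lo hi M S w P N x v Up Um U
    by unfold_locales (fact df df1 dq \<alpha>(1) T S states ulr w w_mem PN bal_u bal_e lip v x0 tr U_mem hull U wU U_cont | intro conjI \<alpha>(2) M; assumption)+
  \<comment> \<open>Removes the motion of the unperturbed shock, so that the shifted shock jumps
    exactly at \<open>x t\<close>.\<close>
  define h where "h t = x t - s.\<sigma> * t" for t
  have sh: "shock f ul ur t (y - h t) = shock_data ul ur (y - x t)" for t y
    by (simp add: shock_def shock_speed_def h_def s.\<sigma>_def)
  have slice: "(LINT y:{a..b}|lebesgue. (u t y - shock_data ul ur (y - x t))\<^sup>2) = (LINT y|lborel. indicator {a..b} y * (s.dev t y)\<^sup>2)"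
    if "t \<in> {0..T}" for t a b
    unfolding set_lebesgue_integral_def
  proof (rule lebesgue_integral_AE_borel(1)[OF s.indicator_dev_measurable])
    show "AE y in lborel. indicator {a..b} y *\<^sub>R (u t y - shock_data ul ur (y - x t))\<^sup>2 = indicator {a..b} y * (s.dev t y)\<^sup>2"
      using uU[OF that] by eventually_elim (simp add: s.dev_def)
  qed
  have slice0: "(LINT y:{a..b}|lebesgue. (u0 y - shock_data ul ur y)\<^sup>2) = (LINT y|lborel. indicator {a..b} y * (s.dev 0 y)\<^sup>2)" for a b
    unfolding set_lebesgue_integral_def
  proof (rule lebesgue_integral_AE_borel(1)[OF s.indicator_dev_measurable])
    have z: "0 \<in> {0..T}" using T by simp
    have "AE y in lborel. u 0 y = u0 y" using u0 by (simp add: AE_completion_iff)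
    then show "AE y in lborel. indicator {a..b} y *\<^sub>R (u0 y - shock_data ul ur y)\<^sup>2 = indicator {a..b} y * (s.dev 0 y)\<^sup>2"
      using uU[OF z] by eventually_elim (simp add: s.dev_def x0)
  qed
  \<comment> \<open>Where \<open>x\<close> has no derivative the value of \<open>deriv h\<close> is
    arbitrary; these times form a null set and do not affect the integral.\<close>
  have path: "(LINT \<tau>:{0..t}|lebesgue. (deriv h \<tau>)\<^sup>2) = (LINT \<tau>|lborel. indicator {0..t} \<tau> * (v \<tau> - s.\<sigma>)\<^sup>2)" for t
    unfolding set_lebesgue_integral_def
  proof (rule lebesgue_integral_AE_borel(1)[OF s.path_dissipation_measurable])
    show "AE \<tau> in lborel. indicator {0..t} \<tau> *\<^sub>R (deriv h \<tau>)\<^sup>2 = indicator {0..t} \<tau> * (v \<tau> - s.\<sigma>)\<^sup>2"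
      using v(3)
    proof eventually_elim
      case (elim \<tau>)
      have "(h has_real_derivative v \<tau> - s.\<sigma>) (at \<tau>)"
        unfolding h_def[abs_def] using elim by (auto intro!: derivative_eq_intros)
      then show ?case by (simp add: DERIV_imp_deriv)
    qed
  qed
  show thesis
  proof (rule that)
    have "\<bar>s.\<sigma>\<bar>-lipschitz_on {0..T} (\<lambda>t. s.\<sigma> * t)"
      by (rule lipschitz_onI) (simp_all add: dist_real_def abs_mult[symmetric] right_diff_distrib)
    from lipschitz_on_diff[OF lipschitz_on_subset[OF lip subset_UNIV] this]
    show "lipschitz_path T h" unfolding lipschitz_path_def h_def[abs_def] by blast
    show "h 0 = 0" by (simp add: h_def x0)
    show "\<alpha> \<le> M" by (rule \<alpha>M)
    fix t assume t: "t \<in> {0..T}"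
    then have t': "0 \<le> t" "t \<le> T" by auto
    show "(LINT x:{-R..R}|lebesgue. \<bar>u t x - shock f ul ur t (x - h t)\<bar>\<^sup>2)
      \<le> (LINT x:{-R - t * S..R + t * S}|lebesgue. \<bar>u0 x - shock_data ul ur x\<bar>\<^sup>2) + 4 * measure P ({0..t} \<times> {-R - t * S..R + t * S})"
      if "R > 0" for R
      unfolding sh power2_abs slice[OF t] slice0 by (rule s.shift_estimate[OF t' that])
    have "2 * s.\<kappa> = \<alpha> / (6 * M\<^sup>2) * (ul - ur)" by (simp add: s.\<kappa>_def)
    then show "\<alpha> / (6 * M\<^sup>2) * (ul - ur) * (LINT \<tau>:{0..t}|lebesgue. (deriv h \<tau>)\<^sup>2)
      \<le> (LINT x:{-2 * S * t..2 * S * t}|lebesgue. (u0 x - shock_data ul ur x)\<^sup>2) + 4 * measure P ({0..t} \<times> {-2 * S * t..2 * S * t})"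
      unfolding path slice0 using s.path_estimate[OF t' Spos] by simp
  qed
qed

theorem theorem1p1:
  shows "\<exists>C>0::real. \<exists>c>0::real.
    \<forall>(f :: real \<Rightarrow> real) (\<alpha> :: real) (T :: real) (u :: real \<Rightarrow> real \<Rightarrow> real) (u0 :: real \<Rightarrow> real)
     (ul :: real) (ur :: real) (\<mu>\<^sub>p :: (real \<times> real) measure) (\<mu>\<^sub>n :: (real \<times> real) measure)
     (I :: real set) (M :: real) (S :: real).
      twice_differentiable f \<and> \<alpha> > 0 \<and> (\<forall>v. deriv (deriv f) v \<ge> \<alpha>) \<and>
      T > 0 \<and> finite_entropy_solution T f u \<and> L1loc_continuous T u \<and>
      (AE x in lebesgue. u 0 x = u0 x) \<and>
      very_strong_traces T u \<and>
      entropy_production T u (\<lambda>v. v\<^sup>2 / 2) (square_flux f) \<mu>\<^sub>p \<mu>\<^sub>n \<and>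
      ul > ur \<and>
      I = state_interval T u ul ur \<and>
      bdd_above (deriv (deriv f) ` I) \<and> M = (SUP v\<in>I. deriv (deriv f) v) \<and>
      S = (SUP v\<in>I. \<bar>deriv f v\<bar>)
      \<longrightarrow>
      (\<exists>h. lipschitz_path T h \<and> h 0 = 0 \<and>
        (\<forall>t\<in>{0..T}. \<forall>R>0.
          (LINT x:{-R..R}|lebesgue. \<bar>u t x - shock f ul ur t (x - h t)\<bar>\<^sup>2)
          \<le> (LINT x:{-R - t * S..R + t * S}|lebesgue. \<bar>u0 x - shock_data ul ur x\<bar>\<^sup>2)
            + C * (M^3 / \<alpha>^3) * measure \<mu>\<^sub>p ({0..t} \<times> {-R - t * S..R + t * S})) \<and>
        (\<forall>t\<in>{0..T}.
          c * (\<alpha> / M\<^sup>2) * (ul - ur) * (LINT \<tau>:{0..t}|lebesgue. (deriv h \<tau>)\<^sup>2)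
          \<le> (LINT x:{-2 * S * t..2 * S * t}|lebesgue. (u0 x - shock_data ul ur x)\<^sup>2)
            + M^3 / \<alpha>^3 * measure \<mu>\<^sub>p ({0..t} \<times> {-2 * S * t..2 * S * t})))"
proof (rule exI[of _ 4], rule conjI, simp, rule exI[of _ "1 / 24"], rule conjI, simp, intro allI impI, elim conjE, goal_cases)
  case (1 f \<alpha> T u u0 ul ur P N I M S)
  note I = \<open>I = state_interval T u ul ur\<close>
  obtain h where h: "lipschitz_path T h" "h 0 = 0"
    and h1: "\<And>t R. t \<in> {0..T} \<Longrightarrow> R > 0 \<Longrightarrow> (LINT x:{-R..R}|lebesgue. \<bar>u t x - shock f ul ur t (x - h t)\<bar>\<^sup>2)
      \<le> (LINT x:{-R - t * S..R + t * S}|lebesgue. \<bar>u0 x - shock_data ul ur x\<bar>\<^sup>2) + 4 * measure P ({0..t} \<times> {-R - t * S..R + t * S})"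
    and h2: "\<And>t. t \<in> {0..T} \<Longrightarrow> \<alpha> / (6 * M\<^sup>2) * (ul - ur) * (LINT \<tau>:{0..t}|lebesgue. (deriv h \<tau>)\<^sup>2)
      \<le> (LINT x:{-2 * S * t..2 * S * t}|lebesgue. (u0 x - shock_data ul ur x)\<^sup>2) + 4 * measure P ({0..t} \<times> {-2 * S * t..2 * S * t})"
    and \<alpha>M: "\<alpha> \<le> M"
    by (rule shift_of_generalized_characteristic[OF 1(1,2) 1(3)[rule_format] 1(4,5,6,7,8,9,10) 1(12,13,14)[unfolded I]]) blast
  \<comment> \<open>From \<open>\<alpha> \<le> M\<close> the ratio is at least 1, so inserting it in
    front of the production term keeps the inequality true.\<close>
  have "\<alpha>^3 \<le> M^3" using \<alpha>M \<open>\<alpha> > 0\<close> by (intro power_mono) auto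
  then have r: "1 \<le> M^3 / \<alpha>^3" using \<open>\<alpha> > 0\<close> by (simp add: le_divide_eq)
  have P: "measure P X \<le> M^3 / \<alpha>^3 * measure P X" for X using mult_right_mono[OF r measure_nonneg] by simp
  show ?case
  proof (intro exI[of _ h] conjI h ballI allI impI)
    fix t R :: real assume t: "t \<in> {0..T}" and R: "0 < R"
    show "(LINT x:{-R..R}|lebesgue. \<bar>u t x - shock f ul ur t (x - h t)\<bar>\<^sup>2)
          \<le> (LINT x:{-R - t * S..R + t * S}|lebesgue. \<bar>u0 x - shock_data ul ur x\<bar>\<^sup>2)
            + 4 * (M^3 / \<alpha>^3) * measure P ({0..t} \<times> {-R - t * S..R + t * S})"
      using h1[OF t R] P[of "{0..t} \<times> {-R - t * S..R + t * S}"] by linarith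
  next
    fix t assume t: "t \<in> {0..T}"
    let ?X = "LINT x:{-2 * S * t..2 * S * t}|lebesgue. (u0 x - shock_data ul ur x)\<^sup>2"
    let ?Y = "LINT \<tau>:{0..t}|lebesgue. (deriv h \<tau>)\<^sup>2"
    \<comment> \<open>The constant \<open>1 / 24\<close> is \<open>1 / 6\<close> divided by 4:
      dividing by 4 brings the factor before the production down to 1, and the nonnegative initial
      term dominates its own quarter.\<close>
    have "0 \<le> ?X" unfolding set_lebesgue_integral_def by (intro integral_nonneg_AE AE_I2) simp
    moreover have "1 / 24 * (\<alpha> / M\<^sup>2) * (ul - ur) * ?Y = (\<alpha> / (6 * M\<^sup>2) * (ul - ur) * ?Y) / 4" by simp
    ultimately show "1 / 24 * (\<alpha> / M\<^sup>2) * (ul - ur) * ?Y \<le> ?X + M^3 / \<alpha>^3 * measure P ({0..t} \<times> {-2 * S * t..2 * S * t})"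
      using h2[OF t] P[of "{0..t} \<times> {-2 * S * t..2 * S * t}"] by linarith
  qed
qed

end
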